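(* Let $\Bbbk$ be an algebraically closed field of characteristic zero, let $\mathfrak s$ be a seaweed subalgebra of $\mathfrak{gl}_n=\mathfrak{gl}_n(\Bbbk)$, and let $S\subset GL_n$ be the connected subgroup with Lie algebra $\mathfrak s$. Then: (i) $\Bbbk(\mathfrak s^* )^S$ is a rational field (i.e. purely transcendental over $\Bbbk$); (ii) the coadjoint action $(S:\mathfrak s^* )$ has a generic stabiliser, which is a torus.
   Context: Seaweed subalgebras of $\mathfrak{gl}(V)$, $\dim V=n$, are the following. Let $\underline a=(a_1,\dots,a_m)$ and $\underline b=(b_1,\dots,b_t)$ be compositions of $n$ (ordered sequences of positive integers with sum $n$). Fix a basis $e_1,\dots,e_n$ of $V$ and put $V_i=\langle e_1,\dots,e_{a_1+\dots+a_i}\rangle$, $W_j=\langle e_{b_1+\dots+b_j+1},\dots,e_n\rangle$. The seaweed subalgebra $\mathfrak s(\underline a\mid\underline b)$ is the subalgebra of $\mathfrak{gl}(V)$ preserving both flags $\{0\}\subset V_1\subset\dots\subset V_m=V$ and $V=W_0\supset W_1\supset\dots\supset W_t=\{0\}$. Equivalently, it is an intersection $\mathfrak p\cap\mathfrak p'$ of two parabolic subalgebras with $\mathfrak p+\mathfrak p'=\mathfrak{gl}(V)$. An action $(G:X)$ of an algebraic group on an irreducible variety has a generic stabiliser if there is a dense open subset $\Omega\subset X$ such that all stabilisers $G_x$, $x\in\Omega$, are conjugate in $G$; each such $G_x$ is then called a generic stabiliser. *)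

theory Defs
  imports
    "HOL-Analysis.Abstract_Topology"
    "HOL-Algebra.Generated_Fields"
    "HOL-Algebra.Group_Action"
    "HOL-Library.Multiset"
    "Jordan_Normal_Form.VS_Connect"
begin

section \<open>Polynomial functions and the Zariski topology\<close>

text \<open>Polynomial functions in the coordinate functions \<open>G\<close>.  The ground field below is infinite,
  so polynomials on an affine variety may be identified with the functions they define.\<close>

inductive_set poly_funs :: "('x \<Rightarrow> 'k::comm_ring_1) set \<Rightarrow> ('x \<Rightarrow> 'k) set"
  for G :: "('x \<Rightarrow> 'k) set" where
  const: "(\<lambda>_. c) \<in> poly_funs G"
| coord: "f \<in> G \<Longrightarrow> f \<in> poly_funs G"
| add: "f \<in> poly_funs G \<Longrightarrow> g \<in> poly_funs G \<Longrightarrow> (\<lambda>x. f x + g x) \<in> poly_funs G"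
| mult: "f \<in> poly_funs G \<Longrightarrow> g \<in> poly_funs G \<Longrightarrow> (\<lambda>x. f x * g x) \<in> poly_funs G"

definition zariski_open :: "'x set \<Rightarrow> ('x \<Rightarrow> 'k::idom) set \<Rightarrow> 'x set \<Rightarrow> bool" where
  "zariski_open X G U \<longleftrightarrow> (\<exists>F \<subseteq> poly_funs G. U = {x \<in> X. \<exists>f\<in>F. f x \<noteq> 0})"

definition zariski :: "'x set \<Rightarrow> ('x \<Rightarrow> 'k::idom) set \<Rightarrow> 'x topology" where
  "zariski X G = topology (zariski_open X G)"

lemma istopology_zariski_open: "istopology (zariski_open X G)"
  unfolding istopology_def
proof (intro conjI allI impI)
  fix U V assume "zariski_open X G U" "zariski_open X G V"
  then obtain F F' where F: "F \<subseteq> poly_funs G" "U = {x \<in> X. \<exists>f\<in>F. f x \<noteq> 0}"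
    and F': "F' \<subseteq> poly_funs G" "V = {x \<in> X. \<exists>f\<in>F'. f x \<noteq> 0}"
    unfolding zariski_open_def by (elim exE conjE)
  let ?H = "\<Union>f\<in>F. (\<lambda>g x. f x * g x) ` F'"
  have "?H \<subseteq> poly_funs G"
    using F(1) F'(1) by (auto intro: poly_funs.mult)
  moreover have "U \<inter> V = {x \<in> X. \<exists>h\<in>?H. h x \<noteq> 0}"
    unfolding F(2) F'(2) by auto
  ultimately show "zariski_open X G (U \<inter> V)"
    unfolding zariski_open_def by (intro exI[of _ ?H] conjI)
next
  fix \<K> assume "\<forall>K\<in>\<K>. zariski_open X G K"
  then have "\<forall>K\<in>\<K>. \<exists>F. F \<subseteq> poly_funs G \<and> K = {x \<in> X. \<exists>f\<in>F. f x \<noteq> 0}"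
    unfolding zariski_open_def .
  then obtain F where F: "\<forall>K\<in>\<K>. F K \<subseteq> poly_funs G \<and> K = {x \<in> X. \<exists>f\<in>F K. f x \<noteq> 0}"
    unfolding bchoice_iff by (elim exE)
  let ?F = "\<Union>K\<in>\<K>. F K"
  have *: "x \<in> \<Union>\<K> \<longleftrightarrow> (\<exists>K\<in>\<K>. x \<in> {x \<in> X. \<exists>f\<in>F K. f x \<noteq> 0})" for x
    using F by (simp only: Union_iff) (rule bex_cong; simp)
  have "\<Union>\<K> = {x \<in> X. \<exists>f\<in>?F. f x \<noteq> 0}"
    unfolding set_eq_iff * by auto
  moreover have "?F \<subseteq> poly_funs G"
    using F by (intro UN_least) simp
  ultimately show "zariski_open X G (\<Union>\<K>)"
    unfolding zariski_open_def by (intro exI[of _ ?F] conjI)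
qed

lemma openin_zariski: "openin (zariski X G) = zariski_open X G"
  unfolding zariski_def by (rule topology_inverse'[OF istopology_zariski_open])


section \<open>Seaweed subalgebras\<close>

definition is_composition :: "nat \<Rightarrow> nat list \<Rightarrow> bool" where
  "is_composition n a \<longleftrightarrow> (\<forall>i\<in>set a. 0 < i) \<and> sum_list a = n"

abbreviation vspan :: "nat \<Rightarrow> 'k::field vec set \<Rightarrow> 'k vec set" where
  "vspan n \<equiv> LinearCombinations.module.span class_ring (module_vec TYPE('k) n)"

definition is_ordered_basis :: "nat \<Rightarrow> 'k::field vec list \<Rightarrow> bool" where
  "is_ordered_basis n es \<longleftrightarrow> distinct es \<and>
     vectorspace.basis class_ring (module_vec TYPE('k) n) (set es)"

definition preserves :: "'k::field mat \<Rightarrow> 'k vec set \<Rightarrow> bool" where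
  "preserves A U \<longleftrightarrow> (\<forall>v\<in>U. A *\<^sub>v v \<in> U)"

definition seaweed :: "nat \<Rightarrow> 'k::field vec list \<Rightarrow> nat list \<Rightarrow> nat list \<Rightarrow> 'k mat set" where
  "seaweed n es a b = {A \<in> carrier_mat n n.
     (\<forall>i \<le> length a. preserves A (vspan n (set (take (sum_list (take i a)) es)))) \<and>
     (\<forall>j \<le> length b. preserves A (vspan n (set (drop (sum_list (take j b)) es))))}"

text \<open>The basis is arbitrary: the notion is stable under conjugation by invertible matrices.\<close>

definition is_seaweed :: "nat \<Rightarrow> 'k::field mat set \<Rightarrow> bool" where
  "is_seaweed n s \<longleftrightarrow> (\<exists>es a b. is_ordered_basis n es \<and> is_composition n a \<and> is_composition n b \<and>
     s = seaweed n es a b)"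


section \<open>Algebraic subgroups of the general linear group\<close>

definition GL :: "nat \<Rightarrow> 'k::field mat monoid" where
  "GL n = units_of (ring_mat TYPE('k) n ())"

abbreviation GL_restrict :: "nat \<Rightarrow> 'k::field mat set \<Rightarrow> 'k mat monoid" where
  "GL_restrict n S \<equiv> (GL n)\<lparr>carrier := S\<rparr>"

definition entries :: "nat \<Rightarrow> ('k::field mat \<Rightarrow> 'k) set" where
  "entries n = {\<lambda>A. A $$ (i, j) | i j. i < n \<and> j < n}"

definition algebraic_subgroup :: "nat \<Rightarrow> 'k::field mat set \<Rightarrow> bool" where
  "algebraic_subgroup n S \<longleftrightarrow>
     subgroup S (GL n) \<and> closedin (zariski (carrier (GL n)) (entries n)) S"

definition connected_algebraic_subgroup :: "nat \<Rightarrow> 'k::field mat set \<Rightarrow> bool" where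
  "connected_algebraic_subgroup n S \<longleftrightarrow>
     algebraic_subgroup n S \<and> connectedin (zariski (carrier (GL n)) (entries n)) S"

text \<open>The Lie algebra of \<open>S\<close> is its tangent space at the identity.  For a polynomial function \<open>f\<close>,
  the value \<open>f (1 + t X)\<close> is a polynomial \<open>p\<close> in \<open>t\<close>, and \<open>p'(0)\<close> is the differential of \<open>f\<close>
  at \<open>1\<close> applied to \<open>X\<close>.  Equations involving \<open>1 / det\<close> give the same tangent space.\<close>

definition lie_algebra :: "nat \<Rightarrow> 'k::field mat set \<Rightarrow> 'k mat set" where
  "lie_algebra n S = {X \<in> carrier_mat n n.
     \<forall>f \<in> poly_funs (entries n). (\<forall>A\<in>S. f A = 0) \<longrightarrow>
       (\<forall>p. (\<forall>t. poly p t = f (1\<^sub>m n + t \<cdot>\<^sub>m X)) \<longrightarrow> poly (pderiv p) 0 = 0)}"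

definition regular_map :: "nat \<Rightarrow> nat \<Rightarrow> 'k::field mat set \<Rightarrow> ('k mat \<Rightarrow> 'k mat) \<Rightarrow> bool" where
  "regular_map d n D \<phi> \<longleftrightarrow>
     (\<forall>i<n. \<forall>j<n. \<exists>f \<in> poly_funs (insert (\<lambda>A. inverse (det A)) (entries d)).
        \<forall>A\<in>D. \<phi> A $$ (i, j) = f A)"

definition diagonal_group :: "nat \<Rightarrow> 'k::field mat set" where
  "diagonal_group d = {A \<in> carrier (GL d). diagonal_mat A}"

definition is_torus :: "nat \<Rightarrow> 'k::field mat set \<Rightarrow> bool" where
  "is_torus n T \<longleftrightarrow> algebraic_subgroup n T \<and>
     (\<exists>d \<phi>. \<phi> \<in> iso (GL_restrict d (diagonal_group d)) (GL_restrict n T) \<and>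
        regular_map d n (diagonal_group d) \<phi> \<and>
        regular_map n d T (inv_into (diagonal_group d) \<phi>))"


section \<open>Coadjoint action and generic stabilisers\<close>

definition lin_dual :: "'k::field mat set \<Rightarrow> ('k mat \<Rightarrow> 'k) set" where
  "lin_dual s = {\<xi> \<in> extensional s.
     (\<forall>x\<in>s. \<forall>y\<in>s. \<xi> (x + y) = \<xi> x + \<xi> y) \<and> (\<forall>c. \<forall>x\<in>s. \<xi> (c \<cdot>\<^sub>m x) = c * \<xi> x)}"

definition coadjoint ::
  "nat \<Rightarrow> 'k::field mat set \<Rightarrow> 'k mat \<Rightarrow> ('k mat \<Rightarrow> 'k) \<Rightarrow> ('k mat \<Rightarrow> 'k)" where
  "coadjoint n s g \<xi> = (\<lambda>x\<in>s. \<xi> (inv\<^bsub>GL n\<^esub> g * x * g))"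

definition dual_coords :: "'k::field mat set \<Rightarrow> (('k mat \<Rightarrow> 'k) \<Rightarrow> 'k) set" where
  "dual_coords s = {\<lambda>\<xi>. \<xi> x | x. x \<in> s}"

definition generic_stabiliser ::
  "('g, 'r) monoid_scheme \<Rightarrow> 'x topology \<Rightarrow> ('g \<Rightarrow> 'x \<Rightarrow> 'x) \<Rightarrow> 'g set \<Rightarrow> bool" where
  "generic_stabiliser G X \<phi> H \<longleftrightarrow> (\<exists>\<Omega>. openin X \<Omega> \<and> X closure_of \<Omega> = topspace X \<and>
     (\<forall>x\<in>\<Omega>. \<forall>y\<in>\<Omega>. \<exists>g\<in>carrier G.
        stabilizer G \<phi> y = g <#\<^bsub>G\<^esub> stabilizer G \<phi> x #>\<^bsub>G\<^esub> inv\<^bsub>G\<^esub> g) \<and>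
     (\<exists>x\<in>\<Omega>. H = stabilizer G \<phi> x))"


section \<open>Rational functions and rational invariants\<close>

definition coord_ring :: "'x set \<Rightarrow> ('x \<Rightarrow> 'k::field) set \<Rightarrow> ('x \<Rightarrow> 'k) ring" where
  "coord_ring X G = \<lparr>carrier = (\<lambda>f. restrict f X) ` poly_funs G,
     mult = (\<lambda>f g. \<lambda>x\<in>X. f x * g x), one = (\<lambda>x\<in>X. 1),
     zero = (\<lambda>x\<in>X. 0), add = (\<lambda>f g. \<lambda>x\<in>X. f x + g x)\<rparr>"

text \<open>The class of the fraction \<open>p / q\<close> of elements of a domain \<open>R\<close>, as a set of pairs.\<close>

definition fraction :: "('a, 'r) ring_scheme \<Rightarrow> 'a \<Rightarrow> 'a \<Rightarrow> ('a \<times> 'a) set" where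
  "fraction R p q = {(p', q'). p' \<in> carrier R \<and> q' \<in> carrier R - {\<zero>\<^bsub>R\<^esub>} \<and>
     p \<otimes>\<^bsub>R\<^esub> q' = p' \<otimes>\<^bsub>R\<^esub> q}"

definition fraction_field :: "('a, 'r) ring_scheme \<Rightarrow> ('a \<times> 'a) set ring" where
  "fraction_field R = \<lparr>carrier = {fraction R p q | p q. p \<in> carrier R \<and> q \<in> carrier R - {\<zero>\<^bsub>R\<^esub>}},
     mult = (\<lambda>u v. \<Union>(p, q)\<in>u. \<Union>(p', q')\<in>v. fraction R (p \<otimes>\<^bsub>R\<^esub> p') (q \<otimes>\<^bsub>R\<^esub> q')),
     one = fraction R \<one>\<^bsub>R\<^esub> \<one>\<^bsub>R\<^esub>,
     zero = fraction R \<zero>\<^bsub>R\<^esub> \<one>\<^bsub>R\<^esub>,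
     add = (\<lambda>u v. \<Union>(p, q)\<in>u. \<Union>(p', q')\<in>v.
       fraction R (p \<otimes>\<^bsub>R\<^esub> q' \<oplus>\<^bsub>R\<^esub> p' \<otimes>\<^bsub>R\<^esub> q) (q \<otimes>\<^bsub>R\<^esub> q'))\<rparr>"

abbreviation function_field :: "'x set \<Rightarrow> ('x \<Rightarrow> 'k::field) set \<Rightarrow> (('x \<Rightarrow> 'k) \<times> ('x \<Rightarrow> 'k)) set ring"
  where "function_field X G \<equiv> fraction_field (coord_ring X G)"

definition constants :: "'x set \<Rightarrow> ('x \<Rightarrow> 'k::field) set \<Rightarrow> (('x \<Rightarrow> 'k) \<times> ('x \<Rightarrow> 'k)) set set" where
  "constants X G = {fraction (coord_ring X G) (\<lambda>x\<in>X. c) (\<lambda>x\<in>X. 1) | c. True}"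

definition translate ::
  "('g, 'r) monoid_scheme \<Rightarrow> 'x set \<Rightarrow> ('g \<Rightarrow> 'x \<Rightarrow> 'x) \<Rightarrow> 'g \<Rightarrow> ('x \<Rightarrow> 'k) \<Rightarrow> ('x \<Rightarrow> 'k)" where
  "translate \<Gamma> X \<phi> g f = (\<lambda>x\<in>X. f (\<phi> (inv\<^bsub>\<Gamma>\<^esub> g) x))"

definition invariant_field ::
  "('g, 'r) monoid_scheme \<Rightarrow> 'x set \<Rightarrow> ('x \<Rightarrow> 'k::field) set \<Rightarrow> ('g \<Rightarrow> 'x \<Rightarrow> 'x) \<Rightarrow>
   (('x \<Rightarrow> 'k) \<times> ('x \<Rightarrow> 'k)) set ring" where
  "invariant_field \<Gamma> X G \<phi> = (function_field X G)\<lparr>carrier :=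
     {u \<in> carrier (function_field X G). \<forall>g\<in>carrier \<Gamma>.
        map_prod (translate \<Gamma> X \<phi> g) (translate \<Gamma> X \<phi> g) ` u = u}\<rparr>"

text \<open>A multiset over \<open>B\<close> encodes a monomial in the elements of \<open>B\<close>, its multiplicities being the
  exponents; \<open>M\<close> and \<open>c\<close> below are thus the support and coefficients of a polynomial over \<open>K\<close>.\<close>

definition alg_independent :: "('a, 'r) ring_scheme \<Rightarrow> 'a set \<Rightarrow> 'a set \<Rightarrow> bool" where
  "alg_independent L K B \<longleftrightarrow> (\<forall>M c. finite M \<and> (\<forall>m\<in>M. set_mset m \<subseteq> B) \<and> c \<in> M \<rightarrow> K \<and>
     (\<Oplus>\<^bsub>L\<^esub>m\<in>M. c m \<otimes>\<^bsub>L\<^esub> (\<Otimes>\<^bsub>L\<^esub>b\<in>set_mset m. b [^]\<^bsub>L\<^esub> count m b)) = \<zero>\<^bsub>L\<^esub> \<longrightarrow>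
     (\<forall>m\<in>M. c m = \<zero>\<^bsub>L\<^esub>))"

definition purely_transcendental :: "('a, 'r) ring_scheme \<Rightarrow> 'a set \<Rightarrow> bool" where
  "purely_transcendental L K \<longleftrightarrow>
     (\<exists>B \<subseteq> carrier L. alg_independent L K B \<and> generate_field L (K \<union> B) = carrier L)"

end

theory Submission
  imports Defs
begin

text \<open>
  In the basis of the flags a seaweed algebra is spanned by the matrix units \<open>E\<^sub>i\<^sub>j\<close> with \<open>P i j\<close> for a
  preorder \<open>P\<close>, the group \<open>S\<close> consists of its units, and a functional is a matrix supported on \<open>P\<close>.
  Coadjoint orbits become isomorphism classes of a category with linear Hom spaces, and
  stabilisers become groups of units of endomorphism algebras. By induction on \<open>n\<close> this category is shown to
  have, generically, a polynomial section of the quotient by isomorphism with rational invariants, and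
  diagonalisable endomorphism algebras. If the first blocks of the two compositions agree, the
  algebra is a product of a smaller seaweed algebra and a full matrix algebra, for which the companion form is a
  section. Otherwise the first block of one flag is contained in that of the other (up to
  transposition), a block of the functional is generically invertible, and normalising it to
  the identity gives a fully faithful embedding of the category of a smaller seaweed algebra. The
  components of the section are algebraically independent and generate the invariant
  field; a generic stabiliser is the torus of units of the endomorphism algebra.
\<close>

section \<open>Matrices over a preorder\<close>

lemma poly_funs_sum:
  "(\<And>a. a \<in> A \<Longrightarrow> f a \<in> poly_funs G) \<Longrightarrow> (\<lambda>x. \<Sum>a\<in>A. f a x) \<in> poly_funs G"
  by (induction A rule: infinite_finite_induct) (auto intro: poly_funs.intros)

lemma poly_funs_prod:
  "(\<And>a. a \<in> A \<Longrightarrow> f a \<in> poly_funs G) \<Longrightarrow> (\<lambda>x. \<Prod>a\<in>A. f a x) \<in> poly_funs G"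
  by (induction A rule: infinite_finite_induct) (auto intro: poly_funs.intros)

lemma poly_funs_power: "f \<in> poly_funs G \<Longrightarrow> (\<lambda>x. f x ^ m) \<in> poly_funs G"
  by (induction m) (auto intro: poly_funs.intros)

lemma poly_funs_minus: "f \<in> poly_funs G \<Longrightarrow> (\<lambda>x. - f x) \<in> poly_funs G"
  using poly_funs.mult[OF poly_funs.const[of "-1"]] by fastforce

lemma poly_funs_diff:
  "f \<in> poly_funs G \<Longrightarrow> g \<in> poly_funs G \<Longrightarrow> (\<lambda>x. f x - g x) \<in> poly_funs G"
  using poly_funs.add[of f G "\<lambda>x. - g x"] poly_funs_minus[of g G] by simp

lemma poly_funs_comp:
  assumes "f \<in> poly_funs H" "\<And>h. h \<in> H \<Longrightarrow> (\<lambda>x. h (\<phi> x)) \<in> poly_funs G"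
  shows "(\<lambda>x. f (\<phi> x)) \<in> poly_funs G"
  using assms by (induction) (auto intro: poly_funs.intros)

definition loc :: "('x \<Rightarrow> 'k::field) set \<Rightarrow> ('x \<Rightarrow> 'k) \<Rightarrow> ('x \<Rightarrow> 'k) set" where
  "loc G D = {f. \<exists>p\<in>poly_funs G. \<exists>m. \<forall>x. D x \<noteq> 0 \<longrightarrow> f x * D x ^ m = p x}"

lemma locI: "p \<in> poly_funs G \<Longrightarrow> (\<And>x. D x \<noteq> 0 \<Longrightarrow> f x * D x ^ m = p x) \<Longrightarrow> f \<in> loc G D"
  unfolding loc_def by blast

lemma loc_poly: "f \<in> poly_funs G \<Longrightarrow> f \<in> loc G D"
  by (rule locI[of f _ _ _ 0]) auto

lemma loc_const [simp]: "(\<lambda>x. c) \<in> loc G D"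
  by (rule loc_poly) (rule poly_funs.const)

lemma loc_add:
  assumes "D \<in> poly_funs G" "f \<in> loc G D" "g \<in> loc G D"
  shows "(\<lambda>x. f x + g x) \<in> loc G D"
proof -
  obtain p m where p: "p \<in> poly_funs G" "\<And>x. D x \<noteq> 0 \<Longrightarrow> f x * D x ^ m = p x"
    using assms(2) unfolding loc_def by blast
  obtain q l where q: "q \<in> poly_funs G" "\<And>x. D x \<noteq> 0 \<Longrightarrow> g x * D x ^ l = q x"
    using assms(3) unfolding loc_def by blast
  show ?thesis
  proof (rule locI[of "\<lambda>x. p x * D x ^ l + q x * D x ^ m" _ _ _ "m + l"])
    show "(\<lambda>x. p x * D x ^ l + q x * D x ^ m) \<in> poly_funs G"
      using p q assms(1) by (intro poly_funs.add poly_funs.mult poly_funs_power)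
  next
    fix x assume "D x \<noteq> 0"
    then show "(f x + g x) * D x ^ (m + l) = p x * D x ^ l + q x * D x ^ m"
      by (simp flip: p(2) q(2) add: algebra_simps power_add)
  qed
qed

lemma loc_mult:
  assumes "f \<in> loc G D" "g \<in> loc G D"
  shows "(\<lambda>x. f x * g x) \<in> loc G D"
proof -
  obtain p m where p: "p \<in> poly_funs G" "\<And>x. D x \<noteq> 0 \<Longrightarrow> f x * D x ^ m = p x"
    using assms(1) unfolding loc_def by blast
  obtain q l where q: "q \<in> poly_funs G" "\<And>x. D x \<noteq> 0 \<Longrightarrow> g x * D x ^ l = q x"
    using assms(2) unfolding loc_def by blast
  show ?thesis
  proof (rule locI[of "\<lambda>x. p x * q x" _ _ _ "m + l"])
    show "(\<lambda>x. p x * q x) \<in> poly_funs G"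
      using p q by (intro poly_funs.mult)
  next
    fix x assume "D x \<noteq> 0"
    then show "(f x * g x) * D x ^ (m + l) = p x * q x"
      by (simp flip: p(2) q(2) add: algebra_simps power_add)
  qed
qed

lemma loc_minus: "f \<in> loc G D \<Longrightarrow> (\<lambda>x. - f x) \<in> loc G D"
  using loc_mult[OF loc_const[of "-1"]] by fastforce

lemma loc_diff:
  "D \<in> poly_funs G \<Longrightarrow> f \<in> loc G D \<Longrightarrow> g \<in> loc G D \<Longrightarrow> (\<lambda>x. f x - g x) \<in> loc G D"
  using loc_add[of D G f "\<lambda>x. - g x"] loc_minus[of g G] by simp

lemma loc_sum:
  "D \<in> poly_funs G \<Longrightarrow> (\<And>a. a \<in> A \<Longrightarrow> f a \<in> loc G D) \<Longrightarrow> (\<lambda>x. \<Sum>a\<in>A. f a x) \<in> loc G D"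
  by (induction A rule: infinite_finite_induct) (auto intro: loc_add)

lemma loc_inverse: "(\<lambda>x. 1 / D x) \<in> loc G D"
  by (rule locI[of "\<lambda>x. 1" _ _ _ 1]) (auto intro: poly_funs.const)

lemma loc_factor:
  assumes "f \<in> loc G D" "E \<in> poly_funs G"
  shows "f \<in> loc G (\<lambda>x. D x * E x)"
proof -
  obtain p m where p: "p \<in> poly_funs G" "\<And>x. D x \<noteq> 0 \<Longrightarrow> f x * D x ^ m = p x"
    using assms(1) unfolding loc_def by blast
  show ?thesis
    by (rule locI[of "\<lambda>x. p x * E x ^ m" _ _ _ m])
      (use p assms(2) in \<open>auto intro!: poly_funs.mult poly_funs_power simp: power_mult_distrib algebra_simps simp flip: p(2)\<close>)
qed

lemma loc_comp:
  assumes "f \<in> poly_funs H" "D \<in> poly_funs G" "\<And>h. h \<in> H \<Longrightarrow> (\<lambda>x. h (\<phi> x)) \<in> loc G D"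
  shows "(\<lambda>x. f (\<phi> x)) \<in> loc G D"
  using assms by (induction) (auto intro: loc_add loc_mult)

lemma loc_comp_denominator:
  assumes "D1 \<in> poly_funs H" "D \<in> poly_funs G" "\<And>h. h \<in> H \<Longrightarrow> (\<lambda>x. h (\<phi> x)) \<in> loc G D"
  obtains E m where "E \<in> poly_funs G" "\<And>x. D x \<noteq> 0 \<Longrightarrow> D1 (\<phi> x) * D x ^ m = E x"
    "\<And>f. f \<in> loc H D1 \<Longrightarrow> (\<lambda>x. f (\<phi> x)) \<in> loc G (\<lambda>x. D x * E x)"
proof -
  obtain E m where E: "E \<in> poly_funs G" "\<And>x. D x \<noteq> 0 \<Longrightarrow> D1 (\<phi> x) * D x ^ m = E x"
    using loc_comp[OF assms(1,2), of \<phi>] assms(3) unfolding loc_def by blast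
  have "(\<lambda>x. f (\<phi> x)) \<in> loc G (\<lambda>x. D x * E x)" if f: "f \<in> loc H D1" for f
  proof -
    obtain p k where p: "p \<in> poly_funs H" "\<And>y. D1 y \<noteq> 0 \<Longrightarrow> f y * D1 y ^ k = p y"
      using f unfolding loc_def by blast
    obtain q a where q: "q \<in> poly_funs G" "\<And>x. D x \<noteq> 0 \<Longrightarrow> p (\<phi> x) * D x ^ a = q x"
      using loc_comp[OF p(1) assms(2), of \<phi>] assms(3) unfolding loc_def by blast
    show ?thesis
    proof (rule locI[of "\<lambda>x. q x * D x ^ (m * k) * E x ^ a * D x ^ k" _ _ _ "k + a"])
      show "(\<lambda>x. q x * D x ^ (m * k) * E x ^ a * D x ^ k) \<in> poly_funs G"
        using q E assms(2) by (intro poly_funs.mult poly_funs_power)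
    next
      fix x assume "D x * E x \<noteq> 0"
      then have D: "D x \<noteq> 0" and "E x \<noteq> 0" by auto
      then have "D1 (\<phi> x) \<noteq> 0" using E(2) by force
      have "f (\<phi> x) * (D x * E x) ^ (k + a) = f (\<phi> x) * E x ^ k * D x ^ a * E x ^ a * D x ^ k"
        by (simp add: power_add power_mult_distrib)
      also have "f (\<phi> x) * E x ^ k = p (\<phi> x) * D x ^ (m * k)"
        using p(2)[OF \<open>D1 (\<phi> x) \<noteq> 0\<close>] by (simp flip: E(2)[OF D] add: power_mult_distrib power_mult mult.assoc)
      finally show "f (\<phi> x) * (D x * E x) ^ (k + a) = q x * D x ^ (m * k) * E x ^ a * D x ^ k"
        by (simp flip: q(2)[OF D] add: ac_simps)
    qed
  qed
  with E that show thesis by blast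
qed

type_synonym 'k fmat = "nat \<Rightarrow> nat \<Rightarrow> 'k"

definition mcoords :: "('k fmat \<Rightarrow> 'k) set" where
  "mcoords = {\<lambda>x. x i j | i j. True}"

lemma mcoords_poly [intro]: "(\<lambda>x. x i j) \<in> poly_funs mcoords"
  by (rule poly_funs.coord) (auto simp: mcoords_def)

lemma mpoly_comp:
  assumes "f \<in> poly_funs mcoords" "\<And>i j. (\<lambda>x. \<phi> x i j) \<in> poly_funs G"
  shows "(\<lambda>x. f (\<phi> x)) \<in> poly_funs G"
proof (rule poly_funs_comp[OF assms(1)])
  fix h :: "'a fmat \<Rightarrow> 'a" assume "h \<in> mcoords"
  then obtain i j where "h = (\<lambda>x. x i j)" unfolding mcoords_def by blast
  then show "(\<lambda>x. h (\<phi> x)) \<in> poly_funs G" using assms(2) by simp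
qed

definition mprod :: "nat set \<Rightarrow> 'k::comm_ring_1 fmat \<Rightarrow> 'k fmat \<Rightarrow> 'k fmat" where
  "mprod I x y = (\<lambda>i j. \<Sum>k\<in>I. x i k * y k j)"

definition mone :: "nat set \<Rightarrow> 'k::comm_ring_1 fmat" where
  "mone I = (\<lambda>i j. if i = j \<and> i \<in> I then 1 else 0)"

lemma mprod_assoc: "mprod I (mprod I x y) z = mprod I x (mprod I y z)"
proof (intro ext)
  fix i j
  have "mprod I (mprod I x y) z i j = (\<Sum>k\<in>I. \<Sum>l\<in>I. x i l * y l k * z k j)"
    by (simp add: mprod_def sum_distrib_right)
  also have "\<dots> = (\<Sum>l\<in>I. \<Sum>k\<in>I. x i l * y l k * z k j)"
    by (rule sum.swap)
  also have "\<dots> = mprod I x (mprod I y z) i j"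
    by (simp add: mprod_def sum_distrib_left mult.assoc)
  finally show "mprod I (mprod I x y) z i j = mprod I x (mprod I y z) i j" .
qed

lemma mprod_mone_left: "finite I \<Longrightarrow> i \<in> I \<Longrightarrow> mprod I (mone I) x i j = x i j"
  by (simp add: mprod_def mone_def if_distrib[of "\<lambda>u. u * _"] cong: if_cong)

lemma mprod_mone_right: "finite I \<Longrightarrow> j \<in> I \<Longrightarrow> mprod I x (mone I) i j = x i j"
  by (simp add: mprod_def mone_def if_distrib[of "\<lambda>u. _ * u"] cong: if_cong conj_cong)

definition malg :: "(nat \<Rightarrow> nat \<Rightarrow> bool) \<Rightarrow> 'k::comm_ring_1 fmat set" where
  "malg P = {h. \<forall>i j. h i j \<noteq> 0 \<longrightarrow> P j i}"

lemma malgI: "(\<And>i j. h i j \<noteq> 0 \<Longrightarrow> P j i) \<Longrightarrow> h \<in> malg P"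
  by (auto simp: malg_def)

lemma malgD: "h \<in> malg P \<Longrightarrow> \<not> P j i \<Longrightarrow> h i j = 0"
  by (auto simp: malg_def)

text \<open>The entries are transposed so that \<open>u\<close> in the group maps the functional \<open>\<xi>\<close> to \<open>\<eta>\<close> if and only
  if the transpose of \<open>u\<close> lies in \<open>mhom I P \<xi> \<eta>\<close>.\<close>

definition mhom ::
  "nat set \<Rightarrow> (nat \<Rightarrow> nat \<Rightarrow> bool) \<Rightarrow> 'k::comm_ring_1 fmat \<Rightarrow> 'k fmat \<Rightarrow> 'k fmat set" where
  "mhom I P \<xi> \<eta> = {h \<in> malg P. \<forall>k l. P k l \<longrightarrow> mprod I \<xi> h k l = mprod I h \<eta> k l}"

definition miso ::
  "nat set \<Rightarrow> (nat \<Rightarrow> nat \<Rightarrow> bool) \<Rightarrow> 'k::comm_ring_1 fmat \<Rightarrow> 'k fmat \<Rightarrow> bool" where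
  "miso I P \<xi> \<eta> \<longleftrightarrow> (\<exists>h\<in>mhom I P \<xi> \<eta>. \<exists>h'\<in>malg P. mprod I h h' = mone I \<and> mprod I h' h = mone I)"

locale preord =
  fixes I :: "nat set" and P :: "nat \<Rightarrow> nat \<Rightarrow> bool"
  assumes fin: "finite I"
    and refl: "i \<in> I \<Longrightarrow> P i i"
    and trans: "P i j \<Longrightarrow> P j k \<Longrightarrow> P i k"
    and fld: "P i j \<Longrightarrow> i \<in> I \<and> j \<in> I"
begin

lemma mone_malg: "mone I \<in> malg P"
  by (auto simp: malg_def mone_def refl)

lemma malg_mprod:
  assumes "g \<in> malg P" "h \<in> malg P" shows "mprod I g h \<in> malg P"
  unfolding malg_def
proof (intro CollectI allI impI)
  fix i j assume "mprod I g h i j \<noteq> 0"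
  then obtain k where "g i k * h k j \<noteq> 0"
    unfolding mprod_def by (meson sum.not_neutral_contains_not_neutral)
  then have "g i k \<noteq> 0" "h k j \<noteq> 0" by auto
  with assms show "P j i" unfolding malg_def using trans by blast
qed

lemma malg_mone_left: "h \<in> malg P \<Longrightarrow> mprod I (mone I) h = h"
proof (intro ext)
  fix i j assume h: "h \<in> malg P"
  show "mprod I (mone I) h i j = h i j"
  proof (cases "i \<in> I")
    case False
    with h have "h i j = 0" using fld unfolding malg_def by blast
    with False show ?thesis by (auto simp: mprod_def mone_def intro!: sum.neutral)
  qed (simp add: mprod_mone_left fin)
qed

lemma malg_mone_right: "h \<in> malg P \<Longrightarrow> mprod I h (mone I) = h"
proof (intro ext)
  fix i j assume h: "h \<in> malg P"
  show "mprod I h (mone I) i j = h i j"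
  proof (cases "j \<in> I")
    case False
    with h have "h i j = 0" using fld unfolding malg_def by blast
    with False show ?thesis by (auto simp: mprod_def mone_def intro!: sum.neutral)
  qed (simp add: mprod_mone_right fin)
qed

lemma mprod_cong_left:
  assumes "h \<in> malg P" "\<And>k l. P k l \<Longrightarrow> x k l = y k l" "P k l"
  shows "mprod I x h k l = mprod I y h k l"
  unfolding mprod_def
proof (rule sum.cong[OF HOL.refl])
  fix j assume "j \<in> I"
  show "x k j * h j l = y k j * h j l"
    using assms trans[of k l j] unfolding malg_def by (cases "h j l = 0") auto
qed

lemma mprod_cong_right:
  assumes "h \<in> malg P" "\<And>k l. P k l \<Longrightarrow> x k l = y k l" "P k l"
  shows "mprod I h x k l = mprod I h y k l"
  unfolding mprod_def
proof (rule sum.cong[OF HOL.refl])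
  fix j assume "j \<in> I"
  show "h k j * x j l = h k j * y j l"
    using assms trans[of j k l] unfolding malg_def by (cases "h k j = 0") auto
qed

lemma mhom_cong:
  assumes "\<And>k l. P k l \<Longrightarrow> x k l = x' k l" "\<And>k l. P k l \<Longrightarrow> y k l = y' k l"
  shows "mhom I P x y = mhom I P x' y'"
proof -
  have "mprod I x h k l = mprod I x' h k l" "mprod I h y k l = mprod I h y' k l"
    if "h \<in> malg P" "P k l" for h k l
    using mprod_cong_left[OF that(1) assms(1) that(2)] mprod_cong_right[OF that(1) assms(2) that(2)]
    by auto
  then show ?thesis unfolding mhom_def by auto
qed

lemma miso_cong:
  assumes "\<And>k l. P k l \<Longrightarrow> x k l = x' k l" "\<And>k l. P k l \<Longrightarrow> y k l = y' k l"
  shows "miso I P x y \<longleftrightarrow> miso I P x' y'"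
  unfolding miso_def using mhom_cong[of x x' y y'] assms by simp

lemma mhom_mprod:
  assumes g: "g \<in> mhom I P x y" and h: "h \<in> mhom I P y z"
  shows "mprod I g h \<in> mhom I P x z"
  unfolding mhom_def
proof (intro CollectI conjI allI impI)
  have a: "g \<in> malg P" "h \<in> malg P" using g h unfolding mhom_def by auto
  then show "mprod I g h \<in> malg P" by (rule malg_mprod)
  fix k l assume kl: "P k l"
  have "mprod I x (mprod I g h) k l = mprod I (mprod I x g) h k l" by (simp add: mprod_assoc)
  also have "\<dots> = mprod I (mprod I g y) h k l"
    using g by (intro mprod_cong_left[OF a(2) _ kl]) (auto simp: mhom_def)
  also have "\<dots> = mprod I g (mprod I y h) k l" by (simp add: mprod_assoc)
  also have "\<dots> = mprod I g (mprod I h z) k l"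
    using h by (intro mprod_cong_right[OF a(1) _ kl]) (auto simp: mhom_def)
  finally show "mprod I x (mprod I g h) k l = mprod I (mprod I g h) z k l" by (simp add: mprod_assoc)
qed

lemma mhom_inverse:
  assumes g: "g \<in> mhom I P x y" and h: "h \<in> malg P"
    and inv: "mprod I g h = mone I" "mprod I h g = mone I"
  shows "h \<in> mhom I P y x"
  unfolding mhom_def
proof (intro CollectI conjI allI impI h)
  have a: "g \<in> malg P" using g unfolding mhom_def by auto
  fix k l assume kl: "P k l"
  then have kl': "k \<in> I" "l \<in> I" using fld by auto
  have *: "mprod I (mprod I g y) h k l = mprod I (mprod I x g) h k l" if "P k l" for k l
    using g by (intro mprod_cong_left[OF h _ that]) (auto simp: mhom_def)
  have "mprod I y h k l = mprod I (mone I) (mprod I y h) k l"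
    by (simp add: mprod_mone_left fin kl')
  also have "\<dots> = mprod I h (mprod I (mprod I g y) h) k l"
    by (simp add: mprod_assoc flip: inv(2))
  also have "\<dots> = mprod I h (mprod I (mprod I x g) h) k l"
    by (rule mprod_cong_right[OF h * kl])
  also have "\<dots> = mprod I (mprod I h x) (mone I) k l"
    by (simp add: mprod_assoc flip: inv(1))
  also have "\<dots> = mprod I h x k l"
    by (simp add: mprod_mone_right fin kl')
  finally show "mprod I y h k l = mprod I h x k l" .
qed

lemma mone_mhom: "mone I \<in> mhom I P x x"
  unfolding mhom_def using mone_malg fld by (auto simp: mprod_mone_left mprod_mone_right fin)

lemma miso_refl: "miso I P x x"
  unfolding miso_def using mone_mhom mone_malg malg_mone_left[OF mone_malg] by blast

lemma miso_sym: "miso I P x y \<Longrightarrow> miso I P y x"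
  unfolding miso_def using mhom_inverse unfolding mhom_def by blast

lemma miso_trans:
  assumes "miso I P x y" "miso I P y z" shows "miso I P x z"
proof -
  obtain g g' where g: "g \<in> mhom I P x y" "g' \<in> malg P" "mprod I g g' = mone I" "mprod I g' g = mone I"
    using assms(1) unfolding miso_def by blast
  obtain h h' where h: "h \<in> mhom I P y z" "h' \<in> malg P" "mprod I h h' = mone I" "mprod I h' h = mone I"
    using assms(2) unfolding miso_def by blast
  have a: "g \<in> malg P" "h \<in> malg P" using g h unfolding mhom_def by auto
  have "mprod I (mprod I g h) (mprod I h' g') = mprod I g (mprod I (mprod I h h') g')"
    by (simp add: mprod_assoc)
  then have 1: "mprod I (mprod I g h) (mprod I h' g') = mone I"
    by (simp add: h g malg_mone_left)
  have "mprod I (mprod I h' g') (mprod I g h) = mprod I h' (mprod I (mprod I g' g) h)"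
    by (simp add: mprod_assoc)
  then have 2: "mprod I (mprod I h' g') (mprod I g h) = mone I"
    by (simp add: h g malg_mone_left a)
  show ?thesis unfolding miso_def
    using mhom_mprod[OF g(1) h(1)] malg_mprod[OF h(2) g(2)] 1 2 by blast
qed

lemma miso_conj:
  assumes "g \<in> malg P" "g' \<in> malg P" "mprod I g g' = mone I" "mprod I g' g = mone I"
  shows "miso I P x (mprod I g' (mprod I x g))"
proof -
  have "mprod I g (mprod I g' (mprod I x g)) k l = mprod I x g k l" if "P k l" for k l
    using fld[OF that] assms by (simp flip: mprod_assoc) (simp add: mprod_assoc mprod_mone_left fin)
  then have "g \<in> mhom I P x (mprod I g' (mprod I x g))"
    using assms unfolding mhom_def by auto
  with assms show ?thesis unfolding miso_def by blast
qed

end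

definition mdiag :: "nat set \<Rightarrow> (nat \<Rightarrow> 'k::comm_ring_1) \<Rightarrow> 'k fmat" where
  "mdiag I t = (\<lambda>i j. if i = j \<and> i \<in> I then t i else 0)"

definition tcoords :: "(('j \<Rightarrow> 'k) \<Rightarrow> 'k) set" where
  "tcoords = {\<lambda>t. t j | j. True}"

text \<open>Where \<open>D\<close> does not vanish, \<open>\<sigma>\<close> is a section of the quotient by isomorphism and \<open>r\<close> is its
  coordinate map; only the coordinates in \<open>J\<close> matter. The classes of \<open>c\<close> are the blocks on which
  diagonal endomorphisms are constant.\<close>

locale good_data =
  fixes I :: "nat set" and P :: "nat \<Rightarrow> nat \<Rightarrow> bool" and J :: "(nat \<times> nat) set"
    and \<sigma> :: "(nat \<times> nat \<Rightarrow> 'k::field) \<Rightarrow> 'k fmat" and r :: "'k fmat \<Rightarrow> nat \<times> nat \<Rightarrow> 'k"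
    and D :: "'k fmat \<Rightarrow> 'k" and c :: "nat \<Rightarrow> nat"
  assumes J: "finite J" "J \<subseteq> I \<times> I"
    and D_poly: "D \<in> poly_funs mcoords"
    and \<sigma>_poly: "(\<lambda>t. \<sigma> t i j) \<in> poly_funs tcoords"
    and \<sigma>_supp: "\<sigma> t i j \<noteq> 0 \<Longrightarrow> P i j"
    and \<sigma>_cong: "(\<And>p. p \<in> J \<Longrightarrow> t p = t' p) \<Longrightarrow> \<sigma> t = \<sigma> t'"
    and D_nonzero: "\<exists>t. D (\<sigma> t) \<noteq> 0"
    and r_loc: "p \<in> J \<Longrightarrow> (\<lambda>x. r x p) \<in> loc mcoords D"
    and iso: "D x \<noteq> 0 \<Longrightarrow> miso I P x (\<sigma> (r x))"
    and r_invariant: "D x \<noteq> 0 \<Longrightarrow> D y \<noteq> 0 \<Longrightarrow> miso I P x y \<Longrightarrow> p \<in> J \<Longrightarrow> r x p = r y p"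
    and r_\<sigma>: "D (\<sigma> t) \<noteq> 0 \<Longrightarrow> p \<in> J \<Longrightarrow> r (\<sigma> t) p = t p"
    and endo: "D x \<noteq> 0 \<Longrightarrow>
      \<exists>y. miso I P x y \<and> mhom I P y y = {mdiag I (t \<circ> c) | t. True}"
    and c_closed: "i \<in> I \<Longrightarrow> c i \<in> I"

definition good :: "'k::field itself \<Rightarrow> nat set \<Rightarrow> (nat \<Rightarrow> nat \<Rightarrow> bool) \<Rightarrow> bool" where
  "good _ I P \<longleftrightarrow> (\<exists>J \<sigma> r D c. good_data I P J \<sigma> (r :: 'k fmat \<Rightarrow> _) D c)"

lemma good_reduction:
  assumes "preord I P" "I1 \<subseteq> I"
    and good: "good_data I1 P1 J \<sigma> (r :: 'k::field fmat \<Rightarrow> _) D c"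
    and \<iota>_poly: "\<And>i j. (\<lambda>x. \<iota> x i j) \<in> poly_funs mcoords"
    and \<iota>_supp: "\<And>x i j. \<iota> x i j \<noteq> (0::'k) \<Longrightarrow> P i j"
    and D0: "D0 \<in> poly_funs mcoords"
    and \<rho>: "\<And>i j. (\<lambda>x. \<rho> x i j) \<in> loc mcoords D0"
    and iso: "\<And>x. D0 x \<noteq> 0 \<Longrightarrow> miso I P x (\<iota> (\<rho> x))"
    and \<iota>: "\<And>x. (\<And>i j. x i j \<noteq> 0 \<Longrightarrow> P1 i j) \<Longrightarrow> D0 (\<iota> x) \<noteq> 0 \<and> \<rho> (\<iota> x) = x"
    and ff: "\<And>x y. miso I P (\<iota> x) (\<iota> y) \<Longrightarrow> miso I1 P1 x y"
            "\<And>x y. miso I1 P1 x y \<Longrightarrow> miso I P (\<iota> x) (\<iota> y)"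
    and diag: "\<And>y. mhom I1 P1 y y = {mdiag I1 (t \<circ> c) | t. True} \<Longrightarrow>
                 mhom I P (\<iota> y) (\<iota> y) = {mdiag I (t \<circ> c') | t. True}"
    and c': "\<And>i. i \<in> I \<Longrightarrow> c' i \<in> I"
  shows "good TYPE('k) I P"
proof -
  interpret preord I P by fact
  interpret g: good_data I1 P1 J \<sigma> r D c by fact
  have \<rho>c: "(\<lambda>x. h (\<rho> x)) \<in> loc mcoords D0" if "h \<in> mcoords" for h
    using \<rho> that by (auto simp: mcoords_def)
  obtain E m where E: "E \<in> poly_funs mcoords" "\<And>x. D0 x \<noteq> 0 \<Longrightarrow> D (\<rho> x) * D0 x ^ m = E x"
    "\<And>f. f \<in> loc mcoords D \<Longrightarrow> (\<lambda>x. f (\<rho> x)) \<in> loc mcoords (\<lambda>x. D0 x * E x)"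
    by (rule loc_comp_denominator[OF g.D_poly D0, of \<rho>]) (use \<rho>c in blast)+
  define D' where "D' = (\<lambda>x. D0 x * E x)"
  have D': "D0 x \<noteq> 0" "D (\<rho> x) \<noteq> 0" if "D' x \<noteq> 0" for x
    using that E(2)[of x] by (auto simp: D'_def)
  have \<sigma>: "D0 (\<iota> (\<sigma> t)) \<noteq> 0" "\<rho> (\<iota> (\<sigma> t)) = \<sigma> t" for t
    using \<iota>[of "\<sigma> t"] g.\<sigma>_supp[of t] by auto
  have D'\<sigma>: "D' (\<iota> (\<sigma> t)) \<noteq> 0 \<longleftrightarrow> D (\<sigma> t) \<noteq> 0" for t
    using E(2)[of "\<iota> (\<sigma> t)"] \<sigma>[of t] by (auto simp: D'_def simp flip: E(2))
  have "good_data I P J (\<lambda>t. \<iota> (\<sigma> t)) (\<lambda>x. r (\<rho> x)) D' c'"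
  proof
    show "finite J" "J \<subseteq> I \<times> I" using g.J assms(2) by auto
    show "D' \<in> poly_funs mcoords" unfolding D'_def by (intro poly_funs.mult D0 E)
    show "(\<lambda>t. \<iota> (\<sigma> t) i j) \<in> poly_funs tcoords" for i j
      by (rule poly_funs_comp[OF \<iota>_poly]) (auto simp: mcoords_def g.\<sigma>_poly)
    show "P i j" if "\<iota> (\<sigma> t) i j \<noteq> 0" for t i j
      by (rule \<iota>_supp[OF that])
    show "\<iota> (\<sigma> t) = \<iota> (\<sigma> t')" if "\<And>j. j \<in> J \<Longrightarrow> t j = t' j" for t t'
      using g.\<sigma>_cong[of t t'] that by auto
    show "\<exists>t. D' (\<iota> (\<sigma> t)) \<noteq> 0" using g.D_nonzero D'\<sigma> by auto
    show "(\<lambda>x. r (\<rho> x) j) \<in> loc mcoords D'" if "j \<in> J" for j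
      unfolding D'_def using E(3)[OF g.r_loc[OF that]] .
    show "miso I P x (\<iota> (\<sigma> (r (\<rho> x))))" if "D' x \<noteq> 0" for x
      using iso[OF D'(1)[OF that]] ff(2)[OF g.iso[OF D'(2)[OF that]]] by (rule miso_trans)
    show "r (\<rho> x) j = r (\<rho> y) j" if x: "D' x \<noteq> 0" and y: "D' y \<noteq> 0" and i: "miso I P x y" and "j \<in> J" for x y j
    proof (rule g.r_invariant)
      have "miso I P (\<iota> (\<rho> x)) (\<iota> (\<rho> y))"
        using miso_trans[OF miso_sym[OF iso[OF D'(1)[OF x]]] miso_trans[OF i iso[OF D'(1)[OF y]]]] .
      then show "miso I1 P1 (\<rho> x) (\<rho> y)" by (rule ff)
    qed (use D' x y \<open>j \<in> J\<close> in auto)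
    show "r (\<rho> (\<iota> (\<sigma> t))) j = t j" if "D' (\<iota> (\<sigma> t)) \<noteq> 0" "j \<in> J" for t j
      using that g.r_\<sigma> by (simp add: \<sigma> D'\<sigma>)
    show "\<exists>y. miso I P x y \<and> mhom I P y y = {mdiag I (t \<circ> c') | t. True}" if x: "D' x \<noteq> 0" for x
    proof -
      obtain y where y: "miso I1 P1 (\<rho> x) y" "mhom I1 P1 y y = {mdiag I1 (t \<circ> c) | t. True}"
        using g.endo[OF D'(2)[OF x]] by blast
      show ?thesis
        using diag[OF y(2)] miso_trans[OF iso[OF D'(1)[OF x]] ff(2)[OF y(1)]] by blast
    qed
    show "c' i \<in> I" if "i \<in> I" for i by (rule c'[OF that])
  qed
  then show ?thesis unfolding good_def by blast
qed

definition mtrans :: "'k fmat \<Rightarrow> 'k fmat" where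
  "mtrans x = (\<lambda>i j. x j i)"

lemma mtrans_mtrans [simp]: "mtrans (mtrans x) = x"
  by (simp add: mtrans_def)

lemma mprod_mtrans: "mprod I (mtrans x) (mtrans y) = mtrans (mprod I y x)"
  by (simp add: mprod_def mtrans_def mult.commute)

lemma mhom_mtrans: "h \<in> mhom I (\<lambda>i j. P j i) x y \<longleftrightarrow> mtrans h \<in> mhom I P (mtrans y) (mtrans x)"
  by (simp add: mhom_def malg_def mprod_mtrans) (auto simp: mtrans_def)

lemma miso_mtrans: "miso I (\<lambda>i j. P j i) x y \<longleftrightarrow> miso I P (mtrans y) (mtrans x)"
proof -
  have m: "h \<in> malg (\<lambda>i j. P j i) \<longleftrightarrow> mtrans h \<in> malg P" for h :: "'a fmat" and P
    by (auto simp: malg_def mtrans_def)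
  have p: "mprod I (mtrans h) (mtrans h') = mone I \<longleftrightarrow> mprod I h' h = mone I" for h h' :: "'a fmat"
    unfolding mprod_mtrans by (auto simp: mtrans_def mone_def fun_eq_iff)
  show ?thesis
  proof
    assume "miso I (\<lambda>i j. P j i) x y"
    then obtain h h' where "h \<in> mhom I (\<lambda>i j. P j i) x y" "h' \<in> malg (\<lambda>i j. P j i)"
      "mprod I h h' = mone I" "mprod I h' h = mone I" unfolding miso_def by blast
    from this have "mtrans h \<in> mhom I P (mtrans y) (mtrans x)" "mtrans h' \<in> malg P"
       "mprod I (mtrans h) (mtrans h') = mone I" "mprod I (mtrans h') (mtrans h) = mone I"
      by (simp_all add: mhom_mtrans[of h I P] m[of h' P] p)
    then show "miso I P (mtrans y) (mtrans x)" unfolding miso_def by blast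
  next
    assume "miso I P (mtrans y) (mtrans x)"
    then obtain h h' where "h \<in> mhom I P (mtrans y) (mtrans x)" "h' \<in> malg P"
      "mprod I h h' = mone I" "mprod I h' h = mone I" unfolding miso_def by blast
    then have "mtrans h \<in> mhom I (\<lambda>i j. P j i) x y" "mtrans h' \<in> malg (\<lambda>i j. P j i)"
       "mprod I (mtrans h) (mtrans h') = mone I" "mprod I (mtrans h') (mtrans h) = mone I"
      using p[of h h'] p[of h' h] by (simp_all add: mhom_mtrans[of "mtrans h" I P] m[of "mtrans h'" P])
    then show "miso I (\<lambda>i j. P j i) x y" unfolding miso_def by blast
  qed
qed

lemma good_mtrans:
  assumes "preord I P" and good: "good TYPE('k::field) I (\<lambda>i j. P j i)"
  shows "good TYPE('k) I P"
proof -
  have "\<exists>J \<sigma> r D c. good_data I (\<lambda>i j. P j i) J \<sigma> (r :: 'k fmat \<Rightarrow> _) D c"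
    using good by (simp only: good_def)
  then obtain J \<sigma> c D and r :: "'k fmat \<Rightarrow> _" where gd: "good_data I (\<lambda>i j. P j i) J \<sigma> r D c"
    by (elim exE)
  define \<iota> :: "'k fmat \<Rightarrow> 'k fmat" where "\<iota> x = (\<lambda>i j. if P i j then x j i else 0)" for x
  interpret preord I P by fact
  interpret T: preord I "\<lambda>i j. P j i"
  proof
    show "P k i" if "P j i" "P k j" for i j k using trans[OF that(2,1)] .
  qed (use fin refl fld in auto)
  have hom: "mhom I P (\<iota> x) (\<iota> y) = mhom I P (mtrans x) (mtrans y)" for x y
    by (rule mhom_cong) (auto simp: \<iota>_def mtrans_def)
  then have iso: "miso I P (\<iota> x) (\<iota> y) = miso I P (mtrans x) (mtrans y)" for x y
    unfolding miso_def by simp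
  show ?thesis
  proof (rule good_reduction[OF assms(1) order.refl gd, of \<iota> "\<lambda>x. 1" mtrans])
    show "(\<lambda>x. \<iota> x i j) \<in> poly_funs mcoords" for i j
      by (cases "P i j") (auto simp: \<iota>_def intro: poly_funs.const)
    show "P i j" if "\<iota> x i j \<noteq> 0" for x i j using that by (auto simp: \<iota>_def split: if_splits)
    show "(\<lambda>x. mtrans x i j) \<in> loc mcoords (\<lambda>x. 1)" for i j
      unfolding mtrans_def by (rule loc_poly) (rule mcoords_poly)
    show "miso I P x (\<iota> (mtrans x))" for x
    proof -
      have "miso I P x (\<iota> (mtrans x)) \<longleftrightarrow> miso I P x x"
        by (rule miso_cong) (auto simp: \<iota>_def mtrans_def)
      then show ?thesis using miso_refl by simp
    qed
    show "1 \<noteq> (0::'k) \<and> mtrans (\<iota> x) = x" if "\<And>i j. x i j \<noteq> 0 \<Longrightarrow> P j i" for x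
      using that by (auto simp: \<iota>_def mtrans_def fun_eq_iff)
    show "miso I (\<lambda>i j. P j i) x y" if "miso I P (\<iota> x) (\<iota> y)" for x y
      using miso_sym[OF that[unfolded iso]] by (simp add: miso_mtrans[of I P])
    show "miso I P (\<iota> x) (\<iota> y)" if "miso I (\<lambda>i j. P j i) x y" for x y
      using miso_sym[OF that[unfolded miso_mtrans[of I P]]] by (simp add: iso)
    show "mhom I P (\<iota> y) (\<iota> y) = {mdiag I (t \<circ> c) | t. True}"
      if "mhom I (\<lambda>i j. P j i) y y = {mdiag I (t \<circ> c) | t. True}" for y
    proof -
      have d: "mtrans (mdiag I t) = mdiag I t" for t :: "nat \<Rightarrow> 'k" by (auto simp: mtrans_def mdiag_def fun_eq_iff)
      have "h \<in> mhom I P (\<iota> y) (\<iota> y) \<longleftrightarrow> mtrans h \<in> mhom I (\<lambda>i j. P j i) y y" for h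
        using mhom_mtrans[of "mtrans h" I P y y] unfolding hom by simp
      also have "mtrans h \<in> mhom I (\<lambda>i j. P j i) y y \<longleftrightarrow> (\<exists>t. h = mdiag I (t \<circ> c))" for h
      proof
        assume "mtrans h \<in> mhom I (\<lambda>i j. P j i) y y"
        then have "\<exists>t. mtrans h = mdiag I (t \<circ> c)" unfolding that mem_Collect_eq by simp
        then obtain t where "mtrans h = mdiag I (t \<circ> c)" by (elim exE)
        then have "mtrans (mtrans h) = mtrans (mdiag I (t \<circ> c))" by (rule arg_cong)
        then have "h = mdiag I (t \<circ> c)" by (simp add: d)
        then show "\<exists>t. h = mdiag I (t \<circ> c)" by (intro exI[of _ t])
      next
        assume "\<exists>t. h = mdiag I (t \<circ> c)"
        then show "mtrans h \<in> mhom I (\<lambda>i j. P j i) y y" unfolding that mem_Collect_eq using d by metis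
      qed
      finally show ?thesis by auto
    qed
    show "c i \<in> I" if "i \<in> I" for i by (rule good_data.c_closed[OF gd that])
  qed (auto intro: poly_funs.const)
qed

definition mcut :: "nat set \<Rightarrow> 'k::zero fmat \<Rightarrow> 'k fmat" where
  "mcut A x = (\<lambda>i j. if i \<in> A \<and> j \<in> A then x i j else 0)"

locale preord_sum = p1: preord I1 P1 + p2: preord I2 P2 for I1 P1 I2 P2 +
  assumes disj: "I1 \<inter> I2 = {}"
begin

abbreviation "P12 \<equiv> \<lambda>i j. P1 i j \<or> P2 i j"

sublocale preord "I1 \<union> I2" P12
proof
  show "finite (I1 \<union> I2)" using p1.fin p2.fin by simp
  show "P12 i i" if "i \<in> I1 \<union> I2" for i using that p1.refl p2.refl by blast
  show "P12 i k" if "P12 i j" "P12 j k" for i j k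
    using that p1.trans[of i j k] p2.trans[of i j k] p1.fld[of i j] p1.fld[of j k] p2.fld[of i j] p2.fld[of j k] disj
    by blast
  show "i \<in> I1 \<union> I2 \<and> j \<in> I1 \<union> I2" if "P12 i j" for i j
    using that p1.fld[of i j] p2.fld[of i j] by blast
qed

lemma mprod_sum1:
  assumes "h \<in> malg P12" "l \<in> I1"
  shows "mprod (I1 \<union> I2) x h k l = mprod I1 x h k l"
  unfolding mprod_def
proof (rule sum.mono_neutral_right)
  have "h i l = 0" if "i \<notin> I1" for i
    using malgD[OF assms(1), of l i] p1.fld[of l i] p2.fld[of l i] assms(2) disj that by blast
  then show "\<forall>i\<in>I1 \<union> I2 - I1. x k i * h i l = 0" by simp
qed (use p1.fin p2.fin in auto)

lemma mprod_sum1':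
  assumes "h \<in> malg P12" "k \<in> I1"
  shows "mprod (I1 \<union> I2) h x k l = mprod I1 h x k l"
  unfolding mprod_def
proof (rule sum.mono_neutral_right)
  have "h k i = 0" if "i \<notin> I1" for i
    using malgD[OF assms(1), of i k] p1.fld[of i k] p2.fld[of i k] assms(2) disj that by blast
  then show "\<forall>i\<in>I1 \<union> I2 - I1. h k i * x i l = 0" by simp
qed (use p1.fin p2.fin in auto)

lemma mcut1_malg: "h \<in> malg P12 \<Longrightarrow> mcut I1 h \<in> malg P1"
proof (rule malgI)
  fix i j assume h: "h \<in> malg P12" and "mcut I1 h i j \<noteq> 0"
  then have "i \<in> I1" "h i j \<noteq> 0" by (auto simp: mcut_def split: if_splits)
  then show "P1 j i" using malgD[OF h, of j i] p2.fld[of j i] disj by blast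
qed

lemma mcut_mone: "mcut I1 (mone (I1 \<union> I2)) = mone I1"
  by (auto simp: mcut_def mone_def fun_eq_iff)

lemma mcut_mprod:
  assumes "g \<in> malg P12" "h \<in> malg P12"
  shows "mcut I1 (mprod (I1 \<union> I2) g h) = mprod I1 (mcut I1 g) (mcut I1 h)"
proof (intro ext)
  fix i j
  show "mcut I1 (mprod (I1 \<union> I2) g h) i j = mprod I1 (mcut I1 g) (mcut I1 h) i j"
  proof (cases "i \<in> I1 \<and> j \<in> I1")
    case True
    then show ?thesis
      using mprod_sum1[OF assms(2), of j g i] by (simp add: mcut_def mprod_def)
  qed (auto simp: mcut_def mprod_def intro!: sum.neutral)
qed

lemma mhom_cut: 
  assumes "h \<in> mhom (I1 \<union> I2) P12 x y" shows "mcut I1 h \<in> mhom I1 P1 x y"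
  unfolding mhom_def
proof (intro CollectI conjI allI impI)
  have h: "h \<in> malg P12" using assms by (simp add: mhom_def)
  then show "mcut I1 h \<in> malg P1" by (rule mcut1_malg)
  fix k l assume kl: "P1 k l"
  then have "k \<in> I1" "l \<in> I1" using p1.fld by auto
  then have "mprod I1 x (mcut I1 h) k l = mprod (I1 \<union> I2) x h k l"
    "mprod I1 (mcut I1 h) y k l = mprod (I1 \<union> I2) h y k l"
    using mprod_sum1[OF h, of l x k] mprod_sum1'[OF h, of k y l] by (auto simp: mprod_def mcut_def)
  then show "mprod I1 x (mcut I1 h) k l = mprod I1 (mcut I1 h) y k l"
    using assms kl by (simp add: mhom_def)
qed

lemma miso_cut:
  assumes "miso (I1 \<union> I2) P12 x y" shows "miso I1 P1 x y"
proof -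
  obtain h h' where h: "h \<in> mhom (I1 \<union> I2) P12 x y" "h' \<in> malg P12"
      "mprod (I1 \<union> I2) h h' = mone (I1 \<union> I2)" "mprod (I1 \<union> I2) h' h = mone (I1 \<union> I2)"
    using assms unfolding miso_def by blast
  then have "h \<in> malg P12" by (simp add: mhom_def)
  then have "mprod I1 (mcut I1 h) (mcut I1 h') = mone I1" "mprod I1 (mcut I1 h') (mcut I1 h) = mone I1"
    using mcut_mprod[of h h'] mcut_mprod[of h' h] h by (auto simp: mcut_mone)
  then show ?thesis
    unfolding miso_def using mhom_cut[OF h(1)] mcut1_malg[OF h(2)] by blast
qed

end

definition madd :: "'k::plus fmat \<Rightarrow> 'k fmat \<Rightarrow> 'k fmat" where
  "madd x y = (\<lambda>i j. x i j + y i j)"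

lemma preord_sum_commute: "preord_sum I1 P1 I2 P2 \<Longrightarrow> preord_sum I2 P2 I1 P1"
  unfolding preord_sum_def preord_sum_axioms_def by auto

context preord_sum
begin

interpretation c: preord_sum I2 P2 I1 P1
  by (rule preord_sum_commute) unfold_locales

lemma miso_cut2: "miso (I1 \<union> I2) P12 x y \<Longrightarrow> miso I2 P2 x y"
  using c.miso_cut[of x y] by (simp add: Un_commute disj_commute)

lemma mhom_cut2: "h \<in> mhom (I1 \<union> I2) P12 x y \<Longrightarrow> mcut I2 h \<in> mhom I2 P2 x y"
  using c.mhom_cut[of h x y] by (simp add: Un_commute disj_commute)

lemma malg_cuts: "h \<in> malg P12 \<Longrightarrow> madd (mcut I1 h) (mcut I2 h) = h"
proof (intro ext)
  fix i j assume h: "h \<in> malg P12"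
  consider "P1 j i" | "P2 j i" | "h i j = 0" using malgD[OF h] by blast
  then show "madd (mcut I1 h) (mcut I2 h) i j = h i j"
  proof cases
    case 1
    with p1.fld[OF 1] disj have "i \<in> I1" "j \<in> I1" "i \<notin> I2" by auto
    then show ?thesis by (simp add: madd_def mcut_def)
  next
    case 2
    with p2.fld[OF 2] disj have "i \<in> I2" "j \<in> I2" "i \<notin> I1" by auto
    then show ?thesis by (simp add: madd_def mcut_def)
  qed (simp add: madd_def mcut_def)
qed

lemma madd_malg: "h1 \<in> malg P1 \<Longrightarrow> h2 \<in> malg P2 \<Longrightarrow> madd h1 h2 \<in> malg P12"
  by (rule malgI) (metis madd_def add_0 malgD)

lemma mcut_madd:
  assumes "h1 \<in> malg P1" "h2 \<in> malg P2"
  shows "mcut I1 (madd h1 h2) = h1" "mcut I2 (madd h1 h2) = h2"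
proof -
  have 1: "h1 i j = 0" if "i \<notin> I1 \<or> j \<notin> I1" for i j
    using malgD[OF assms(1), of j i] p1.fld[of j i] that by blast
  have 2: "h2 i j = 0" if "i \<notin> I2 \<or> j \<notin> I2" for i j
    using malgD[OF assms(2), of j i] p2.fld[of j i] that by blast
  have "h1 i j = 0" if "i \<in> I2" for i j using 1 that disj by blast
  moreover have "h2 i j = 0" if "i \<in> I1" for i j using 2 that disj by blast
  ultimately show "mcut I1 (madd h1 h2) = h1" "mcut I2 (madd h1 h2) = h2"
    using 1 2 by (auto simp: madd_def mcut_def fun_eq_iff)
qed

lemma madd_mhom:
  assumes "h1 \<in> mhom I1 P1 x y" "h2 \<in> mhom I2 P2 x y"
  shows "madd h1 h2 \<in> mhom (I1 \<union> I2) P12 x y"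
  unfolding mhom_def
proof (intro CollectI conjI allI impI)
  have h: "h1 \<in> malg P1" "h2 \<in> malg P2" using assms by (auto simp: mhom_def)
  then show m: "madd h1 h2 \<in> malg P12" by (rule madd_malg)
  have m': "madd h1 h2 \<in> malg (\<lambda>i j. P2 i j \<or> P1 i j)" using m by (simp add: malg_def disj_commute)
  fix k l assume "P1 k l \<or> P2 k l"
  then show "mprod (I1 \<union> I2) x (madd h1 h2) k l = mprod (I1 \<union> I2) (madd h1 h2) y k l"
  proof
    assume kl: "P1 k l"
    then have I: "k \<in> I1" "l \<in> I1" using p1.fld by auto
    have "h2 j l = 0" "h2 k j = 0" for j using I p2.fld disj by (auto intro!: malgD[OF h(2)])
    then show ?thesis
      using mprod_sum1[OF m, of l x k] mprod_sum1'[OF m, of k y l] I assms(1) kl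
      by (simp add: mprod_def madd_def mhom_def)
  next
    assume kl: "P2 k l"
    then have I: "k \<in> I2" "l \<in> I2" using p2.fld by auto
    have "h1 j l = 0" "h1 k j = 0" for j using I p1.fld disj by (auto intro!: malgD[OF h(1)])
    then show ?thesis
      using c.mprod_sum1[OF m', of l x k] c.mprod_sum1'[OF m', of k y l] I assms(2) kl
      by (simp add: mprod_def madd_def mhom_def Un_commute)
  qed
qed

lemma madd_mprod:
  assumes "g1 \<in> malg P1" "g2 \<in> malg P2" "h1 \<in> malg P1" "h2 \<in> malg P2"
  shows "mprod (I1 \<union> I2) (madd g1 g2) (madd h1 h2) = madd (mprod I1 g1 h1) (mprod I2 g2 h2)"
proof -
  note m = madd_malg[OF assms(1,2)] madd_malg[OF assms(3,4)]
  have m': "madd g1 g2 \<in> malg (\<lambda>i j. P2 i j \<or> P1 i j)" "madd h1 h2 \<in> malg (\<lambda>i j. P2 i j \<or> P1 i j)"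
    using m by (simp_all add: malg_def disj_commute)
  have "mprod (I1 \<union> I2) (madd g1 g2) (madd h1 h2) = 
    madd (mcut I1 (mprod (I1 \<union> I2) (madd g1 g2) (madd h1 h2))) (mcut I2 (mprod (I1 \<union> I2) (madd g1 g2) (madd h1 h2)))"
    by (rule malg_cuts[OF malg_mprod[OF m], symmetric])
  then show ?thesis
    using mcut_mprod[OF m] c.mcut_mprod[OF m'] by (simp add: mcut_madd assms Un_commute)
qed

lemma miso_madd:
  assumes "miso I1 P1 x y" "miso I2 P2 x y" shows "miso (I1 \<union> I2) P12 x y"
proof -
  obtain g g' where g: "g \<in> mhom I1 P1 x y" "g' \<in> malg P1" "mprod I1 g g' = mone I1" "mprod I1 g' g = mone I1"
    using assms(1) unfolding miso_def by blast
  obtain h h' where h: "h \<in> mhom I2 P2 x y" "h' \<in> malg P2" "mprod I2 h h' = mone I2" "mprod I2 h' h = mone I2"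
    using assms(2) unfolding miso_def by blast
  have a: "g \<in> malg P1" "h \<in> malg P2" using g h unfolding mhom_def by auto
  have o: "madd (mone I1) (mone I2) = (mone (I1 \<union> I2) :: 'a fmat)"
    using disj by (auto simp: madd_def mone_def fun_eq_iff)
  show ?thesis unfolding miso_def
    using madd_mhom[OF g(1) h(1)] madd_malg[OF g(2) h(2)]
      madd_mprod[OF a(1,2) g(2) h(2)] madd_mprod[OF g(2) h(2) a(1,2)]
    unfolding g h o by blast
qed

lemma good_sum:
  assumes "good TYPE('k::field) I1 P1" "good TYPE('k) I2 P2"
  shows "good TYPE('k) (I1 \<union> I2) P12"
proof -
  obtain J1 \<sigma>1 c1 D1 and r1 :: "'k fmat \<Rightarrow> _" where gd1: "good_data I1 P1 J1 \<sigma>1 r1 D1 c1"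
    using assms(1) unfolding good_def by blast
  obtain J2 \<sigma>2 c2 D2 and r2 :: "'k fmat \<Rightarrow> _" where gd2: "good_data I2 P2 J2 \<sigma>2 r2 D2 c2"
    using assms(2) unfolding good_def by blast
  interpret g1: good_data I1 P1 J1 \<sigma>1 r1 D1 c1 by fact
  interpret g2: good_data I2 P2 J2 \<sigma>2 r2 D2 c2 by fact
  have J: "J1 \<inter> J2 = {}" using g1.J g2.J disj by blast
  define \<sigma> where "\<sigma> t = madd (\<sigma>1 t) (\<sigma>2 t)" for t
  define r where "r x j = (if j \<in> J1 then r1 (mcut I1 x) j else r2 (mcut I2 x) j)" for x j
  define E1 where "E1 x = D1 (mcut I1 x)" for x
  define E2 where "E2 x = D2 (mcut I2 x)" for x
  define D where "D x = E1 x * E2 x" for x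
  define c where "c i = (if i \<in> I1 then c1 i else c2 i)" for i
  have s1: "\<sigma>1 t i j = 0" if "i \<notin> I1 \<or> j \<notin> I1" for t i j using g1.\<sigma>_supp[of t i j] p1.fld that by blast
  have s2: "\<sigma>2 t i j = 0" if "i \<notin> I2 \<or> j \<notin> I2" for t i j using g2.\<sigma>_supp[of t i j] p2.fld that by blast
  have cut\<sigma>: "mcut I1 (\<sigma> t) = \<sigma>1 t" "mcut I2 (\<sigma> t) = \<sigma>2 t" for t
  proof -
    have "\<sigma>1 t i j = 0" if "i \<in> I2" for i j using that disj s1 by blast
    moreover have "\<sigma>2 t i j = 0" if "i \<in> I1" for i j using that disj s2 by blast
    ultimately show "mcut I1 (\<sigma> t) = \<sigma>1 t" "mcut I2 (\<sigma> t) = \<sigma>2 t"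
      by (auto simp: mcut_def \<sigma>_def madd_def fun_eq_iff s1 s2)
  qed
  have cutp: "(\<lambda>x. mcut A x i j) \<in> poly_funs mcoords" for A i j
    unfolding mcut_def by (cases "i \<in> A \<and> j \<in> A") (auto intro: poly_funs.const)
  have E: "E1 \<in> poly_funs mcoords" "E2 \<in> poly_funs mcoords"
    unfolding E1_def[abs_def] E2_def[abs_def] by (rule mpoly_comp[OF _ cutp], rule g1.D_poly g2.D_poly)+
  have iso1: "miso I1 P1 (mcut I1 x) y \<longleftrightarrow> miso I1 P1 x y" "miso I1 P1 y (mcut I1 x) \<longleftrightarrow> miso I1 P1 y x" for x y :: "'k fmat"
    by (rule p1.miso_cong; use p1.fld in \<open>auto simp: mcut_def\<close>)+
  have iso2: "miso I2 P2 (mcut I2 x) y \<longleftrightarrow> miso I2 P2 x y" "miso I2 P2 y (mcut I2 x) \<longleftrightarrow> miso I2 P2 y x" for x y :: "'k fmat"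
    by (rule p2.miso_cong; use p2.fld in \<open>auto simp: mcut_def\<close>)+
  have \<sigma>J: "\<sigma>1 t = \<sigma>1 t'" "\<sigma>2 t = \<sigma>2 t'" if "\<And>j. j \<in> J1 \<union> J2 \<Longrightarrow> t j = t' j" for t t'
    using g1.\<sigma>_cong[of t t'] g2.\<sigma>_cong[of t t'] that by auto
  have \<sigma>r: "\<sigma>1 (r x) = \<sigma>1 (r1 (mcut I1 x))" "\<sigma>2 (r x) = \<sigma>2 (r2 (mcut I2 x))" for x
  proof -
    show "\<sigma>1 (r x) = \<sigma>1 (r1 (mcut I1 x))" by (rule g1.\<sigma>_cong) (simp add: r_def)
    show "\<sigma>2 (r x) = \<sigma>2 (r2 (mcut I2 x))" by (rule g2.\<sigma>_cong) (use J in \<open>auto simp: r_def\<close>)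
  qed
  have loc1: "(\<lambda>x. f (mcut I1 x)) \<in> loc mcoords D" if f: "f \<in> loc mcoords D1" for f
  proof -
    obtain p m where p: "p \<in> poly_funs mcoords" "\<And>x. D1 x \<noteq> 0 \<Longrightarrow> f x * D1 x ^ m = p x"
      using f unfolding loc_def by blast
    have "(\<lambda>x. f (mcut I1 x)) \<in> loc mcoords E1"
      by (rule locI[of "\<lambda>x. p (mcut I1 x)" _ _ _ m])
        (simp_all add: mpoly_comp[OF p(1) cutp] p(2) E1_def)
    from loc_factor[OF this E(2)] show ?thesis by (simp add: D_def[abs_def])
  qed
  have loc2: "(\<lambda>x. f (mcut I2 x)) \<in> loc mcoords D" if f: "f \<in> loc mcoords D2" for f
  proof -
    obtain p m where p: "p \<in> poly_funs mcoords" "\<And>x. D2 x \<noteq> 0 \<Longrightarrow> f x * D2 x ^ m = p x"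
      using f unfolding loc_def by blast
    have "(\<lambda>x. f (mcut I2 x)) \<in> loc mcoords E2"
      by (rule locI[of "\<lambda>x. p (mcut I2 x)" _ _ _ m])
        (simp_all add: mpoly_comp[OF p(1) cutp] p(2) E2_def)
    from loc_factor[OF this E(1)] show ?thesis by (simp add: D_def[abs_def] mult.commute)
  qed
  have D12: "D x \<noteq> 0 \<longleftrightarrow> D1 (mcut I1 x) \<noteq> 0 \<and> D2 (mcut I2 x) \<noteq> 0" for x
    by (simp add: D_def E1_def E2_def)
  have "good_data (I1 \<union> I2) P12 (J1 \<union> J2) \<sigma> r D c"
  proof
    show "finite (J1 \<union> J2)" "J1 \<union> J2 \<subseteq> (I1 \<union> I2) \<times> (I1 \<union> I2)" using g1.J g2.J by auto
    show "D \<in> poly_funs mcoords" unfolding D_def[abs_def] by (intro poly_funs.mult E)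
    show "(\<lambda>t. \<sigma> t i j) \<in> poly_funs tcoords" for i j
      unfolding \<sigma>_def madd_def by (intro poly_funs.add g1.\<sigma>_poly g2.\<sigma>_poly)
    show "P12 i j" if "\<sigma> t i j \<noteq> 0" for t i j
      using that g1.\<sigma>_supp[of t i j] g2.\<sigma>_supp[of t i j] unfolding \<sigma>_def madd_def by (metis add_0)
    show "\<sigma> t = \<sigma> t'" if "\<And>j. j \<in> J1 \<union> J2 \<Longrightarrow> t j = t' j" for t t'
      unfolding \<sigma>_def using \<sigma>J[of t t'] that by simp
    show "\<exists>t. D (\<sigma> t) \<noteq> 0"
    proof -
      obtain t1 t2 where t: "D1 (\<sigma>1 t1) \<noteq> 0" "D2 (\<sigma>2 t2) \<noteq> 0" using g1.D_nonzero g2.D_nonzero by blast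
      define t where "t j = (if j \<in> J1 then t1 j else t2 j)" for j
      have "\<sigma>1 t = \<sigma>1 t1" "\<sigma>2 t = \<sigma>2 t2"
        using J by (auto intro!: g1.\<sigma>_cong g2.\<sigma>_cong simp: t_def)
      with t have "D (\<sigma> t) \<noteq> 0" unfolding D12 cut\<sigma> by simp
      then show ?thesis by blast
    qed
    show "(\<lambda>x. r x j) \<in> loc mcoords D" if "j \<in> J1 \<union> J2" for j
      using loc1[OF g1.r_loc, of j] loc2[OF g2.r_loc, of j] that unfolding r_def by (cases "j \<in> J1") auto
    show "miso (I1 \<union> I2) P12 x (\<sigma> (r x))" if "D x \<noteq> 0" for x
    proof (rule miso_madd)
      have "miso I1 P1 (mcut I1 x) (mcut I1 (\<sigma> (r x)))"
        using that g1.iso[of "mcut I1 x"] by (simp add: D12 cut\<sigma> \<sigma>r)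
      then show "miso I1 P1 x (\<sigma> (r x))" unfolding iso1 .
      have "miso I2 P2 (mcut I2 x) (mcut I2 (\<sigma> (r x)))"
        using that g2.iso[of "mcut I2 x"] by (simp add: D12 cut\<sigma> \<sigma>r)
      then show "miso I2 P2 x (\<sigma> (r x))" unfolding iso2 .
    qed
    show "r x j = r y j" if x: "D x \<noteq> 0" and y: "D y \<noteq> 0" and i: "miso (I1 \<union> I2) P12 x y"
      and "j \<in> J1 \<union> J2" for x y j
    proof -
      have "miso I1 P1 (mcut I1 x) (mcut I1 y)" "miso I2 P2 (mcut I2 x) (mcut I2 y)"
        using miso_cut[OF i] miso_cut2[OF i] by (simp_all add: iso1 iso2)
      then show ?thesis
        using x y \<open>j \<in> J1 \<union> J2\<close> g1.r_invariant[of "mcut I1 x" "mcut I1 y" j]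
          g2.r_invariant[of "mcut I2 x" "mcut I2 y" j] unfolding D12 r_def by auto
    qed
    show "r (\<sigma> t) j = t j" if "D (\<sigma> t) \<noteq> 0" "j \<in> J1 \<union> J2" for t j
      using that g1.r_\<sigma>[of t j] g2.r_\<sigma>[of t j] unfolding D12 r_def cut\<sigma> by auto
    show "c i \<in> I1 \<union> I2" if "i \<in> I1 \<union> I2" for i using that g1.c_closed g2.c_closed by (auto simp: c_def)
    show "\<exists>y. miso (I1 \<union> I2) P12 x y \<and> mhom (I1 \<union> I2) P12 y y = {mdiag (I1 \<union> I2) (t \<circ> c) | t. True}"
      if x: "D x \<noteq> 0" for x
    proof -
      obtain y1 where y1: "miso I1 P1 (mcut I1 x) y1" "mhom I1 P1 y1 y1 = {mdiag I1 (t \<circ> c1) | t. True}"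
        using g1.endo[of "mcut I1 x"] x unfolding D12 by (elim conjE) blast
      obtain y2 where y2: "miso I2 P2 (mcut I2 x) y2" "mhom I2 P2 y2 y2 = {mdiag I2 (t \<circ> c2) | t. True}"
        using g2.endo[of "mcut I2 x"] x unfolding D12 by (elim conjE) blast
      define y where "y = madd (mcut I1 y1) (mcut I2 y2)"
      have y: "mcut I1 y = mcut I1 y1" "mcut I2 y = mcut I2 y2"
        using disj by (auto simp: y_def madd_def mcut_def fun_eq_iff)
      have h1: "mhom I1 P1 y y = mhom I1 P1 y1 y1"
      proof (rule p1.mhom_cong)
        fix k l assume "P1 k l"
        then have "k \<in> I1" "l \<in> I1" using p1.fld by auto
        moreover have "mcut I1 y k l = mcut I1 y1 k l" by (simp add: y)
        ultimately show "y k l = y1 k l" "y k l = y1 k l" by (simp_all add: mcut_def)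
      qed
      have h2: "mhom I2 P2 y y = mhom I2 P2 y2 y2"
      proof (rule p2.mhom_cong)
        fix k l assume "P2 k l"
        then have "k \<in> I2" "l \<in> I2" using p2.fld by auto
        moreover have "mcut I2 y k l = mcut I2 y2 k l" by (simp add: y)
        ultimately show "y k l = y2 k l" "y k l = y2 k l" by (simp_all add: mcut_def)
      qed
      have "miso I1 P1 x y" using y1(1) iso1(2)[of x y] iso1(2)[of x y1] by (simp add: iso1(1) y)
      moreover have "miso I2 P2 x y" using y2(1) iso2(2)[of x y] iso2(2)[of x y2] by (simp add: iso2(1) y)
      ultimately have "miso (I1 \<union> I2) P12 x y" by (rule miso_madd)
      moreover have "mhom (I1 \<union> I2) P12 y y = {mdiag (I1 \<union> I2) (t \<circ> c) | t :: nat \<Rightarrow> 'k. True}"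
      proof (intro equalityI subsetI)
        fix h assume h: "h \<in> mhom (I1 \<union> I2) P12 y y"
        obtain t1 where t1: "mcut I1 h = mdiag I1 (t1 \<circ> c1)" using mhom_cut[OF h] h1 y1 by auto
        obtain t2 where t2: "mcut I2 h = mdiag I2 (t2 \<circ> c2)" using mhom_cut2[OF h] h2 y2 by auto
        define t where "t i = (if i \<in> I1 then t1 i else t2 i)" for i
        have "h = madd (mdiag I1 (t1 \<circ> c1)) (mdiag I2 (t2 \<circ> c2))"
          using malg_cuts[of h] h t1 t2 by (simp add: mhom_def)
        also have "\<dots> = mdiag (I1 \<union> I2) (t \<circ> c)"
          using g1.c_closed g2.c_closed disj by (auto simp: madd_def mdiag_def c_def t_def fun_eq_iff disjoint_iff)
        finally show "h \<in> {mdiag (I1 \<union> I2) (t \<circ> c) | t. True}" by blast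
      next
        fix h :: "'k fmat" assume "h \<in> {mdiag (I1 \<union> I2) (t \<circ> c) | t. True}"
        then obtain t :: "nat \<Rightarrow> 'k" where t: "h = mdiag (I1 \<union> I2) (t \<circ> c)" by blast
        have "h = madd (mdiag I1 (t \<circ> c1)) (mdiag I2 (t \<circ> c2))"
          unfolding t using g1.c_closed g2.c_closed disj by (auto simp: madd_def mdiag_def c_def fun_eq_iff disjoint_iff)
        moreover have "mdiag I1 (t \<circ> c1) \<in> mhom I1 P1 y y" "mdiag I2 (t \<circ> c2) \<in> mhom I2 P2 y y"
          unfolding h1 h2 y1 y2 by auto
        ultimately show "h \<in> mhom (I1 \<union> I2) P12 y y" using madd_mhom by blast
      qed
      ultimately show ?thesis by blast
    qed
  qed
  then show ?thesis unfolding good_def by blast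
qed

end

section \<open>The pivot reduction\<close>

text \<open>\<open>K \<union> L\<close> is the first block of one flag and \<open>K \<union> L \<union> Z \<union> Q\<close> that of the other. The block of
  entries \<open>(i, \<tau> j)\<close> with \<open>i\<close> and \<open>j\<close> in \<open>L\<close> is generically invertible; normalising it to the identity
  removes the indices in \<open>L\<close>.\<close>

locale pivot = preord I P for I P +
  fixes K L Z Q W :: "nat set" and \<tau> \<tau>' :: "nat \<Rightarrow> nat"
  assumes I_eq: "I = K \<union> L \<union> (Z \<union> Q \<union> W)"
    and disj: "K \<inter> L = {}" "K \<inter> (Z \<union> Q \<union> W) = {}" "L \<inter> (Z \<union> Q \<union> W) = {}"
      "Z \<inter> Q = {}" "Z \<inter> W = {}" "Q \<inter> W = {}"
    and \<tau>: "i \<in> L \<Longrightarrow> \<tau> i \<in> Q" "i \<in> L \<Longrightarrow> \<tau>' (\<tau> i) = i"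
    and \<tau>': "i \<in> Q \<Longrightarrow> \<tau>' i \<in> L" "i \<in> Q \<Longrightarrow> \<tau> (\<tau>' i) = i"
    and AA: "i \<in> K \<union> L \<Longrightarrow> j \<in> K \<union> L \<Longrightarrow> P i j"
    and AC: "i \<in> K \<union> L \<Longrightarrow> j \<in> Z \<union> Q \<Longrightarrow> P i j"
    and AW: "i \<in> K \<union> L \<Longrightarrow> j \<in> W \<Longrightarrow> \<not> P i j"
    and RA: "i \<in> Z \<union> Q \<union> W \<Longrightarrow> j \<in> K \<union> L \<Longrightarrow> \<not> P i j"
    and CW: "i \<in> Z \<union> Q \<Longrightarrow> j \<in> W \<Longrightarrow> \<not> P i j"
    and ZQ: "i \<in> Z \<Longrightarrow> j \<in> Q \<Longrightarrow> P i j"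
    and KZ: "K = {} \<or> Z = {}"
begin

abbreviation "R \<equiv> Z \<union> Q \<union> W"
abbreviation "I1 \<equiv> K \<union> R"

definition P1 :: "nat \<Rightarrow> nat \<Rightarrow> bool" where
  "P1 i j \<longleftrightarrow> P i j \<and> i \<notin> L \<and> j \<notin> L \<and> \<not> (i \<in> Z \<and> j \<in> Q)"

lemma fins: "finite K" "finite L" "finite Z" "finite Q" "finite W"
  using fin unfolding I_eq by auto

lemma inI: "i \<in> K \<Longrightarrow> i \<in> I" "i \<in> L \<Longrightarrow> i \<in> I" "i \<in> R \<Longrightarrow> i \<in> I"
  unfolding I_eq by auto

lemma p_inI: "i \<in> I1 \<Longrightarrow> i \<in> I"
  unfolding I_eq by auto

lemma dK: "i \<in> K \<Longrightarrow> i \<notin> L \<and> i \<notin> Z \<and> i \<notin> Q \<and> i \<notin> W"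
  and dL: "i \<in> L \<Longrightarrow> i \<notin> K \<and> i \<notin> Z \<and> i \<notin> Q \<and> i \<notin> W"
  and dZ: "i \<in> Z \<Longrightarrow> i \<notin> K \<and> i \<notin> L \<and> i \<notin> Q \<and> i \<notin> W"
  and dQ: "i \<in> Q \<Longrightarrow> i \<notin> K \<and> i \<notin> L \<and> i \<notin> Z \<and> i \<notin> W"
  and dW: "i \<in> W \<Longrightarrow> i \<notin> K \<and> i \<notin> L \<and> i \<notin> Z \<and> i \<notin> Q"
  and dR: "i \<in> R \<Longrightarrow> i \<notin> K \<and> i \<notin> L"
  using disj by blast+

lemma sum_I: "(\<Sum>j\<in>I. f j) = (\<Sum>j\<in>K. f j) + (\<Sum>j\<in>L. f j) + (\<Sum>j\<in>R. f j)"
  unfolding I_eq using disj fins by (simp add: sum.union_disjoint Int_Un_distrib2)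

lemma sum_I1: "(\<Sum>j\<in>I1. f j) = (\<Sum>j\<in>K. f j) + (\<Sum>j\<in>R. f j)"
  using disj fins by (simp add: sum.union_disjoint)

lemma sum_\<tau>: "(\<Sum>j\<in>L. f j (\<tau> j)) = (\<Sum>q\<in>Q. f (\<tau>' q) q)"
  by (rule sum.reindex_bij_witness[of _ \<tau>' \<tau>]) (use \<tau> \<tau>' in auto)

lemma sum_R_Q: 
  assumes "\<And>j. j \<in> Z \<Longrightarrow> f j = 0" "\<And>j. j \<in> W \<Longrightarrow> f j = 0"
  shows "(\<Sum>j\<in>R. f j) = (\<Sum>q\<in>Q. f q)"
  by (rule sum.mono_neutral_right) (use fins assms in auto)

lemma P_cases:
  assumes "P i j"
  obtains "i \<in> K" "j \<in> K" | "i \<in> K" "j \<in> L" | "i \<in> L" "j \<in> K" | "i \<in> L" "j \<in> L"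
    | "i \<in> K" "j \<in> Q" "Z = {}" | "i \<in> L" "j \<in> Q" | "i \<in> L" "j \<in> Z" "K = {}"
    | "i \<in> R" "j \<in> R"
proof -
  have ij: "i \<in> K \<union> L \<union> R" "j \<in> K \<union> L \<union> R" using fld[OF assms] unfolding I_eq by auto
  show thesis
  proof (cases "i \<in> R")
    case True
    then have "j \<notin> K \<union> L" using RA[OF True] assms by blast
    then show thesis using ij True that(8) by blast
  next
    case False
    then have A: "i \<in> K \<union> L" using ij by blast
    then have "j \<notin> W" using AW[OF A] assms by blast
    then show thesis using ij(2) A KZ that by blast
  qed
qed

lemma P1_cases:
  assumes "P1 i j"
  obtains "i \<in> K" "j \<in> K" | "i \<in> K" "j \<in> Q" "Z = {}" | "i \<in> R" "j \<in> R" "P i j" "\<not> (i \<in> Z \<and> j \<in> Q)"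
proof -
  have a: "P i j" "i \<notin> L" "j \<notin> L" "\<not> (i \<in> Z \<and> j \<in> Q)" using assms unfolding P1_def by auto
  from a(1) show thesis
  proof (cases rule: P_cases)
    case 1 then show thesis by (rule that(1))
  next
    case 5 then show thesis by (rule that(2))
  next
    case 8 then show thesis using a(1,4) by (rule that(3))
  qed (use a in blast)+
qed

lemma P1_I1: "P1 i j \<Longrightarrow> i \<in> I1 \<and> j \<in> I1"
  by (erule P1_cases) auto

lemma P1_P: "P1 i j \<Longrightarrow> P i j"
  by (simp add: P1_def)

lemma P1_KK: "i \<in> K \<Longrightarrow> j \<in> K \<Longrightarrow> P1 i j"
  using AA[of i j] dK[of i] dK[of j] by (simp add: P1_def)

lemma P1_KQ: "i \<in> K \<Longrightarrow> j \<in> Q \<Longrightarrow> P1 i j"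
  using AC[of i j] dK[of i] dQ[of j] by (simp add: P1_def)

lemma CR: "i \<in> Z \<union> Q \<Longrightarrow> P i j \<Longrightarrow> j \<in> Z \<union> Q"
  using fld[of i j] RA[of i j] CW[of i j] unfolding I_eq by blast

sublocale p1: preord I1 P1
proof
  show "finite I1" using fins by auto
  show "P1 i i" if "i \<in> I1" for i using that refl[OF p_inI[OF that]] disj by (auto simp: P1_def)
  show "P1 i k" if "P1 i j" "P1 j k" for i j k
  proof -
    have ik: "P i k" using trans[of i j k] that by (simp add: P1_def)
    have "\<not> (i \<in> Z \<and> k \<in> Q)"
    proof
      assume a: "i \<in> Z \<and> k \<in> Q"
      then have "j \<in> Z \<union> Q" using CR[of i j] that(1) by (auto simp: P1_def)
      then show False using a that by (auto simp: P1_def)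
    qed
    then show ?thesis using ik that by (simp add: P1_def)
  qed
  show "i \<in> I1 \<and> j \<in> I1" if "P1 i j" for i j using P1_I1[OF that] .
qed

definition cut :: "'k::zero fmat \<Rightarrow> 'k fmat" where
  "cut x = (\<lambda>i j. if P1 i j then x i j else 0)"

definition \<iota> :: "'k::{zero,one} fmat \<Rightarrow> 'k fmat" where
  "\<iota> x = (\<lambda>i j. if i \<in> L then (if j = \<tau> i then 1 else 0)
     else if i \<in> K \<and> j \<in> L then x i (\<tau> j)
     else if i \<in> K \<and> j \<notin> K then 0
     else cut x i j)"

lemma row_L: "k \<in> L \<Longrightarrow> mprod I (\<iota> x) h k l = h (\<tau> k) l"
  using fin \<tau>(1)[of k] inI(3)[of "\<tau> k"]
  by (simp add: mprod_def \<iota>_def if_distrib[of "\<lambda>u. u * _"] cong: if_cong)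

lemma row_K: 
  assumes "k \<in> K" 
  shows "mprod I (\<iota> x) h k l = (\<Sum>j\<in>K. x k j * h j l) + (\<Sum>j\<in>L. x k (\<tau> j) * h j l)"
proof -
  have "(\<Sum>j\<in>K. \<iota> x k j * h j l) = (\<Sum>j\<in>K. x k j * h j l)"
    using assms by (intro sum.cong) (auto simp: \<iota>_def dK cut_def P1_KK)
  moreover have "(\<Sum>j\<in>L. \<iota> x k j * h j l) = (\<Sum>j\<in>L. x k (\<tau> j) * h j l)"
    using assms by (intro sum.cong) (auto simp: \<iota>_def dK)
  moreover have "(\<Sum>j\<in>R. \<iota> x k j * h j l) = 0"
    using assms dK[OF assms] dR by (intro sum.neutral) (auto simp: \<iota>_def)
  ultimately show ?thesis unfolding mprod_def sum_I by simp
qed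

lemma row_R:
  assumes "k \<in> R"
  shows "mprod I (\<iota> x) h k l = (\<Sum>j\<in>R. cut x k j * h j l)"
proof -
  have k: "k \<notin> K" "k \<notin> L" using dR[OF assms] by auto
  have "(\<Sum>j\<in>K. \<iota> x k j * h j l) = 0" "(\<Sum>j\<in>L. \<iota> x k j * h j l) = 0"
    using RA[OF assms] k by (auto intro!: sum.neutral simp: \<iota>_def cut_def P1_def)
  moreover have "(\<Sum>j\<in>R. \<iota> x k j * h j l) = (\<Sum>j\<in>R. cut x k j * h j l)"
    using k by (intro sum.cong) (auto simp: \<iota>_def)
  ultimately show ?thesis unfolding mprod_def sum_I by simp
qed

lemma \<iota>_KL: "l \<in> K \<Longrightarrow> i \<in> L \<Longrightarrow> \<iota> x i l = 0" "l \<in> L \<Longrightarrow> i \<in> L \<Longrightarrow> \<iota> x i l = 0"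
  using \<tau>(1)[of i] dQ[of "\<tau> i"] by (auto simp: \<iota>_def)

lemma \<iota>_RA: "l \<in> K \<union> L \<Longrightarrow> i \<in> R \<Longrightarrow> \<iota> x i l = 0"
  using RA[of i l] dR[of i] by (auto simp: \<iota>_def cut_def P1_def)

lemma col_K:
  assumes "l \<in> K"
  shows "mprod I h (\<iota> y) k l = (\<Sum>i\<in>K. h k i * y i l)"
proof -
  have "(\<Sum>j\<in>K. h k j * \<iota> y j l) = (\<Sum>j\<in>K. h k j * y j l)"
    using assms by (intro sum.cong) (auto simp: \<iota>_def dK cut_def P1_KK)
  moreover have "(\<Sum>j\<in>L. h k j * \<iota> y j l) = 0" "(\<Sum>j\<in>R. h k j * \<iota> y j l) = 0"
    using assms by (auto intro!: sum.neutral simp: \<iota>_KL \<iota>_RA)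
  ultimately show ?thesis unfolding mprod_def sum_I by simp
qed

lemma col_L:
  assumes "l \<in> L"
  shows "mprod I h (\<iota> y) k l = (\<Sum>i\<in>K. h k i * y i (\<tau> l))"
proof -
  have "(\<Sum>j\<in>K. h k j * \<iota> y j l) = (\<Sum>j\<in>K. h k j * y j (\<tau> l))"
    using assms by (intro sum.cong) (auto simp: \<iota>_def dK)
  moreover have "(\<Sum>j\<in>L. h k j * \<iota> y j l) = 0" "(\<Sum>j\<in>R. h k j * \<iota> y j l) = 0"
    using assms by (auto intro!: sum.neutral simp: \<iota>_KL \<iota>_RA)
  ultimately show ?thesis unfolding mprod_def sum_I by simp
qed

lemma col_R:
  assumes "l \<in> R"
  shows "mprod I h (\<iota> y) k l = (\<Sum>i\<in>R. h k i * cut y i l) + (if l \<in> Q then h k (\<tau>' l) else 0)"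
proof -
  have l: "l \<notin> K" "l \<notin> L" using dR[OF assms] by auto
  have "(\<Sum>j\<in>K. h k j * \<iota> y j l) = 0"
    using l by (intro sum.neutral) (auto simp: \<iota>_def dK)
  moreover have "(\<Sum>j\<in>L. h k j * \<iota> y j l) = (if l \<in> Q then h k (\<tau>' l) else 0)"
  proof -
    have "(\<Sum>j\<in>L. h k j * \<iota> y j l) = (\<Sum>j\<in>L. if l \<in> Q \<and> j = \<tau>' l then h k j else 0)"
      using \<tau> \<tau>' by (intro sum.cong) (auto simp: \<iota>_def)
    also have "\<dots> = (if l \<in> Q then h k (\<tau>' l) else 0)"
      using fins \<tau>'(1)[of l] by auto
    finally show ?thesis .
  qed
  moreover have "(\<Sum>j\<in>R. h k j * \<iota> y j l) = (\<Sum>j\<in>R. h k j * cut y j l)"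
    using dR by (intro sum.cong) (auto simp: \<iota>_def)
  ultimately show ?thesis unfolding mprod_def sum_I by simp
qed

lemma malg_AR: "h \<in> malg P \<Longrightarrow> i \<in> K \<union> L \<Longrightarrow> j \<in> R \<Longrightarrow> h i j = 0"
  using malgD RA by blast

lemma malg_WA: "h \<in> malg P \<Longrightarrow> i \<in> W \<Longrightarrow> j \<in> K \<union> L \<Longrightarrow> h i j = 0"
  using malgD AW by blast

definition hom_eqs :: "'k::comm_ring_1 fmat \<Rightarrow> 'k fmat \<Rightarrow> 'k fmat \<Rightarrow> bool" where
  "hom_eqs x y h \<longleftrightarrow>
     (\<forall>k\<in>L. \<forall>l\<in>K. h (\<tau> k) l = (\<Sum>i\<in>K. h k i * y i l)) \<and>
     (\<forall>k\<in>L. \<forall>l\<in>L. h (\<tau> k) l = (\<Sum>i\<in>K. h k i * y i (\<tau> l))) \<and>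
     (\<forall>k\<in>L. \<forall>l\<in>Z. h (\<tau> k) l = 0) \<and>
     (\<forall>k\<in>L. \<forall>l\<in>Q. h (\<tau> k) l = h k (\<tau>' l)) \<and>
     (\<forall>k\<in>K. \<forall>l\<in>K. (\<Sum>j\<in>K. x k j * h j l) + (\<Sum>j\<in>L. x k (\<tau> j) * h j l) = (\<Sum>i\<in>K. h k i * y i l)) \<and>
     (\<forall>k\<in>K. \<forall>l\<in>L. (\<Sum>j\<in>K. x k j * h j l) + (\<Sum>j\<in>L. x k (\<tau> j) * h j l) = (\<Sum>i\<in>K. h k i * y i (\<tau> l))) \<and>
     (\<forall>k\<in>K. \<forall>l\<in>Q. h k (\<tau>' l) = 0) \<and>
     (\<forall>k\<in>R. \<forall>l\<in>R. P k l \<longrightarrow>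
        (\<Sum>j\<in>R. cut x k j * h j l) = (\<Sum>i\<in>R. h k i * cut y i l) + (if l \<in> Q then h k (\<tau>' l) else 0))"

lemma mhom_\<iota>_iff: "h \<in> mhom I P (\<iota> x) (\<iota> y) \<longleftrightarrow> h \<in> malg P \<and> hom_eqs x y h"
proof -
  have "(\<forall>k l. P k l \<longrightarrow> mprod I (\<iota> x) h k l = mprod I h (\<iota> y) k l) \<longleftrightarrow> hom_eqs x y h" if h: "h \<in> malg P"
  proof -
    note AR = malg_AR[OF h]
    have z1: "(\<Sum>j\<in>R. h k j * g j l) = 0" if "k \<in> K \<union> L" for k l and g :: "'a fmat"
      using AR[OF that] by (intro sum.neutral) simp
    have z2: "(\<Sum>j\<in>K. g k j * h j l) = 0" "(\<Sum>j\<in>L. g k j * h j l) = 0"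
        "(\<Sum>j\<in>L. g k (\<tau> j) * h j l) = 0" if "l \<in> R" for k l and g :: "'a fmat"
      using AR that by (auto intro!: sum.neutral)
    note S = row_L row_K row_R col_K col_L col_R z1 z2
    show ?thesis
    proof
      assume a: "\<forall>k l. P k l \<longrightarrow> mprod I (\<iota> x) h k l = mprod I h (\<iota> y) k l"
      then have b: "mprod I (\<iota> x) h k l = mprod I h (\<iota> y) k l" if "P k l" for k l using that by blast
      show "hom_eqs x y h"
        unfolding hom_eqs_def
      proof (intro conjI ballI impI)
        fix k l assume k: "k \<in> L"
        { assume "l \<in> K" with b[OF AA[of k l]] k show "h (\<tau> k) l = (\<Sum>i\<in>K. h k i * y i l)" by (simp add: S) }
        { assume "l \<in> L" with b[OF AA[of k l]] k show "h (\<tau> k) l = (\<Sum>i\<in>K. h k i * y i (\<tau> l))" by (simp add: S) }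
        { assume "l \<in> Z" with b[OF AC[of k l]] k show "h (\<tau> k) l = 0" by (simp add: S dZ) }
        { assume "l \<in> Q" with b[OF AC[of k l]] k show "h (\<tau> k) l = h k (\<tau>' l)" by (simp add: S) }
      next
        fix k l assume k: "k \<in> K"
        { assume "l \<in> K" with b[OF AA[of k l]] k
          show "(\<Sum>j\<in>K. x k j * h j l) + (\<Sum>j\<in>L. x k (\<tau> j) * h j l) = (\<Sum>i\<in>K. h k i * y i l)" by (simp add: S) }
        { assume "l \<in> L" with b[OF AA[of k l]] k
          show "(\<Sum>j\<in>K. x k j * h j l) + (\<Sum>j\<in>L. x k (\<tau> j) * h j l) = (\<Sum>i\<in>K. h k i * y i (\<tau> l))" by (simp add: S) }
        { assume "l \<in> Q" with b[OF AC[of k l]] k show "h k (\<tau>' l) = 0" by (simp add: S) }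
      next
        fix k l assume k: "k \<in> R" "l \<in> R" "P k l"
        show "(\<Sum>j\<in>R. cut x k j * h j l) = (\<Sum>i\<in>R. h k i * cut y i l) + (if l \<in> Q then h k (\<tau>' l) else 0)"
          using b[OF k(3)] unfolding row_R[OF k(1)] col_R[OF k(2)] .
      qed
    next
      assume e: "hom_eqs x y h"
      show "\<forall>k l. P k l \<longrightarrow> mprod I (\<iota> x) h k l = mprod I h (\<iota> y) k l"
      proof (intro allI impI)
        fix k l assume "P k l"
        then show "mprod I (\<iota> x) h k l = mprod I h (\<iota> y) k l"
        proof (cases rule: P_cases)
          case 8 
          then show ?thesis unfolding row_R[OF 8(1)] col_R[OF 8(2)] using e \<open>P k l\<close> unfolding hom_eqs_def by blast
        next
          case 5
          from 5(1,2) e show ?thesis by (simp add: S hom_eqs_def)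
        next
          case 7
          from 7(1,2) e show ?thesis by (simp add: S dZ hom_eqs_def)
        qed (use e in \<open>simp_all add: S hom_eqs_def\<close>)
      qed
    qed
  qed
  then show ?thesis unfolding mhom_def by blast
qed

definition hom_eqs1 :: "'k::comm_ring_1 fmat \<Rightarrow> 'k fmat \<Rightarrow> 'k fmat \<Rightarrow> bool" where
  "hom_eqs1 x y h \<longleftrightarrow>
     (\<forall>k\<in>K. \<forall>l\<in>K. (\<Sum>j\<in>K. x k j * h j l) + (\<Sum>q\<in>Q. x k q * h q l) = (\<Sum>i\<in>K. h k i * y i l)) \<and>
     (\<forall>k\<in>K. \<forall>l\<in>Q. (\<Sum>q\<in>Q. x k q * h q l) = (\<Sum>i\<in>K. h k i * y i l)) \<and>
     (\<forall>k\<in>R. \<forall>l\<in>R. P1 k l \<longrightarrow>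
        (\<Sum>j\<in>R. cut x k j * h j l) = (\<Sum>i\<in>R. h k i * cut y i l) + (\<Sum>i\<in>K. h k i * y i l))"

lemma malg1_KR: "h \<in> malg P1 \<Longrightarrow> i \<in> K \<Longrightarrow> j \<in> R \<Longrightarrow> h i j = 0"
  using RA[of j i] by (intro malgD[of h P1]) (auto simp: P1_def)

lemma malg1_nQK: "h \<in> malg P1 \<Longrightarrow> i \<notin> K \<Longrightarrow> i \<notin> Q \<Longrightarrow> j \<in> K \<Longrightarrow> h i j = 0"
proof (rule malgD[of h P1])
  assume "i \<notin> K" "i \<notin> Q" "j \<in> K"
  then show "\<not> P1 j i" using dK[of j] by (auto elim: P1_cases)
qed

lemma mhom1_iff: "h \<in> mhom I1 P1 x y \<longleftrightarrow> h \<in> malg P1 \<and> hom_eqs1 x y h"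
proof -
  have "(\<forall>k l. P1 k l \<longrightarrow> mprod I1 x h k l = mprod I1 h y k l) \<longleftrightarrow> hom_eqs1 x y h" if h: "h \<in> malg P1"
  proof -
    note KR = malg1_KR[OF h] and nQK = malg1_nQK[OF h]
    have KK: "mprod I1 x h k l = (\<Sum>j\<in>K. x k j * h j l) + (\<Sum>q\<in>Q. x k q * h q l)"
       "mprod I1 h y k l = (\<Sum>i\<in>K. h k i * y i l)" if "k \<in> K" "l \<in> K" for k l
    proof -
      have "(\<Sum>j\<in>R. x k j * h j l) = (\<Sum>q\<in>Q. x k q * h q l)"
        using nQK[OF _ _ that(2)] dZ dW by (intro sum_R_Q) force+
      then show "mprod I1 x h k l = (\<Sum>j\<in>K. x k j * h j l) + (\<Sum>q\<in>Q. x k q * h q l)"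
        unfolding mprod_def sum_I1 by simp
      have "(\<Sum>j\<in>R. h k j * y j l) = 0" using KR[OF that(1)] by (intro sum.neutral) simp
      then show "mprod I1 h y k l = (\<Sum>i\<in>K. h k i * y i l)" unfolding mprod_def sum_I1 by simp
    qed
    have KQ: "mprod I1 x h k l = (\<Sum>q\<in>Q. x k q * h q l)"
       "mprod I1 h y k l = (\<Sum>i\<in>K. h k i * y i l)" if "k \<in> K" "l \<in> Q" for k l
    proof -
      have "(\<Sum>j\<in>R. x k j * h j l) = (\<Sum>q\<in>Q. x k q * h q l)"
      proof (rule sum_R_Q)
        show "x k j * h j l = 0" if "j \<in> Z" for j using that KZ \<open>k \<in> K\<close> by auto
        show "x k j * h j l = 0" if "j \<in> W" for j
          using malgD[OF h, of l j] CW[of l j] that \<open>l \<in> Q\<close> by (simp add: P1_def)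
      qed
      moreover have "(\<Sum>j\<in>K. x k j * h j l) = 0" using KR that(2) by (intro sum.neutral) simp
      ultimately show "mprod I1 x h k l = (\<Sum>q\<in>Q. x k q * h q l)"
        unfolding mprod_def sum_I1 by simp
      have "(\<Sum>j\<in>R. h k j * y j l) = 0" using KR[OF that(1)] by (intro sum.neutral) simp
      then show "mprod I1 h y k l = (\<Sum>i\<in>K. h k i * y i l)" unfolding mprod_def sum_I1 by simp
    qed
    have RR: "mprod I1 x h k l = (\<Sum>j\<in>R. cut x k j * h j l)"
       "mprod I1 h y k l = (\<Sum>i\<in>R. h k i * cut y i l) + (\<Sum>i\<in>K. h k i * y i l)" if "k \<in> R" "l \<in> R" "P1 k l" for k l
    proof -
      have "(\<Sum>j\<in>R. x k j * h j l) = (\<Sum>j\<in>R. cut x k j * h j l)"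
      proof (intro sum.cong HOL.refl)
        fix j show "x k j * h j l = cut x k j * h j l"
          using malgD[OF h, of l j] p1.trans[OF that(3), of j] by (cases "P1 l j") (simp_all add: cut_def)
      qed
      moreover have "(\<Sum>j\<in>K. x k j * h j l) = 0" using KR that(2) by (intro sum.neutral) simp
      ultimately show "mprod I1 x h k l = (\<Sum>j\<in>R. cut x k j * h j l)"
        unfolding mprod_def sum_I1 by simp
      have "(\<Sum>j\<in>R. h k j * y j l) = (\<Sum>j\<in>R. h k j * cut y j l)"
      proof (intro sum.cong HOL.refl)
        fix j show "h k j * y j l = h k j * cut y j l"
          using malgD[OF h, of j k] p1.trans[OF _ that(3), of j] by (cases "P1 j k") (simp_all add: cut_def)
      qed
      then show "mprod I1 h y k l = (\<Sum>i\<in>R. h k i * cut y i l) + (\<Sum>i\<in>K. h k i * y i l)"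
        unfolding mprod_def sum_I1 by simp
    qed
    show ?thesis
    proof
      assume "\<forall>k l. P1 k l \<longrightarrow> mprod I1 x h k l = mprod I1 h y k l"
      then have b: "mprod I1 x h k l = mprod I1 h y k l" if "P1 k l" for k l using that by blast
      show "hom_eqs1 x y h" unfolding hom_eqs1_def
      proof (intro conjI ballI impI)
        fix k l assume k: "k \<in> K"
        { assume l: "l \<in> K" 
          show "(\<Sum>j\<in>K. x k j * h j l) + (\<Sum>q\<in>Q. x k q * h q l) = (\<Sum>i\<in>K. h k i * y i l)"
            using b[OF P1_KK[OF k l]] KK[OF k l] by simp }
        { assume l: "l \<in> Q" 
          show "(\<Sum>q\<in>Q. x k q * h q l) = (\<Sum>i\<in>K. h k i * y i l)"
            using b[OF P1_KQ[OF k l]] KQ[OF k l] by simp }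
      next
        fix k l assume kl: "k \<in> R" "l \<in> R" "P1 k l"
        show "(\<Sum>j\<in>R. cut x k j * h j l) = (\<Sum>i\<in>R. h k i * cut y i l) + (\<Sum>i\<in>K. h k i * y i l)"
          using b[OF kl(3)] RR[OF kl] by simp
      qed
    next
      assume e: "hom_eqs1 x y h"
      show "\<forall>k l. P1 k l \<longrightarrow> mprod I1 x h k l = mprod I1 h y k l"
      proof (intro allI impI)
        fix k l assume kl: "P1 k l"
        then show "mprod I1 x h k l = mprod I1 h y k l"
        proof (cases rule: P1_cases)
          case 1
          then show ?thesis using KK[OF 1] e unfolding hom_eqs1_def by simp
        next
          case 2
          then show ?thesis using KQ[OF 2(1,2)] e unfolding hom_eqs1_def by simp
        next
          case 3
          then show ?thesis unfolding RR[OF 3(1,2) kl] using e kl unfolding hom_eqs1_def by blast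
        qed
      qed
    qed
  qed
  then show ?thesis unfolding mhom_def by blast
qed

end

context pivot
begin

definition restr :: "'k::comm_ring_1 fmat \<Rightarrow> 'k fmat" where
  "restr h = (\<lambda>i j. if i \<in> Q \<and> j \<in> K then h (\<tau>' i) j
     else if i \<in> I1 \<and> j \<in> I1 then h i j else 0)"

definition lift :: "'k::comm_ring_1 fmat \<Rightarrow> 'k fmat \<Rightarrow> 'k fmat \<Rightarrow> 'k fmat" where
  "lift x y h = (\<lambda>i j.
     if i \<in> L then (if j \<in> K then h (\<tau> i) j else if j \<in> L then h (\<tau> i) (\<tau> j) else 0)
     else if i \<in> K then (if j \<in> K then h i j else 0)
     else if i \<in> R then
       (if j \<in> R then h i j
        else if j \<in> K then (if i \<in> Q then \<Sum>k\<in>K. h i k * y k j else 0)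
        else if j \<in> L then
          (if i \<in> Q then \<Sum>k\<in>K. h i k * y k (\<tau> j)
           else if i \<in> Z then (\<Sum>k\<in>R. cut x i k * h k (\<tau> j)) - (\<Sum>k\<in>R. h i k * cut y k (\<tau> j))
           else 0)
        else 0)
     else 0)"

lemma I_cases:
  obtains "i \<in> K" | "i \<in> L" | "i \<in> Z" | "i \<in> Q" | "i \<in> W" | "i \<notin> I"
  unfolding I_eq by blast

lemma restr_simps:
  "i \<in> Q \<Longrightarrow> j \<in> K \<Longrightarrow> restr h i j = h (\<tau>' i) j"
  "i \<in> R \<Longrightarrow> j \<in> R \<Longrightarrow> restr h i j = h i j"
  "i \<in> K \<Longrightarrow> j \<in> K \<Longrightarrow> restr h i j = h i j"
    apply (simp add: restr_def)
   apply (use dR[of j] in \<open>auto simp: restr_def\<close>)[1]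
  apply (use dK[of i] in \<open>auto simp: restr_def\<close>)[1]
  done

lemma lift_simps:
  "i \<in> L \<Longrightarrow> j \<in> K \<Longrightarrow> lift x y h i j = h (\<tau> i) j"
  "i \<in> L \<Longrightarrow> j \<in> L \<Longrightarrow> lift x y h i j = h (\<tau> i) (\<tau> j)"
  "i \<in> L \<Longrightarrow> j \<in> R \<Longrightarrow> lift x y h i j = 0"
  "i \<in> K \<Longrightarrow> j \<in> K \<Longrightarrow> lift x y h i j = h i j"
  "i \<in> K \<Longrightarrow> j \<in> L \<Longrightarrow> lift x y h i j = 0"
  "i \<in> K \<Longrightarrow> j \<in> R \<Longrightarrow> lift x y h i j = 0"
  "i \<in> R \<Longrightarrow> j \<in> R \<Longrightarrow> lift x y h i j = h i j"
  "i \<in> Q \<Longrightarrow> j \<in> K \<Longrightarrow> lift x y h i j = (\<Sum>k\<in>K. h i k * y k j)"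
  "i \<in> Q \<Longrightarrow> j \<in> L \<Longrightarrow> lift x y h i j = (\<Sum>k\<in>K. h i k * y k (\<tau> j))"
  "i \<in> Z \<Longrightarrow> j \<in> L \<Longrightarrow> lift x y h i j = (\<Sum>k\<in>R. cut x i k * h k (\<tau> j)) - (\<Sum>k\<in>R. h i k * cut y k (\<tau> j))"
  "i \<in> Z \<Longrightarrow> j \<in> K \<Longrightarrow> lift x y h i j = 0"
  "i \<in> W \<Longrightarrow> j \<in> K \<union> L \<Longrightarrow> lift x y h i j = 0"
  "i \<notin> I \<Longrightarrow> lift x y h i j = 0"
  "j \<notin> I \<Longrightarrow> lift x y h i j = 0"
               apply (use dK[of i] dK[of j] in \<open>force simp: lift_def\<close>)
              apply (use dL[of i] dL[of j] in \<open>force simp: lift_def\<close>)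
             apply (use dL[of i] dR[of j] in \<open>force simp: lift_def\<close>)
            apply (use dK[of i] dK[of j] in \<open>force simp: lift_def\<close>)
           apply (use dK[of i] dL[of j] in \<open>force simp: lift_def\<close>)
          apply (use dK[of i] dR[of j] in \<open>force simp: lift_def\<close>)
         apply (use dR[of i] dR[of j] in \<open>force simp: lift_def\<close>)
        apply (use dQ[of i] dK[of j] in \<open>force simp: lift_def\<close>)
       apply (use dQ[of i] dL[of j] in \<open>force simp: lift_def\<close>)
      apply (use dZ[of i] dL[of j] in \<open>force simp: lift_def\<close>)
     apply (use dZ[of i] dK[of j] in \<open>force simp: lift_def\<close>)
    apply (use dW[of i] dK[of j] dL[of j] in \<open>force simp: lift_def\<close>)
   apply (force simp: lift_def I_eq)
  apply (force simp: lift_def I_eq)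
  done

lemma malg_outside: "h \<in> malg P \<Longrightarrow> i \<notin> I \<or> j \<notin> I \<Longrightarrow> h i j = 0"
  using malgD[of h P j i] fld[of j i] by blast

lemma hom_restr:
  assumes "h \<in> mhom I P (\<iota> x) (\<iota> y)"
  shows hom_KL: "i \<in> K \<Longrightarrow> j \<in> L \<Longrightarrow> h i j = 0"
    and hom_QZ: "i \<in> Q \<Longrightarrow> j \<in> Z \<Longrightarrow> h i j = 0"
    and hom_LL: "i \<in> L \<Longrightarrow> j \<in> L \<Longrightarrow> h i j = h (\<tau> i) (\<tau> j)"
    and hom_QQ: "i \<in> Q \<Longrightarrow> j \<in> Q \<Longrightarrow> h i j = h (\<tau>' i) (\<tau>' j)"
    and hom_QK: "i \<in> Q \<Longrightarrow> j \<in> K \<Longrightarrow> h i j = (\<Sum>k\<in>K. h (\<tau>' i) k * y k j)"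
    and hom_QL: "i \<in> Q \<Longrightarrow> j \<in> L \<Longrightarrow> h i j = (\<Sum>k\<in>K. h (\<tau>' i) k * y k (\<tau> j))"
    and hom_RR: "k \<in> R \<Longrightarrow> l \<in> R \<Longrightarrow> P k l \<Longrightarrow>
        (\<Sum>j\<in>R. cut x k j * h j l) = (\<Sum>i\<in>R. h k i * cut y i l) + (if l \<in> Q then h k (\<tau>' l) else 0)"
proof -
  note e = assms[unfolded mhom_\<iota>_iff hom_eqs_def]
  { assume "i \<in> K" "j \<in> L"
    then have "h i (\<tau>' (\<tau> j)) = 0" using e \<tau>(1)[of j] by blast
    then show "h i j = 0" using \<tau>(2)[OF \<open>j \<in> L\<close>] by simp }
  { assume "i \<in> Q" "j \<in> Z"
    then have "h (\<tau> (\<tau>' i)) j = 0" using e \<tau>'(1)[of i] by blast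
    then show "h i j = 0" using \<tau>'(2)[OF \<open>i \<in> Q\<close>] by simp }
  { assume "i \<in> L" "j \<in> L"
    then have "h (\<tau> i) (\<tau> j) = h i (\<tau>' (\<tau> j))" using e \<tau>(1)[of j] by blast
    then show "h i j = h (\<tau> i) (\<tau> j)" using \<tau>(2)[OF \<open>j \<in> L\<close>] by simp }
  { assume "i \<in> Q" "j \<in> Q"
    then have "h (\<tau> (\<tau>' i)) j = h (\<tau>' i) (\<tau>' j)" using e \<tau>'(1)[of i] by blast
    then show "h i j = h (\<tau>' i) (\<tau>' j)" using \<tau>'(2)[OF \<open>i \<in> Q\<close>] by simp }
  { assume "i \<in> Q" "j \<in> K"
    then have "h (\<tau> (\<tau>' i)) j = (\<Sum>k\<in>K. h (\<tau>' i) k * y k j)" using e \<tau>'(1)[of i] by blast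
    then show "h i j = (\<Sum>k\<in>K. h (\<tau>' i) k * y k j)" using \<tau>'(2)[OF \<open>i \<in> Q\<close>] by simp }
  { assume "i \<in> Q" "j \<in> L"
    then have "h (\<tau> (\<tau>' i)) j = (\<Sum>k\<in>K. h (\<tau>' i) k * y k (\<tau> j))" using e \<tau>'(1)[of i] by blast
    then show "h i j = (\<Sum>k\<in>K. h (\<tau>' i) k * y k (\<tau> j))" using \<tau>'(2)[OF \<open>i \<in> Q\<close>] by simp }
  { assume "k \<in> R" "l \<in> R" "P k l"
    then show "(\<Sum>j\<in>R. cut x k j * h j l) = (\<Sum>i\<in>R. h k i * cut y i l) + (if l \<in> Q then h k (\<tau>' l) else 0)"
      using e by blast }
qed

lemma restr_malg:
  assumes h: "h \<in> mhom I P (\<iota> x) (\<iota> y)" shows "restr h \<in> malg P1"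
proof (rule malgI)
  fix i j assume nz: "restr h i j \<noteq> 0"
  have m: "h \<in> malg P" using h by (simp add: mhom_def)
  show "P1 j i"
  proof (cases "i \<in> Q \<and> j \<in> K")
    case True then show ?thesis by (simp add: P1_KQ)
  next
    case False
    then have ij: "i \<in> I1" "j \<in> I1" and hij: "h i j \<noteq> 0" using nz by (auto simp: restr_def split: if_splits)
    then have "P j i" using malgD[OF m] by blast
    moreover have "i \<notin> L" "j \<notin> L" using ij dK[of i] dR[of i] dK[of j] dR[of j] by blast+
    moreover have "\<not> (j \<in> Z \<and> i \<in> Q)" using hom_QZ[OF h] hij by blast
    ultimately show ?thesis by (simp add: P1_def)
  qed
qed

lemma restr_mhom:
  assumes h: "h \<in> mhom I P (\<iota> x) (\<iota> y)" shows "restr h \<in> mhom I1 P1 x y"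
proof -
  have m: "h \<in> malg P" using h by (simp add: mhom_def)
  note e = h[unfolded mhom_\<iota>_iff hom_eqs_def]
  have "hom_eqs1 x y (restr h)"
    unfolding hom_eqs1_def
  proof (intro conjI ballI impI)
    fix k l assume k: "k \<in> K"
    { assume l: "l \<in> K"
      have "(\<Sum>j\<in>K. x k j * h j l) + (\<Sum>j\<in>L. x k (\<tau> j) * h j l) = (\<Sum>i\<in>K. h k i * y i l)"
        using e k l by blast
      moreover have "(\<Sum>j\<in>L. x k (\<tau> j) * h j l) = (\<Sum>q\<in>Q. x k q * restr h q l)"
        unfolding sum_\<tau>[of "\<lambda>j q. x k q * h j l"] using l by (intro sum.cong) (simp_all add: restr_simps)
      ultimately show "(\<Sum>j\<in>K. x k j * restr h j l) + (\<Sum>q\<in>Q. x k q * restr h q l) = (\<Sum>i\<in>K. restr h k i * y i l)"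
        using k l by (simp add: restr_simps) }
    { assume l: "l \<in> Q"
      then have l': "\<tau>' l \<in> L" "\<tau> (\<tau>' l) = l" using \<tau>' by auto
      have "(\<Sum>j\<in>K. x k j * h j (\<tau>' l)) + (\<Sum>j\<in>L. x k (\<tau> j) * h j (\<tau>' l)) = (\<Sum>i\<in>K. h k i * y i (\<tau> (\<tau>' l)))"
        using e k l'(1) by blast
      moreover have "(\<Sum>j\<in>K. x k j * h j (\<tau>' l)) = 0"
        using hom_KL[OF h _ l'(1)] by (intro sum.neutral) simp
      moreover have "(\<Sum>j\<in>L. x k (\<tau> j) * h j (\<tau>' l)) = (\<Sum>q\<in>Q. x k q * restr h q l)"
        unfolding sum_\<tau>[of "\<lambda>j q. x k q * h j (\<tau>' l)"] using l hom_QQ[OF h _ l]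
        by (intro sum.cong) (simp_all add: restr_simps)
      ultimately show "(\<Sum>q\<in>Q. x k q * restr h q l) = (\<Sum>i\<in>K. restr h k i * y i l)"
        using k l by (simp add: restr_simps l') }
  next
    fix k l assume k: "k \<in> R" and l: "l \<in> R" and kl: "P1 k l"
    have "(if l \<in> Q then h k (\<tau>' l) else 0) = (\<Sum>i\<in>K. restr h k i * y i l)"
    proof (cases "k \<in> Q")
      case True
      show ?thesis
      proof (cases "l \<in> Q")
        case lQ: True
        have "h k (\<tau>' l) = (\<Sum>i\<in>K. h (\<tau>' k) i * y i l)"
          using hom_QL[OF h True \<tau>'(1)[OF lQ]] \<tau>'(2)[OF lQ] by simp
        then show ?thesis using True lQ by (simp add: restr_simps)
      next
        case False
        then have "l \<in> Z" using CR[of k l] True kl by (simp add: P1_def)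
        then have "K = {}" using KZ by auto
        then show ?thesis using False by simp
      qed
    next
      case False
      have "(\<Sum>i\<in>K. restr h k i * y i l) = 0"
      proof (intro sum.neutral ballI)
        fix i assume i: "i \<in> K"
        have "k \<notin> K" using dR[OF k] by simp
        then have "restr h k i = 0" by (rule malg1_nQK[OF restr_malg[OF h] _ False i])
        then show "restr h k i * y i l = 0" by simp
      qed
      moreover have "h k (\<tau>' l) = 0" if "l \<in> Q"
      proof -
        have "k \<in> W" using False k kl that by (auto simp: P1_def)
        then show ?thesis using malg_WA[OF m] \<tau>'(1)[OF that] by simp
      qed
      ultimately show ?thesis by simp
    qed
    then show "(\<Sum>j\<in>R. cut x k j * restr h j l) = (\<Sum>i\<in>R. restr h k i * cut y i l) + (\<Sum>i\<in>K. restr h k i * y i l)"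
      using hom_RR[OF h k l P1_P[OF kl]] k l by (simp add: restr_simps)
  qed
  then show ?thesis using mhom1_iff restr_malg[OF h] by blast
qed

lemma lift_restr:
  assumes h: "h \<in> mhom I P (\<iota> x) (\<iota> y)" shows "lift x y (restr h) = h"
proof (intro ext)
  fix i j
  have m: "h \<in> malg P" using h by (simp add: mhom_def)
  show "lift x y (restr h) i j = h i j"
  proof (cases i rule: I_cases)
    case 1
    show ?thesis by (cases j rule: I_cases) (use 1 hom_KL[OF h] malg_AR[OF m] malg_outside[OF m] in \<open>simp_all add: lift_simps restr_simps\<close>)
  next
    case 2
    have q: "\<tau> i \<in> Q" "\<tau>' (\<tau> i) = i" using 2 \<tau> by auto
    show ?thesis
      by (cases j rule: I_cases)
        (use 2 q \<tau>(1)[of j] hom_LL[OF h 2, of j] malg_AR[OF m] malg_outside[OF m] in \<open>simp_all add: lift_simps restr_simps\<close>)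
  next
    case 3
    show ?thesis
    proof (cases j rule: I_cases)
      case 1 with 3 KZ have False by auto
      then show ?thesis ..
    next
      case 2
      have q: "\<tau> j \<in> Q" "\<tau>' (\<tau> j) = j" "P i (\<tau> j)" using 2 \<tau> ZQ[OF 3] by auto
      have "lift x y (restr h) i j = (\<Sum>k\<in>R. cut x i k * h k (\<tau> j)) - (\<Sum>k\<in>R. h i k * cut y k (\<tau> j))"
        using 3 2 q by (simp add: lift_simps restr_simps)
      also have "\<dots> = h i j" using hom_RR[OF h _ _ q(3)] 3 q by simp
      finally show ?thesis .
    qed (use 3 malg_outside[OF m] in \<open>simp_all add: lift_simps restr_simps\<close>)
  next
    case 4
    show ?thesis
      by (cases j rule: I_cases)
        (use 4 \<tau>(1)[of j] hom_QK[OF h 4, of j] hom_QL[OF h 4, of j] malg_outside[OF m] in \<open>simp_all add: lift_simps restr_simps\<close>)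
  next
    case 5
    show ?thesis
      by (cases j rule: I_cases) (use 5 malg_WA[OF m] malg_outside[OF m] in \<open>simp_all add: lift_simps restr_simps\<close>)
  next
    case 6
    then show ?thesis using malg_outside[OF m] by (simp add: lift_simps)
  qed
qed

lemma lift_mhom:
  assumes h: "h \<in> mhom I1 P1 x y"
  shows "lift x y h \<in> mhom I P (\<iota> x) (\<iota> y)" and "restr (lift x y h) = h"
proof -
  have m: "h \<in> malg P1" using h by (simp add: mhom_def)
  note e = h[unfolded mhom1_iff hom_eqs1_def]
  have KR: "h i j = 0" if "i \<in> K" "j \<in> R" for i j using malg1_KR[OF m that] .
  have QZ: "h i j = 0" if "i \<in> Q" "j \<in> Z" for i j using malgD[OF m, of j i] that by (simp add: P1_def)
  have nP: "h i j = 0" if "\<not> P j i" for i j using malgD[OF m, of j i] P1_P[of j i] that by blast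
  have out: "h i j = 0" if "i \<notin> I1 \<or> j \<notin> I1" for i j using malgD[OF m, of j i] P1_I1[of j i] that by blast
  have lm: "lift x y h \<in> malg P"
  proof (rule malgI)
    fix i j assume nz: "lift x y h i j \<noteq> 0"
    then have I: "i \<in> I" "j \<in> I"
      using lift_simps(13)[of i x y h j] lift_simps(14)[of j x y h i] by auto
    show "P j i"
    proof (cases "j \<in> K \<union> L")
      case True
      then show ?thesis using AA[OF True, of i] AC[OF True, of i] nz I(1) lift_simps(12)[of i j x y h] unfolding I_eq by blast
    next
      case False
      then have j: "j \<in> R" using I unfolding I_eq by auto
      then have "i \<in> R" using nz lift_simps(3)[of i j x y h] lift_simps(6)[of i j x y h] I unfolding I_eq by blast
      then show ?thesis using nz j nP[of j i] lift_simps(7)[of i j x y h] by force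
    qed
  qed
  have "hom_eqs x y (lift x y h)"
    unfolding hom_eqs_def
  proof (intro conjI ballI impI)
    fix k l assume k: "k \<in> L"
    then have k': "\<tau> k \<in> Q" "\<tau>' (\<tau> k) = k" using \<tau> by auto
    { assume "l \<in> K" then show "lift x y h (\<tau> k) l = (\<Sum>i\<in>K. lift x y h k i * y i l)"
       using k k' by (simp add: lift_simps) }
    { assume "l \<in> L" then show "lift x y h (\<tau> k) l = (\<Sum>i\<in>K. lift x y h k i * y i (\<tau> l))"
       using k k' by (simp add: lift_simps) }
    { assume "l \<in> Z" then show "lift x y h (\<tau> k) l = 0"
       using k k' by (simp add: lift_simps QZ) }
    { assume "l \<in> Q" then show "lift x y h (\<tau> k) l = lift x y h k (\<tau>' l)"
       using k k' \<tau>'[of l] by (simp add: lift_simps) }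
  next
    fix k l assume k: "k \<in> K"
    { assume l: "l \<in> K"
      have "(\<Sum>j\<in>K. x k j * h j l) + (\<Sum>q\<in>Q. x k q * h q l) = (\<Sum>i\<in>K. h k i * y i l)"
        using e k l by blast
      moreover have "(\<Sum>j\<in>L. x k (\<tau> j) * lift x y h j l) = (\<Sum>q\<in>Q. x k q * h q l)"
        unfolding sum_\<tau>[of "\<lambda>j q. x k q * lift x y h j l"] using l \<tau>' by (intro sum.cong) (simp_all add: lift_simps)
      ultimately show "(\<Sum>j\<in>K. x k j * lift x y h j l) + (\<Sum>j\<in>L. x k (\<tau> j) * lift x y h j l) = (\<Sum>i\<in>K. lift x y h k i * y i l)"
        using k l by (simp add: lift_simps) }
    { assume l: "l \<in> L"
      then have l': "\<tau> l \<in> Q" using \<tau> by auto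
      have "(\<Sum>q\<in>Q. x k q * h q (\<tau> l)) = (\<Sum>i\<in>K. h k i * y i (\<tau> l))"
        using e k l' by blast
      moreover have "(\<Sum>j\<in>L. x k (\<tau> j) * lift x y h j l) = (\<Sum>q\<in>Q. x k q * h q (\<tau> l))"
        unfolding sum_\<tau>[of "\<lambda>j q. x k q * lift x y h j l"] using l \<tau>' by (intro sum.cong) (simp_all add: lift_simps)
      ultimately show "(\<Sum>j\<in>K. x k j * lift x y h j l) + (\<Sum>j\<in>L. x k (\<tau> j) * lift x y h j l) = (\<Sum>i\<in>K. lift x y h k i * y i (\<tau> l))"
        using k l by (simp add: lift_simps) }
    { assume "l \<in> Q" then show "lift x y h k (\<tau>' l) = 0" using k \<tau>'[of l] by (simp add: lift_simps) }
  next
    fix k l assume k: "k \<in> R" and l: "l \<in> R" and kl: "P k l"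
    show "(\<Sum>j\<in>R. cut x k j * lift x y h j l) = (\<Sum>i\<in>R. lift x y h k i * cut y i l) + (if l \<in> Q then lift x y h k (\<tau>' l) else 0)"
    proof (cases "P1 k l")
      case True
      have "(\<Sum>j\<in>R. cut x k j * h j l) = (\<Sum>i\<in>R. h k i * cut y i l) + (\<Sum>i\<in>K. h k i * y i l)"
        using e k l True by blast
      moreover have "(\<Sum>i\<in>K. h k i * y i l) = (if l \<in> Q then lift x y h k (\<tau>' l) else 0)"
      proof (cases "k \<in> Q")
        case kQ: True
        show ?thesis
        proof (cases "l \<in> Q")
          case lQ: True
          then show ?thesis using kQ \<tau>'[OF lQ] by (simp add: lift_simps)
        next
          case False
          then have "l \<in> Z" using CR[of k l] kQ kl by simp
          then have "K = {}" using KZ by auto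
          then show ?thesis using False by simp
        qed
      next
        case False
        have "(\<Sum>i\<in>K. h k i * y i l) = 0"
          using malg1_nQK[OF m _ False] dR[OF k] by (intro sum.neutral) simp
        moreover have "lift x y h k (\<tau>' l) = 0" if "l \<in> Q"
        proof -
          have "k \<in> W" using False k True that by (auto simp: P1_def)
          then show ?thesis using \<tau>'(1)[OF that] by (simp add: lift_simps)
        qed
        ultimately show ?thesis by simp
      qed
      ultimately show ?thesis using k l by (simp add: lift_simps)
    next
      case False
      then have kZ: "k \<in> Z" and lQ: "l \<in> Q" using kl k l dR by (auto simp: P1_def)
      then show ?thesis using k l \<tau>'[OF lQ] by (simp add: lift_simps)
    qed
  qed
  then show "lift x y h \<in> mhom I P (\<iota> x) (\<iota> y)" using mhom_\<iota>_iff lm by blast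
  show "restr (lift x y h) = h"
  proof (intro ext)
    fix i j
    show "restr (lift x y h) i j = h i j"
    proof (cases "i \<in> I1 \<and> j \<in> I1")
      case False
      then have "restr (lift x y h) i j = 0" by (auto simp: restr_def)
      then show ?thesis using out False by simp
    next
      case True
      then consider "i \<in> K" "j \<in> K" | "i \<in> K" "j \<in> R" | "i \<in> R" "j \<in> R" | "i \<in> Q" "j \<in> K" | "i \<in> Z" "j \<in> K" | "i \<in> W" "j \<in> K" by blast
      then show ?thesis
      proof cases
        case 1 then show ?thesis by (simp add: restr_simps lift_simps)
      next
        case 2 then show ?thesis using KR[OF 2] lift_simps(6)[OF 2] dK[OF 2(1)] True by (simp add: restr_def)
      next
        case 3 then show ?thesis by (simp add: restr_simps lift_simps)
      next
        case 4 then show ?thesis using \<tau>'[OF 4(1)] by (simp add: restr_simps lift_simps)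
      next
        case 5 then show ?thesis using KZ by auto
      next
        case 6
        then have "h i j = 0" using nP[of j i] AW[of j i] by blast
        then show ?thesis using 6 dW[OF 6(1)] True by (simp add: restr_def lift_simps)
      qed
    qed
  qed
qed

lemma restr_mone: "restr (mone I) = mone I1"
proof (intro ext)
  fix i j
  have "\<tau>' i \<noteq> j" if "i \<in> Q" "j \<in> K" using that \<tau>'(1) dK by blast
  moreover have "i \<noteq> j" if "i \<in> Q" "j \<in> K" using that dK by blast
  ultimately show "restr (mone I) i j = mone I1 i j"
    using p_inI[of i] by (auto simp: restr_def mone_def)
qed

lemma restr_mprod:
  assumes g: "g \<in> mhom I P (\<iota> x) (\<iota> y)" and h: "h \<in> mhom I P (\<iota> y) (\<iota> z)"
  shows "restr (mprod I g h) = mprod I1 (restr g) (restr h)"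
proof (intro ext)
  fix i j
  have m: "g \<in> malg P" "h \<in> malg P" using g h by (auto simp: mhom_def)
  have r: "restr g \<in> malg P1" "restr h \<in> malg P1" using restr_malg g h by blast+
  have gh: "restr (mprod I g h) \<in> malg P1" using restr_malg[OF mhom_mprod[OF g h]] .
  have gh': "mprod I1 (restr g) (restr h) \<in> malg P1" using p1.malg_mprod[OF r] .
  have KK: "mprod I g h i j = mprod I1 (restr g) (restr h) i j" if "i \<in> K" "j \<in> K"
  proof -
    have "(\<Sum>k\<in>L. g i k * h k j) = 0" "(\<Sum>k\<in>R. g i k * h k j) = 0" "(\<Sum>k\<in>R. restr g i k * restr h k j) = 0"
      using hom_KL[OF g] malg_AR[OF m(1)] malg1_KR[OF r(1)] that by (auto intro!: sum.neutral)
    then show ?thesis using that unfolding mprod_def sum_I sum_I1 by (simp add: restr_simps)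
  qed
  have RR: "mprod I g h i j = mprod I1 (restr g) (restr h) i j" if "i \<in> R" "j \<in> R"
  proof -
    have "(\<Sum>k\<in>K. g i k * h k j) = 0" "(\<Sum>k\<in>L. g i k * h k j) = 0" "(\<Sum>k\<in>K. restr g i k * restr h k j) = 0"
      using malg_AR[OF m(2)] malg1_KR[OF r(2)] that by (auto intro!: sum.neutral)
    then show ?thesis using that unfolding mprod_def sum_I sum_I1 by (simp add: restr_simps)
  qed
  have QK: "mprod I g h (\<tau>' i) j = mprod I1 (restr g) (restr h) i j" if "i \<in> Q" "j \<in> K"
  proof -
    have a: "(\<Sum>k\<in>R. g (\<tau>' i) k * h k j) = 0"
      using malg_AR[OF m(1)] \<tau>'(1)[OF that(1)] by (intro sum.neutral) simp
    have "(\<Sum>k\<in>R. restr g i k * restr h k j) = (\<Sum>k\<in>Q. restr g i k * restr h k j)"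
      using malg1_nQK[OF r(2) _ _ that(2)] dZ dW by (intro sum_R_Q) force+
    also have "\<dots> = (\<Sum>k\<in>Q. g (\<tau>' i) (\<tau>' k) * h (\<tau>' k) j)"
      using that hom_QQ[OF g that(1)] by (intro sum.cong) (simp_all add: restr_simps)
    also have "\<dots> = (\<Sum>k\<in>L. g (\<tau>' i) k * h k j)"
      by (rule sum_\<tau>[of "\<lambda>j q. g (\<tau>' i) j * h j _", symmetric])
    finally show ?thesis using that a unfolding mprod_def sum_I sum_I1 by (simp add: restr_simps)
  qed
  show "restr (mprod I g h) i j = mprod I1 (restr g) (restr h) i j"
  proof (cases "P1 j i")
    case False then show ?thesis using malgD[OF gh] malgD[OF gh'] by simp
  next
    case True
    then show ?thesis
    proof (cases rule: P1_cases)
      case 1 then show ?thesis using KK by (simp add: restr_simps)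
    next
      case 2 then show ?thesis using QK unfolding restr_simps(1)[OF 2(2,1)] by blast
    next
      case 3 then show ?thesis using RR by (simp add: restr_simps)
    qed
  qed
qed

lemma miso_\<iota>_imp: "miso I P (\<iota> x) (\<iota> y) \<Longrightarrow> miso I1 P1 x y"
  unfolding miso_def
proof (elim bexE conjE)
  fix h h' assume h: "h \<in> mhom I P (\<iota> x) (\<iota> y)" "h' \<in> malg P" "mprod I h h' = mone I" "mprod I h' h = mone I"
  have h': "h' \<in> mhom I P (\<iota> y) (\<iota> x)" using mhom_inverse[OF h] .
  show "\<exists>h\<in>mhom I1 P1 x y. \<exists>h'\<in>malg P1. mprod I1 h h' = mone I1 \<and> mprod I1 h' h = mone I1"
    using restr_mhom[OF h(1)] restr_malg[OF h'] restr_mprod[OF h(1) h'] restr_mprod[OF h' h(1)] h(3,4)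
    unfolding restr_mone[symmetric] by (metis (no_types))
qed

lemma miso_\<iota>: "miso I1 P1 x y \<Longrightarrow> miso I P (\<iota> x) (\<iota> y)"
proof -
  assume "miso I1 P1 x y"
  then obtain h h' where h: "h \<in> mhom I1 P1 x y" "h' \<in> malg P1" "mprod I1 h h' = mone I1" "mprod I1 h' h = mone I1"
    unfolding miso_def by blast
  have h': "h' \<in> mhom I1 P1 y x" using p1.mhom_inverse[OF h] .
  define g where "g = lift x y h"
  define g' where "g' = lift y x h'"
  have g: "g \<in> mhom I P (\<iota> x) (\<iota> y)" "g' \<in> mhom I P (\<iota> y) (\<iota> x)"
    unfolding g_def g'_def by (rule lift_mhom(1), rule h h')+
  have r: "restr g = h" "restr g' = h'"
    unfolding g_def g'_def by (rule lift_mhom(2), rule h h')+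
  have "mprod I g g' = lift x x (restr (mprod I g g'))" 
    using lift_restr[OF mhom_mprod[OF g]] by simp
  also have "restr (mprod I g g') = restr (mone I)" unfolding restr_mprod[OF g] r h(3) restr_mone ..
  also have "lift x x (restr (mone I)) = mone I" by (rule lift_restr[OF mone_mhom])
  finally have 1: "mprod I g g' = mone I" .
  have "mprod I g' g = lift y y (restr (mprod I g' g))" 
    using lift_restr[OF mhom_mprod[OF g(2,1)]] by simp
  also have "restr (mprod I g' g) = restr (mone I)" unfolding restr_mprod[OF g(2,1)] r h(4) restr_mone ..
  also have "lift y y (restr (mone I)) = mone I" by (rule lift_restr[OF mone_mhom])
  finally have 2: "mprod I g' g = mone I" .
  have "g' \<in> malg P" using g(2) by (simp add: mhom_def)
  then show ?thesis unfolding miso_def using g(1) 1 2 by blast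
qed

definition extend_label :: "(nat \<Rightarrow> nat) \<Rightarrow> nat \<Rightarrow> nat" where
  "extend_label c i = (if i \<in> L then c (\<tau> i) else c i)"

lemma lift_mdiag: "lift y y (mdiag I1 (t \<circ> c)) = mdiag I (t \<circ> extend_label c)"
proof (intro ext)
  fix i j
  let ?d = "mdiag I1 (t \<circ> c)"
  have q: "\<tau> i \<in> I1" if "i \<in> L" for i using \<tau>(1)[OF that] by simp
  have inj: "\<tau> i = \<tau> j \<longleftrightarrow> i = j" if "i \<in> L" "j \<in> L" using \<tau>(2)[OF that(1)] \<tau>(2)[OF that(2)] by metis
  have QK: "(\<Sum>k\<in>K. ?d i k * y k l) = 0" if "i \<in> Q" for i l 
    using dQ[OF that] by (intro sum.neutral) (auto simp: mdiag_def)
  have 1: "(\<Sum>k\<in>R. cut y i k * ?d k (\<tau> j)) = 0" if "i \<in> Z" "j \<in> L"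
    using that \<tau>(1)[OF that(2)] by (intro sum.neutral) (auto simp: mdiag_def cut_def P1_def)
  have 2: "(\<Sum>k\<in>R. ?d i k * cut y k (\<tau> j)) = 0" if "i \<in> Z" "j \<in> L"
    using that \<tau>(1)[OF that(2)] by (intro sum.neutral) (auto simp: mdiag_def cut_def P1_def)
  show "lift y y ?d i j = mdiag I (t \<circ> extend_label c) i j"
  proof (cases "i \<in> I \<and> j \<in> I")
    case False
    then show ?thesis using lift_simps(13,14) by (auto simp: mdiag_def)
  next
    case True
    have R: "lift y y ?d i j = mdiag I (t \<circ> extend_label c) i j" if "i \<in> R" "j \<in> R"
      using that dR[OF that(1)] inI(3)[OF that(1)] by (auto simp: lift_simps mdiag_def extend_label_def)
    consider "i \<in> R" "j \<in> R" | "i \<in> K" "j \<in> K" | "i \<in> L" "j \<in> L" | "i \<in> L" "j \<in> K" | "i \<in> L" "j \<in> R"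
      | "i \<in> K" "j \<in> L" | "i \<in> K" "j \<in> R" | "i \<in> Q" "j \<in> K" | "i \<in> Q" "j \<in> L" | "i \<in> Z" "j \<in> K" | "i \<in> Z" "j \<in> L"
      | "i \<in> W" "j \<in> K \<union> L"
      using True unfolding I_eq by blast
    then show ?thesis
    proof cases
      case 1 then show ?thesis by (rule R)
    next
      case 2 then show ?thesis using dK[of i] inI(1)[of i] by (auto simp: lift_simps mdiag_def extend_label_def)
    next
      case 3 then show ?thesis using inj q[of i] inI(2)[of i] by (auto simp: lift_simps mdiag_def extend_label_def)
    next
      case 4 then show ?thesis using dL[of i] dK[of "\<tau> i"] \<tau>(1)[of i] by (auto simp: lift_simps mdiag_def)
    next
      case 5 then show ?thesis using dR[of j] by (auto simp: lift_simps mdiag_def)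
    next
      case 6 then show ?thesis using dK[of i] by (auto simp: lift_simps mdiag_def)
    next
      case 7 then show ?thesis using dR[of j] by (auto simp: lift_simps mdiag_def)
    next
      case 8 then show ?thesis using dQ[of i] QK by (auto simp: lift_simps mdiag_def)
    next
      case 9 then show ?thesis using dQ[of i] QK by (auto simp: lift_simps mdiag_def)
    next
      case 10 then show ?thesis using dZ[of i] by (auto simp: lift_simps mdiag_def)
    next
      case 11 then show ?thesis using dZ[of i] 1 2 by (auto simp: lift_simps mdiag_def)
    next
      case 12 then show ?thesis using dW[of i] by (auto simp: lift_simps mdiag_def)
    qed
  qed
qed

lemma mhom_\<iota>_diag:
  fixes y :: "'k::comm_ring_1 fmat"
  assumes "mhom I1 P1 y y = {mdiag I1 (t \<circ> c) | t. True}"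
  shows "mhom I P (\<iota> y) (\<iota> y) = {mdiag I (t \<circ> extend_label c) | t. True}"
proof (intro equalityI subsetI)
  fix h assume h: "h \<in> mhom I P (\<iota> y) (\<iota> y)"
  then obtain t where "restr h = mdiag I1 (t \<circ> c)" using restr_mhom[OF h] assms by auto
  then have "h = mdiag I (t \<circ> extend_label c)" using lift_restr[OF h] lift_mdiag by metis
  then show "h \<in> {mdiag I (t \<circ> extend_label c) | t. True}" by blast
next
  fix h :: "'k fmat" assume "h \<in> {mdiag I (t \<circ> extend_label c) | t. True}"
  then obtain t :: "nat \<Rightarrow> 'k" where t: "h = mdiag I (t \<circ> extend_label c)" by blast
  have "mdiag I1 (t \<circ> c) \<in> mhom I1 P1 y y" using assms by auto
  from lift_mhom(1)[OF this] show "h \<in> mhom I P (\<iota> y) (\<iota> y)" unfolding t lift_mdiag .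
qed

end

lemma det_poly_funs:
  assumes "\<And>x. A x \<in> carrier_mat n n"
    and "\<And>i j. i < n \<Longrightarrow> j < n \<Longrightarrow> (\<lambda>x. A x $$ (i, j)) \<in> poly_funs G"
  shows "(\<lambda>x. det (A x)) \<in> poly_funs G"
proof -
  have "(\<lambda>x. \<Sum>p\<in>{p. p permutes {0..<n}}. signof p * (\<Prod>i = 0..<n. A x $$ (i, p i))) \<in> poly_funs G"
  proof (intro poly_funs_sum poly_funs.mult poly_funs.const poly_funs_prod)
    fix p i assume "p \<in> {p. p permutes {0..<n}}" "i \<in> {0..<n}"
    then show "(\<lambda>x. A x $$ (i, p i)) \<in> poly_funs G"
      using permutes_in_image[of p "{0..<n}" i] by (intro assms(2)) auto
  qed
  then show ?thesis unfolding det_def'[OF assms(1)] .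
qed

lemma adj_mat_poly_funs:
  assumes A: "\<And>x. A x \<in> carrier_mat n n"
    and p: "\<And>i j. i < n \<Longrightarrow> j < n \<Longrightarrow> (\<lambda>x. A x $$ (i, j)) \<in> poly_funs G"
    and ij: "i < n" "j < n"
  shows "(\<lambda>x. adj_mat (A x) $$ (i, j)) \<in> poly_funs G"
proof -
  have d: "dim_row (A x) = n" "dim_col (A x) = n" for x using A[of x] by auto
  have "(\<lambda>x. det (mat_delete (A x) j i)) \<in> poly_funs G"
  proof (rule det_poly_funs[where n = "n - 1"])
    show "mat_delete (A x) j i \<in> carrier_mat (n - 1) (n - 1)" for x
      using mat_delete_carrier[OF A] by simp
    show "(\<lambda>x. mat_delete (A x) j i $$ (k, l)) \<in> poly_funs G" if "k < n - 1" "l < n - 1" for k l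
    proof -
      have "mat_delete (A x) j i $$ (k, l) = A x $$ (if k < j then k else Suc k, if l < i then l else Suc l)" for x
        unfolding mat_delete_def using that d by simp
      then show ?thesis using that by (simp add: p)
    qed
  qed
  then have "(\<lambda>x. (-1) ^ (j + i) * det (mat_delete (A x) j i)) \<in> poly_funs G"
    by (rule poly_funs.mult[OF poly_funs.const])
  moreover have "adj_mat (A x) $$ (i, j) = (-1) ^ (j + i) * det (mat_delete (A x) j i)" for x
    using ij d by (simp add: adj_mat_def cofactor_def)
  ultimately show ?thesis by simp
qed

lemma loc_comp_poly:
  assumes "f \<in> loc mcoords D" "\<And>i j. (\<lambda>x. \<phi> x i j) \<in> poly_funs G"
  shows "(\<lambda>x. f (\<phi> x)) \<in> loc G (\<lambda>x. D (\<phi> x))"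
proof -
  obtain p m where p: "p \<in> poly_funs mcoords" "\<And>x. D x \<noteq> 0 \<Longrightarrow> f x * D x ^ m = p x"
    using assms(1) unfolding loc_def by blast
  show ?thesis
    by (rule locI[of "\<lambda>x. p (\<phi> x)" _ _ _ m]) (simp_all add: mpoly_comp[OF p(1) assms(2)] p(2))
qed

lemma generic_inverse:
  assumes L: "finite L"
  obtains D :: "'k::field fmat \<Rightarrow> 'k" and v where
    "D \<in> poly_funs mcoords"
    "\<And>i j. (\<lambda>x. v x i j) \<in> loc mcoords D"
    "\<And>x i j. D x \<noteq> 0 \<Longrightarrow> i \<in> L \<Longrightarrow> j \<in> L \<Longrightarrow> (\<Sum>k\<in>L. x i k * v x k j) = (if i = j then 1 else 0)"
    "\<And>x i j. D x \<noteq> 0 \<Longrightarrow> i \<in> L \<Longrightarrow> j \<in> L \<Longrightarrow> (\<Sum>k\<in>L. v x i k * x k j) = (if i = j then 1 else 0)"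
    "\<And>x. (\<And>i j. i \<in> L \<Longrightarrow> j \<in> L \<Longrightarrow> x i j = (if i = j then 1 else 0)) \<Longrightarrow> D x = 1"
    "\<And>x. (\<And>w i. (\<And>i. i \<in> L \<Longrightarrow> (\<Sum>j\<in>L. x i j * w j) = 0) \<Longrightarrow> i \<in> L \<Longrightarrow> w i = 0) \<Longrightarrow> D x \<noteq> 0"
proof -
  define n where "n = card L"
  obtain e where e: "bij_betw e {0..<n} L" using ex_bij_betw_nat_finite[OF L] unfolding n_def by blast
  define e' where "e' = inv_into {0..<n} e"
  have e': "e' i < n" "e (e' i) = i" if "i \<in> L" for i
    using that e bij_betw_inv_into_right[OF e that] inv_into_into[of i e "{0..<n}"]
    unfolding e'_def bij_betw_def by auto
  have ee: "e i \<in> L" "e' (e i) = i" if "i < n" for i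
    using that e bij_betw_inv_into_left[OF e] unfolding e'_def bij_betw_def by auto
  have e'_inj: "e' i = e' j \<longleftrightarrow> i = j" if "i \<in> L" "j \<in> L" for i j using e'(2) that by metis
  define M where "M x = mat n n (\<lambda>(i, j). x (e i) (e j))" for x :: "'k fmat"
  have M: "M x \<in> carrier_mat n n" for x by (simp add: M_def)
  have Mp: "(\<lambda>x. M x $$ (i, j)) \<in> poly_funs mcoords" if "i < n" "j < n" for i j
    using that by (simp add: M_def mcoords_poly)
  define D where "D x = det (M x)" for x
  define v where "v x i j = (if i \<in> L \<and> j \<in> L then adj_mat (M x) $$ (e' i, e' j) * (1 / D x) else 0)" for x i j
  have s: "(\<Sum>k\<in>L. f k) = (\<Sum>k = 0..<n. f (e k))" for f :: "nat \<Rightarrow> 'k"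
    using sum.reindex_bij_betw[OF e, of f] by simp
  note adj = adj_mat[OF M]
  show thesis
  proof (rule that[of D v])
    show "D \<in> poly_funs mcoords" unfolding D_def[abs_def] by (rule det_poly_funs[OF M Mp])
    show "(\<lambda>x. v x i j) \<in> loc mcoords D" for i j
    proof (cases "i \<in> L \<and> j \<in> L")
      case True
      then have "(\<lambda>x. adj_mat (M x) $$ (e' i, e' j) * (1 / D x)) \<in> loc mcoords D"
        by (intro loc_mult loc_inverse loc_poly adj_mat_poly_funs[OF M Mp] e') auto
      then show ?thesis using True by (simp add: v_def)
    next
      case False
      then have "(\<lambda>x. v x i j) = (\<lambda>x. 0)" by (auto simp: v_def)
      then show ?thesis by simp
    qed
    fix x i j assume D: "D x \<noteq> 0" and i: "i \<in> L" and j: "j \<in> L"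
    have "(\<Sum>k\<in>L. x i k * v x k j) = (\<Sum>k = 0..<n. M x $$ (e' i, k) * adj_mat (M x) $$ (k, e' j)) * (1 / D x)"
      unfolding s sum_distrib_right using e' ee i j by (intro sum.cong) (auto simp: v_def M_def)
    also have "(\<Sum>k = 0..<n. M x $$ (e' i, k) * adj_mat (M x) $$ (k, e' j)) = (M x * adj_mat (M x)) $$ (e' i, e' j)"
      using e' i j M[of x] adj(1)[of x] by (simp add: scalar_prod_def)
    also have "\<dots> * (1 / D x) = (if i = j then 1 else 0)"
      unfolding adj(2) using e' i j D by (simp add: e'_inj D_def)
    finally show "(\<Sum>k\<in>L. x i k * v x k j) = (if i = j then 1 else 0)" .
    have "(\<Sum>k\<in>L. v x i k * x k j) = (\<Sum>k = 0..<n. adj_mat (M x) $$ (e' i, k) * M x $$ (k, e' j)) * (1 / D x)"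
      unfolding s sum_distrib_right using e' ee i j by (intro sum.cong) (auto simp: v_def M_def)
    also have "(\<Sum>k = 0..<n. adj_mat (M x) $$ (e' i, k) * M x $$ (k, e' j)) = (adj_mat (M x) * M x) $$ (e' i, e' j)"
      using e' i j M[of x] adj(1)[of x] by (simp add: scalar_prod_def)
    also have "\<dots> * (1 / D x) = (if i = j then 1 else 0)"
      unfolding adj(3) using e' i j D by (simp add: e'_inj D_def)
    finally show "(\<Sum>k\<in>L. v x i k * x k j) = (if i = j then 1 else 0)" .
  next
    fix x :: "'k fmat" assume x: "\<And>i j. i \<in> L \<Longrightarrow> j \<in> L \<Longrightarrow> x i j = (if i = j then 1 else 0)"
    have "e i = e j \<longleftrightarrow> i = j" if "i < n" "j < n" for i j using ee that by metis
    then have "M x = 1\<^sub>m n" using x ee by (intro eq_matI) (auto simp: M_def)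
    then show "D x = 1" by (simp add: D_def)
  next
    fix x :: "'k fmat"
    assume inj: "\<And>w i. (\<And>i. i \<in> L \<Longrightarrow> (\<Sum>j\<in>L. x i j * w j) = 0) \<Longrightarrow> i \<in> L \<Longrightarrow> w i = 0"
    show "D x \<noteq> 0"
    proof
      assume "D x = 0"
      then obtain w where w: "w \<in> carrier_vec n" "w \<noteq> 0\<^sub>v n" "M x *\<^sub>v w = 0\<^sub>v n"
        using det_0_iff_vec_prod_zero[OF M[of x]] by (auto simp: D_def)
      have "(\<Sum>j\<in>L. x i j * w $ e' j) = 0" if i: "i \<in> L" for i
      proof -
        have "(\<Sum>j\<in>L. x i j * w $ e' j) = (\<Sum>j = 0..<n. M x $$ (e' i, j) * w $ j)"
          unfolding s using e' ee i by (intro sum.cong) (auto simp: M_def)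
        also have "\<dots> = (M x *\<^sub>v w) $ e' i"
          using e' i w(1) M[of x] by (simp add: scalar_prod_def)
        finally show ?thesis using w(3) e' i by simp
      qed
      then have "w $ e' i = 0" if "i \<in> L" for i using inj[of "\<lambda>j. w $ e' j"] that by blast
      then have "w $ j = 0" if "j < n" for j using ee[OF that] by metis
      then have "w = 0\<^sub>v n" using w(1) by (intro eq_vecI) auto
      then show False using w(2) by simp
    qed
  qed
qed

context preord
begin

definition unip :: "'k::comm_ring_1 fmat \<Rightarrow> 'k fmat \<Rightarrow> 'k fmat" where
  "unip n x = mprod I (\<lambda>i j. mone I i j - n i j) (mprod I x (\<lambda>i j. mone I i j + n i j))"

lemma unip_apply:
  assumes "i \<in> I" "j \<in> I"
  shows "unip n x i j = x i j + mprod I x n i j - mprod I n x i j - mprod I n (mprod I x n) i j"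
proof -
  have r: "mprod I u (\<lambda>i j. mone I i j + n i j) k j = u k j + mprod I u n k j" for u k
    using mprod_mone_right[OF fin assms(2), of u k] by (simp add: mprod_def distrib_left sum.distrib)
  have "unip n x i j = mprod I (mone I) (mprod I x (\<lambda>i j. mone I i j + n i j)) i j
      - mprod I n (mprod I x (\<lambda>i j. mone I i j + n i j)) i j"
    by (simp add: unip_def mprod_def left_diff_distrib sum_subtractf)
  also have "\<dots> = x i j + mprod I x n i j - mprod I (mprod I n x) (\<lambda>i j. mone I i j + n i j) i j"
    by (simp add: mprod_mone_left[OF fin assms(1)] r mprod_assoc)
  also have "\<dots> = x i j + mprod I x n i j - mprod I n x i j - mprod I n (mprod I x n) i j"
    by (simp only: r) (simp add: mprod_assoc)
  finally show ?thesis .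
qed

lemma miso_unip:
  assumes n: "n \<in> malg P" and n2: "mprod I n n = (\<lambda>i j. 0)"
  shows "miso I P x (unip n x)"
  unfolding unip_def
proof (rule miso_conj)
  have a: "(\<lambda>i j. a i j + b i j) \<in> malg P" "(\<lambda>i j. a i j - b i j) \<in> malg P"
    if "a \<in> malg P" "b \<in> malg P" for a b :: "'a fmat"
    using malgD[OF that(1)] malgD[OF that(2)] by (force intro!: malgI)+
  show p: "(\<lambda>i j. mone I i j + n i j) \<in> malg P" "(\<lambda>i j. mone I i j - n i j) \<in> malg P"
    using a[OF mone_malg n] by auto
  have d: "mprod I (\<lambda>i j. a i j + b i j) c = (\<lambda>i j. mprod I a c i j + mprod I b c i j)"
    "mprod I (\<lambda>i j. a i j - b i j) c = (\<lambda>i j. mprod I a c i j - mprod I b c i j)"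
    "mprod I c (\<lambda>i j. a i j + b i j) = (\<lambda>i j. mprod I c a i j + mprod I c b i j)"
    "mprod I c (\<lambda>i j. a i j - b i j) = (\<lambda>i j. mprod I c a i j - mprod I c b i j)" for a b c :: "'a fmat"
    by (simp_all add: mprod_def algebra_simps sum.distrib sum_subtractf)
  show "mprod I (\<lambda>i j. mone I i j + n i j) (\<lambda>i j. mone I i j - n i j) = mone I"
    "mprod I (\<lambda>i j. mone I i j - n i j) (\<lambda>i j. mone I i j + n i j) = mone I"
    by (simp_all add: d n2 malg_mone_left[OF n] malg_mone_right[OF n] malg_mone_left[OF mone_malg])
qed

lemma unip_zero:
  assumes "\<And>i j. x i j \<noteq> 0 \<Longrightarrow> i \<in> I \<and> j \<in> I" "\<And>i j. n i j = 0"
  shows "unip n x = x"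
proof (intro ext)
  fix i j
  have n0: "n = (\<lambda>i j. 0)" using assms(2) by auto
  show "unip n x i j = x i j"
  proof (cases "i \<in> I \<and> j \<in> I")
    case True
    then show ?thesis by (simp add: unip_apply n0 mprod_def)
  next
    case False
    then have "x i j = 0" using assms(1) by blast
    moreover have "unip n x i j = 0"
    proof (cases "i \<in> I")
      case True
      then have "j \<notin> I" using False by simp
      then have "mprod I x (mone I) k j = 0" for k
        by (auto simp: mprod_def mone_def intro!: sum.neutral)
      then show ?thesis by (simp add: unip_def n0 mprod_def)
    qed (auto simp: unip_def n0 mprod_def mone_def intro!: sum.neutral)
    ultimately show ?thesis by simp
  qed
qed

end

lemma mprod_loc:
  assumes "D \<in> poly_funs G" "\<And>i j. (\<lambda>x. f x i j) \<in> loc G D" "\<And>i j. (\<lambda>x. g x i j) \<in> loc G D"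
  shows "(\<lambda>x. mprod I (f x) (g x) i j) \<in> loc G D"
  unfolding mprod_def by (intro loc_sum loc_mult assms)

context preord
begin

lemma unip_loc:
  assumes "D \<in> poly_funs G" "\<And>i j. (\<lambda>x. f x i j) \<in> loc G D" "\<And>i j. (\<lambda>x. g x i j) \<in> loc G D"
  shows "(\<lambda>x. unip (f x) (g x) i j) \<in> loc G D"
  unfolding unip_def by (intro mprod_loc loc_add loc_diff assms loc_const)

end

context pivot
begin

definition n2 :: "'k::comm_ring_1 fmat \<Rightarrow> 'k fmat" where
  "n2 x = (\<lambda>i j. if i \<in> K \<and> j \<in> L then x i (\<tau> j) else if i \<in> Q \<and> j \<in> Z then - x (\<tau>' i) j else 0)"

definition n3 :: "'k::comm_ring_1 fmat \<Rightarrow> 'k fmat" where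
  "n3 x = (\<lambda>i j. if i \<in> Q \<and> j \<in> K \<union> L then - x (\<tau>' i) j else if i \<in> Z \<and> j \<in> L then x i (\<tau> j) else 0)"

lemma n2_row: "i \<notin> K \<Longrightarrow> i \<notin> Q \<Longrightarrow> n2 x i j = 0"
  and n2_col: "j \<notin> L \<Longrightarrow> j \<notin> Z \<Longrightarrow> n2 x i j = 0"
  and n3_row: "i \<notin> Z \<Longrightarrow> i \<notin> Q \<Longrightarrow> n3 x i j = 0"
  and n3_col: "j \<notin> K \<Longrightarrow> j \<notin> L \<Longrightarrow> n3 x i j = 0"
  by (auto simp: n2_def n3_def)

lemma n2_malg: "n2 x \<in> malg P"
proof (rule malgI)
  fix i j assume "n2 x i j \<noteq> 0"
  then have "i \<in> K \<and> j \<in> L \<or> i \<in> Q \<and> j \<in> Z" by (simp add: n2_def split: if_splits)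
  then show "P j i" using AA[of j i] ZQ[of j i] by blast
qed

lemma n3_malg: "n3 x \<in> malg P"
proof (rule malgI)
  fix i j assume "n3 x i j \<noteq> 0"
  then have "i \<in> Z \<union> Q \<and> j \<in> K \<union> L" by (auto simp: n3_def split: if_splits)
  then show "P j i" using AC[of j i] by blast
qed

lemma mprod_zero: "(\<And>k. k \<in> I \<Longrightarrow> x i k * y k j = 0) \<Longrightarrow> mprod I x y i j = 0"
  unfolding mprod_def by (rule sum.neutral) simp

lemma n2_n2: "mprod I (n2 x) (n2 x) = (\<lambda>i j. 0)"
proof (intro ext mprod_zero)
  fix i j k
  show "n2 x i k * n2 x k j = 0"
  proof (cases "k \<in> L \<or> k \<in> Z")
    case True
    then have "k \<notin> K" "k \<notin> Q" using dL dZ by blast+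
    then show ?thesis by (simp add: n2_row)
  qed (simp add: n2_col)
qed

lemma n3_n3: "mprod I (n3 x) (n3 x) = (\<lambda>i j. 0)"
proof (intro ext mprod_zero)
  fix i j k
  show "n3 x i k * n3 x k j = 0"
  proof (cases "k \<in> K \<or> k \<in> L")
    case True
    then have "k \<notin> Z" "k \<notin> Q" using dK dL by blast+
    then show ?thesis by (simp add: n3_row)
  qed (simp add: n3_col)
qed

lemma mprod_row0: "(\<And>k. x i k = 0) \<Longrightarrow> mprod I x y i j = 0"
  and mprod_col0: "(\<And>k. y k j = 0) \<Longrightarrow> mprod I x y i j = 0"
  by (simp_all add: mprod_def)

lemma sum_delta_\<tau>: "a \<in> L \<Longrightarrow> (\<Sum>q\<in>Q. (if q = \<tau> a then 1 else 0) * f q) = (f (\<tau> a) :: 'k::comm_ring_1)"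
  using fins \<tau>(1)[of a] by (simp add: if_distrib[of "\<lambda>u. u * _"] cong: if_cong)

lemma sum_delta_\<tau>': "q \<in> Q \<Longrightarrow> (\<Sum>a\<in>L. f a * (if q = \<tau> a then 1 else 0)) = (f (\<tau>' q) :: 'k::comm_ring_1)"
proof -
  assume q: "q \<in> Q"
  have "(\<Sum>a\<in>L. f a * (if q = \<tau> a then 1 else 0)) = (\<Sum>a\<in>L. if a = \<tau>' q then f a else 0)"
    using \<tau>(2) \<tau>'(2)[OF q] by (intro sum.cong) auto
  also have "\<dots> = f (\<tau>' q)" using fins \<tau>'(1)[OF q] by simp
  finally show ?thesis .
qed

lemma unip_n2:
  assumes N': "\<forall>a\<in>L. \<forall>q\<in>Q. x a q = (if q = \<tau> a then 1 else 0)"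
  defines "x2 \<equiv> unip (n2 x) x"
  shows "a \<in> L \<Longrightarrow> q \<in> Q \<Longrightarrow> x2 a q = (if q = \<tau> a then 1 else 0)"
    and "a \<in> L \<Longrightarrow> z \<in> Z \<Longrightarrow> x2 a z = 0"
    and "k \<in> K \<Longrightarrow> q \<in> Q \<Longrightarrow> x2 k q = 0"
proof -
  have N: "x a q = (if q = \<tau> a then 1 else 0)" if "a \<in> L" "q \<in> Q" for a q using N' that by blast
  have I: "i \<in> I" if "i \<in> K \<or> i \<in> L \<or> i \<in> Z \<or> i \<in> Q" for i using that unfolding I_eq by auto
  have colQ: "mprod I u (n2 x) i q = 0" if "q \<in> Q" for u i q
    using dQ[OF that] by (intro mprod_col0 n2_col) auto
  have rowL: "mprod I (n2 x) u a j = 0" if "a \<in> L" for u a j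
    using dL[OF that] by (intro mprod_row0 n2_row) auto
  show "x2 a q = (if q = \<tau> a then 1 else 0)" if a: "a \<in> L" and q: "q \<in> Q"
    unfolding x2_def using a q by (simp add: unip_apply I colQ rowL N)
  show "x2 a z = 0" if a: "a \<in> L" and z: "z \<in> Z"
  proof -
    have "mprod I x (n2 x) a z = (\<Sum>j\<in>Q. x a j * - x (\<tau>' j) z)"
    proof -
      have "(\<Sum>j\<in>Q. x a j * n2 x j z) = (\<Sum>j\<in>Q. x a j * - x (\<tau>' j) z)"
        using z dZ[OF z] dQ by (intro sum.cong) (auto simp: n2_def)
      moreover have "(\<Sum>j\<in>K. x a j * n2 x j z) = 0" "(\<Sum>j\<in>L. x a j * n2 x j z) = 0"
        using dZ[OF z] dK dL by (auto intro!: sum.neutral simp: n2_def)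
      moreover have "(\<Sum>j\<in>R. x a j * n2 x j z) = (\<Sum>j\<in>Q. x a j * n2 x j z)"
      proof (rule sum_R_Q)
        show "x a j * n2 x j z = 0" if "j \<in> Z" for j using dZ[OF that] by (simp add: n2_def)
        show "x a j * n2 x j z = 0" if "j \<in> W" for j using dW[OF that] by (simp add: n2_def)
      qed
      ultimately show ?thesis unfolding mprod_def sum_I by simp
    qed
    also have "\<dots> = (\<Sum>j\<in>Q. (if j = \<tau> a then 1 else 0) * - x (\<tau>' j) z)"
      by (intro sum.cong HOL.refl) (simp add: N[OF a])
    also have "\<dots> = - x a z" unfolding sum_delta_\<tau>[OF a] using \<tau>(2)[OF a] by simp
    finally show ?thesis unfolding x2_def using a z by (simp add: unip_apply I rowL)
  qed
  show "x2 k q = 0" if k: "k \<in> K" and q: "q \<in> Q"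
  proof -
    have "mprod I (n2 x) x k q = (\<Sum>j\<in>L. x k (\<tau> j) * x j q)"
    proof -
      have "(\<Sum>j\<in>L. n2 x k j * x j q) = (\<Sum>j\<in>L. x k (\<tau> j) * x j q)"
        using k by (intro sum.cong) (auto simp: n2_def)
      moreover have "(\<Sum>j\<in>K. n2 x k j * x j q) = 0"
        using dK by (intro sum.neutral) (auto simp: n2_def)
      moreover have "(\<Sum>j\<in>R. n2 x k j * x j q) = 0"
        using dK[OF k] dR by (intro sum.neutral) (auto simp: n2_def)
      ultimately show ?thesis unfolding mprod_def sum_I by simp
    qed
    also have "\<dots> = (\<Sum>j\<in>L. x k (\<tau> j) * (if q = \<tau> j then 1 else 0))"
      using N q by (intro sum.cong) auto
    also have "\<dots> = x k q" unfolding sum_delta_\<tau>'[OF q] using \<tau>'(2)[OF q] by simp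
    finally show ?thesis unfolding x2_def using k q colQ[OF q] by (simp add: unip_apply I mprod_def)
  qed
qed

lemma unip_n3:
  assumes LQ': "\<forall>a\<in>L. \<forall>q\<in>Q. x a q = (if q = \<tau> a then 1 else 0)"
    and LZ': "\<forall>a\<in>L. \<forall>z\<in>Z. x a z = 0"
    and KQ': "\<forall>k\<in>K. \<forall>q\<in>Q. x k q = 0"
  defines "x3 \<equiv> unip (n3 x) x"
  shows "a \<in> L \<Longrightarrow> q \<in> Q \<Longrightarrow> x3 a q = (if q = \<tau> a then 1 else 0)"
    and "a \<in> L \<Longrightarrow> z \<in> Z \<Longrightarrow> x3 a z = 0"
    and "k \<in> K \<Longrightarrow> q \<in> Q \<Longrightarrow> x3 k q = 0"
    and "a \<in> L \<Longrightarrow> j \<in> K \<union> L \<Longrightarrow> x3 a j = 0"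
    and "z \<in> Z \<Longrightarrow> q \<in> Q \<Longrightarrow> x3 z q = 0"
proof -
  have LQ: "x a q = (if q = \<tau> a then 1 else 0)" if "a \<in> L" "q \<in> Q" for a q using LQ' that by blast
  have LZ: "x a z = 0" if "a \<in> L" "z \<in> Z" for a z using LZ' that by blast
  have KQ: "x k q = 0" if "k \<in> K" "q \<in> Q" for k q using KQ' that by blast
  have I: "i \<in> I" if "i \<in> K \<or> i \<in> L \<or> i \<in> Z \<or> i \<in> Q" for i using that unfolding I_eq by auto
  have colR: "mprod I u (n3 x) i j = 0" if "j \<in> R" for u i j
    using dR[OF that] by (intro mprod_col0 n3_col) auto
  have rowA: "mprod I (n3 x) u a j = 0" if "a \<in> K \<union> L" for u a j
    using dK[of a] dL[of a] that by (intro mprod_row0 n3_row) auto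
  show "x3 a q = (if q = \<tau> a then 1 else 0)" if a: "a \<in> L" and q: "q \<in> Q"
    unfolding x3_def using a q by (simp add: unip_apply I colR rowA LQ)
  show "x3 a z = 0" if a: "a \<in> L" and z: "z \<in> Z"
    unfolding x3_def using a z by (simp add: unip_apply I colR rowA LZ)
  show "x3 k q = 0" if k: "k \<in> K" and q: "q \<in> Q"
    unfolding x3_def using k q by (simp add: unip_apply I colR rowA KQ)
  show "x3 a j = 0" if a: "a \<in> L" and j: "j \<in> K \<union> L"
  proof -
    have jI: "j \<in> I" using j I by auto
    have "mprod I x (n3 x) a j = (\<Sum>q\<in>Q. x a q * - x (\<tau>' q) j)"
    proof -
      have "(\<Sum>q\<in>Q. x a q * n3 x q j) = (\<Sum>q\<in>Q. x a q * - x (\<tau>' q) j)"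
        using j by (intro sum.cong) (auto simp: n3_def)
      moreover have "(\<Sum>q\<in>K. x a q * n3 x q j) = 0" "(\<Sum>q\<in>L. x a q * n3 x q j) = 0"
        using dK dL by (auto intro!: sum.neutral simp: n3_def)
      moreover have "(\<Sum>q\<in>R. x a q * n3 x q j) = (\<Sum>q\<in>Q. x a q * n3 x q j)"
      proof (rule sum_R_Q)
        show "x a q * n3 x q j = 0" if "q \<in> Z" for q using LZ[OF a that] by simp
        show "x a q * n3 x q j = 0" if "q \<in> W" for q using dW[OF that] by (simp add: n3_def)
      qed
      ultimately show ?thesis unfolding mprod_def sum_I by simp
    qed
    also have "\<dots> = (\<Sum>q\<in>Q. (if q = \<tau> a then 1 else 0) * - x (\<tau>' q) j)"
      by (intro sum.cong HOL.refl) (simp add: LQ[OF a])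
    also have "\<dots> = - x a j" unfolding sum_delta_\<tau>[OF a] using \<tau>(2)[OF a] by simp
    finally show ?thesis unfolding x3_def using a jI by (simp add: unip_apply I rowA)
  qed
  show "x3 z q = 0" if z: "z \<in> Z" and q: "q \<in> Q"
  proof -
    have "mprod I (n3 x) x z q = (\<Sum>j\<in>L. x z (\<tau> j) * x j q)"
    proof -
      have "(\<Sum>j\<in>L. n3 x z j * x j q) = (\<Sum>j\<in>L. x z (\<tau> j) * x j q)"
        using z dZ[OF z] by (intro sum.cong) (auto simp: n3_def)
      moreover have "(\<Sum>j\<in>K. n3 x z j * x j q) = 0"
        using dK dZ[OF z] by (intro sum.neutral) (auto simp: n3_def)
      moreover have "(\<Sum>j\<in>R. n3 x z j * x j q) = 0"
        using dR by (intro sum.neutral) (auto simp: n3_def)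
      ultimately show ?thesis unfolding mprod_def sum_I by simp
    qed
    also have "\<dots> = (\<Sum>j\<in>L. x z (\<tau> j) * (if q = \<tau> j then 1 else 0))"
      using LQ q by (intro sum.cong) auto
    also have "\<dots> = x z q" unfolding sum_delta_\<tau>'[OF q] using \<tau>'(2)[OF q] by simp
    finally show ?thesis unfolding x3_def using z q colR[of q] by (simp add: unip_apply I mprod_def)
  qed
qed

lemma good_pivot:
  assumes "good TYPE('k::field) I1 P1"
  shows "good TYPE('k) I P"
proof -
  obtain J \<sigma> c D and r :: "'k fmat \<Rightarrow> _" where gd: "good_data I1 P1 J \<sigma> r D c"
    using assms unfolding good_def by blast
  interpret g: good_data I1 P1 J \<sigma> r D c by fact
  obtain E :: "'k fmat \<Rightarrow> 'k" and v where E: "E \<in> poly_funs mcoords"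
    and v_loc: "\<And>i j. (\<lambda>x. v x i j) \<in> loc mcoords E"
    and v1: "\<And>x i j. E x \<noteq> 0 \<Longrightarrow> i \<in> L \<Longrightarrow> j \<in> L \<Longrightarrow> (\<Sum>k\<in>L. x i k * v x k j) = (if i = j then 1 else 0)"
    and v2: "\<And>x i j. E x \<noteq> 0 \<Longrightarrow> i \<in> L \<Longrightarrow> j \<in> L \<Longrightarrow> (\<Sum>k\<in>L. v x i k * x k j) = (if i = j then 1 else 0)"
    and E1: "\<And>x. (\<And>i j. i \<in> L \<Longrightarrow> j \<in> L \<Longrightarrow> x i j = (if i = j then 1 else 0)) \<Longrightarrow> E x = 1"
    by (rule generic_inverse[OF fins(2)]) blast
  define m where "m x = (\<lambda>i j. x i (\<tau> j))" for x :: "'k fmat"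
  have m_poly: "(\<lambda>x. m x i j) \<in> poly_funs mcoords" for i j by (simp add: m_def mcoords_poly)
  define D0 where "D0 x = E (m x)" for x
  have D0: "D0 \<in> poly_funs mcoords" unfolding D0_def[abs_def] by (rule mpoly_comp[OF E m_poly])
  define u where "u x = (\<lambda>i j. if i \<in> L \<and> j \<in> L then x i (\<tau> j) else mone I i j)" for x :: "'k fmat"
  define w where "w x = (\<lambda>i j. if i \<in> L \<and> j \<in> L then v (m x) i j else mone I i j)" for x :: "'k fmat"
  define x1 where "x1 x = mprod I (w x) (mprod I x (u x))" for x
  define x2 where "x2 x = unip (n2 (x1 x)) (x1 x)" for x
  define x3 where "x3 x = unip (n3 (x2 x)) (x2 x)" for x
  define \<rho> where "\<rho> x = (\<lambda>i j. if P1 i j then (if i \<in> K \<and> j \<in> Q then x3 x i (\<tau>' j) else x3 x i j) else 0)" for x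
  have one: "mone I i j = (0 :: 'k)" if "i \<in> L \<and> j \<notin> L \<or> i \<notin> L \<and> j \<in> L" for i j
    using that by (auto simp: mone_def)
  have mP: "P j i" if "mone I i j \<noteq> (0 :: 'k)" for i j
    using that refl by (auto simp: mone_def split: if_splits)
  have uw_malg: "u x \<in> malg P" "w x \<in> malg P" for x
  proof -
    have "P j i" if "u x i j \<noteq> 0 \<or> w x i j \<noteq> 0" for i j
      using that mP[of i j] AA[of j i] unfolding u_def w_def by (cases "i \<in> L \<and> j \<in> L") auto
    then show "u x \<in> malg P" "w x \<in> malg P" by (auto intro!: malgI)
  qed
  have blk: "mprod I a b = mone I"
    if a: "\<And>i j. \<not> (i \<in> L \<and> j \<in> L) \<Longrightarrow> a i j = mone I i j" and b: "\<And>i j. \<not> (i \<in> L \<and> j \<in> L) \<Longrightarrow> b i j = mone I i j"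
      and ab: "\<And>i j. i \<in> L \<Longrightarrow> j \<in> L \<Longrightarrow> (\<Sum>k\<in>L. a i k * b k j) = (if i = j then 1 else 0)" for a b :: "'k fmat"
  proof (intro ext)
    fix i j
    show "mprod I a b i j = mone I i j"
    proof (cases "i \<in> L \<and> j \<in> L")
      case True
      have a0: "a i k = 0" if "k \<notin> L" for k using a[of i k] one[of i k] True that by simp
      have "a i k = 0" if "k \<in> K" for k using a0 dK that by blast
      moreover have "a i k = 0" if "k \<in> R" for k using a0 dR that by blast
      ultimately have "(\<Sum>k\<in>K. a i k * b k j) = 0" "(\<Sum>k\<in>R. a i k * b k j) = 0"
        by (auto intro!: sum.neutral)
      then show ?thesis using ab[of i j] True inI(2) unfolding mprod_def sum_I by (simp add: mone_def)
    next
      case False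
      have "mprod I a b i j = mprod I (mone I) (mone I) i j"
        unfolding mprod_def
      proof (intro sum.cong HOL.refl)
        fix k assume "k \<in> I"
        show "a i k * b k j = mone I i k * mone I k j"
          using a[of i k] b[of k j] False one[of i k] one[of k j]
          by (cases "i \<in> L"; cases "k \<in> L"; cases "j \<in> L") auto
      qed
      then show ?thesis using malg_mone_left[OF mone_malg] by metis
    qed
  qed
  have uw: "mprod I (u x) (w x) = mone I" "mprod I (w x) (u x) = mone I" if D: "D0 x \<noteq> 0" for x
  proof -
    have D': "E (m x) \<noteq> 0" using D by (simp add: D0_def)
    have o: "u x i j = mone I i j" "w x i j = mone I i j" if "\<not> (i \<in> L \<and> j \<in> L)" for i j
      using that by (auto simp: u_def w_def)
    have "(\<Sum>k\<in>L. u x i k * w x k j) = (\<Sum>k\<in>L. m x i k * v (m x) k j)"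
      "(\<Sum>k\<in>L. w x i k * u x k j) = (\<Sum>k\<in>L. v (m x) i k * m x k j)" if "i \<in> L" "j \<in> L" for i j
      using that by (auto intro!: sum.cong simp: u_def w_def m_def)
    then have s: "(\<Sum>k\<in>L. u x i k * w x k j) = (if i = j then 1 else 0)"
      "(\<Sum>k\<in>L. w x i k * u x k j) = (if i = j then 1 else 0)" if "i \<in> L" "j \<in> L" for i j
      using v1[OF D'] v2[OF D'] that by auto
    show "mprod I (u x) (w x) = mone I" by (rule blk[OF o s(1)])
    show "mprod I (w x) (u x) = mone I" by (rule blk[OF o(2,1) s(2)])
  qed
  have iso1: "miso I P x (x1 x)" if "D0 x \<noteq> 0" for x
    unfolding x1_def by (rule miso_conj[OF uw_malg uw[OF that]])
  have iso2: "miso I P (x1 x) (x2 x)" for x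
    unfolding x2_def by (rule miso_unip[OF n2_malg n2_n2])
  have iso3: "miso I P (x2 x) (x3 x)" for x
    unfolding x3_def by (rule miso_unip[OF n3_malg n3_n3])
  have LQ1: "x1 x a q = (if q = \<tau> a then 1 else 0)" if D: "D0 x \<noteq> 0" and a: "a \<in> L" and q: "q \<in> Q" for x a q
  proof -
    have qL: "q \<notin> L" "q \<in> I" using q dQ[OF q] unfolding I_eq by auto
    have 1: "mprod I x (u x) k q = x k q" for k
    proof -
      have "mprod I x (u x) k q = mprod I x (mone I) k q"
        unfolding mprod_def u_def using qL by simp
      then show ?thesis using mprod_mone_right[OF fin qL(2)] by simp
    qed
    have 2: "(\<Sum>k\<in>K. w x a k * x k q) = 0" "(\<Sum>k\<in>R. w x a k * x k q) = 0"
    proof -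
      have w0: "w x a k = 0" if "k \<notin> L" for k using a one[of a k] that by (simp add: w_def)
      have "w x a k = 0" if "k \<in> K" for k using w0 dK that by blast
      moreover have "w x a k = 0" if "k \<in> R" for k using w0 dR that by blast
      ultimately show "(\<Sum>k\<in>K. w x a k * x k q) = 0" "(\<Sum>k\<in>R. w x a k * x k q) = 0"
        by (auto intro!: sum.neutral)
    qed
    have "x1 x a q = (\<Sum>k\<in>L. v (m x) a k * m x k (\<tau>' q))"
      unfolding x1_def mprod_def[of I "w x"] 1 sum_I 2 using a \<tau>'(2)[OF q] by (simp add: w_def m_def)
    also have "\<dots> = (if a = \<tau>' q then 1 else 0)"
      using v2[of "m x" a "\<tau>' q"] D a \<tau>'(1)[OF q] by (simp add: D0_def)
    finally show ?thesis using \<tau>(2)[OF a] \<tau>'(2)[OF q] by auto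
  qed
  have iso: "miso I P x (\<iota> (\<rho> x))" if D: "D0 x \<noteq> 0" for x
  proof -
    have "\<forall>a\<in>L. \<forall>q\<in>Q. x1 x a q = (if q = \<tau> a then 1 else 0)" using LQ1[OF D] by blast
    note f2 = unip_n2[OF this, folded x2_def]
    have "\<forall>a\<in>L. \<forall>q\<in>Q. x2 x a q = (if q = \<tau> a then 1 else 0)" "\<forall>a\<in>L. \<forall>z\<in>Z. x2 x a z = 0" "\<forall>k\<in>K. \<forall>q\<in>Q. x2 x k q = 0"
      using f2 by blast+
    note f3 = unip_n3[OF this, folded x3_def]
    have "miso I P x (x3 x)" using miso_trans[OF iso1[OF D] miso_trans[OF iso2 iso3]] .
    moreover have "miso I P x (x3 x) \<longleftrightarrow> miso I P x (\<iota> (\<rho> x))"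
    proof (rule miso_cong)
      fix k l assume kl: "P k l"
      then show "x3 x k l = \<iota> (\<rho> x) k l"
      proof (cases rule: P_cases)
        case 1
        then show ?thesis using dK[OF 1(1)] dK[OF 1(2)] P1_KK[OF 1] by (simp add: \<iota>_def cut_def \<rho>_def)
      next
        case 2
        then show ?thesis using dK[OF 2(1)] \<tau>[OF 2(2)] P1_KQ[OF 2(1), of "\<tau> l"] by (simp add: \<iota>_def \<rho>_def)
      next
        case 3
        then show ?thesis using f3(4)[OF 3(1), of l] \<tau>(1)[OF 3(1)] dK[OF 3(2)] by (auto simp: \<iota>_def)
      next
        case 4
        then show ?thesis using f3(4)[OF 4(1), of l] \<tau>(1)[OF 4(1)] dL[OF 4(2)] by (auto simp: \<iota>_def)
      next
        case 5
        show ?thesis using 5(1,2) f3(3)[OF 5(1,2)] dK[OF 5(1)] dQ[OF 5(2)] by (auto simp: \<iota>_def)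
      next
        case 6
        then show ?thesis using f3(1)[OF 6] by (auto simp: \<iota>_def)
      next
        case 7
        show ?thesis using 7(1,2) f3(2)[OF 7(1,2)] \<tau>(1)[OF 7(1)] dZ[OF 7(2)] by (auto simp: \<iota>_def)
      next
        case 8
        show ?thesis
        proof (cases "P1 k l")
          case True
          then show ?thesis using dR[OF 8(1)] by (simp add: \<iota>_def cut_def \<rho>_def)
        next
          case False
          then have "k \<in> Z" "l \<in> Q" using kl dR[OF 8(1)] dR[OF 8(2)] by (auto simp: P1_def)
          then show ?thesis using f3(5) dR[OF 8(1)] False by (simp add: \<iota>_def cut_def)
        qed
      qed
    qed simp
    ultimately show ?thesis by simp
  qed
  have \<iota>_supp: "P i j" if "\<iota> x i j \<noteq> 0" for x :: "'k fmat" and i j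
  proof -
    have "P i j" if "i \<in> L" "j = \<tau> i" using AC[of i j] that \<tau>(1)[of i] by auto
    moreover have "P i j" if "i \<in> K" "j \<in> L" using AA[of i j] that by auto
    moreover have "P i j" if "cut x i j \<noteq> 0" using that P1_P by (auto simp: cut_def split: if_splits)
    ultimately show ?thesis using that by (auto simp: \<iota>_def split: if_splits)
  qed
  have fix\<iota>: "D0 (\<iota> x) \<noteq> 0 \<and> \<rho> (\<iota> x) = x" if x: "\<And>i j. x i j \<noteq> 0 \<Longrightarrow> P1 i j" for x
  proof -
    have \<tau>\<tau>: "\<tau> j = \<tau> i \<longleftrightarrow> i = j" if "i \<in> L" "j \<in> L" for i j using \<tau>(2)[OF that(1)] \<tau>(2)[OF that(2)] by metis
    have m\<iota>: "m (\<iota> x) i j = (if i = j then 1 else 0)" if "i \<in> L" "j \<in> L" for i j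
      using that \<tau>\<tau>[OF that] by (simp add: m_def \<iota>_def)
    have D1: "D0 (\<iota> x) = 1" unfolding D0_def by (rule E1[OF m\<iota>])
    have sI: "i \<in> I \<and> j \<in> I" if "\<iota> x i j \<noteq> 0" for i j using \<iota>_supp[OF that] fld by blast
    have v\<iota>: "v (m (\<iota> x)) i j = (if i = j then 1 else 0)" if "i \<in> L" "j \<in> L" for i j
    proof -
      have "(\<Sum>k\<in>L. m (\<iota> x) i k * v (m (\<iota> x)) k j) = (\<Sum>k\<in>L. if i = k then v (m (\<iota> x)) k j else 0)"
        using m\<iota> that by (intro sum.cong) auto
      then have "(\<Sum>k\<in>L. m (\<iota> x) i k * v (m (\<iota> x)) k j) = v (m (\<iota> x)) i j" using that fins by simp
      then show ?thesis using v1[of "m (\<iota> x)" i j] D1 that by (simp add: D0_def)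
    qed
    have "u (\<iota> x) = mone I" "w (\<iota> x) = mone I"
      using m\<iota> v\<iota> inI(2) unfolding u_def w_def by (auto simp: m_def mone_def fun_eq_iff)
    then have "x1 (\<iota> x) = unip (\<lambda>i j. 0) (\<iota> x)" by (simp add: x1_def unip_def)
    then have 1: "x1 (\<iota> x) = \<iota> x" using unip_zero[of "\<iota> x" "\<lambda>i j. 0"] sI by auto
    have "n2 (\<iota> x) i j = 0" for i j
      unfolding n2_def using \<tau>(1)[of j] \<tau>'[of i] dK[of i] dQ[of "\<tau> j"] dZ[of j] by (auto simp: \<iota>_def)
    then have 2: "x2 (\<iota> x) = \<iota> x" unfolding x2_def 1 using unip_zero[of "\<iota> x"] sI by blast
    have "n3 (\<iota> x) i j = 0" for i j
    proof -
      have "\<iota> x (\<tau>' i) j = 0" if "i \<in> Q" "j \<in> K \<union> L"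
        using that \<tau>'[OF that(1)] dQ[OF that(1)] by (auto simp: \<iota>_def)
      moreover have "\<iota> x i (\<tau> j) = 0" if "i \<in> Z" "j \<in> L"
        using that \<tau>(1)[OF that(2)] dZ[OF that(1)] by (auto simp: \<iota>_def cut_def P1_def)
      ultimately show ?thesis by (auto simp: n3_def)
    qed
    then have 3: "x3 (\<iota> x) = \<iota> x" unfolding x3_def 2 using unip_zero[of "\<iota> x"] sI by blast
    have \<rho>\<iota>: "\<rho> (\<iota> x) i j = (if P1 i j then (if i \<in> K \<and> j \<in> Q then \<iota> x i (\<tau>' j) else \<iota> x i j) else 0)" for i j
      by (simp only: \<rho>_def 3)
    have "\<rho> (\<iota> x) i j = x i j" for i j
    proof (cases "P1 i j")
      case True
      then show ?thesis
      proof (cases rule: P1_cases)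
        case 1
        then show ?thesis unfolding \<rho>\<iota> using dK[OF 1(1)] dK[OF 1(2)] True by (simp add: \<iota>_def cut_def)
      next
        case 2
        show ?thesis unfolding \<rho>\<iota> using 2(1,2) dK[OF 2(1)] \<tau>'[OF 2(2)] True by (simp add: \<iota>_def)
      next
        case RR: 3
        then show ?thesis unfolding \<rho>\<iota> using dR[OF RR(1)] True by (simp add: \<iota>_def cut_def)
      qed
    next
      case False
      then show ?thesis using x[of i j] by (auto simp: \<rho>\<iota>)
    qed
    then show ?thesis using D1 by auto
  qed
  have u_loc: "(\<lambda>x. u x i j) \<in> loc mcoords D0" for i j
    by (cases "i \<in> L \<and> j \<in> L") (auto simp: u_def intro!: loc_poly mcoords_poly poly_funs.const)
  have w_loc: "(\<lambda>x. w x i j) \<in> loc mcoords D0" for i j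
    using loc_comp_poly[OF v_loc[of i j] m_poly]
    by (cases "i \<in> L \<and> j \<in> L") (auto simp: w_def D0_def[abs_def])
  have x_loc: "(\<lambda>x. x i j) \<in> loc mcoords D0" for i j by (intro loc_poly mcoords_poly)
  have x1_loc: "(\<lambda>x. x1 x i j) \<in> loc mcoords D0" for i j
    unfolding x1_def by (intro mprod_loc D0 u_loc w_loc x_loc)
  have n2_loc: "(\<lambda>x. n2 (x1 x) i j) \<in> loc mcoords D0" for i j
    by (cases "i \<in> K \<and> j \<in> L"; cases "i \<in> Q \<and> j \<in> Z") (auto simp: n2_def intro!: x1_loc loc_minus)
  have x2_loc: "(\<lambda>x. x2 x i j) \<in> loc mcoords D0" for i j
    unfolding x2_def by (intro unip_loc D0 n2_loc x1_loc)
  have n3_loc: "(\<lambda>x. n3 (x2 x) i j) \<in> loc mcoords D0" for i j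
    by (cases "i \<in> Q \<and> j \<in> K \<union> L"; cases "i \<in> Z \<and> j \<in> L") (auto simp: n3_def intro!: x2_loc loc_minus)
  have x3_loc: "(\<lambda>x. x3 x i j) \<in> loc mcoords D0" for i j
    unfolding x3_def by (intro unip_loc D0 n3_loc x2_loc)
  show ?thesis
  proof (rule good_reduction[OF preord_axioms _ gd _ \<iota>_supp D0 _ iso fix\<iota> miso_\<iota>_imp miso_\<iota> mhom_\<iota>_diag])
    show "I1 \<subseteq> I" using p_inI by blast
    show "(\<lambda>x. \<iota> x i j) \<in> poly_funs mcoords" for i j
      by (cases "i \<in> L"; cases "i \<in> K"; cases "j \<in> L"; cases "j \<in> K"; cases "P1 i j")
        (auto simp: \<iota>_def cut_def intro: poly_funs.const)
    show "(\<lambda>x. \<rho> x i j) \<in> loc mcoords D0" for i j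
      by (cases "P1 i j"; cases "i \<in> K \<and> j \<in> Q") (auto simp: \<rho>_def intro!: x3_loc)
    show "extend_label c i \<in> I" if i: "i \<in> I" for i
    proof (cases "i \<in> L")
      case True
      then have "\<tau> i \<in> I1" using \<tau>(1) by auto
      then show ?thesis using g.c_closed[of "\<tau> i"] p_inI True by (simp add: extend_label_def)
    next
      case False
      then have "i \<in> I1" using i unfolding I_eq by auto
      then show ?thesis using g.c_closed[of i] p_inI False by (simp add: extend_label_def)
    qed
  qed
qed

end

section \<open>Full matrix algebras\<close>

lemma good_empty: "good TYPE('k::field) {} (\<lambda>i j. False)"
proof -
  interpret preord "{}" "\<lambda>i j. False" by standard auto
  have "good_data {} (\<lambda>i j. False) {} (\<lambda>_ _ _. 0 :: 'k) (\<lambda>_ _. 0) (\<lambda>_. 1) id"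
  proof
    have z: "malg (\<lambda>i j. False) = {\<lambda>i j. 0 :: 'k}" by (auto simp: malg_def fun_eq_iff)
    have m: "mone {} = (\<lambda>i j. 0 :: 'k)" by (auto simp: mone_def)
    have h: "mhom {} (\<lambda>i j. False) x y = {\<lambda>i j. 0 :: 'k}" for x y unfolding mhom_def z by auto
    have i: "miso {} (\<lambda>i j. False) x y" for x y :: "'k fmat" unfolding miso_def h z m by (simp add: mprod_def)
    show "miso {} (\<lambda>i j. False) x (\<lambda>_ _. 0)" for x :: "'k fmat" by (rule i)
    have "{mdiag {} (t \<circ> id) | t. True} = {\<lambda>i j. 0 :: 'k}" by (auto simp: mdiag_def)
    then show "\<exists>y. miso {} (\<lambda>i j. False) x y \<and> mhom {} (\<lambda>i j. False) y y = {mdiag {} (t \<circ> id) | t. True}"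
      for x :: "'k fmat" using i h by blast
  qed (auto intro: poly_funs.const)
  then show ?thesis unfolding good_def by blast
qed

fun mpow :: "nat set \<Rightarrow> 'k::comm_ring_1 fmat \<Rightarrow> nat \<Rightarrow> 'k fmat" where
  "mpow I x 0 = mone I"
| "mpow I x (Suc n) = mprod I x (mpow I x n)"

locale full_matrices =
  fixes I :: "nat set" and m :: nat and e e' :: "nat \<Rightarrow> nat"
  assumes m: "0 < m"
    and e': "i \<in> I \<Longrightarrow> e' i < m" "i \<in> I \<Longrightarrow> e (e' i) = i"
    and e: "j < m \<Longrightarrow> e j \<in> I" "j < m \<Longrightarrow> e' (e j) = j"
begin

lemma bij_e: "bij_betw e {..<m} I"
  by (rule bij_betwI[of _ _ _ e']) (use e e' in auto)

abbreviation PP :: "nat \<Rightarrow> nat \<Rightarrow> bool" where "PP \<equiv> \<lambda>i j. i \<in> I \<and> j \<in> I"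

sublocale preord I PP
proof
  show "finite I" using bij_betw_finite[OF bij_e] by simp
qed auto

lemma e0: "e 0 \<in> I" "e' (e 0) = 0"
  using e m by auto

lemma e'_eq: "i \<in> I \<Longrightarrow> j < m \<Longrightarrow> e' i = j \<longleftrightarrow> i = e j"
  using e e' by auto

lemma sum_delta: "a \<in> I \<Longrightarrow> (\<Sum>k\<in>I. f k * (if k = a then 1 else 0)) = (f a :: 'k::comm_ring_1)"
  using fin by (simp add: if_distrib[of "\<lambda>u. _ * u"] cong: if_cong)

lemma mpow_malg: "x \<in> malg PP \<Longrightarrow> mpow I x n \<in> malg PP"
  by (induction n) (auto intro: malg_mprod mone_malg)

lemma mpow_comm: "x \<in> malg PP \<Longrightarrow> mprod I (mpow I x n) x = mprod I x (mpow I x n)"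
  by (induction n) (simp_all add: malg_mone_left malg_mone_right mprod_assoc)

lemma mpow_comm': "x \<in> malg PP \<Longrightarrow> mprod I (mpow I x n) (mpow I x k) = mprod I (mpow I x k) (mpow I x n)"
proof (induction k)
  case 0
  then show ?case by (simp add: malg_mone_left malg_mone_right mpow_malg)
next
  case (Suc k)
  have "mprod I (mpow I x n) (mprod I x (mpow I x k)) = mprod I (mprod I (mpow I x n) x) (mpow I x k)"
    by (simp add: mprod_assoc)
  also have "\<dots> = mprod I (mprod I x (mpow I x n)) (mpow I x k)" using Suc.prems by (simp add: mpow_comm)
  also have "\<dots> = mprod I x (mprod I (mpow I x k) (mpow I x n))" using Suc by (simp add: mprod_assoc)
  finally show ?case by (simp add: mprod_assoc)
qed

lemma mpow_intertwine:
  assumes "mprod I x h = mprod I h y" "h \<in> malg PP"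
  shows "mprod I (mpow I x n) h = mprod I h (mpow I y n)"
proof (induction n)
  case 0
  then show ?case using assms(2) by (simp add: malg_mone_left malg_mone_right)
next
  case (Suc n)
  have "mprod I (mpow I x (Suc n)) h = mprod I x (mprod I (mpow I x n) h)" by (simp add: mprod_assoc)
  also have "\<dots> = mprod I (mprod I x h) (mpow I y n)" using Suc by (simp add: mprod_assoc)
  also have "\<dots> = mprod I h (mpow I y (Suc n))" using assms by (simp add: mprod_assoc)
  finally show ?case .
qed

definition mpoly :: "(nat \<Rightarrow> 'k::comm_ring_1) \<Rightarrow> 'k fmat \<Rightarrow> 'k fmat" where
  "mpoly t x = (\<lambda>i j. \<Sum>k\<in>I. t k * mpow I x (e' k) i j)"

lemma mpoly_malg: "x \<in> malg PP \<Longrightarrow> mpoly t x \<in> malg PP"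
proof (rule malgI)
  fix i j assume x: "x \<in> malg PP" and "mpoly t x i j \<noteq> 0"
  then obtain k where "mpow I x (e' k) i j \<noteq> 0"
    unfolding mpoly_def by (metis (no_types, lifting) mult_zero_right sum.neutral)
  then show "j \<in> I \<and> i \<in> I" using malgD[OF mpow_malg[OF x], of j i] by blast
qed

lemma mprod_mpoly_left: "mprod I (mpoly t x) y i j = (\<Sum>k\<in>I. t k * mprod I (mpow I x (e' k)) y i j)"
  unfolding mprod_def mpoly_def sum_distrib_right sum_distrib_left
  by (subst sum.swap) (simp add: mult.assoc)

lemma mprod_mpoly_right: "mprod I y (mpoly t x) i j = (\<Sum>k\<in>I. t k * mprod I y (mpow I x (e' k)) i j)"
  unfolding mprod_def mpoly_def sum_distrib_right sum_distrib_left
  by (subst sum.swap) (simp add: algebra_simps)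

definition krylov :: "'k::comm_ring_1 fmat \<Rightarrow> 'k fmat" where
  "krylov x = (\<lambda>i j. if i \<in> I \<and> j \<in> I then mpow I x (e' j) i (e 0) else 0)"

definition companion :: "(nat \<Rightarrow> 'k::comm_ring_1) \<Rightarrow> 'k fmat" where
  "companion t = (\<lambda>i j. if i \<in> I \<and> j \<in> I then
     (if Suc (e' j) < m then (if e' i = Suc (e' j) then 1 else 0) else t i) else 0)"

lemma krylov_malg: "krylov x \<in> malg PP"
  and companion_malg: "companion t \<in> malg PP"
  by (auto intro!: malgI simp: krylov_def companion_def split: if_splits)

lemma krylov_companion:
  assumes "x \<in> malg PP" and t: "\<And>i. i \<in> I \<Longrightarrow> (\<Sum>k\<in>I. krylov x i k * t k) = mpow I x m i (e 0)"
  shows "mprod I x (krylov x) = mprod I (krylov x) (companion t)"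
proof (intro ext)
  fix i j
  show "mprod I x (krylov x) i j = mprod I (krylov x) (companion t) i j"
  proof (cases "i \<in> I \<and> j \<in> I")
    case False
    then show ?thesis
      using malgD[OF malg_mprod[OF assms(1) krylov_malg], of j i]
        malgD[OF malg_mprod[OF krylov_malg companion_malg], of j i x t] by auto
  next
    case True
    then have i: "i \<in> I" and j: "j \<in> I" by auto
    have l: "mprod I x (krylov x) i j = mpow I x (Suc (e' j)) i (e 0)"
      using j by (auto simp: mprod_def krylov_def intro!: sum.cong)
    show ?thesis
    proof (cases "Suc (e' j) < m")
      case True
      have "mprod I (krylov x) (companion t) i j = (\<Sum>k\<in>I. krylov x i k * (if k = e (Suc (e' j)) then 1 else 0))"
        unfolding mprod_def using j True e'_eq[OF _ True] by (intro sum.cong) (auto simp: companion_def)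
      also have "\<dots> = krylov x i (e (Suc (e' j)))" using e(1)[OF True] by (rule sum_delta)
      also have "\<dots> = mpow I x (Suc (e' j)) i (e 0)" using i e[OF True] by (simp add: krylov_def)
      finally show ?thesis using l by simp
    next
      case False
      then have "Suc (e' j) = m" using e'(1)[OF j] by simp
      moreover have "mprod I (krylov x) (companion t) i j = (\<Sum>k\<in>I. krylov x i k * t k)"
        unfolding mprod_def using j False by (intro sum.cong) (auto simp: companion_def)
      ultimately show ?thesis using l t[OF i] by simp
    qed
  qed
qed

lemma mpow_companion: "j < m \<Longrightarrow> i \<in> I \<Longrightarrow> mpow I (companion t) j i (e 0) = (if i = e j then 1 else 0)"
proof (induction j arbitrary: i)
  case 0
  then show ?case using e0 by (auto simp: mone_def)
next
  case (Suc j)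
  then have j: "j < m" by simp
  have "mpow I (companion t) (Suc j) i (e 0) = (\<Sum>k\<in>I. companion t i k * (if k = e j then 1 else 0))"
    using Suc.IH[OF j] by (simp add: mprod_def cong: sum.cong)
  also have "\<dots> = companion t i (e j)" using e(1)[OF j] by (rule sum_delta)
  also have "\<dots> = (if i = e (Suc j) then 1 else 0)"
    using Suc.prems e[OF j] e'_eq[OF Suc.prems(2,1)] by (simp add: companion_def)
  finally show ?case .
qed

lemma mpow_companion_m: "i \<in> I \<Longrightarrow> mpow I (companion t) m i (e 0) = t i"
proof -
  assume i: "i \<in> I"
  define l where "l = m - 1"
  have l: "Suc l = m" using m by (simp add: l_def)
  then have j: "l < m" by simp
  have "mpow I x (Suc l) = mprod I x (mpow I x l)" for x :: "'a fmat" by simp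
  then have p: "mpow I x m = mprod I x (mpow I x l)" for x :: "'a fmat" unfolding l .
  have "mpow I (companion t) m i (e 0) = (\<Sum>k\<in>I. companion t i k * (if k = e l then 1 else 0))"
    unfolding p using mpow_companion[OF j, of _ t] by (simp add: mprod_def cong: sum.cong)
  also have "\<dots> = companion t i (e l)" using e(1)[OF j] by (rule sum_delta)
  also have "\<dots> = t i" using i e[OF j] l by (simp add: companion_def)
  finally show ?thesis .
qed

lemma krylov_of_companion: "krylov (companion t) = mone I"
proof (intro ext)
  fix i j show "krylov (companion t) i j = mone I i j"
    using mpow_companion[of "e' j" i t] e'[of j] by (auto simp: krylov_def mone_def)
qed

lemma mpoly_annihilates:
  fixes x :: "'k::comm_ring_1 fmat"
  assumes x: "x \<in> malg PP" and t: "\<And>i. i \<in> I \<Longrightarrow> (\<Sum>k\<in>I. krylov x i k * t k) = mpow I x m i (e 0)"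
    and v: "mprod I (krylov x) v = mone I"
  shows "mpoly t x = mpow I x m"
proof -
  define z where "z i j = mpoly t x i j - mpow I x m i j" for i j
  have col: "z i (e 0) = 0" if "i \<in> I" for i
  proof -
    have "mpoly t x i (e 0) = (\<Sum>k\<in>I. krylov x i k * t k)"
      unfolding mpoly_def using that by (intro sum.cong) (auto simp: krylov_def mult.commute)
    then show ?thesis using t[OF that] by (simp add: z_def)
  qed
  have comm: "mprod I z (mpow I x n) i j = mprod I (mpow I x n) z i j" for n i j
  proof -
    have "mprod I z (mpow I x n) i j = mprod I (mpoly t x) (mpow I x n) i j - mprod I (mpow I x m) (mpow I x n) i j"
      by (simp add: mprod_def z_def left_diff_distrib sum_subtractf)
    also have "\<dots> = mprod I (mpow I x n) (mpoly t x) i j - mprod I (mpow I x n) (mpow I x m) i j"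
      unfolding mprod_mpoly_left mprod_mpoly_right by (simp add: mpow_comm'[OF x, of _ n])
    also have "\<dots> = mprod I (mpow I x n) z i j"
      by (simp add: mprod_def z_def right_diff_distrib sum_subtractf)
    finally show ?thesis .
  qed
  have zK: "mprod I z (krylov x) i j = 0" if "i \<in> I" "j \<in> I" for i j
  proof -
    have "mprod I z (krylov x) i j = mprod I z (mpow I x (e' j)) i (e 0)"
      unfolding mprod_def using that by (intro sum.cong) (auto simp: krylov_def)
    also have "\<dots> = (\<Sum>k\<in>I. mpow I x (e' j) i k * z k (e 0))" unfolding comm by (simp add: mprod_def)
    also have "\<dots> = 0" using col by (intro sum.neutral) simp
    finally show ?thesis .
  qed
  have "z i j = 0" if ij: "i \<in> I" "j \<in> I" for i j
  proof -
    have "z i j = mprod I z (mprod I (krylov x) v) i j" unfolding v using mprod_mone_right[OF fin ij(2)] by metis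
    also have "\<dots> = (\<Sum>k\<in>I. mprod I z (krylov x) i k * v k j)" unfolding mprod_assoc[symmetric] by (simp add: mprod_def)
    also have "\<dots> = 0" using zK[OF ij(1)] by (intro sum.neutral) simp
    finally show ?thesis .
  qed
  moreover have "z i j = 0" if "\<not> (i \<in> I \<and> j \<in> I)" for i j
    using malgD[OF mpoly_malg[OF x], of j i t] malgD[OF mpow_malg[OF x], of j i m] that by (auto simp: z_def)
  ultimately have "z i j = 0" for i j by blast
  then show ?thesis by (auto simp: z_def fun_eq_iff)
qed

definition vand :: "(nat \<Rightarrow> 'k::comm_ring_1) \<Rightarrow> 'k fmat" where
  "vand l = (\<lambda>i j. if i \<in> I \<and> j \<in> I then l i ^ e' j else 0)"

lemma row_companion:
  assumes root: "(\<Sum>k\<in>I. t k * l ^ e' k) = l ^ m" and j: "j \<in> I"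
  shows "(\<Sum>k\<in>I. l ^ e' k * companion t k j) = l * l ^ e' j"
proof (cases "Suc (e' j) < m")
  case True
  have "(\<Sum>k\<in>I. l ^ e' k * companion t k j) = (\<Sum>k\<in>I. l ^ e' k * (if k = e (Suc (e' j)) then 1 else 0))"
    using j True e'_eq[OF _ True] by (intro sum.cong) (auto simp: companion_def)
  also have "\<dots> = l ^ e' (e (Suc (e' j)))" using e(1)[OF True] by (rule sum_delta)
  finally show ?thesis using e[OF True] by simp
next
  case False
  then have "Suc (e' j) = m" using e'(1)[OF j] by simp
  moreover have "(\<Sum>k\<in>I. l ^ e' k * companion t k j) = (\<Sum>k\<in>I. t k * l ^ e' k)"
    using j False by (intro sum.cong) (auto simp: companion_def mult.commute)
  ultimately show ?thesis using root by (metis power_Suc)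
qed

lemma row_mpow_companion:
  assumes root: "(\<Sum>k\<in>I. t k * l ^ e' k) = l ^ m" and j: "j \<in> I"
  shows "(\<Sum>k\<in>I. l ^ e' k * mpow I (companion t) n k j) = l ^ n * l ^ e' j"
proof (induction n)
  case 0
  have "(\<Sum>k\<in>I. l ^ e' k * mpow I (companion t) 0 k j) = (\<Sum>k\<in>I. l ^ e' k * (if k = j then 1 else 0))"
    by (intro sum.cong) (auto simp: mone_def)
  then show ?case using sum_delta[OF j] by simp
next
  case (Suc n)
  have "(\<Sum>k\<in>I. l ^ e' k * mpow I (companion t) (Suc n) k j)
      = (\<Sum>i\<in>I. (\<Sum>k\<in>I. l ^ e' k * companion t k i) * mpow I (companion t) n i j)"
    unfolding mpow.simps mprod_def sum_distrib_left sum_distrib_right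
    by (subst sum.swap) (simp add: mult.assoc)
  also have "\<dots> = (\<Sum>i\<in>I. l * (l ^ e' i * mpow I (companion t) n i j))"
    by (intro sum.cong HOL.refl) (simp add: row_companion[OF root] mult.assoc)
  also have "\<dots> = l ^ Suc n * l ^ e' j" unfolding sum_distrib_left[symmetric] Suc by (simp add: mult.assoc)
  finally show ?case .
qed

definition chpoly :: "(nat \<Rightarrow> 'k::comm_ring_1) \<Rightarrow> 'k poly" where
  "chpoly t = monom 1 m - (\<Sum>k\<in>I. monom (t k) (e' k))"

lemma poly_chpoly: "poly (chpoly t) l = l ^ m - (\<Sum>k\<in>I. t k * l ^ e' k)"
  by (simp add: chpoly_def poly_sum poly_monom)

lemma coeff_chpoly: "coeff (chpoly t) m = 1" "k > m \<Longrightarrow> coeff (chpoly t) k = 0"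
proof -
  have "coeff (\<Sum>k\<in>I. monom (t k) (e' k)) j = 0" if "j \<ge> m" for j
    unfolding coeff_sum using e'(1) that by (intro sum.neutral) force
  then show "coeff (chpoly t) m = 1" "k > m \<Longrightarrow> coeff (chpoly t) k = 0"
    by (auto simp: chpoly_def)
qed

lemma degree_chpoly: "degree (chpoly t :: 'k::comm_ring_1 poly) = m"
proof (rule antisym)
  show "degree (chpoly t) \<le> m" by (rule degree_le) (simp add: coeff_chpoly)
  show "m \<le> degree (chpoly t)" by (rule le_degree) (simp add: coeff_chpoly)
qed

definition dmat :: "(nat \<Rightarrow> 'k::comm_ring_1) \<Rightarrow> 'k fmat" where
  "dmat t = (\<lambda>i j. of_nat m * mpow I (companion t) (m - 1) i j
     - (\<Sum>k\<in>I. of_nat (e' k) * t k * mpow I (companion t) (e' k - 1) i j))"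

lemma poly_pderiv_chpoly:
  "poly (pderiv (chpoly t)) l = of_nat m * l ^ (m - 1) - (\<Sum>k\<in>I. of_nat (e' k) * t k * l ^ (e' k - 1))"
  for t :: "nat \<Rightarrow> 'k::field_char_0"
proof -
  have s: "pderiv (\<Sum>k\<in>A. g k) = (\<Sum>k\<in>A. pderiv (g k))" for A and g :: "nat \<Rightarrow> 'k poly"
    by (induction A rule: infinite_finite_induct) (auto simp: pderiv_add)
  show ?thesis
    by (simp add: chpoly_def pderiv_diff s pderiv_monom poly_sum poly_monom)
qed

lemma row_dmat:
  fixes t :: "nat \<Rightarrow> 'k::field_char_0"
  assumes root: "poly (chpoly t) l = 0" and j: "j \<in> I"
  shows "(\<Sum>i\<in>I. l ^ e' i * dmat t i j) = poly (pderiv (chpoly t)) l * l ^ e' j"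
proof -
  have r: "(\<Sum>k\<in>I. t k * l ^ e' k) = l ^ m" using root by (simp add: poly_chpoly)
  have "(\<Sum>i\<in>I. l ^ e' i * dmat t i j) = of_nat m * (\<Sum>i\<in>I. l ^ e' i * mpow I (companion t) (m - 1) i j)
     - (\<Sum>k\<in>I. of_nat (e' k) * t k * (\<Sum>i\<in>I. l ^ e' i * mpow I (companion t) (e' k - 1) i j))"
  proof -
    have "(\<Sum>i\<in>I. l ^ e' i * (\<Sum>k\<in>I. of_nat (e' k) * t k * mpow I (companion t) (e' k - 1) i j))
       = (\<Sum>k\<in>I. of_nat (e' k) * t k * (\<Sum>i\<in>I. l ^ e' i * mpow I (companion t) (e' k - 1) i j))"
      unfolding sum_distrib_left by (subst sum.swap) (simp add: algebra_simps)
    then show ?thesis by (simp add: dmat_def right_diff_distrib sum_subtractf sum_distrib_left algebra_simps)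
  qed
  also have "\<dots> = poly (pderiv (chpoly t)) l * l ^ e' j"
    by (simp add: row_mpow_companion[OF r j] poly_pderiv_chpoly left_diff_distrib sum_distrib_right mult.assoc)
  finally show ?thesis .
qed

end

lemma alg_closed_distinct_roots:
  fixes p :: "'k::{alg_closed_field, field_char_0} poly"
  assumes "p \<noteq> 0" "\<And>a. poly p a = 0 \<Longrightarrow> poly (pderiv p) a \<noteq> 0"
  shows "card {a. poly p a = 0} = degree p"
proof -
  obtain A where A: "size A = degree p" "p = Polynomial.smult (lead_coeff p) (\<Prod>x\<in>#A. [:-x, 1:])"
    using alg_closed_imp_factorization[OF assms(1)] by metis
  have roots: "{a. poly p a = 0} = set_mset A"
  proof -
    have "poly p a = 0 \<longleftrightarrow> a \<in># A" for a
      using assms(1) by (subst A(2)) (auto simp: poly_prod_mset prod_mset_zero_iff image_mset.compositionality)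
    then show ?thesis by blast
  qed
  have "count A a \<le> 1" for a
  proof (rule ccontr)
    assume "\<not> count A a \<le> 1"
    then have "replicate_mset 2 a \<subseteq># A" by (intro mset_subset_eqI) (auto simp: not_le)
    then obtain B where B: "A = replicate_mset 2 a + B" by (metis subset_mset.add_diff_inverse)
    define q where "q = Polynomial.smult (lead_coeff p) (\<Prod>x\<in>#B. [:-x, 1:])"
    have p: "p = [:-a, 1:] * ([:-a, 1:] * q)"
      by (subst A(2)) (simp add: B q_def numeral_2_eq_2 mult.assoc)
    have "poly (pderiv p) a = 0" unfolding p pderiv_mult by simp
    moreover have "poly p a = 0" by (subst p) simp
    ultimately show False using assms(2) by blast
  qed
  then have "A = mset_set (set_mset A)"
    by (intro multiset_eqI) (metis One_nat_def count_eq_zero_iff count_mset_set(1,3) finite_set_mset le_Suc_eq le_zero_eq)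
  then have "card (set_mset A) = size A" by (metis size_mset_set)
  then show ?thesis using A(1) roots by simp
qed

context full_matrices
begin

lemma good_full: "good TYPE('k::{alg_closed_field, field_char_0}) I PP"
proof -
  obtain E :: "'k fmat \<Rightarrow> 'k" and v where E: "E \<in> poly_funs mcoords"
    and v_loc: "\<And>i j. (\<lambda>x. v x i j) \<in> loc mcoords E"
    and v1: "\<And>x i j. E x \<noteq> 0 \<Longrightarrow> i \<in> I \<Longrightarrow> j \<in> I \<Longrightarrow> (\<Sum>k\<in>I. x i k * v x k j) = (if i = j then 1 else 0)"
    and v2: "\<And>x i j. E x \<noteq> 0 \<Longrightarrow> i \<in> I \<Longrightarrow> j \<in> I \<Longrightarrow> (\<Sum>k\<in>I. v x i k * x k j) = (if i = j then 1 else 0)"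
    and E1: "\<And>x. (\<And>i j. i \<in> I \<Longrightarrow> j \<in> I \<Longrightarrow> x i j = (if i = j then 1 else 0)) \<Longrightarrow> E x = 1"
    and E_inj: "\<And>x. (\<And>w i. (\<And>i. i \<in> I \<Longrightarrow> (\<Sum>j\<in>I. x i j * w j) = 0) \<Longrightarrow> i \<in> I \<Longrightarrow> w i = 0) \<Longrightarrow> E x \<noteq> 0"
    by (rule generic_inverse[OF fin]) blast
  define iv where "iv x = (\<lambda>i j. if i \<in> I \<and> j \<in> I then v x i j else 0)" for x
  have inv_malg: "iv x \<in> malg PP" for x by (auto intro!: malgI simp: iv_def split: if_splits)
  have iv: "mprod I x (iv x) = mone I" "mprod I (iv x) x = mone I" if "E x \<noteq> 0" "x \<in> malg PP" for x
  proof -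
    have "mprod I x (iv x) i j = mone I i j \<and> mprod I (iv x) x i j = mone I i j" for i j
    proof (cases "i \<in> I \<and> j \<in> I")
      case True
      have "mprod I x (iv x) i j = (\<Sum>k\<in>I. x i k * v x k j)" "mprod I (iv x) x i j = (\<Sum>k\<in>I. v x i k * x k j)"
        unfolding mprod_def using True by (auto intro!: sum.cong simp: iv_def)
      then show ?thesis
        using v1[OF that(1), of i j] v2[OF that(1), of i j] True by (simp_all add: mone_def)
    next
      case False
      then show ?thesis
        using malgD[OF malg_mprod[OF that(2) inv_malg], of j i] malgD[OF malg_mprod[OF inv_malg that(2)], of j i]
        by (auto simp: mone_def)
    qed
    then show "mprod I x (iv x) = mone I" "mprod I (iv x) x = mone I" by auto
  qed
  define c where "c x = mcut I x" for x :: "'k fmat"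
  have c: "c x \<in> malg PP" for x by (auto intro!: malgI simp: c_def mcut_def split: if_splits)
  have c_id: "c x = x" if "x \<in> malg PP" for x
    using malgD[OF that] by (auto simp: c_def mcut_def fun_eq_iff)
  have iso_c: "miso I PP x y \<longleftrightarrow> miso I PP (c x) y" "miso I PP y x \<longleftrightarrow> miso I PP y (c x)" for x y
    by (rule miso_cong; simp add: c_def mcut_def)+
  define E0 where "E0 x = E (krylov (c x))" for x :: "'k fmat"
  define s where "s x i = (\<Sum>k\<in>I. iv (krylov (c x)) i k * mpow I (c x) m k (e 0))" for x i
  define r where "r x p = s x (fst p)" for x and p :: "nat \<times> nat"
  define u :: "(nat \<times> nat \<Rightarrow> 'k) \<Rightarrow> nat \<Rightarrow> 'k" where "u t i = t (i, e 0)" for t i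
  define \<sigma> where "\<sigma> t = companion (u t)" for t
  define J where "J = I \<times> {e 0}"
  have ur: "u (r x) = s x" for x by (auto simp: u_def r_def)
  have c_poly: "(\<lambda>x. c x i j) \<in> poly_funs mcoords" for i j
    unfolding c_def mcut_def by (cases "i \<in> I \<and> j \<in> I") (auto intro: poly_funs.const)
  have pw_poly: "(\<lambda>x. mpow I (f x) n i j) \<in> poly_funs G"
    if "\<And>i j. (\<lambda>x. f x i j) \<in> poly_funs G" for G n i j and f :: "'x \<Rightarrow> 'k fmat"
  proof (induction n arbitrary: i j)
    case 0 show ?case by (simp add: poly_funs.const)
  next
    case (Suc n) show ?case by (simp add: mprod_def, intro poly_funs_sum poly_funs.mult that Suc)
  qed
  have k_poly: "(\<lambda>x. krylov (c x) i j) \<in> poly_funs mcoords" for i j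
    unfolding krylov_def by (cases "i \<in> I \<and> j \<in> I") (auto intro: poly_funs.const pw_poly c_poly)
  have E0: "E0 \<in> poly_funs mcoords" unfolding E0_def[abs_def] by (rule mpoly_comp[OF E k_poly])
  have i_loc: "(\<lambda>x. iv (krylov (c x)) i j) \<in> loc mcoords E0" for i j
    unfolding iv_def using loc_comp_poly[OF v_loc[of i j] k_poly]
    by (cases "i \<in> I \<and> j \<in> I") (auto simp: E0_def[abs_def])
  have s_loc: "(\<lambda>x. s x i) \<in> loc mcoords E0" for i
    unfolding s_def by (intro loc_sum E0 loc_mult i_loc loc_poly pw_poly c_poly)
  have u_poly: "(\<lambda>t. u t i) \<in> poly_funs tcoords" for i
    unfolding u_def by (rule poly_funs.coord) (auto simp: tcoords_def)
  have \<sigma>_poly: "(\<lambda>t. \<sigma> t i j) \<in> poly_funs tcoords" for i j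
    unfolding \<sigma>_def companion_def
    by (cases "i \<in> I \<and> j \<in> I"; cases "Suc (e' j) < m") (auto intro: poly_funs.const u_poly)
  define E2 where "E2 t = E (dmat (u t))" for t
  have E2: "E2 \<in> poly_funs tcoords"
    unfolding E2_def[abs_def]
  proof (rule mpoly_comp[OF E])
    show "(\<lambda>t. dmat (u t) i j) \<in> poly_funs tcoords" for i j
      unfolding dmat_def using pw_poly[OF \<sigma>_poly]
      by (intro poly_funs_diff poly_funs.mult poly_funs_sum poly_funs.const u_poly) (auto simp: \<sigma>_def)
  qed
  have r_loc: "(\<lambda>x. h (r x)) \<in> loc mcoords E0" if "h \<in> tcoords" for h
    using that s_loc by (auto simp: tcoords_def r_def)
  obtain q n where q: "q \<in> poly_funs mcoords" "\<And>x. E0 x \<noteq> 0 \<Longrightarrow> E2 (r x) * E0 x ^ n = q x"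
    using loc_comp[OF E2 E0, of r] r_loc unfolding loc_def by blast
  define D where "D x = E0 x * q x" for x
  have D: "E0 x \<noteq> 0" "E2 (r x) \<noteq> 0" if "D x \<noteq> 0" for x
    using that q(2)[of x] by (auto simp: D_def)
  have kr: "(\<Sum>k\<in>I. krylov (c x) i k * s x k) = mpow I (c x) m i (e 0)" if D: "E0 x \<noteq> 0" and i: "i \<in> I" for x i
  proof -
    have "(\<Sum>k\<in>I. krylov (c x) i k * s x k) = mprod I (krylov (c x)) (mprod I (iv (krylov (c x))) (mpow I (c x) m)) i (e 0)"
      by (simp add: mprod_def s_def)
    also have "\<dots> = mprod I (mone I) (mpow I (c x) m) i (e 0)"
      unfolding mprod_assoc[symmetric] using iv(1)[OF D[unfolded E0_def] krylov_malg] by simp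
    finally show ?thesis using i by (simp add: mprod_mone_left fin)
  qed
  have iso: "miso I PP x (companion (s x))" if D: "E0 x \<noteq> 0" for x
  proof -
    have K: "krylov (c x) \<in> mhom I PP (c x) (companion (s x))"
      unfolding mhom_def using krylov_companion[OF c kr[OF D]] krylov_malg by auto
    have "miso I PP (c x) (companion (s x))" unfolding miso_def
      by (rule bexI[OF _ K], rule bexI[OF _ inv_malg[of "krylov (c x)"]]) (simp add: iv[OF D[unfolded E0_def] krylov_malg])
    then show ?thesis using iso_c(1) by blast
  qed
  have ann: "mpoly (s x) (c x) = mpow I (c x) m" if D: "E0 x \<noteq> 0" for x
    using mpoly_annihilates[OF c kr[OF D] iv(1)[OF D[unfolded E0_def] krylov_malg]] .
  have s_inv: "s x i = s y i" if Dx: "E0 x \<noteq> 0" and Dy: "E0 y \<noteq> 0" and xy: "miso I PP x y" and i: "i \<in> I" for x y i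
  proof -
    have "miso I PP (c x) (c y)" using xy iso_c(1)[of x y] iso_c(2)[of "c x" y] iso_c(2)[of y "c x"] by blast
    then obtain h h' where h: "h \<in> mhom I PP (c x) (c y)" "h' \<in> malg PP" "mprod I h h' = mone I" "mprod I h' h = mone I"
      unfolding miso_def by blast
    have hm: "h \<in> malg PP" using h by (simp add: mhom_def)
    have "mprod I (c x) h i j = mprod I h (c y) i j" for i j
    proof (cases "i \<in> I \<and> j \<in> I")
      case True then show ?thesis using h(1) unfolding mhom_def by blast
    next
      case False then show ?thesis
        using malgD[OF malg_mprod[OF c hm], of j i] malgD[OF malg_mprod[OF hm c], of j i] by auto
    qed
    then have xh: "mprod I (c x) h = mprod I h (c y)" by blast
    note pw = mpow_intertwine[OF xh hm]
    have "mprod I h (mpoly (s x) (c y)) = mprod I (mpoly (s x) (c x)) h"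
      by (intro ext) (simp add: mprod_mpoly_left mprod_mpoly_right pw)
    also have "\<dots> = mprod I h (mpow I (c y) m)" unfolding ann[OF Dx] pw ..
    finally have "mprod I h' (mprod I h (mpoly (s x) (c y))) = mprod I h' (mprod I h (mpow I (c y) m))" by simp
    then have eq: "mpoly (s x) (c y) = mpow I (c y) m"
      unfolding mprod_assoc[symmetric] h(4) by (simp add: malg_mone_left mpoly_malg mpow_malg c)
    have "(\<Sum>k\<in>I. krylov (c y) i k * s x k) = mpow I (c y) m i (e 0)" if "i \<in> I" for i
    proof -
      have "(\<Sum>k\<in>I. krylov (c y) i k * s x k) = mpoly (s x) (c y) i (e 0)"
        unfolding mpoly_def using that by (intro sum.cong) (auto simp: krylov_def mult.commute)
      then show ?thesis by (simp add: eq)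
    qed
    then have "(\<Sum>k\<in>I. iv (krylov (c y)) i k * (\<Sum>l\<in>I. krylov (c y) k l * s x l)) = s y i"
      unfolding s_def[of y] by (intro sum.cong) auto
    moreover have "(\<Sum>k\<in>I. iv (krylov (c y)) i k * (\<Sum>l\<in>I. krylov (c y) k l * s x l))
       = (\<Sum>l\<in>I. mprod I (iv (krylov (c y))) (krylov (c y)) i l * s x l)"
      unfolding mprod_def sum_distrib_left sum_distrib_right by (subst sum.swap) (simp add: mult.assoc)
    moreover have "\<dots> = s x i"
      unfolding iv(2)[OF Dy[unfolded E0_def] krylov_malg]
      using mprod_mone_left[OF fin i, of "\<lambda>l _. s x l" 0] by (simp add: mprod_def)
    ultimately show ?thesis by simp
  qed
  have comp: "E0 (companion t) = 1" "i \<in> I \<Longrightarrow> s (companion t) i = t i" for t i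
  proof -
    have cc: "c (companion t) = companion t" by (rule c_id[OF companion_malg])
    show "E0 (companion t) = 1" unfolding E0_def cc krylov_of_companion by (rule E1) (simp add: mone_def)
    then have n: "E (mone I) \<noteq> 0" unfolding E0_def cc krylov_of_companion by simp
    have "iv (mone I) = mone I"
      using iv(2)[OF n mone_malg] malg_mone_right[OF inv_malg] by metis
    then show "s (companion t) i = t i" if "i \<in> I"
      unfolding s_def cc krylov_of_companion
      using mprod_mone_left[OF fin that, of "mpow I (companion t) m" "e 0"] mpow_companion_m[OF that]
      by (simp add: mprod_def)
  qed
  have D\<sigma>: "D (\<sigma> t) \<noteq> 0 \<longleftrightarrow> E2 t \<noteq> 0" for t
  proof -
    have "u (r (\<sigma> t)) i = u t i" if "i \<in> I" for i using comp(2)[OF that] by (simp add: ur \<sigma>_def)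
    moreover have "companion a = companion b" "dmat a = dmat b" if "\<And>i. i \<in> I \<Longrightarrow> a i = b i" for a b :: "nat \<Rightarrow> 'k"
    proof -
      show "companion a = companion b" using that by (auto simp: companion_def fun_eq_iff)
      then show "dmat a = dmat b" using that by (simp add: dmat_def cong: sum.cong)
    qed
    ultimately have "E2 (r (\<sigma> t)) = E2 t" unfolding E2_def by metis
    then show ?thesis using q(2)[of "\<sigma> t"] comp(1)[of "u t"] by (simp add: D_def \<sigma>_def)
  qed
  have ex: "\<exists>t. E2 t \<noteq> 0"
  proof -
    define t :: "nat \<times> nat \<Rightarrow> 'k" where "t p = (if fst p = e 0 then 1 else 0)" for p
    define C where "C = companion (u t)"
    have C: "C \<in> malg PP" unfolding C_def by (rule companion_malg)
    have ut: "u t i = (if i = e 0 then 1 else 0)" for i by (simp add: u_def t_def)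
    have cc: "c C = C" by (rule c_id[OF C])
    have "mpoly (s C) (c C) = mpow I (c C) m" using ann[of C] comp(1)[of "u t"] by (simp add: C_def)
    moreover have "mpoly (s C) C = mpow I C 0"
    proof (intro ext)
      fix i j
      have "mpoly (s C) C i j = (\<Sum>k\<in>I. mpow I C (e' k) i j * (if k = e 0 then 1 else 0))"
        unfolding mpoly_def using comp(2)[of _ "u t"] by (intro sum.cong) (auto simp: C_def ut)
      also have "\<dots> = mpow I C (e' (e 0)) i j" using e0(1) by (rule sum_delta)
      finally show "mpoly (s C) C i j = mpow I C 0 i j" by (simp add: e0)
    qed
    ultimately have Cm: "mpow I C m = mone I" unfolding cc by simp
    have dm: "dmat (u t) i j = of_nat m * mpow I C (m - 1) i j" for i j
    proof -
      have "(\<Sum>k\<in>I. of_nat (e' k) * u t k * mpow I (companion (u t)) (e' k - 1) i j) = 0"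
        by (intro sum.neutral) (auto simp: ut e0)
      then show ?thesis by (simp add: dmat_def C_def)
    qed
    have "E2 t \<noteq> 0" unfolding E2_def
    proof (rule E_inj)
      fix w i assume w: "\<And>i. i \<in> I \<Longrightarrow> (\<Sum>j\<in>I. dmat (u t) i j * w j) = 0" and i: "i \<in> I"
      have w': "(\<Sum>j\<in>I. mpow I C (m - 1) i j * w j) = 0" if "i \<in> I" for i
      proof -
        have "of_nat m * (\<Sum>j\<in>I. mpow I C (m - 1) i j * w j) = 0"
          using w[OF that] by (simp add: dm sum_distrib_left mult.assoc)
        then show ?thesis using m by simp
      qed
      have "mpow I x (Suc k) = mprod I x (mpow I x k)" for x :: "'k fmat" and k by simp
      from this[of C "m - 1"] have "mone I = mprod I C (mpow I C (m - 1))" using m Cm by simp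
      then have "(\<Sum>j\<in>I. mone I i j * w j) = (\<Sum>j\<in>I. mprod I C (mpow I C (m - 1)) i j * w j)" by simp
      also have "\<dots> = (\<Sum>k\<in>I. C i k * (\<Sum>j\<in>I. mpow I C (m - 1) k j * w j))"
        unfolding mprod_def sum_distrib_left sum_distrib_right by (subst sum.swap) (simp add: mult.assoc)
      also have "\<dots> = 0" using w' by (intro sum.neutral) simp
      finally show "w i = 0" using mprod_mone_left[OF fin i, of "\<lambda>l _. w l" 0] by (simp add: mprod_def)
    qed
    then show ?thesis by blast
  qed
  have endo: "\<exists>y. miso I PP x y \<and> mhom I PP y y = {mdiag I (t \<circ> id) | t. True}" if Dx: "D x \<noteq> 0" for x
  proof -
    define t where "t = s x"
    have d: "E (dmat t) \<noteq> 0" using D(2)[OF Dx] by (simp add: E2_def ur t_def)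
    have nodbl: "poly (pderiv (chpoly t)) a \<noteq> 0" if a: "poly (chpoly t) a = 0" for a
    proof
      assume a': "poly (pderiv (chpoly t)) a = 0"
      have z: "(\<Sum>i\<in>I. a ^ e' i * dmat t i j) = 0" if "j \<in> I" for j
        using row_dmat[OF a that] a' by simp
      have "(\<Sum>i\<in>I. a ^ e' i * (\<Sum>k\<in>I. dmat t i k * v (dmat t) k (e 0))) = 
        (\<Sum>k\<in>I. (\<Sum>i\<in>I. a ^ e' i * dmat t i k) * v (dmat t) k (e 0))"
        unfolding sum_distrib_left sum_distrib_right by (subst sum.swap) (simp add: mult.assoc)
      also have "\<dots> = 0" using z by (intro sum.neutral) simp
      also have "(\<Sum>i\<in>I. a ^ e' i * (\<Sum>k\<in>I. dmat t i k * v (dmat t) k (e 0))) = (\<Sum>i\<in>I. a ^ e' i * (if i = e 0 then 1 else 0))"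
        using v1[OF d _ e0(1)] by (intro sum.cong) auto
      also have "\<dots> = a ^ e' (e 0)" by (rule sum_delta[OF e0(1)])
      finally show False by (simp add: e0)
    qed
    have "chpoly t \<noteq> 0" using coeff_chpoly(1)[of t] by auto
    then have card: "card {a. poly (chpoly t) a = 0} = m"
      using alg_closed_distinct_roots[of "chpoly t"] nodbl degree_chpoly[of t] by simp
    moreover have "card I = m" using bij_betw_same_card[OF bij_e] by simp
    ultimately obtain l where l: "bij_betw l I {a. poly (chpoly t) a = 0}"
      using finite_same_card_bij[OF fin] m by (metis card_ge_0_finite)
    have root: "(\<Sum>k\<in>I. t k * l i ^ e' k) = l i ^ m" if "i \<in> I" for i
      using bij_betwE[OF l] that by (auto simp: poly_chpoly)
    have l_inj: "l i = l j \<longleftrightarrow> i = j" if "i \<in> I" "j \<in> I" for i j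
      using l that by (auto simp: bij_betw_def inj_on_def)
    define y where "y = mdiag I l"
    have y: "y \<in> malg PP" by (auto intro!: malgI simp: y_def mdiag_def split: if_splits)
    have V: "vand l \<in> malg PP" by (auto intro!: malgI simp: vand_def split: if_splits)
    have EV: "E (vand l) \<noteq> 0"
    proof (rule E_inj)
      fix w i assume w: "\<And>i. i \<in> I \<Longrightarrow> (\<Sum>j\<in>I. vand l i j * w j) = 0" and i: "i \<in> I"
      define p where "p = (\<Sum>k\<in>I. monom (w k) (e' k))"
      have pz: "poly p (l i) = 0" if "i \<in> I" for i
      proof -
        have "poly p (l i) = (\<Sum>j\<in>I. vand l i j * w j)"
          using that by (simp add: p_def poly_sum poly_monom vand_def mult.commute)
        then show ?thesis using w[OF that] by simp
      qed
      have deg: "degree p < m"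
      proof -
        have "degree p \<le> m - 1" unfolding p_def
        proof (rule degree_sum_le[OF fin])
          fix k assume "k \<in> I"
          then show "degree (monom (w k) (e' k)) \<le> m - 1" using degree_monom_le[of "w k" "e' k"] e'(1)[of k] by simp
        qed
        then show ?thesis using m by simp
      qed
      have "p = 0"
      proof (rule ccontr)
        assume "p \<noteq> 0"
        then have "card {a. poly p a = 0} \<le> degree p" "finite {a. poly p a = 0}"
          using card_poly_roots_bound poly_roots_finite by blast+
        moreover have "{a. poly (chpoly t) a = 0} \<subseteq> {a. poly p a = 0}" unfolding bij_betw_imp_surj_on[OF l, symmetric] using pz by auto
        ultimately show False using card deg by (metis card_mono leD le_trans)
      qed
      moreover have "coeff p (e' i) = w i"
      proof -
        have "coeff p (e' i) = (\<Sum>k\<in>I. w k * (if k = i then 1 else 0))"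
          unfolding p_def coeff_sum using e'(2) i by (intro sum.cong) (auto, metis)
        then show ?thesis using sum_delta[OF i] by simp
      qed
      ultimately show "w i = 0" by simp
    qed
    have "mprod I y (vand l) = mprod I (vand l) (companion t)"
    proof (intro ext)
      fix i j
      show "mprod I y (vand l) i j = mprod I (vand l) (companion t) i j"
      proof (cases "i \<in> I \<and> j \<in> I")
        case True
        then have i: "i \<in> I" and j: "j \<in> I" by auto
        have "mprod I y (vand l) i j = (\<Sum>k\<in>I. l i * vand l k j * (if k = i then 1 else 0))"
          unfolding mprod_def y_def mdiag_def using i by (intro sum.cong) auto
        also have "\<dots> = l i * vand l i j" using sum_delta[OF i] .
        also have "\<dots> = l i * l i ^ e' j" using i j by (simp add: vand_def)
        also have "\<dots> = mprod I (vand l) (companion t) i j"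
          unfolding mprod_def row_companion[OF root[OF i] j, symmetric] using i by (intro sum.cong) (auto simp: vand_def)
        finally show ?thesis .
      next
        case False
        then show ?thesis
          using malgD[OF malg_mprod[OF y V], of j i] malgD[OF malg_mprod[OF V companion_malg], of j i t] by auto
      qed
    qed
    then have "vand l \<in> mhom I PP y (companion t)" using V by (simp add: mhom_def)
    then have "miso I PP y (companion t)" unfolding miso_def using iv[OF EV V] inv_malg by blast
    then have xy: "miso I PP x y" using iso[OF D(1)[OF Dx]] miso_sym miso_trans unfolding t_def by blast
    have "mhom I PP y y = {mdiag I (t \<circ> id) | t. True}"
    proof (intro equalityI subsetI)
      have dl: "mprod I y h i j = l i * h i j" "mprod I h y i j = h i j * l j" if "i \<in> I" "j \<in> I" for h i j
      proof -
        have "mprod I y h i j = (\<Sum>k\<in>I. l i * h k j * (if k = i then 1 else 0))"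
          unfolding mprod_def y_def mdiag_def using that by (intro sum.cong) auto
        then show "mprod I y h i j = l i * h i j" using sum_delta[OF that(1)] by simp
        have "mprod I h y i j = (\<Sum>k\<in>I. h i k * l k * (if k = j then 1 else 0))"
          unfolding mprod_def y_def mdiag_def using that by (intro sum.cong) auto
        then show "mprod I h y i j = h i j * l j" using sum_delta[OF that(2)] by simp
      qed
      { fix h assume h: "h \<in> mhom I PP y y"
        have "h = mdiag I ((\<lambda>i. h i i) \<circ> id)"
        proof (intro ext)
          fix i j
          show "h i j = mdiag I ((\<lambda>i. h i i) \<circ> id) i j"
          proof (cases "i \<in> I \<and> j \<in> I")
            case True
            then have "mprod I y h i j = mprod I h y i j" using h unfolding mhom_def by blast
            then have "l i * h i j = h i j * l j" using dl True by simp
            then have "(l i - l j) * h i j = 0" by (simp add: algebra_simps)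
            then show ?thesis using l_inj[of i j] True by (auto simp: mdiag_def)
          next
            case False
            then show ?thesis using h malgD[of h PP j i] by (auto simp: mhom_def mdiag_def)
          qed
        qed
        then show "h \<in> {mdiag I (t \<circ> id) | t. True}" by blast }
      { fix h :: "'k fmat" assume "h \<in> {mdiag I (t \<circ> id) | t. True}"
        then obtain t :: "nat \<Rightarrow> 'k" where h: "h = mdiag I t" by auto
        have "h \<in> malg PP" by (auto intro!: malgI simp: h mdiag_def split: if_splits)
        then show "h \<in> mhom I PP y y" unfolding mhom_def by (auto simp: dl) (auto simp: h mdiag_def) }
    qed
    then show ?thesis using xy by blast
  qed
  have "good_data I PP J \<sigma> r D id"
  proof
    show "finite J" "J \<subseteq> I \<times> I" using fin e0 by (auto simp: J_def)
    show "D \<in> poly_funs mcoords" unfolding D_def[abs_def] by (intro poly_funs.mult E0 q)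
    show "(\<lambda>t. \<sigma> t i j) \<in> poly_funs tcoords" for i j by (rule \<sigma>_poly)
    show "i \<in> I \<and> j \<in> I" if "\<sigma> t i j \<noteq> 0" for t i j using that by (auto simp: \<sigma>_def companion_def split: if_splits)
    show "\<sigma> t = \<sigma> t'" if "\<And>p. p \<in> J \<Longrightarrow> t p = t' p" for t t'
      using that by (auto simp: \<sigma>_def companion_def J_def u_def fun_eq_iff)
    show "\<exists>t. D (\<sigma> t) \<noteq> 0" using ex D\<sigma> by simp
    show "(\<lambda>x. r x p) \<in> loc mcoords D" if "p \<in> J" for p
      unfolding r_def D_def[abs_def] by (rule loc_factor[OF s_loc q(1)])
    show "miso I PP x (\<sigma> (r x))" if "D x \<noteq> 0" for x
      using iso[OF D(1)[OF that]] by (simp add: \<sigma>_def ur)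
    show "r x p = r y p" if "D x \<noteq> 0" "D y \<noteq> 0" "miso I PP x y" "p \<in> J" for x y p
      using s_inv[OF D(1)[OF that(1)] D(1)[OF that(2)] that(3)] that(4) by (auto simp: r_def J_def)
    show "r (\<sigma> t) p = t p" if "D (\<sigma> t) \<noteq> 0" "p \<in> J" for t p
      using that(2) comp(2)[of "fst p" "u t"] by (auto simp: r_def \<sigma>_def J_def u_def)
    show "\<exists>y. miso I PP x y \<and> mhom I PP y y = {mdiag I (t \<circ> id) | t. True}" if "D x \<noteq> 0" for x
      by (rule endo[OF that])
  qed auto
  then show ?thesis unfolding good_def by blast
qed

end

lemma good_full:
  assumes "finite I"
  shows "good TYPE('k::{alg_closed_field, field_char_0}) I (\<lambda>i j. i \<in> I \<and> j \<in> I)"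
proof (cases "I = {}")
  case True
  then show ?thesis using good_empty by simp
next
  case False
  obtain e where e: "bij_betw e {0..<card I} I" using ex_bij_betw_nat_finite[OF assms] by blast
  interpret full_matrices I "card I" e "inv_into {0..<card I} e"
  proof
    show "0 < card I" using False assms by (simp add: card_gt_0_iff)
    show "inv_into {0..<card I} e i < card I" "e (inv_into {0..<card I} e i) = i" if "i \<in> I" for i
      using that e bij_betw_inv_into_right[OF e that] inv_into_into[of i e "{0..<card I}"]
      by (auto simp: bij_betw_def)
    show "e j \<in> I" "inv_into {0..<card I} e (e j) = j" if "j < card I" for j
      using that e bij_betw_inv_into_left[OF e] by (auto simp: bij_betw_def)
  qed
  show ?thesis by (rule good_full)
qed

section \<open>Seaweed preorders\<close>

text \<open>\<open>\<alpha>\<close> and \<open>\<beta>\<close> number the blocks of the two compositions.\<close>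

definition sw_rel :: "nat set \<Rightarrow> (nat \<Rightarrow> nat) \<Rightarrow> (nat \<Rightarrow> nat) \<Rightarrow> nat \<Rightarrow> nat \<Rightarrow> bool" where
  "sw_rel I \<alpha> \<beta> i j \<longleftrightarrow> i \<in> I \<and> j \<in> I \<and> \<alpha> i \<le> \<alpha> j \<and> \<beta> j \<le> \<beta> i"

lemma preord_sw: "finite I \<Longrightarrow> preord I (sw_rel I \<alpha> \<beta>)"
  by unfold_locales (auto simp: sw_rel_def)

lemma largest_subset:
  fixes S :: "nat set"
  assumes "finite S" "k \<le> card S"
  obtains T where "T \<subseteq> S" "card T = k" "\<And>x y. x \<in> S - T \<Longrightarrow> y \<in> T \<Longrightarrow> x < y"
proof -
  have "\<exists>T\<subseteq>S. card T = k \<and> (\<forall>x\<in>S - T. \<forall>y\<in>T. x < y)"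
    using assms(2)
  proof (induction k)
    case 0
    show ?case by (rule exI[of _ "{}"]) auto
  next
    case (Suc k)
    then obtain T where T: "T \<subseteq> S" "card T = k" "\<forall>x\<in>S - T. \<forall>y\<in>T. x < y" by auto
    have fT: "finite T" using T(1) assms(1) by (rule finite_subset)
    have ne: "S - T \<noteq> {}"
    proof
      assume "S - T = {}"
      then have "card S \<le> card T" using fT by (intro card_mono) auto
      then show False using Suc.prems T(2) by simp
    qed
    define z where "z = Max (S - T)"
    have z: "z \<in> S - T" "\<And>x. x \<in> S - T \<Longrightarrow> x \<le> z"
      unfolding z_def using ne assms(1) by (meson Max_in Max_ge finite_Diff)+
    show ?case
    proof (intro exI[of _ "insert z T"] conjI ballI)
      show "insert z T \<subseteq> S" using T z by auto
      show "card (insert z T) = Suc k" using z(1) fT T(2) by simp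
      fix x y assume "x \<in> S - insert z T" "y \<in> insert z T"
      then show "x < y" using z(2)[of x] T(3) by auto
    qed
  qed
  then show thesis using that by blast
qed

lemma obtain_bij:
  assumes "finite A" "finite B" "card A = card B"
  obtains f f' :: "nat \<Rightarrow> nat" where "\<And>i. i \<in> A \<Longrightarrow> f i \<in> B" "\<And>i. i \<in> A \<Longrightarrow> f' (f i) = i"
    "\<And>i. i \<in> B \<Longrightarrow> f' i \<in> A" "\<And>i. i \<in> B \<Longrightarrow> f (f' i) = i"
proof -
  obtain f where f: "bij_betw f A B" using finite_same_card_bij[OF assms] by blast
  show thesis
  proof (rule that[of f "inv_into A f"])
    show "i \<in> A \<Longrightarrow> f i \<in> B" for i using bij_betwE[OF f] by blast
    show "i \<in> A \<Longrightarrow> inv_into A f (f i) = i" for i by (rule bij_betw_inv_into_left[OF f])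
    show "i \<in> B \<Longrightarrow> inv_into A f i \<in> A" for i using bij_betwE[OF bij_betw_inv_into[OF f]] by blast
    show "i \<in> B \<Longrightarrow> f (inv_into A f i) = i" for i by (rule bij_betw_inv_into_right[OF f])
  qed
qed

definition first_block :: "nat set \<Rightarrow> (nat \<Rightarrow> nat) \<Rightarrow> nat set" where
  "first_block I \<alpha> = {i \<in> I. \<forall>j\<in>I. \<alpha> i \<le> \<alpha> j}"

lemma first_block_cmp:
  assumes "mono_on I \<alpha>" "mono_on I \<beta>"
  shows "first_block I \<alpha> \<subseteq> first_block I \<beta> \<or> first_block I \<beta> \<subseteq> first_block I \<alpha>"
proof (rule ccontr)
  assume "\<not> ?thesis"
  then obtain x y where x: "x \<in> first_block I \<alpha>" "x \<notin> first_block I \<beta>"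
    and y: "y \<in> first_block I \<beta>" "y \<notin> first_block I \<alpha>" by blast
  have I: "x \<in> I" "y \<in> I" using x(1) y(1) by (auto simp: first_block_def)
  show False
  proof (cases "x \<le> y")
    case True
    then have "\<beta> x \<le> \<beta> y" using assms(2) I by (auto simp: mono_on_def)
    moreover have "\<forall>j\<in>I. \<beta> y \<le> \<beta> j" using y(1) by (simp add: first_block_def)
    ultimately have "\<forall>j\<in>I. \<beta> x \<le> \<beta> j" using order.trans by blast
    then have "x \<in> first_block I \<beta>" using I by (simp add: first_block_def)
    then show False using x(2) by simp
  next
    case False
    then have "\<alpha> y \<le> \<alpha> x" using assms(1) I by (auto simp: mono_on_def)
    moreover have "\<forall>j\<in>I. \<alpha> x \<le> \<alpha> j" using x(1) by (simp add: first_block_def)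
    ultimately have "\<forall>j\<in>I. \<alpha> y \<le> \<alpha> j" using order.trans by blast
    then have "y \<in> first_block I \<alpha>" using I by (simp add: first_block_def)
    then show False using y(2) by simp
  qed
qed

lemma good_sw_step:
  assumes fin: "finite I" and ne: "I \<noteq> {}" and mono: "mono_on I \<alpha>" "mono_on I \<beta>"
    and sub: "first_block I \<alpha> \<subseteq> first_block I \<beta>"
    and IH: "\<And>I' \<alpha>' \<beta>'. card I' < card I \<Longrightarrow> finite I' \<Longrightarrow> mono_on I' \<alpha>' \<Longrightarrow> mono_on I' \<beta>' \<Longrightarrow>
      good TYPE('k::{alg_closed_field, field_char_0}) I' (sw_rel I' \<alpha>' \<beta>')"
  shows "good TYPE('k) I (sw_rel I \<alpha> \<beta>)"
proof -
  define A where "A = first_block I \<alpha>"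
  define C where "C = first_block I \<beta> - A"
  define W where "W = I - first_block I \<beta>"
  define P where "P = sw_rel I \<alpha> \<beta>"
  have "\<exists>i\<in>I. \<forall>j\<in>I. \<alpha> i \<le> \<alpha> j"
  proof -
    have "Min (\<alpha> ` I) \<in> \<alpha> ` I" using fin ne by (intro Min_in) auto
    then obtain i where i: "i \<in> I" "Min (\<alpha> ` I) = \<alpha> i" by blast
    have "\<alpha> i \<le> \<alpha> j" if "j \<in> I" for j unfolding i(2)[symmetric] using fin that by simp
    then show ?thesis using i(1) by blast
  qed
  then have Ane: "A \<noteq> {}" by (auto simp: A_def first_block_def)
  have AI: "A \<subseteq> I" "first_block I \<beta> \<subseteq> I" by (auto simp: A_def first_block_def)
  have I_eq: "I = A \<union> C \<union> W" using AI sub by (auto simp: C_def W_def A_def)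
  have fins: "finite A" "finite C" "finite W" using fin I_eq by auto
  have d: "A \<inter> C = {}" "A \<inter> W = {}" "C \<inter> W = {}" using sub by (auto simp: C_def W_def A_def)
  have \<alpha>A: "\<alpha> i \<le> \<alpha> j" if "i \<in> A" "j \<in> I" for i j using that by (auto simp: A_def first_block_def)
  have \<alpha>R: "\<alpha> i < \<alpha> j" if "i \<in> A" "j \<in> I" "j \<notin> A" for i j
  proof (rule ccontr)
    assume "\<not> \<alpha> i < \<alpha> j"
    then have "\<forall>k\<in>I. \<alpha> j \<le> \<alpha> k" using \<alpha>A[OF that(1)] by (meson not_le order.trans)
    then show False using that(2,3) by (simp add: A_def first_block_def)
  qed
  have \<beta>B: "\<beta> i \<le> \<beta> j" if "i \<in> A \<union> C" "j \<in> I" for i j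
    using that sub by (auto simp: A_def C_def first_block_def)
  have \<beta>W: "\<beta> i < \<beta> j" if i: "i \<in> A \<union> C" and j: "j \<in> W" for i j
  proof -
    have "j \<in> I" "j \<notin> first_block I \<beta>" using j by (auto simp: W_def)
    then obtain k where k: "k \<in> I" "\<beta> k < \<beta> j" by (auto simp: first_block_def not_le)
    then show ?thesis using \<beta>B[OF i k(1)] by simp
  qed
  have AC: "a < x" if "a \<in> A" "x \<in> C \<union> W" for a x
  proof (rule ccontr)
    assume "\<not> a < x"
    then have "\<alpha> x \<le> \<alpha> a" using mono(1) that AI I_eq by (auto simp: mono_on_def)
    then show False using \<alpha>R[of a x] that d I_eq by fastforce
  qed
  have PA: "P i j" if "i \<in> A" "j \<in> A \<union> C" for i j
    using that \<alpha>A[of i j] \<beta>B[of j i] I_eq by (auto simp: P_def sw_rel_def)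
  have PAW: "\<not> P i j" if "i \<in> A \<union> C" "j \<in> W" for i j
    using \<beta>W[OF that] by (simp add: P_def sw_rel_def)
  have PRA: "\<not> P i j" if "i \<in> C \<union> W" "j \<in> A" for i j
    using \<alpha>R[of j i] that d I_eq by (fastforce simp: P_def sw_rel_def)
  have PCC: "P i j" if "i \<in> C" "j \<in> C" "i \<le> j" for i j
    using that \<beta>B[of j i] mono(1) I_eq by (auto simp: P_def sw_rel_def mono_on_def)
  have mon: "mono_on J \<alpha>" "mono_on J \<beta>" if "J \<subseteq> I" for J
    by (rule mono_on_subset[OF mono(1) that], rule mono_on_subset[OF mono(2) that])
  have pI: "preord I P" unfolding P_def by (rule preord_sw[OF fin])
  have "good TYPE('k) I P"
  proof (cases "C = {}")
    case True
    have "card W < card I" using Ane d fin I_eq fins by (intro psubset_card_mono) auto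
    then have gW: "good TYPE('k) W (sw_rel W \<alpha> \<beta>)"
      using mon[of W] I_eq fins by (intro IH) auto
    interpret preord_sum A "\<lambda>i j. i \<in> A \<and> j \<in> A" W "sw_rel W \<alpha> \<beta>"
      by (intro preord_sum.intro preord_sw preord_sum_axioms.intro d fins) (unfold_locales, use fins in auto)
    have "good TYPE('k) (A \<union> W) (\<lambda>i j. i \<in> A \<and> j \<in> A \<or> sw_rel W \<alpha> \<beta> i j)"
      by (rule good_sum[OF good_full[OF fins(1)] gW])
    moreover have "(\<lambda>i j. i \<in> A \<and> j \<in> A \<or> sw_rel W \<alpha> \<beta> i j) = P"
    proof (intro ext)
      fix i j
      have "P i j \<longleftrightarrow> sw_rel W \<alpha> \<beta> i j" if "i \<in> W" "j \<in> W"
        using that I_eq by (auto simp: P_def sw_rel_def)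
      moreover have "\<not> P i j" if "i \<notin> I \<or> j \<notin> I" using that by (auto simp: P_def sw_rel_def)
      moreover have "\<not> sw_rel W \<alpha> \<beta> i j" if "i \<notin> W \<or> j \<notin> W" using that by (auto simp: sw_rel_def)
      ultimately show "(i \<in> A \<and> j \<in> A \<or> sw_rel W \<alpha> \<beta> i j) = P i j"
        using PA[of i j] PAW[of i j] PRA[of i j] d I_eq True by blast
    qed
    moreover have "A \<union> W = I" using I_eq True by auto
    ultimately show ?thesis by simp
  next
    case Cne: False
    show ?thesis
    proof (cases "card A \<le> card C")
      case True
      obtain Q where Q: "Q \<subseteq> C" "card Q = card A" "\<And>x y. x \<in> C - Q \<Longrightarrow> y \<in> Q \<Longrightarrow> x < y"
        by (rule largest_subset[OF fins(2) True]) blast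
      define Z where "Z = C - Q"
      have fQ: "finite Q" using Q(1) fins(2) by (rule finite_subset)
      obtain \<tau> \<tau>' where \<tau>: "\<And>i. i \<in> A \<Longrightarrow> \<tau> i \<in> Q" "\<And>i. i \<in> A \<Longrightarrow> \<tau>' (\<tau> i) = i"
        "\<And>i. i \<in> Q \<Longrightarrow> \<tau>' i \<in> A" "\<And>i. i \<in> Q \<Longrightarrow> \<tau> (\<tau>' i) = i"
        by (rule obtain_bij[OF fins(1) fQ]) (use Q(2) in auto)
      have C_eq: "Z \<union> Q = C" using Q(1) by (auto simp: Z_def)
      interpret p: pivot I P "{}" A Z Q W \<tau> \<tau>'
      proof (intro pivot.intro pI pivot_axioms.intro)
        show "I = {} \<union> A \<union> (Z \<union> Q \<union> W)" using I_eq C_eq by auto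
        show "Z \<inter> Q = {}" by (auto simp: Z_def)
        show "Z \<inter> W = {}" "Q \<inter> W = {}" "A \<inter> (Z \<union> Q \<union> W) = {}" unfolding C_eq using d C_eq by blast+
        show "P i j" if "i \<in> Z" "j \<in> Q" for i j
        proof -
          have "i \<in> C" "j \<in> C" "i \<in> C - Q" using that C_eq by (auto simp: Z_def)
          then show ?thesis using PCC[of i j] Q(3)[of i j] that(2) by simp
        qed
        show "P i j" if "i \<in> {} \<union> A" "j \<in> {} \<union> A" for i j using PA that by simp
        show "P i j" if "i \<in> {} \<union> A" "j \<in> Z \<union> Q" for i j using PA that unfolding C_eq by simp
        show "\<not> P i j" if "i \<in> {} \<union> A" "j \<in> W" for i j using PAW that by simp
        show "\<not> P i j" if "i \<in> Z \<union> Q \<union> W" "j \<in> {} \<union> A" for i j using PRA that unfolding C_eq by simp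
        show "\<not> P i j" if "i \<in> Z \<union> Q" "j \<in> W" for i j using PAW that unfolding C_eq by simp
      qed (simp_all add: \<tau>)
      define \<beta>' where "\<beta>' i = (if i \<in> Z then 0 else Suc (\<beta> i))" for i
      have ZW: "z < x" if "z \<in> Z" "x \<in> Q \<union> W" for z x
      proof (cases "x \<in> Q")
        case True then show ?thesis using Q(3) that by (auto simp: Z_def)
      next
        case False
        then have x: "x \<in> W" using that by simp
        show ?thesis
        proof (rule ccontr)
          assume "\<not> z < x"
          then have "\<beta> x \<le> \<beta> z" using mono(2) that x I_eq C_eq by (auto simp: mono_on_def)
          then show False using \<beta>W[of z x] x that C_eq by auto
        qed
      qed
      have "mono_on (Z \<union> Q \<union> W) \<beta>'"
      proof (rule mono_onI)
        fix i j assume ij: "i \<in> Z \<union> Q \<union> W" "j \<in> Z \<union> Q \<union> W" "i \<le> j"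
        show "\<beta>' i \<le> \<beta>' j"
        proof (cases "j \<in> Z")
          case True
          then have "i \<in> Z" using ZW[of j i] ij by force
          then show ?thesis by (simp add: \<beta>'_def)
        next
          case False
          have "\<beta> i \<le> \<beta> j" using mono(2) ij I_eq C_eq by (auto simp: mono_on_def)
          then show ?thesis using False by (simp add: \<beta>'_def)
        qed
      qed
      moreover have "card (Z \<union> Q \<union> W) < card I"
        using Ane d fin I_eq C_eq fins by (intro psubset_card_mono) auto
      ultimately have g: "good TYPE('k) (Z \<union> Q \<union> W) (sw_rel (Z \<union> Q \<union> W) \<alpha> \<beta>')"
        using mon(1)[of "Z \<union> Q \<union> W"] I_eq C_eq fins fin by (intro IH) auto
      have "sw_rel (Z \<union> Q \<union> W) \<alpha> \<beta>' = p.P1"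
      proof (intro ext)
        fix i j
        have R: "i \<in> I \<and> i \<notin> A \<longleftrightarrow> i \<in> Z \<union> Q \<union> W" for i using I_eq C_eq d by auto
        have "\<beta>' j \<le> \<beta>' i \<longleftrightarrow> \<beta> j \<le> \<beta> i \<and> \<not> (i \<in> Z \<and> j \<in> Q)" if ij: "i \<in> Z \<union> Q \<union> W" "j \<in> Z \<union> Q \<union> W"
        proof (cases "j \<in> Z")
          case True
          then have "\<beta> j \<le> \<beta> i" using \<beta>B[of j i] ij I_eq C_eq by auto
          moreover have "j \<notin> Q" using True by (simp add: Z_def)
          ultimately show ?thesis using True by (simp add: \<beta>'_def)
        next
          case False
          show ?thesis
          proof (cases "i \<in> Z")
            case True
            then have "\<not> \<beta> j \<le> \<beta> i" if "j \<notin> Q" using \<beta>W[of i j] that ij False C_eq by fastforce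
            then show ?thesis using True False by (auto simp: \<beta>'_def)
          qed (use False in \<open>simp add: \<beta>'_def\<close>)
        qed
        then show "sw_rel (Z \<union> Q \<union> W) \<alpha> \<beta>' i j = p.P1 i j"
          using R[of i] R[of j] unfolding p.P1_def unfolding P_def sw_rel_def by blast
      qed
      then show ?thesis using p.good_pivot g by simp
    next
      case False
      then have "card C \<le> card A" by simp
      then obtain L where L: "L \<subseteq> A" "card L = card C" "\<And>x y. x \<in> A - L \<Longrightarrow> y \<in> L \<Longrightarrow> x < y"
        by (rule largest_subset[OF fins(1)]) blast
      define K where "K = A - L"
      have fL: "finite L" using L(1) fins(1) by (rule finite_subset)
      obtain \<tau> \<tau>' where \<tau>: "\<And>i. i \<in> L \<Longrightarrow> \<tau> i \<in> C" "\<And>i. i \<in> L \<Longrightarrow> \<tau>' (\<tau> i) = i"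
        "\<And>i. i \<in> C \<Longrightarrow> \<tau>' i \<in> L" "\<And>i. i \<in> C \<Longrightarrow> \<tau> (\<tau>' i) = i"
        by (rule obtain_bij[OF fL fins(2)]) (use L(2) in auto)
      have A_eq: "K \<union> L = A" using L(1) by (auto simp: K_def)
      interpret p: pivot I P K L "{}" C W \<tau> \<tau>'
      proof (intro pivot.intro pI pivot_axioms.intro)
        show "I = K \<union> L \<union> ({} \<union> C \<union> W)" using I_eq A_eq by auto
        show "K \<inter> L = {}" by (auto simp: K_def)
        show "K \<inter> ({} \<union> C \<union> W) = {}" "L \<inter> ({} \<union> C \<union> W) = {}" "C \<inter> W = {}" using d A_eq by blast+
        show "P i j" if "i \<in> K \<union> L" "j \<in> K \<union> L" for i j using PA that unfolding A_eq by simp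
        show "P i j" if "i \<in> K \<union> L" "j \<in> {} \<union> C" for i j using PA that unfolding A_eq by simp
        show "\<not> P i j" if "i \<in> K \<union> L" "j \<in> W" for i j using PAW that unfolding A_eq by simp
        show "\<not> P i j" if "i \<in> {} \<union> C \<union> W" "j \<in> K \<union> L" for i j using PRA that unfolding A_eq by simp
        show "\<not> P i j" if "i \<in> {} \<union> C" "j \<in> W" for i j using PAW that by simp
      qed (simp_all add: \<tau>)
      have "card (K \<union> ({} \<union> C \<union> W)) < card I"
      proof (intro psubset_card_mono fin)
        have "L \<noteq> {}" using L(2) Cne fins(2) by auto
        moreover have "K \<inter> L = {}" by (auto simp: K_def)
        ultimately show "K \<union> ({} \<union> C \<union> W) \<subset> I" using I_eq A_eq d by blast
      qed
      then have g: "good TYPE('k) (K \<union> ({} \<union> C \<union> W)) (sw_rel (K \<union> ({} \<union> C \<union> W)) \<alpha> \<beta>)"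
        using mon[of "K \<union> ({} \<union> C \<union> W)"] I_eq A_eq fins fin by (intro IH) auto
      have "sw_rel (K \<union> ({} \<union> C \<union> W)) \<alpha> \<beta> = p.P1"
      proof (intro ext)
        fix i j
        have R: "i \<in> I \<and> i \<notin> L \<longleftrightarrow> i \<in> K \<union> ({} \<union> C \<union> W)" for i
        proof -
          have "i \<in> K \<longleftrightarrow> i \<in> A \<and> i \<notin> L" by (auto simp: K_def)
          then show ?thesis using I_eq A_eq d by blast
        qed
        show "sw_rel (K \<union> ({} \<union> C \<union> W)) \<alpha> \<beta> i j = p.P1 i j"
          using R[of i] R[of j] unfolding p.P1_def unfolding P_def sw_rel_def by blast
      qed
      then show ?thesis using p.good_pivot g by simp
    qed
  qed
  then show ?thesis by (simp add: P_def)
qed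

theorem good_seaweed:
  assumes "finite I" "mono_on I \<alpha>" "mono_on I \<beta>"
  shows "good TYPE('k::{alg_closed_field, field_char_0}) I (sw_rel I \<alpha> \<beta>)"
  using assms
proof (induction "card I" arbitrary: I \<alpha> \<beta> rule: less_induct)
  case less
  show ?case
  proof (cases "I = {}")
    case True
    have "sw_rel {} \<alpha> \<beta> = (\<lambda>i j. False)" by (auto simp: sw_rel_def fun_eq_iff)
    then show ?thesis using good_empty True by simp
  next
    case False
    show ?thesis
    proof (cases "first_block I \<alpha> \<subseteq> first_block I \<beta>")
      case True
      show ?thesis by (rule good_sw_step[OF less.prems(1) False less.prems(2,3) True less.hyps])
    next
      case nsub: False
      then have sub: "first_block I \<beta> \<subseteq> first_block I \<alpha>" using first_block_cmp[OF less.prems(2,3)] by blast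
      have "good TYPE('k) I (sw_rel I \<beta> \<alpha>)"
        by (rule good_sw_step[OF less.prems(1) False less.prems(3,2) sub less.hyps])
      moreover have "sw_rel I \<beta> \<alpha> = (\<lambda>i j. sw_rel I \<alpha> \<beta> j i)" by (auto simp: sw_rel_def fun_eq_iff)
      ultimately show ?thesis using good_mtrans[OF preord_sw[OF less.prems(1)]] by simp
    qed
  qed
qed

section \<open>Directional derivatives of polynomial functions on matrices\<close>

lemma poly_funs_line:
  assumes "f \<in> poly_funs G" "\<And>g. g \<in> G \<Longrightarrow> \<exists>p. \<forall>t. poly p t = g (z t)"
  shows "\<exists>p. \<forall>t. poly p t = f (z t)"
  using assms
proof (induction)
  case (const c)
  show ?case by (rule exI[of _ "[:c:]"]) simp
next
  case (add f g)
  then obtain p q where "\<forall>t. poly p t = f (z t)" "\<forall>t. poly q t = g (z t)" by metis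
  then show ?case by (intro exI[of _ "p + q"]) simp
next
  case (mult f g)
  then obtain p q where "\<forall>t. poly p t = f (z t)" "\<forall>t. poly q t = g (z t)" by metis
  then show ?case by (intro exI[of _ "p * q"]) simp
qed blast

definition lp :: "('k::{field_char_0} mat \<Rightarrow> 'k) \<Rightarrow> 'k mat \<Rightarrow> 'k mat \<Rightarrow> 'k poly" where
  "lp f A Y = (THE p. \<forall>t. poly p t = f (A + t \<cdot>\<^sub>m Y))"

definition dd :: "('k::{field_char_0} mat \<Rightarrow> 'k) \<Rightarrow> 'k mat \<Rightarrow> 'k mat \<Rightarrow> 'k" where
  "dd f A Y = poly (pderiv (lp f A Y)) 0"

lemma lp_unique: "(\<And>t. poly p t = f (A + t \<cdot>\<^sub>m Y)) \<Longrightarrow> lp f A Y = p"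
  unfolding lp_def by (rule the_equality) (auto simp: fun_eq_iff simp flip: poly_eq_poly_eq_iff)

lemma entries_poly: "i < n \<Longrightarrow> j < n \<Longrightarrow> (\<lambda>A. A $$ (i, j)) \<in> poly_funs (entries n)"
  by (rule poly_funs.coord) (auto simp: entries_def)

context
  fixes n :: nat
begin

lemma poly_lp:
  assumes "f \<in> poly_funs (entries n)" "A \<in> carrier_mat n n" "Y \<in> carrier_mat n n"
  shows "poly (lp f A Y) t = f (A + t \<cdot>\<^sub>m Y)"
proof -
  have "\<exists>p. \<forall>t. poly p t = f (A + t \<cdot>\<^sub>m Y)"
  proof (rule poly_funs_line[OF assms(1)])
    fix g :: "'a mat \<Rightarrow> 'a" assume "g \<in> entries n"
    then obtain i j where "i < n" "j < n" "g = (\<lambda>A. A $$ (i, j))" by (auto simp: entries_def)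
    then show "\<exists>p. \<forall>t. poly p t = g (A + t \<cdot>\<^sub>m Y)"
      using assms by (intro exI[of _ "[:A $$ (i, j), Y $$ (i, j):]"]) simp
  qed
  then obtain p where "\<And>t. poly p t = f (A + t \<cdot>\<^sub>m Y)" by blast
  then show ?thesis using lp_unique[of p f A Y] by metis
qed

lemma smult_0: "A \<in> carrier_mat n n \<Longrightarrow> Y \<in> carrier_mat n n \<Longrightarrow> A + 0 \<cdot>\<^sub>m Y = (A :: 'k::field_char_0 mat)"
  by (intro eq_matI) auto

lemma dd_const: "dd (\<lambda>_. c) A Y = 0"
proof -
  have "lp (\<lambda>_. c) A Y = [:c:]" by (rule lp_unique) simp
  then show ?thesis by (simp add: dd_def pderiv_pCons)
qed

lemma dd_entry:
  assumes "i < n" "j < n" "A \<in> carrier_mat n n" "Y \<in> carrier_mat n n"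
  shows "dd (\<lambda>A. A $$ (i, j)) A Y = Y $$ (i, j)"
proof -
  have "lp (\<lambda>A. A $$ (i, j)) A Y = [:A $$ (i, j), Y $$ (i, j):]" by (rule lp_unique) (use assms in simp)
  then show ?thesis by (simp add: dd_def pderiv_pCons)
qed

lemma dd_add:
  assumes "f \<in> poly_funs (entries n)" "g \<in> poly_funs (entries n)" "A \<in> carrier_mat n n" "Y \<in> carrier_mat n n"
  shows "dd (\<lambda>x. f x + g x) A Y = dd f A Y + dd g A Y"
proof -
  have "lp (\<lambda>x. f x + g x) A Y = lp f A Y + lp g A Y" by (rule lp_unique) (simp add: poly_lp assms)
  then show ?thesis by (simp add: dd_def pderiv_add)
qed

lemma dd_mult:
  assumes "f \<in> poly_funs (entries n)" "g \<in> poly_funs (entries n)" "A \<in> carrier_mat n n" "Y \<in> carrier_mat n n"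
  shows "dd (\<lambda>x. f x * g x) A Y = f A * dd g A Y + g A * dd f A Y"
proof -
  have "lp (\<lambda>x. f x * g x) A Y = lp f A Y * lp g A Y" by (rule lp_unique) (simp add: poly_lp assms)
  then show ?thesis by (simp add: dd_def pderiv_mult poly_lp assms smult_0)
qed

lemma dd_linear:
  assumes "f \<in> poly_funs (entries n)" "A \<in> carrier_mat n n" "Y \<in> carrier_mat n n" "Z \<in> carrier_mat n n"
  shows "dd f A (Y + c \<cdot>\<^sub>m Z) = dd f A Y + c * dd f A Z"
  using assms
proof (induction)
  case (const c) then show ?case by (simp add: dd_const)
next
  case (coord f)
  then obtain i j where "i < n" "j < n" "f = (\<lambda>A. A $$ (i, j))" by (auto simp: entries_def)
  then show ?case using coord by (simp add: dd_entry)
next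
  case (add f g) then show ?case by (simp add: dd_add algebra_simps)
next
  case (mult f g) then show ?case by (simp add: dd_mult algebra_simps)
qed

lemma dd_poly_funs:
  assumes "f \<in> poly_funs (entries n)" and \<Phi>: "\<And>A. A \<in> carrier_mat n n \<Longrightarrow> \<Phi> A \<in> carrier_mat n n"
    and \<Phi>p: "\<And>i j. i < n \<Longrightarrow> j < n \<Longrightarrow> \<exists>g\<in>poly_funs (entries n). \<forall>A\<in>carrier_mat n n. g A = \<Phi> A $$ (i, j)"
  shows "\<exists>g\<in>poly_funs (entries n). \<forall>A\<in>carrier_mat n n. g A = dd f A (\<Phi> A)"
  using assms(1)
proof (induction)
  case (const c)
  show ?case by (rule bexI[OF _ poly_funs.const[of 0]]) (simp add: dd_const)
next
  case (coord f)
  then obtain i j where ij: "i < n" "j < n" "f = (\<lambda>A. A $$ (i, j))" by (auto simp: entries_def)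
  then show ?case using \<Phi>p[OF ij(1,2)] \<Phi> by (simp add: dd_entry)
next
  case (add f g)
  then obtain f' g' where "f' \<in> poly_funs (entries n)" "\<forall>A\<in>carrier_mat n n. f' A = dd f A (\<Phi> A)"
    "g' \<in> poly_funs (entries n)" "\<forall>A\<in>carrier_mat n n. g' A = dd g A (\<Phi> A)" by blast
  then show ?case using add \<Phi> by (intro bexI[OF _ poly_funs.add[of f' _ g']]) (auto simp: dd_add)
next
  case (mult f g)
  then obtain f' g' where "f' \<in> poly_funs (entries n)" "\<forall>A\<in>carrier_mat n n. f' A = dd f A (\<Phi> A)"
    "g' \<in> poly_funs (entries n)" "\<forall>A\<in>carrier_mat n n. g' A = dd g A (\<Phi> A)" by blast
  then show ?case using mult \<Phi>
    by (intro bexI[OF _ poly_funs.add[OF poly_funs.mult[of f _ g'] poly_funs.mult[of g _ f']]]) (auto simp: dd_mult)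
qed

lemma pderiv_lp:
  assumes f: "f \<in> poly_funs (entries n)" and A: "A \<in> carrier_mat n n" and Y: "Y \<in> carrier_mat n n"
  shows "poly (pderiv (lp f A Y)) t = dd f (A + t \<cdot>\<^sub>m Y) Y"
proof -
  have "lp f (A + t \<cdot>\<^sub>m Y) Y = pcompose (lp f A Y) [:t, 1:]"
  proof (rule lp_unique)
    fix u
    have "A + (t + u) \<cdot>\<^sub>m Y = A + t \<cdot>\<^sub>m Y + u \<cdot>\<^sub>m Y" using A Y by (intro eq_matI) (auto simp: algebra_simps)
    then show "poly (pcompose (lp f A Y) [:t, 1:]) u = f (A + t \<cdot>\<^sub>m Y + u \<cdot>\<^sub>m Y)"
      by (simp add: poly_pcompose poly_lp[OF f A Y])
  qed
  then show ?thesis by (simp add: dd_def pderiv_pcompose poly_pcompose pderiv_pCons)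
qed

lemma mult_entries_poly:
  assumes "B \<in> carrier_mat n n" "C \<in> carrier_mat n n" "i < n" "j < n"
  shows "\<exists>g\<in>poly_funs (entries n). \<forall>A\<in>carrier_mat n n. g A = (B * A * C) $$ (i, j)"
proof -
  define g where "g A = (\<Sum>l<n. (\<Sum>k<n. B $$ (i, k) * A $$ (k, l)) * C $$ (l, j))" for A
  have "g \<in> poly_funs (entries n)" unfolding g_def[abs_def]
    by (intro poly_funs_sum poly_funs.mult poly_funs.const entries_poly) auto
  moreover have "g A = (B * A * C) $$ (i, j)" if "A \<in> carrier_mat n n" for A
  proof -
    have "(B * A * C) $$ (i, j) = (\<Sum>l<n. (B * A) $$ (i, l) * C $$ (l, j))"
      using assms that by (simp add: scalar_prod_def lessThan_atLeast0 del: assoc_mult_mat)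
    also have "\<dots> = g A"
      unfolding g_def using assms that by (intro sum.cong) (auto simp: scalar_prod_def lessThan_atLeast0)
    finally show ?thesis by simp
  qed
  ultimately show ?thesis by blast
qed

lemma comp_mult_poly:
  assumes f: "f \<in> poly_funs (entries n)" and B: "B \<in> carrier_mat n n" "C \<in> carrier_mat n n"
  shows "\<exists>g\<in>poly_funs (entries n). \<forall>A\<in>carrier_mat n n. g A = f (B * A * C)"
  using f
proof (induction)
  case (const c)
  show ?case by (rule bexI[OF _ poly_funs.const[of c]]) simp
next
  case (coord f)
  then obtain i j where "i < n" "j < n" "f = (\<lambda>A. A $$ (i, j))" by (auto simp: entries_def)
  then show ?case using mult_entries_poly[OF B] by simp
next
  case (add f g)
  then obtain f' g' where "f' \<in> poly_funs (entries n)" "\<forall>A\<in>carrier_mat n n. f' A = f (B * A * C)"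
    "g' \<in> poly_funs (entries n)" "\<forall>A\<in>carrier_mat n n. g' A = g (B * A * C)" by blast
  then show ?case by (intro bexI[OF _ poly_funs.add[of f' _ g']]) auto
next
  case (mult f g)
  then obtain f' g' where "f' \<in> poly_funs (entries n)" "\<forall>A\<in>carrier_mat n n. f' A = f (B * A * C)"
    "g' \<in> poly_funs (entries n)" "\<forall>A\<in>carrier_mat n n. g' A = g (B * A * C)" by blast
  then show ?case by (intro bexI[OF _ poly_funs.mult[of f' _ g']]) auto
qed

end

section \<open>The Lie algebra of an algebraic group\<close>

lemma GL_carrier: "A \<in> carrier (GL n) \<longleftrightarrow> A \<in> carrier_mat n n \<and> (\<exists>B\<in>carrier_mat n n. A * B = 1\<^sub>m n \<and> B * A = 1\<^sub>m n)"
  by (auto simp: GL_def units_of_def Units_def ring_mat_simps)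

lemma GL_mult: "x \<otimes>\<^bsub>GL n\<^esub> y = x * y"
  by (simp add: GL_def units_of_def ring_mat_simps)

lemma GL_one: "\<one>\<^bsub>GL n\<^esub> = 1\<^sub>m n"
  by (simp add: GL_def units_of_def ring_mat_simps)

lemma GL_group: "group (GL n :: 'k::field mat monoid)"
proof -
  interpret ring "ring_mat TYPE('k) n ()" by (rule ring_mat)
  show ?thesis unfolding GL_def by (rule units_group)
qed

lemma GL_inv:
  assumes "g \<in> carrier (GL n)"
  shows "inv\<^bsub>GL n\<^esub> g \<in> carrier (GL n)" "inv\<^bsub>GL n\<^esub> g \<in> carrier_mat n n" "g \<in> carrier_mat n n"
    "inv\<^bsub>GL n\<^esub> g * g = 1\<^sub>m n" "g * inv\<^bsub>GL n\<^esub> g = 1\<^sub>m n"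
proof -
  interpret group "GL n" by (rule GL_group)
  show "inv\<^bsub>GL n\<^esub> g \<in> carrier (GL n)" using assms by simp
  then show "inv\<^bsub>GL n\<^esub> g \<in> carrier_mat n n" using GL_carrier by blast
  show "g \<in> carrier_mat n n" using assms GL_carrier by blast
  show "inv\<^bsub>GL n\<^esub> g * g = 1\<^sub>m n" "g * inv\<^bsub>GL n\<^esub> g = 1\<^sub>m n"
    using l_inv[OF assms] r_inv[OF assms] by (simp_all add: GL_mult GL_one)
qed

lemma lie_dd:
  assumes "X \<in> lie_algebra n S" "f \<in> poly_funs (entries n)" "\<And>A. A \<in> S \<Longrightarrow> f A = 0"
  shows "dd f (1\<^sub>m n) X = 0"
proof -
  have X: "X \<in> carrier_mat n n" using assms(1) by (simp add: lie_algebra_def)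
  have "\<forall>t. poly (lp f (1\<^sub>m n) X) t = f (1\<^sub>m n + t \<cdot>\<^sub>m X)" using poly_lp[OF assms(2) _ X] by simp
  then show ?thesis using assms unfolding lie_algebra_def dd_def by blast
qed

lemma lie_derivation:
  assumes S: "subgroup S (GL n)" and X: "X \<in> lie_algebra n S"
    and f: "f \<in> poly_funs (entries n)" "\<And>A. A \<in> S \<Longrightarrow> f A = 0"
  obtains g where "g \<in> poly_funs (entries n)" "\<And>A. A \<in> S \<Longrightarrow> g A = 0"
    "\<And>A. A \<in> carrier_mat n n \<Longrightarrow> g A = dd f A (A * X)"
proof -
  have Xc: "X \<in> carrier_mat n n" using X by (simp add: lie_algebra_def)
  have "\<exists>g\<in>poly_funs (entries n). \<forall>A\<in>carrier_mat n n. g A = dd f A (A * X)"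
  proof (rule dd_poly_funs[OF f(1)])
    fix i j assume "i < n" "j < n"
    from mult_entries_poly[OF one_carrier_mat Xc this]
    show "\<exists>g\<in>poly_funs (entries n). \<forall>A\<in>carrier_mat n n. g A = (A * X) $$ (i, j)"
      by (metis left_mult_one_mat)
  qed (use Xc in auto)
  then obtain g where g: "g \<in> poly_funs (entries n)" "\<And>A. A \<in> carrier_mat n n \<Longrightarrow> g A = dd f A (A * X)" by blast
  have "g A = 0" if A: "A \<in> S" for A
  proof -
    have Ac: "A \<in> carrier_mat n n" using subgroup.mem_carrier[OF S A] GL_carrier by blast
    obtain h where h: "h \<in> poly_funs (entries n)" "\<And>B. B \<in> carrier_mat n n \<Longrightarrow> h B = f (A * B * 1\<^sub>m n)"
      using comp_mult_poly[OF f(1) Ac one_carrier_mat] by blast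
    have h': "h B = f (A * B)" if "B \<in> carrier_mat n n" for B
      using h(2)[OF that] Ac that by (metis mult_carrier_mat right_mult_one_mat)
    have "h B = 0" if B: "B \<in> S" for B
    proof -
      have "B \<in> carrier_mat n n" using subgroup.mem_carrier[OF S B] GL_carrier by blast
      moreover have "A * B \<in> S" using subgroup.m_closed[OF S A B] by (simp add: GL_mult)
      ultimately show ?thesis using h' f(2) by simp
    qed
    then have "dd h (1\<^sub>m n) X = 0" using lie_dd[OF X h(1)] by blast
    moreover have "lp f A (A * X) = lp h (1\<^sub>m n) X"
    proof (rule lp_unique)
      fix t
      have "A * (1\<^sub>m n + t \<cdot>\<^sub>m X) = A + t \<cdot>\<^sub>m (A * X)"
        using Ac by (simp add: mult_add_distrib_mat[OF Ac one_carrier_mat smult_carrier_mat[OF Xc]] mult_smult_distrib[OF Ac Xc])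
      then show "poly (lp h (1\<^sub>m n) X) t = f (A + t \<cdot>\<^sub>m (A * X))"
        using poly_lp[OF h(1) one_carrier_mat Xc] h'[of "1\<^sub>m n + t \<cdot>\<^sub>m X"] Xc by simp
    qed
    ultimately show ?thesis using g(2)[OF Ac] by (simp add: dd_def)
  qed
  then show thesis using that g by blast
qed

lemma lie_Ad:
  assumes S: "subgroup S (GL n)" and X: "X \<in> lie_algebra n S" and g: "g \<in> S"
  shows "inv\<^bsub>GL n\<^esub> g * X * g \<in> lie_algebra n S"
proof -
  have Xc: "X \<in> carrier_mat n n" using X by (simp add: lie_algebra_def)
  have gG: "g \<in> carrier (GL n)" using subgroup.mem_carrier[OF S g] .
  note gi = GL_inv[OF gG]
  let ?i = "inv\<^bsub>GL n\<^esub> g"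
  have iS: "?i \<in> S" using subgroup.m_inv_closed[OF S g] .
  show ?thesis
    unfolding lie_algebra_def
  proof (intro CollectI conjI ballI impI allI)
    show "?i * X * g \<in> carrier_mat n n" using gi Xc by auto
    fix f p assume f: "f \<in> poly_funs (entries n)" "\<forall>A\<in>S. f A = 0"
      and p: "\<forall>t. poly p t = f (1\<^sub>m n + t \<cdot>\<^sub>m (?i * X * g))"
    obtain h where h: "h \<in> poly_funs (entries n)" "\<And>B. B \<in> carrier_mat n n \<Longrightarrow> h B = f (?i * B * g)"
      using comp_mult_poly[OF f(1) gi(2,3)] by blast
    have "h B = 0" if B: "B \<in> S" for B
    proof -
      have "B \<in> carrier_mat n n" using subgroup.mem_carrier[OF S B] GL_carrier by blast
      moreover have "?i * B * g \<in> S"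
        using subgroup.m_closed[OF S subgroup.m_closed[OF S iS B] g] by (simp add: GL_mult)
      ultimately show ?thesis using h(2) f(2) by simp
    qed
    moreover have "poly p t = h (1\<^sub>m n + t \<cdot>\<^sub>m X)" for t
    proof -
      have "?i * (1\<^sub>m n + t \<cdot>\<^sub>m X) * g = (?i + t \<cdot>\<^sub>m (?i * X)) * g"
        using gi(2) by (simp add: mult_add_distrib_mat[OF gi(2) one_carrier_mat smult_carrier_mat[OF Xc]] mult_smult_distrib[OF gi(2) Xc])
      also have "\<dots> = 1\<^sub>m n + t \<cdot>\<^sub>m (?i * X * g)"
        by (simp add: add_mult_distrib_mat[OF gi(2) smult_carrier_mat[OF mult_carrier_mat[OF gi(2) Xc]] gi(3)]
            mult_smult_assoc_mat[OF mult_carrier_mat[OF gi(2) Xc] gi(3)] gi(4))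
      finally show ?thesis using p h(2)[of "1\<^sub>m n + t \<cdot>\<^sub>m X"] Xc by simp
    qed
    ultimately show "poly (pderiv p) 0 = 0" using X h(1) unfolding lie_algebra_def by blast
  qed
qed

lemma lie_vanishing:
  fixes X :: "'k::field_char_0 mat"
  assumes S: "subgroup S (GL n)" and X: "\<And>j. X ^\<^sub>m Suc j \<in> lie_algebra n S"
    and f: "f \<in> poly_funs (entries n)" "\<And>A. A \<in> S \<Longrightarrow> f A = 0"
  shows "f (1\<^sub>m n + X) = 0"
proof -
  have pc: "X ^\<^sub>m Suc j \<in> carrier_mat n n" for j using X[of j] by (simp add: lie_algebra_def)
  have dX: "dim_row X = n" using carrier_matD(1)[OF pc[of 0]] by simp
  have Xc: "X \<in> carrier_mat n n"
  proof -
    have "X ^\<^sub>m Suc 0 = X" using dX by (intro eq_matI) auto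
    then show ?thesis using pc[of 0] by simp
  qed
  have "\<forall>f. f \<in> poly_funs (entries n) \<longrightarrow> (\<forall>A\<in>S. f A = 0) \<longrightarrow> (\<forall>k\<le>K. coeff (lp f (1\<^sub>m n) X) k = 0)" for K
  proof (induction K)
    case 0
    have "coeff (lp f (1\<^sub>m n) X) 0 = 0" if "f \<in> poly_funs (entries n)" "\<forall>A\<in>S. f A = 0" for f
    proof -
      have "poly (lp f (1\<^sub>m n) X) 0 = f (1\<^sub>m n)"
        unfolding poly_lp[OF that(1) one_carrier_mat Xc] using smult_0[OF one_carrier_mat Xc] by simp
      moreover have "1\<^sub>m n \<in> S" using subgroup.one_closed[OF S] by (simp add: GL_one)
      ultimately show ?thesis using that by (simp add: poly_0_coeff_0)
    qed
    then show ?case by simp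
  next
    case (Suc K)
    show ?case
    proof (intro allI impI)
      fix f k assume f: "f \<in> poly_funs (entries n)" "\<forall>A\<in>S. f A = 0" and k: "k \<le> Suc K"
      have "\<exists>q. \<forall>t. poly q t = dd f (1\<^sub>m n + t \<cdot>\<^sub>m X) (X ^\<^sub>m Suc j)" for j
      proof -
        have "\<exists>g\<in>poly_funs (entries n). \<forall>A\<in>carrier_mat n n. g A = dd f A (X ^\<^sub>m Suc j)"
        proof (rule dd_poly_funs[OF f(1)])
          show "\<exists>g\<in>poly_funs (entries n). \<forall>A\<in>carrier_mat n n. g A = (X ^\<^sub>m Suc j) $$ (a, b)" for a b
            by (rule bexI[OF _ poly_funs.const[of "(X ^\<^sub>m Suc j) $$ (a, b)"]]) simp
        qed (rule pc)
        then obtain g where g: "g \<in> poly_funs (entries n)" "\<And>A. A \<in> carrier_mat n n \<Longrightarrow> g A = dd f A (X ^\<^sub>m Suc j)" by blast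
        show ?thesis using poly_lp[OF g(1) one_carrier_mat Xc] g(2) Xc by (intro exI[of _ "lp g (1\<^sub>m n) X"]) simp
      qed
      then obtain q where q: "\<And>j t. poly (q j) t = dd f (1\<^sub>m n + t \<cdot>\<^sub>m X) (X ^\<^sub>m Suc j)" by metis
      have "\<exists>g. g \<in> poly_funs (entries n) \<and> (\<forall>A\<in>S. g A = 0) \<and>
          (\<forall>A\<in>carrier_mat n n. g A = dd f A (A * X ^\<^sub>m Suc j))" for j
        by (rule lie_derivation[OF S X[of j] f(1)]) (use f(2) in auto)
      then obtain g where g: "\<And>j. g j \<in> poly_funs (entries n)" "\<And>j. \<forall>A\<in>S. g j A = 0"
        "\<And>j A. A \<in> carrier_mat n n \<Longrightarrow> g j A = dd f A (A * X ^\<^sub>m Suc j)" by metis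
      define h where "h j = lp (g j) (1\<^sub>m n) X" for j
      have hz: "coeff (h j) i = 0" if "i \<le> K" for i j
        using Suc.IH g(1,2) that unfolding h_def by blast
      have rec: "q j = h j - [:0, 1:] * q (Suc j)" for j
      proof -
        have "poly (q j) t = poly (h j - [:0, 1:] * q (Suc j)) t" for t
        proof -
          let ?A = "1\<^sub>m n + t \<cdot>\<^sub>m X"
          have A: "?A \<in> carrier_mat n n" using Xc by simp
          have "?A * X ^\<^sub>m Suc j = X ^\<^sub>m Suc j + t \<cdot>\<^sub>m X ^\<^sub>m Suc (Suc j)"
          proof -
            have "X * X ^\<^sub>m Suc j = X ^\<^sub>m Suc (Suc j)"
            proof (induction j)
              case 0 show ?case using Xc by simp
            next
              case (Suc j)
              have "X * X ^\<^sub>m Suc (Suc j) = X * X ^\<^sub>m Suc j * X"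
                using assoc_mult_mat[OF Xc pc[of j] Xc] by simp
              then show ?case using Suc by simp
            qed
            then show ?thesis
              using Xc pc[of j] by (simp add: add_mult_distrib_mat[OF one_carrier_mat _ pc] mult_smult_assoc_mat[OF Xc pc] del: pow_mat.simps)
          qed
          then have "dd f ?A (?A * X ^\<^sub>m Suc j) = dd f ?A (X ^\<^sub>m Suc j) + t * dd f ?A (X ^\<^sub>m Suc (Suc j))"
            using dd_linear[OF f(1) A pc pc] by metis
          moreover have "poly (h j) t = dd f ?A (?A * X ^\<^sub>m Suc j)"
            unfolding h_def poly_lp[OF g(1) one_carrier_mat Xc] using g(3)[OF A] .
          ultimately show ?thesis by (simp add: q del: pow_mat.simps)
        qed
        then show ?thesis by (simp add: poly_eq_poly_eq_iff[symmetric] fun_eq_iff del: poly_diff poly_mult)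
      qed
      have qz: "coeff (q j) i = 0" if "i \<le> K" for i j
        using that
      proof (induction i arbitrary: j)
        case 0
        have "coeff (q j) 0 = coeff (h j) 0" by (subst rec) simp
        then show ?case using hz by simp
      next
        case (Suc i)
        have "coeff (q j) (Suc i) = coeff (h j) (Suc i) - coeff (q (Suc j)) i" by (subst rec) simp
        then show ?case using hz Suc by simp
      qed
      have "pderiv (lp f (1\<^sub>m n) X) = q 0"
      proof -
        have "X ^\<^sub>m Suc 0 = X" using Xc by simp
        then have "poly (pderiv (lp f (1\<^sub>m n) X)) t = poly (q 0) t" for t
          using pderiv_lp[OF f(1) one_carrier_mat Xc, of t] q[of 0 t] by simp
        then show ?thesis by (simp add: poly_eq_poly_eq_iff[symmetric] fun_eq_iff)
      qed
      then have "of_nat (Suc K) * coeff (lp f (1\<^sub>m n) X) (Suc K) = 0" using qz[of K 0] by (metis coeff_pderiv order.refl)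
      then have "coeff (lp f (1\<^sub>m n) X) (Suc K) = 0" by (simp del: of_nat_Suc)
      then show "coeff (lp f (1\<^sub>m n) X) k = 0" using Suc.IH f k by (cases "k = Suc K") auto
    qed
  qed
  then have "coeff (lp f (1\<^sub>m n) X) k = 0" for k using f by blast
  then have "lp f (1\<^sub>m n) X = 0" by (intro poly_eqI) simp
  then have "f (1\<^sub>m n + 1 \<cdot>\<^sub>m X) = 0" using poly_lp[OF f(1) one_carrier_mat Xc, of 1] by simp
  moreover have "1 \<cdot>\<^sub>m X = X" by (intro eq_matI) auto
  ultimately show ?thesis by simp
qed

section \<open>Tori\<close>

lemma topspace_zariski: "topspace (zariski X G) = X"
proof -
  have "openin (zariski X G) X"
    unfolding openin_zariski zariski_open_def by (rule exI[of _ "{\<lambda>_. 1}"]) (auto intro: poly_funs.const)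
  moreover have "U \<subseteq> X" if "openin (zariski X G) U" for U
    using that unfolding openin_zariski zariski_open_def by auto
  ultimately show ?thesis by (meson openin_subset openin_topspace subset_antisym)
qed

lemma closedin_zeros:
  assumes "F \<subseteq> poly_funs G" shows "closedin (zariski X G) {x \<in> X. \<forall>f\<in>F. f x = 0}"
proof -
  have "X - {x \<in> X. \<forall>f\<in>F. f x = 0} = {x \<in> X. \<exists>f\<in>F. f x \<noteq> 0}" by auto
  then show ?thesis unfolding closedin_def topspace_zariski openin_zariski zariski_open_def using assms by auto
qed

definition dmat :: "nat \<Rightarrow> (nat \<Rightarrow> 'k::field) \<Rightarrow> 'k mat" where
  "dmat n t = mat n n (\<lambda>(i, j). if i = j then t i else 0)"

lemma dmat_carrier [simp]: "dmat n t \<in> carrier_mat n n"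
  by (simp add: dmat_def)

lemma dmat_dim [simp]: "dim_row (dmat n t) = n" "dim_col (dmat n t) = n"
  by (simp_all add: dmat_def)

lemma dmat_entry [simp]: "i < n \<Longrightarrow> j < n \<Longrightarrow> dmat n t $$ (i, j) = (if i = j then t i else 0)"
  by (simp add: dmat_def)

lemma dmat_mult: "dmat n t * dmat n u = dmat n (\<lambda>i. t i * u i)"
proof (rule eq_matI)
  fix i j assume ij: "i < dim_row (dmat n (\<lambda>i. t i * u i))" "j < dim_col (dmat n (\<lambda>i. t i * u i))"
  have "(dmat n t * dmat n u) $$ (i, j) = (\<Sum>k = 0..<n. (if i = k then t i else 0) * (if k = j then u k else 0))"
    using ij by (auto simp: dmat_def scalar_prod_def intro!: sum.cong)
  also have "\<dots> = (\<Sum>k = 0..<n. if k = i then (if i = j then t i * u i else 0) else 0)"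
    by (rule sum.cong) auto
  finally show "(dmat n t * dmat n u) $$ (i, j) = dmat n (\<lambda>i. t i * u i) $$ (i, j)" using ij by (simp add: dmat_def)
qed (auto simp: dmat_def)

lemma dmat_one: "(\<And>i. i < n \<Longrightarrow> t i = 1) \<Longrightarrow> dmat n t = 1\<^sub>m n"
  by (rule eq_matI) (auto simp: dmat_def)

lemma diagonal_group_iff:
  "A \<in> diagonal_group d \<longleftrightarrow> (\<exists>t. A = dmat d t \<and> (\<forall>i<d. t i \<noteq> 0))"
proof
  assume "A \<in> diagonal_group d"
  then obtain B where A: "A \<in> carrier_mat d d" "diagonal_mat A" and B: "B \<in> carrier_mat d d" "A * B = 1\<^sub>m d"
    unfolding diagonal_group_def GL_carrier by blast
  have e: "A = dmat d (\<lambda>i. A $$ (i, i))"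
    by (rule eq_matI) (use A in \<open>auto simp: dmat_def diagonal_mat_def\<close>)
  have "A $$ (i, i) \<noteq> 0" if i: "i < d" for i
  proof
    assume z: "A $$ (i, i) = 0"
    have "(A * B) $$ (i, i) = (\<Sum>k = 0..<d. A $$ (i, k) * B $$ (k, i))" using A B(1) i by (simp add: scalar_prod_def)
    also have "\<dots> = 0"
    proof (intro sum.neutral ballI)
      fix k assume "k \<in> {0..<d}"
      then have "A $$ (i, k) = 0" using A z i unfolding diagonal_mat_def by (cases "k = i") auto
      then show "A $$ (i, k) * B $$ (k, i) = 0" by simp
    qed
    finally show False unfolding B(2) using i by simp
  qed
  then show "\<exists>t. A = dmat d t \<and> (\<forall>i<d. t i \<noteq> 0)" using e by blast
next
  assume "\<exists>t. A = dmat d t \<and> (\<forall>i<d. t i \<noteq> 0)"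
  then obtain t where t: "A = dmat d t" "\<forall>i<d. t i \<noteq> 0" by blast
  have "A * dmat d (\<lambda>i. inverse (t i)) = 1\<^sub>m d" "dmat d (\<lambda>i. inverse (t i)) * A = 1\<^sub>m d"
    unfolding t(1) dmat_mult by (rule dmat_one, use t in simp)+
  then show "A \<in> diagonal_group d" unfolding diagonal_group_def GL_carrier
    using t(1) by (auto simp: diagonal_mat_def dmat_def intro!: bexI[of _ "dmat d (\<lambda>i. inverse (t i))"])
qed

lemma mat_mult_entry:
  assumes "X \<in> carrier_mat n n" "Y \<in> carrier_mat n n" "i < n" "j < n"
  shows "(X * Y) $$ (i, j) = (\<Sum>k<n. X $$ (i, k) * Y $$ (k, j))"
  using assms by (simp add: scalar_prod_def lessThan_atLeast0)

lemma torus_of_classes: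
  fixes M Mi :: "'k::field mat" and c :: "nat \<Rightarrow> nat"
  assumes M: "M \<in> carrier_mat n n" "Mi \<in> carrier_mat n n" "M * Mi = 1\<^sub>m n" "Mi * M = 1\<^sub>m n"
    and H: "H = {M * dmat n (t \<circ> c) * Mi | t. \<forall>i<n. t (c i) \<noteq> 0}"
  shows "is_torus n H"
proof -
  interpret GL: group "GL n :: 'k mat monoid" by (rule GL_group)
  define d where "d = card (c ` {..<n})"
  obtain e where e: "bij_betw e {..<d} (c ` {..<n})"
    using ex_bij_betw_nat_finite[of "c ` {..<n}"] unfolding d_def lessThan_atLeast0 by auto
  define b where "b = (\<lambda>i. inv_into {..<d} e (c i))"
  have b: "b i < d" "e (b i) = c i" if "i < n" for i
  proof -
    have "c i \<in> e ` {..<d}" using e that by (auto simp: bij_betw_def)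
    then show "b i < d" "e (b i) = c i" unfolding b_def
      using inv_into_into[of "c i" e "{..<d}"] f_inv_into_f[of "c i" e "{..<d}"] by blast+
  qed
  have "\<exists>i<n. b i = j" if j: "j < d" for j
  proof -
    have "e j \<in> c ` {..<n}" using e j by (auto simp: bij_betw_def)
    then obtain i where "i < n" "e j = c i" by auto
    then have "b i = j" unfolding b_def using inv_into_f_f[of e "{..<d}" j] e j by (simp add: bij_betw_def)
    then show ?thesis using \<open>i < n\<close> by blast
  qed
  then obtain m where m: "\<And>j. j < d \<Longrightarrow> m j < n \<and> b (m j) = j" by metis
  have mc: "X \<in> carrier_mat n n \<Longrightarrow> Y \<in> carrier_mat n n \<Longrightarrow> X * Y \<in> carrier_mat n n" for X Y :: "'k mat"
    by (rule mult_carrier_mat)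
  note assoc = mc assoc_mult_mat[of _ n n _ n _ n] left_mult_one_mat[of _ n n]
  define \<delta> where "\<delta> t = M * dmat n (\<lambda>i. t (b i)) * Mi" for t :: "nat \<Rightarrow> 'k"
  have \<delta>c: "\<delta> t \<in> carrier_mat n n" for t unfolding \<delta>_def by (intro mc M(1,2) dmat_carrier)
  have conj: "Mi * (M * X * Mi) * M = X" if X: "X \<in> carrier_mat n n" for X
  proof -
    have "Mi * (M * X * Mi) * M = (Mi * M) * X * (Mi * M)"
      using M(1,2) X by (simp add: assoc)
    then show ?thesis unfolding M(4) using X by simp
  qed
  have \<delta>M: "Mi * \<delta> t * M = dmat n (\<lambda>i. t (b i))" for t unfolding \<delta>_def by (rule conj) simp
  have \<delta>mult: "\<delta> t * \<delta> u = \<delta> (\<lambda>j. t j * u j)" for t u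
  proof -
    have "\<delta> t * \<delta> u = M * dmat n (\<lambda>i. t (b i)) * (Mi * M) * (dmat n (\<lambda>i. u (b i)) * Mi)"
      unfolding \<delta>_def using M(1,2) by (simp add: assoc)
    also have "\<dots> = M * (dmat n (\<lambda>i. t (b i)) * dmat n (\<lambda>i. u (b i))) * Mi"
      unfolding M(4) using M(1,2) by (simp add: assoc)
    finally show ?thesis unfolding dmat_mult \<delta>_def .
  qed
  have \<delta>cong: "\<delta> t = \<delta> u" if "\<And>j. j < d \<Longrightarrow> t j = u j" for t u
  proof -
    have "dmat n (\<lambda>i. t (b i)) = dmat n (\<lambda>i. u (b i))" by (rule eq_matI) (use that b in \<open>auto simp: dmat_def\<close>)
    then show ?thesis by (simp add: \<delta>_def)
  qed
  have \<delta>one: "\<delta> t = 1\<^sub>m n" if "\<And>j. j < d \<Longrightarrow> t j = 1" for t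
    unfolding \<delta>_def by (subst dmat_one) (use that b M in auto)
  have H': "H = \<delta> ` {t. \<forall>j<d. t j \<noteq> 0}"
  proof (intro subset_antisym subsetI)
    fix A assume "A \<in> H"
    then obtain t where t: "A = M * dmat n (t \<circ> c) * Mi" "\<forall>i<n. t (c i) \<noteq> 0" unfolding H by blast
    have "dmat n (t \<circ> c) = dmat n (\<lambda>i. (t \<circ> e) (b i))" by (rule eq_matI) (use b in \<open>auto simp: dmat_def\<close>)
    then have "A = \<delta> (t \<circ> e)" unfolding t \<delta>_def by simp
    moreover have "(t \<circ> e) j \<noteq> 0" if "j < d" for j using m[OF that] b(2)[of "m j"] t(2) by auto
    ultimately show "A \<in> \<delta> ` {t. \<forall>j<d. t j \<noteq> 0}" by blast
  next
    fix A assume "A \<in> \<delta> ` {t. \<forall>j<d. t j \<noteq> 0}"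
    then obtain t where t: "A = \<delta> t" "\<forall>j<d. t j \<noteq> 0" by blast
    have *: "inv_into {..<d} e (c i) = b i" for i by (simp add: b_def)
    have "A = M * dmat n ((\<lambda>k. t (inv_into {..<d} e k)) \<circ> c) * Mi" unfolding t(1) \<delta>_def o_def * ..
    then show "A \<in> H" unfolding H using t(2) b(1) * by (auto intro!: exI[of _ "\<lambda>k. t (inv_into {..<d} e k)"])
  qed
  have inv: "\<delta> (\<lambda>j. inverse (t j)) * \<delta> t = 1\<^sub>m n" "\<delta> t * \<delta> (\<lambda>j. inverse (t j)) = 1\<^sub>m n" if "\<forall>j<d. t j \<noteq> 0" for t
    unfolding \<delta>mult by (rule \<delta>one, use that in simp)+
  have HGL: "\<delta> t \<in> carrier (GL n)" if "\<forall>j<d. t j \<noteq> 0" for t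
    unfolding GL_carrier using inv[OF that] \<delta>c by blast
  have sub: "subgroup H (GL n)"
  proof (rule GL.subgroupI)
    show "H \<subseteq> carrier (GL n)" unfolding H' using HGL by blast
    have "\<delta> (\<lambda>_. 1) \<in> H" unfolding H' by auto
    then show "H \<noteq> {}" by blast
    fix A assume "A \<in> H"
    then obtain t where t: "A = \<delta> t" "\<forall>j<d. t j \<noteq> 0" unfolding H' by blast
    have t': "\<forall>j<d. inverse (t j) \<noteq> 0" using t(2) by simp
    have "inv\<^bsub>GL n\<^esub> A = \<delta> (\<lambda>j. inverse (t j))"
      by (rule GL.inv_equality) (use inv(1)[OF t(2)] HGL[OF t(2)] HGL[OF t'] t(1) in \<open>auto simp: GL_mult GL_one\<close>)
    then show "inv\<^bsub>GL n\<^esub> A \<in> H" unfolding H' using t' by blast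
    fix B assume "B \<in> H"
    then obtain u where u: "B = \<delta> u" "\<forall>j<d. u j \<noteq> 0" unfolding H' by blast
    show "A \<otimes>\<^bsub>GL n\<^esub> B \<in> H" unfolding GL_mult t(1) u(1) \<delta>mult H' using t(2) u(2) by auto
  qed
  have poly: "\<exists>g\<in>poly_funs (entries n). \<forall>A\<in>carrier_mat n n. g A = (Mi * A * M) $$ (i, j)" if "i < n" "j < n" for i j
    using mult_entries_poly[OF M(2,1) that] .
  then obtain f where f: "\<And>i j. i < n \<Longrightarrow> j < n \<Longrightarrow> f i j \<in> poly_funs (entries n)"
    "\<And>i j A. i < n \<Longrightarrow> j < n \<Longrightarrow> A \<in> carrier_mat n n \<Longrightarrow> f i j A = (Mi * A * M) $$ (i, j)" by metis
  define Z where "Z = {f i j | i j. i < n \<and> j < n \<and> i \<noteq> j} \<union> {\<lambda>A. f i i A - f j j A | i j. i < n \<and> j < n \<and> b i = b j}"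
  have Z: "Z \<subseteq> poly_funs (entries n)" unfolding Z_def using f(1) poly_funs_diff by blast
  have "H = {A \<in> carrier (GL n). \<forall>g\<in>Z. g A = 0}"
  proof (intro subset_antisym subsetI)
    fix A assume "A \<in> H"
    then obtain t where t: "A = \<delta> t" "\<forall>j<d. t j \<noteq> 0" unfolding H' by blast
    have "f i j A = (if i = j then t (b i) else 0)" if "i < n" "j < n" for i j
      using f(2)[OF that \<delta>c] \<delta>M that unfolding t(1) by simp
    then have "\<forall>g\<in>Z. g A = 0" unfolding Z_def by auto
    then show "A \<in> {A \<in> carrier (GL n). \<forall>g\<in>Z. g A = 0}" using HGL t by blast
  next
    fix A assume "A \<in> {A \<in> carrier (GL n). \<forall>g\<in>Z. g A = 0}"
    then have A: "A \<in> carrier (GL n)" "\<And>g. g \<in> Z \<Longrightarrow> g A = 0" by auto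
    then obtain B where B: "A \<in> carrier_mat n n" "B \<in> carrier_mat n n" "A * B = 1\<^sub>m n" unfolding GL_carrier by blast
    define t where "t j = f (m j) (m j) A" for j
    have "f i j A = (if i = j then t (b i) else 0)" if "i < n" "j < n" for i j
    proof (cases "i = j")
      case True
      have "(\<lambda>A. f i i A - f (m (b i)) (m (b i)) A) \<in> Z" 
        unfolding Z_def by (rule UnI2, rule CollectI, rule exI[of _ i], rule exI[of _ "m (b i)"])
          (use that m[OF b(1)[OF that(1)]] in auto)
      then have "f i i A - f (m (b i)) (m (b i)) A = 0" by (rule A(2))
      then show ?thesis using True unfolding t_def by simp
    next
      case False
      then have "f i j \<in> Z" unfolding Z_def using that by blast
      then show ?thesis using A(2) False by simp
    qed
    then have D: "Mi * A * M = dmat n (\<lambda>i. t (b i))" using f(2)[OF _ _ B(1)] B(1) M by (intro eq_matI) (auto simp del: assoc_mult_mat index_mult_mat(1))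
    have "M * (Mi * A * M) * Mi = (M * Mi) * A * (M * Mi)"
      using M(1,2) B(1) by (simp add: assoc)
    then have A': "A = \<delta> t" unfolding D M(3) \<delta>_def using B(1) by simp
    have "dmat n (\<lambda>i. t (b i)) * (Mi * B * M) = Mi * A * (M * Mi) * (B * M)"
      unfolding D[symmetric] using M(1,2) B by (simp add: assoc)
    also have "\<dots> = Mi * (A * B) * M"
      unfolding M(3) using M(1,2) B(1,2) by (simp add: assoc)
    finally have "dmat n (\<lambda>i. t (b i)) * (Mi * B * M) = 1\<^sub>m n" unfolding B(3) using M by simp
    moreover have "Mi * B * M \<in> carrier_mat n n" by (intro mc M B)
    moreover from calculation have "(Mi * B * M) * dmat n (\<lambda>i. t (b i)) = 1\<^sub>m n"
      using mat_mult_left_right_inverse[OF dmat_carrier] by blast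
    ultimately have "dmat n (\<lambda>i. t (b i)) \<in> diagonal_group n"
      unfolding diagonal_group_def GL_carrier by (auto simp: diagonal_mat_def dmat_def)
    then obtain u where u: "dmat n (\<lambda>i. t (b i)) = dmat n u" "\<forall>i<n. u i \<noteq> 0" unfolding diagonal_group_iff by blast
    have "t j \<noteq> 0" if "j < d" for j
      using arg_cong[OF u(1), of "\<lambda>X. X $$ (m j, m j)"] u(2) m[OF that] by simp
    then show "A \<in> H" unfolding H' A' by blast
  qed
  then have cl: "closedin (zariski (carrier (GL n)) (entries n)) H" using closedin_zeros[OF Z] by simp
  define \<phi> where "\<phi> \<Delta> = \<delta> (\<lambda>j. \<Delta> $$ (j, j))" for \<Delta> :: "'k mat"
  define \<psi> where "\<psi> A = dmat d (\<lambda>j. (Mi * A * M) $$ (m j, m j))" for A :: "'k mat"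
  have \<phi>d: "\<phi> (dmat d t) = \<delta> t" for t unfolding \<phi>_def by (rule \<delta>cong) simp
  have \<psi>\<delta>: "\<psi> (\<delta> t) = dmat d t" for t
    unfolding \<psi>_def \<delta>M by (rule eq_matI) (use m in \<open>auto simp: dmat_def\<close>)
  have \<psi>H: "inv_into (diagonal_group d) \<phi> A = \<psi> A" if A: "A \<in> H" for A
  proof (rule inv_into_f_eq)
    show "inj_on \<phi> (diagonal_group d)"
      by (rule inj_on_inverseI[of _ \<psi>]) (auto simp: diagonal_group_iff \<phi>d \<psi>\<delta>)
    obtain t where "A = \<delta> t" "\<forall>j<d. t j \<noteq> 0" using A unfolding H' by blast
    then show "\<psi> A \<in> diagonal_group d" "\<phi> (\<psi> A) = A" unfolding diagonal_group_iff by (auto simp: \<psi>\<delta> \<phi>d)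
  qed
  have "\<phi> \<in> iso (GL_restrict d (diagonal_group d)) (GL_restrict n H)"
  proof (rule isoI)
    show "\<phi> \<in> hom (GL_restrict d (diagonal_group d)) (GL_restrict n H)"
    proof (rule homI)
      fix x y :: "'k mat" assume "x \<in> carrier (GL_restrict d (diagonal_group d))" "y \<in> carrier (GL_restrict d (diagonal_group d))"
      then obtain t u where t: "x = dmat d t" "\<forall>i<d. t i \<noteq> 0" and u: "y = dmat d u" "\<forall>i<d. u i \<noteq> 0"
        by (auto simp: diagonal_group_iff)
      show "\<phi> x \<in> carrier (GL_restrict n H)" unfolding t(1) \<phi>d H' using t(2) by auto
      show "\<phi> (x \<otimes>\<^bsub>GL_restrict d (diagonal_group d)\<^esub> y) = \<phi> x \<otimes>\<^bsub>GL_restrict n H\<^esub> \<phi> y"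
        by (simp add: GL_mult t(1) u(1) dmat_mult \<phi>d \<delta>mult)
    qed
    show "bij_betw \<phi> (carrier (GL_restrict d (diagonal_group d))) (carrier (GL_restrict n H))"
    proof (rule bij_betw_byWitness[of _ \<psi>])
      show "\<forall>x\<in>carrier (GL_restrict d (diagonal_group d)). \<psi> (\<phi> x) = x"
        by (auto simp: diagonal_group_iff \<phi>d \<psi>\<delta>)
      show "\<forall>y\<in>carrier (GL_restrict n H). \<phi> (\<psi> y) = y"
        by (auto simp: H' \<phi>d \<psi>\<delta>)
      show "\<phi> ` carrier (GL_restrict d (diagonal_group d)) \<subseteq> carrier (GL_restrict n H)"
        by (auto simp: diagonal_group_iff \<phi>d H')
      show "\<psi> ` carrier (GL_restrict n H) \<subseteq> carrier (GL_restrict d (diagonal_group d))"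
        by (auto simp: diagonal_group_iff \<psi>\<delta> H')
    qed
  qed
  moreover have "regular_map d n (diagonal_group d) \<phi>" unfolding regular_map_def
  proof (intro allI impI)
    fix i j assume ij: "i < n" "j < n"
    let ?f = "\<lambda>A. \<Sum>k<n. M $$ (i, k) * A $$ (b k, b k) * Mi $$ (k, j)"
    have P: "?f \<in> poly_funs (insert (\<lambda>A. inverse (det A)) (entries d))"
      by (intro poly_funs_sum poly_funs.mult poly_funs.const poly_funs.coord) (use b(1) in \<open>auto simp: entries_def\<close>)
    have E: "\<phi> A $$ (i, j) = ?f A" if "A \<in> diagonal_group d" for A
    proof -
      have "(M * dmat n t) $$ (i, k) = M $$ (i, k) * t k" if "k < n" for t k
      proof -
        have "(M * dmat n t) $$ (i, k) = (\<Sum>l = 0..<n. if l = k then M $$ (i, k) * t k else 0)"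
          using M(1) ij that by (simp add: scalar_prod_def dmat_def if_distrib[of "times _"] cong: if_cong)
        then show ?thesis using that by simp
      qed
      moreover have "M * dmat n t \<in> carrier_mat n n" for t by (intro mc M(1)) simp
      then have "\<phi> A $$ (i, j) = (\<Sum>k<n. (M * dmat n (\<lambda>i. A $$ (b i, b i))) $$ (i, k) * Mi $$ (k, j))"
        unfolding \<phi>_def \<delta>_def by (rule mat_mult_entry[OF _ M(2) ij])
      ultimately show ?thesis by simp
    qed
    show "\<exists>f\<in>poly_funs (insert (\<lambda>A. inverse (det A)) (entries d)). \<forall>A\<in>diagonal_group d. \<phi> A $$ (i, j) = f A"
      by (rule bexI[of _ ?f], rule ballI, erule E, rule P)
  qed
  moreover have "regular_map n d H (inv_into (diagonal_group d) \<phi>)" unfolding regular_map_def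
  proof (intro allI impI)
    fix i j assume ij: "i < d" "j < d"
    let ?G = "insert (\<lambda>A. inverse (det A)) (entries n)"
    let ?f = "if i = j then f (m i) (m i) else (\<lambda>_. 0)"
    have "f (m i) (m i) \<in> poly_funs ?G"
      by (rule poly_funs_comp[OF f(1), of _ _ "\<lambda>x. x"]) (use m[OF ij(1)] in \<open>auto intro: poly_funs.coord\<close>)
    then have "?f \<in> poly_funs ?G" by (auto intro: poly_funs.const)
    moreover have "inv_into (diagonal_group d) \<phi> A $$ (i, j) = ?f A" if "A \<in> H" for A
    proof -
      have "A \<in> carrier_mat n n" using that \<delta>c unfolding H' by blast
      then show ?thesis unfolding \<psi>H[OF that] \<psi>_def using ij m[OF ij(1)] f(2)[of "m i" "m i" A] by (auto simp del: assoc_mult_mat index_mult_mat(1))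
    qed
    ultimately show "\<exists>f\<in>poly_funs ?G. \<forall>A\<in>H. inv_into (diagonal_group d) \<phi> A $$ (i, j) = f A" by blast
  qed
  ultimately show ?thesis unfolding is_torus_def algebraic_subgroup_def using sub cl by blast
qed

section \<open>Algebras spanned by matrix units\<close>

locale based_algebra =
  fixes n :: nat and G Gi :: "'k::field_char_0 mat" and P :: "nat \<Rightarrow> nat \<Rightarrow> bool"
  assumes G: "G \<in> carrier_mat n n" "Gi \<in> carrier_mat n n" "G * Gi = 1\<^sub>m n" "Gi * G = 1\<^sub>m n"
    and preord: "preord {..<n} P"
begin

sublocale preord "{..<n}" P by (rule preord)

abbreviation "I \<equiv> {..<n}"

definition of_mat :: "'k mat \<Rightarrow> 'k fmat" where
  "of_mat A = (\<lambda>i j. if i < n \<and> j < n then (Gi * A * G) $$ (i, j) else 0)"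

definition to_mat :: "'k fmat \<Rightarrow> 'k mat" where
  "to_mat x = G * mat n n (\<lambda>(i, j). x i j) * Gi"

definition alg :: "'k mat set" where
  "alg = {A \<in> carrier_mat n n. \<forall>i j. of_mat A i j \<noteq> 0 \<longrightarrow> P i j}"

lemma alg_carrier: "A \<in> alg \<Longrightarrow> A \<in> carrier_mat n n"
  by (simp add: alg_def)

lemma to_mat_carrier: "to_mat x \<in> carrier_mat n n"
  unfolding to_mat_def by (rule mult_carrier_mat[OF mult_carrier_mat[OF G(1)] G(2)]) simp

lemma cancel: 
  assumes M: "M \<in> carrier_mat n n"
  shows "Gi * (G * M) = M" "G * (Gi * M) = M"
proof -
  have "Gi * (G * M) = (Gi * G) * M" by (rule assoc_mult_mat[symmetric, OF G(2,1) M])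
  then show "Gi * (G * M) = M" unfolding G(4) using M by simp
  have "G * (Gi * M) = (G * Gi) * M" by (rule assoc_mult_mat[symmetric, OF G(1,2) M])
  then show "G * (Gi * M) = M" unfolding G(3) using M by simp
qed

lemma conj_cancel: "M \<in> carrier_mat n n \<Longrightarrow> Gi * (G * M * Gi) * G = M"
proof -
  assume M: "M \<in> carrier_mat n n"
  have "Gi * (G * M * Gi) * G = Gi * (G * (M * (Gi * G)))"
    using G(1,2) M by (simp add: assoc_mult_mat[of _ n n _ n _ n])
  then show ?thesis unfolding G(4) using cancel(1)[OF M] M by simp
qed

lemma conj_cancel': "M \<in> carrier_mat n n \<Longrightarrow> G * (Gi * M * G) * Gi = M"
proof -
  assume M: "M \<in> carrier_mat n n"
  have "G * (Gi * M * G) * Gi = G * (Gi * (M * (G * Gi)))"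
    using G(1,2) M by (simp add: assoc_mult_mat[of _ n n _ n _ n])
  then show ?thesis unfolding G(3) using cancel(2)[OF M] M by simp
qed

lemma of_to_mat: "(\<And>i j. x i j \<noteq> 0 \<Longrightarrow> i < n \<and> j < n) \<Longrightarrow> of_mat (to_mat x) = x"
  unfolding of_mat_def to_mat_def by (subst conj_cancel) (auto simp: fun_eq_iff)

lemma to_of_mat: "A \<in> carrier_mat n n \<Longrightarrow> to_mat (of_mat A) = A"
proof -
  assume A: "A \<in> carrier_mat n n"
  have "mat n n (\<lambda>(i, j). of_mat A i j) = Gi * A * G"
    using G A by (intro eq_matI) (auto simp: of_mat_def)
  then show ?thesis unfolding to_mat_def using conj_cancel'[OF A] by simp
qed

lemma of_mat_inj: "A \<in> carrier_mat n n \<Longrightarrow> B \<in> carrier_mat n n \<Longrightarrow> of_mat A = of_mat B \<Longrightarrow> A = B"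
  using to_of_mat by metis

lemma of_mat_add: "A \<in> carrier_mat n n \<Longrightarrow> B \<in> carrier_mat n n \<Longrightarrow> of_mat (A + B) i j = of_mat A i j + of_mat B i j"
  using G by (simp add: of_mat_def mult_add_distrib_mat[of _ n n] add_mult_distrib_mat[of _ n n])

lemma of_mat_smult: "A \<in> carrier_mat n n \<Longrightarrow> of_mat (c \<cdot>\<^sub>m A) i j = c * of_mat A i j"
  using G by (simp add: of_mat_def mult_smult_distrib[of _ n n] mult_smult_assoc_mat[of _ n n])

lemma of_mat_mult:
  assumes A: "A \<in> carrier_mat n n" and B: "B \<in> carrier_mat n n"
  shows "of_mat (A * B) = mprod I (of_mat A) (of_mat B)"
proof (intro ext)
  fix i j
  have e: "Gi * (A * B) * G = (Gi * A * G) * (Gi * B * G)"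
  proof -
    have "(Gi * A * G) * (Gi * B * G) = Gi * A * (G * Gi) * B * G"
      using G(1,2) A B by (simp add: assoc_mult_mat[of _ n n _ n _ n])
    also have "\<dots> = Gi * (A * B) * G" unfolding G(3) using G(1,2) A B by (simp add: assoc_mult_mat[of _ n n _ n _ n])
    finally show ?thesis by simp
  qed
  show "of_mat (A * B) i j = mprod I (of_mat A) (of_mat B) i j"
  proof (cases "i < n \<and> j < n")
    case True
    have c: "Gi * A * G \<in> carrier_mat n n" "Gi * B * G \<in> carrier_mat n n" using G A B by auto
    have "of_mat (A * B) i j = ((Gi * A * G) * (Gi * B * G)) $$ (i, j)" using True e by (simp add: of_mat_def)
    also have "\<dots> = (\<Sum>k<n. (Gi * A * G) $$ (i, k) * (Gi * B * G) $$ (k, j))"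
      using True by (intro mat_mult_entry[OF c]) auto
    also have "\<dots> = mprod I (of_mat A) (of_mat B) i j"
      unfolding mprod_def using True by (intro sum.cong) (auto simp: of_mat_def)
    finally show ?thesis .
  qed (auto simp: of_mat_def mprod_def)
qed

lemma of_mat_one: "of_mat (1\<^sub>m n) = mone I"
  using G by (auto simp: of_mat_def mone_def fun_eq_iff)

lemma alg_one: "1\<^sub>m n \<in> alg"
  using refl by (auto simp: alg_def of_mat_one mone_def)

lemma alg_add: "A \<in> alg \<Longrightarrow> B \<in> alg \<Longrightarrow> A + B \<in> alg"
  by (auto simp: alg_def of_mat_add) (metis add_0)

lemma alg_smult: "A \<in> alg \<Longrightarrow> c \<cdot>\<^sub>m A \<in> alg"
  by (auto simp: alg_def of_mat_smult)

lemma alg_malg: "A \<in> carrier_mat n n \<Longrightarrow> A \<in> alg \<longleftrightarrow> mtrans (of_mat A) \<in> malg P"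
  by (auto simp: alg_def malg_def mtrans_def)

lemma alg_mult: "A \<in> alg \<Longrightarrow> B \<in> alg \<Longrightarrow> A * B \<in> alg"
proof -
  assume A: "A \<in> alg" and B: "B \<in> alg"
  note c = alg_carrier[OF A] alg_carrier[OF B]
  have "mprod I (mtrans (of_mat B)) (mtrans (of_mat A)) \<in> malg P"
    using A B c alg_malg by (intro malg_mprod) auto
  then show ?thesis using c by (simp add: alg_malg of_mat_mult mprod_mtrans)
qed

lemma alg_pow: "A \<in> alg \<Longrightarrow> A ^\<^sub>m Suc j \<in> alg"
proof (induction j)
  case 0
  then have "A \<in> carrier_mat n n" by (rule alg_carrier)
  then show ?case using 0 by simp
next
  case (Suc j)
  then show ?case using alg_mult by simp
qed

lemma of_mat_poly: "i < n \<Longrightarrow> j < n \<Longrightarrow> \<exists>g\<in>poly_funs (entries n). \<forall>A\<in>carrier_mat n n. g A = of_mat A i j"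
  using mult_entries_poly[OF G(2,1)] by (simp add: of_mat_def)

lemma units_subset:
  assumes S: "algebraic_subgroup n S" and lie: "lie_algebra n S = alg"
    and A: "A \<in> alg" "A \<in> carrier (GL n)"
  shows "A \<in> S"
proof -
  have sub: "subgroup S (GL n)" and cl: "closedin (zariski (carrier (GL n)) (entries n)) S"
    using S by (auto simp: algebraic_subgroup_def)
  have "openin (zariski (carrier (GL n)) (entries n)) (carrier (GL n) - S)"
    using cl by (simp add: closedin_def topspace_zariski)
  then obtain F where F: "F \<subseteq> poly_funs (entries n)" "carrier (GL n) - S = {x \<in> carrier (GL n). \<exists>f\<in>F. f x \<noteq> 0}"
    unfolding openin_zariski zariski_open_def by blast
  have "f A = 0" if f: "f \<in> F" for f
  proof -
    have fS: "f B = 0" if "B \<in> S" for B using F(2) subgroup.mem_carrier[OF sub that] that f by blast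
    define X where "X = A + (-1) \<cdot>\<^sub>m 1\<^sub>m n"
    have X: "X \<in> alg" unfolding X_def by (intro alg_add alg_smult alg_one A)
    have "f (1\<^sub>m n + X) = 0"
      by (rule lie_vanishing[OF sub]) (use alg_pow[OF X] lie F(1) f fS in auto)
    moreover have "1\<^sub>m n + X = A" unfolding X_def using alg_carrier[OF A(1)] by (intro eq_matI) auto
    ultimately show ?thesis by simp
  qed
  then show ?thesis using F(2) A(2) by blast
qed

lemma of_mat_unit:
  assumes "i < n" shows "of_mat (to_mat (\<lambda>k l. if k = i \<and> l = i then 1 else 0)) = (\<lambda>k l. if k = i \<and> l = i then 1 else 0)"
  by (rule of_to_mat) (use assms in \<open>auto split: if_splits\<close>)

lemma subset_units:
  assumes S: "connected_algebraic_subgroup n S" and lie: "lie_algebra n S = alg" and u: "u \<in> S"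
  shows "u \<in> alg"
proof -
  let ?T = "zariski (carrier (GL n :: 'k mat monoid)) (entries n)"
  have sub: "subgroup S (GL n)" and con: "connectedin ?T S"
    using S by (auto simp: connected_algebraic_subgroup_def algebraic_subgroup_def)
  have SG: "x \<in> carrier (GL n)" if "x \<in> S" for x using subgroup.mem_carrier[OF sub that] .
  note closed = closedin_zeros[of _ "entries n" "carrier (GL n :: 'k mat monoid)"]
  have "of_mat u i j = 0" if ij: "\<not> P i j" and i: "i < n" and j: "j < n" for i j
  proof -
    define I0 where "I0 = {l. l < n \<and> P l j}"
    define ofp where "ofp a b = (SOME g. g \<in> poly_funs (entries n) \<and> (\<forall>A\<in>carrier_mat n n. g A = of_mat A a b))" for a b
    have ofp: "ofp a b \<in> poly_funs (entries n)" "A \<in> carrier_mat n n \<Longrightarrow> ofp a b A = of_mat A a b" if "a < n" "b < n" for a b A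
    proof -
      have "\<exists>g. g \<in> poly_funs (entries n) \<and> (\<forall>A\<in>carrier_mat n n. g A = of_mat A a b)" using of_mat_poly[OF that] by blast
      from someI_ex[OF this] show "ofp a b \<in> poly_funs (entries n)" "A \<in> carrier_mat n n \<Longrightarrow> ofp a b A = of_mat A a b"
        unfolding ofp_def by auto
    qed
    define cm where "cm A = mat n n (\<lambda>(a, b). A $$ (a, b))" for A :: "'k mat"
    have cm: "cm A \<in> carrier_mat n n" for A by (simp add: cm_def)
    have cm_id: "cm A = A" if "A \<in> carrier_mat n n" for A using that by (intro eq_matI) (auto simp: cm_def)
    have cm_poly: "(\<lambda>A. cm A $$ (a, b)) \<in> poly_funs (entries n)" if "a < n" "b < n" for a b
      using that by (simp add: cm_def entries_poly)
    define adjp where "adjp a b A = ofp a b (adj_mat (cm A))" for a b A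
    have adj: "adj_mat (cm A) \<in> carrier_mat n n" for A using adj_mat(1)[OF cm] .
    have adjp: "adjp a b \<in> poly_funs (entries n)" if ab: "a < n" "b < n" for a b
      unfolding adjp_def[abs_def]
    proof (rule poly_funs_comp[OF ofp(1)[OF ab]])
      fix h :: "'k mat \<Rightarrow> 'k" assume "h \<in> entries n"
      then obtain k l where kl: "k < n" "l < n" "h = (\<lambda>A. A $$ (k, l))" by (auto simp: entries_def)
      show "(\<lambda>x. h (adj_mat (cm x))) \<in> poly_funs (entries n)"
        unfolding kl(3) by (rule adj_mat_poly_funs[OF cm cm_poly kl(1,2)])
    qed
    have adj_inv: "of_mat (inv\<^bsub>GL n\<^esub> x) a b * det x = adjp a b x" if x: "x \<in> carrier (GL n)" and ab: "a < n" "b < n" for x a b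
    proof -
      note gi = GL_inv[OF x]
      have "adj_mat x = det x \<cdot>\<^sub>m inv\<^bsub>GL n\<^esub> x"
      proof -
        have "adj_mat x = adj_mat x * (x * inv\<^bsub>GL n\<^esub> x)" unfolding gi(5) using adj_mat(1)[OF gi(3)] by simp
        also have "\<dots> = (adj_mat x * x) * inv\<^bsub>GL n\<^esub> x"
          using assoc_mult_mat[OF adj_mat(1)[OF gi(3)] gi(3) gi(2)] by simp
        also have "\<dots> = det x \<cdot>\<^sub>m inv\<^bsub>GL n\<^esub> x"
          unfolding adj_mat(3)[OF gi(3)] using gi(2) by (simp add: mult_smult_assoc_mat[OF one_carrier_mat gi(2)])
        finally show ?thesis .
      qed
      then show ?thesis
        using ofp(2)[OF ab adj[of x]] of_mat_smult[OF gi(2), of "det x" a b]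
        by (simp add: adjp_def cm_id[OF gi(3)] mult.commute)
    qed
    have det: "det x \<noteq> 0" if x: "x \<in> carrier (GL n)" for x
    proof
      assume "det x = 0"
      note gi = GL_inv[OF x]
      have "det (inv\<^bsub>GL n\<^esub> x * x) = 0" unfolding det_mult[OF gi(2,3)] using \<open>det x = 0\<close> by simp
      then show False unfolding gi(4) by simp
    qed
    define C1 where "C1 = {x \<in> carrier (GL n). \<forall>f\<in>(\<lambda>l. ofp i l) ` I0. f x = 0}"
    define C2 where "C2 = {x \<in> carrier (GL n). \<forall>f\<in>(\<lambda>k. adjp k i) ` (I - I0). f x = 0}"
    have C: "closedin ?T C1" "closedin ?T C2"
      unfolding C1_def C2_def by (rule closed; use ofp(1) adjp i in \<open>auto simp: I0_def\<close>)+
    have C1: "x \<in> C1 \<longleftrightarrow> (\<forall>l\<in>I0. of_mat x i l = 0)" if "x \<in> carrier (GL n)" for x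
      using that ofp(2)[OF i] GL_inv(3)[OF that] by (auto simp: C1_def I0_def)
    have C2: "x \<in> C2 \<longleftrightarrow> (\<forall>k\<in>I - I0. of_mat (inv\<^bsub>GL n\<^esub> x) k i = 0)" if x: "x \<in> carrier (GL n)" for x
    proof -
      have "adjp k i x = 0 \<longleftrightarrow> of_mat (inv\<^bsub>GL n\<^esub> x) k i = 0" if "k < n" for k
        using adj_inv[OF x that i] det[OF x] by (metis mult_eq_0_iff)
      then show ?thesis using x by (auto simp: C2_def)
    qed
    have prod0: "of_mat (inv\<^bsub>GL n\<^esub> x) k i * of_mat x i l = 0" if x: "x \<in> S" and k: "k \<in> I - I0" and l: "l \<in> I0" for x k l
    proof -
      let ?e = "\<lambda>k l. if k = i \<and> l = i then 1 else 0 :: 'k"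
      note gi = GL_inv[OF SG[OF x]]
      have E: "to_mat ?e \<in> alg" using of_mat_unit[OF i] refl i to_mat_carrier by (auto simp: alg_def)
      have "inv\<^bsub>GL n\<^esub> x * to_mat ?e * x \<in> alg" using lie_Ad[OF sub _ x] E lie by blast
      moreover have "\<not> P k l" using k l trans[of k l j] by (auto simp: I0_def)
      ultimately have z: "of_mat (inv\<^bsub>GL n\<^esub> x * to_mat ?e * x) k l = 0" by (auto simp: alg_def)
      have "of_mat (inv\<^bsub>GL n\<^esub> x * to_mat ?e * x) k l = mprod I (mprod I (of_mat (inv\<^bsub>GL n\<^esub> x)) ?e) (of_mat x) k l"
        using gi to_mat_carrier of_mat_unit[OF i] by (simp add: of_mat_mult)
      also have "\<dots> = (\<Sum>b<n. if b = i then of_mat (inv\<^bsub>GL n\<^esub> x) k i * of_mat x i l else 0)"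
        unfolding mprod_def
      proof (rule sum.cong[OF HOL.refl])
        fix b assume "b \<in> I"
        have "(\<Sum>a<n. of_mat (inv\<^bsub>GL n\<^esub> x) k a * ?e a b) = (if b = i then of_mat (inv\<^bsub>GL n\<^esub> x) k i else 0)"
          using i by (simp add: if_distrib[of "\<lambda>u. _ * u"] cong: if_cong conj_cong)
        then show "(\<Sum>a<n. of_mat (inv\<^bsub>GL n\<^esub> x) k a * ?e a b) * of_mat x b l
            = (if b = i then of_mat (inv\<^bsub>GL n\<^esub> x) k i * of_mat x i l else 0)" by simp
      qed
      also have "\<dots> = of_mat (inv\<^bsub>GL n\<^esub> x) k i * of_mat x i l" using i by simp
      finally show ?thesis using z by simp
    qed
    have "S \<subseteq> C1 \<union> C2"
    proof
      fix x assume x: "x \<in> S"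
      show "x \<in> C1 \<union> C2"
      proof (rule ccontr)
        assume "x \<notin> C1 \<union> C2"
        then obtain l k where "l \<in> I0" "of_mat x i l \<noteq> 0" "k \<in> I - I0" "of_mat (inv\<^bsub>GL n\<^esub> x) k i \<noteq> 0"
          using C1[OF SG[OF x]] C2[OF SG[OF x]] by blast
        then show False using prod0[OF x] by auto
      qed
    qed
    moreover have "C1 \<inter> C2 \<inter> S = {}"
    proof (rule ccontr)
      assume "C1 \<inter> C2 \<inter> S \<noteq> {}"
      then obtain x where x: "x \<in> C1" "x \<in> C2" "x \<in> S" by blast
      note gi = GL_inv[OF SG[OF x(3)]]
      have "of_mat x i l * of_mat (inv\<^bsub>GL n\<^esub> x) l i = 0" if "l < n" for l
        using x(1,2) C1[OF SG[OF x(3)]] C2[OF SG[OF x(3)]] that by (cases "l \<in> I0") auto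
      then have "mprod I (of_mat x) (of_mat (inv\<^bsub>GL n\<^esub> x)) i i = 0" unfolding mprod_def by (intro sum.neutral) simp
      moreover have "mprod I (of_mat x) (of_mat (inv\<^bsub>GL n\<^esub> x)) = mone I"
        using of_mat_mult[OF gi(3,2)] gi(5) of_mat_one by simp
      ultimately show False using i by (simp add: mone_def)
    qed
    moreover have "1\<^sub>m n \<in> C1 \<inter> S"
    proof -
      have 1: "1\<^sub>m n \<in> S" using subgroup.one_closed[OF sub] by (simp add: GL_one)
      moreover have "of_mat (1\<^sub>m n) i l = 0" if "l \<in> I0" for l using that ij by (auto simp: of_mat_one mone_def I0_def)
      ultimately show ?thesis using C1[OF SG[OF 1]] by blast
    qed
    ultimately have "C2 \<inter> S = {}" using con C unfolding connectedin_closedin by blast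
    then have "u \<in> C1" using \<open>S \<subseteq> C1 \<union> C2\<close> u by blast
    moreover have "j \<in> I0" using j refl by (simp add: I0_def)
    ultimately show ?thesis using C1[OF SG[OF u]] by blast
  qed
  moreover have "of_mat u i j = 0" if "\<not> (i < n \<and> j < n)" for i j using that by (auto simp: of_mat_def)
  moreover have "u \<in> carrier_mat n n" using SG[OF u] GL_carrier by blast
  ultimately show ?thesis unfolding alg_def by blast
qed

theorem group_eq_units:
  assumes "connected_algebraic_subgroup n S" "lie_algebra n S = alg"
  shows "S = alg \<inter> carrier (GL n)"
proof
  have S: "algebraic_subgroup n S" using assms(1) by (simp add: connected_algebraic_subgroup_def)
  then have "subgroup S (GL n)" by (simp add: algebraic_subgroup_def)
  then show "S \<subseteq> alg \<inter> carrier (GL n)" using subset_units[OF assms] subgroup.subset by blast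
  show "alg \<inter> carrier (GL n) \<subseteq> S" using units_subset[OF S assms(2)] by blast
qed

end

lemma vspan_list:
  fixes vs :: "'k::field vec list"
  assumes "set vs \<subseteq> carrier_vec n"
  shows "v \<in> vspan n (set vs) \<longleftrightarrow> (\<exists>c. v = mat_of_cols n vs *\<^sub>v vec (length vs) c)"
proof -
  interpret vec_space "TYPE('k)" n .
  have d: "\<forall>w\<in>set vs. dim_vec w = n" using assms by auto
  show ?thesis unfolding span_list_as_span[OF assms, symmetric] span_list_def lincomb_list_as_mat_mult[OF d] by auto
qed

lemma ordered_basis_inverse:
  fixes es :: "'k::field vec list"
  assumes "is_ordered_basis n es"
  obtains Gi where "length es = n" "set es \<subseteq> carrier_vec n" "Gi \<in> carrier_mat n n"
    "mat_of_cols n es * Gi = 1\<^sub>m n" "Gi * mat_of_cols n es = 1\<^sub>m n"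
proof -
  interpret vec_space "TYPE('k)" n .
  have b: "distinct es" "basis (set es)" using assms by (auto simp: is_ordered_basis_def)
  have c: "set es \<subseteq> carrier_vec n" and s: "span (set es) = carrier_vec n" using b(2) by (auto simp: basis_def)
  have len: "length es = n" using dim_basis[OF _ b(2)] dim_is_n distinct_card[OF b(1)] by simp
  have M: "mat_of_cols n es \<in> carrier_mat n n" using len by auto
  have "\<exists>c. unit_vec n j = mat_of_cols n es *\<^sub>v vec n c" for j
    using vspan_list[OF c, of "unit_vec n j"] s len by simp
  then obtain c where c': "\<And>j. unit_vec n j = mat_of_cols n es *\<^sub>v vec n (c j)" by metis
  define Gi where "Gi = mat n n (\<lambda>(i, j). c j i)"
  have "mat_of_cols n es * Gi = 1\<^sub>m n"
  proof (rule eq_matI)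
    fix i j assume ij: "i < dim_row (1\<^sub>m n :: 'k mat)" "j < dim_col (1\<^sub>m n :: 'k mat)"
    have "col Gi j = vec n (c j)" using ij by (auto simp: Gi_def)
    then have "(mat_of_cols n es * Gi) $$ (i, j) = (mat_of_cols n es *\<^sub>v vec n (c j)) $ i"
      using ij len by (simp add: Gi_def)
    then show "(mat_of_cols n es * Gi) $$ (i, j) = 1\<^sub>m n $$ (i, j)" using ij unfolding c'[symmetric] by simp
  qed (auto simp: Gi_def)
  moreover have "Gi \<in> carrier_mat n n" by (simp add: Gi_def)
  ultimately show thesis using that len c mat_mult_left_right_inverse[OF M] by blast
qed

lemma vspan_segment:
  fixes es :: "'k::field vec list"
  assumes es: "length es = n" "set es \<subseteq> carrier_vec n" and al: "a + l \<le> n"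
    and Gi: "Gi \<in> carrier_mat n n" "mat_of_cols n es * Gi = 1\<^sub>m n" "Gi * mat_of_cols n es = 1\<^sub>m n"
  shows "v \<in> vspan n (set (take l (drop a es))) \<longleftrightarrow>
    v \<in> carrier_vec n \<and> (\<forall>i<n. i \<notin> {a..<a + l} \<longrightarrow> (Gi *\<^sub>v v) $ i = 0)"
proof -
  define G where "G = mat_of_cols n es"
  have G: "G \<in> carrier_mat n n" unfolding G_def using es(1) by auto
  let ?vs = "take l (drop a es)"
  have vs: "set ?vs \<subseteq> carrier_vec n" using es(2) by (meson order_trans set_drop_subset set_take_subset)
  have len: "length ?vs = l" using al es(1) by simp
  have e: "mat_of_cols n ?vs *\<^sub>v vec l c = G *\<^sub>v vec n (\<lambda>j. if j \<in> {a..<a + l} then c (j - a) else 0)" for c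
  proof (rule eq_vecI)
    fix i assume "i < dim_vec (G *\<^sub>v vec n (\<lambda>j. if j \<in> {a..<a + l} then c (j - a) else 0))"
    then have i: "i < n" using G by simp
    have "(mat_of_cols n ?vs *\<^sub>v vec l c) $ i = (\<Sum>j = 0..<l. es ! (a + j) $ i * c j)"
      using i len es(1) al by (auto simp: mat_of_cols_def scalar_prod_def intro!: sum.cong)
    also have "\<dots> = (\<Sum>j = a..<a + l. es ! j $ i * c (j - a))"
      using sum.shift_bounds_nat_ivl[of "\<lambda>j. es ! j $ i * c (j - a)" 0 a l] by (simp add: add.commute)
    also have "\<dots> = (\<Sum>j = 0..<n. es ! j $ i * (if j \<in> {a..<a + l} then c (j - a) else 0))"
      using al by (intro sum.mono_neutral_cong_left) auto
    also have "\<dots> = (G *\<^sub>v vec n (\<lambda>j. if j \<in> {a..<a + l} then c (j - a) else 0)) $ i"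
      using i es(1) by (auto simp: G_def mat_of_cols_def scalar_prod_def intro!: sum.cong)
    finally show "(mat_of_cols n ?vs *\<^sub>v vec l c) $ i = (G *\<^sub>v vec n (\<lambda>j. if j \<in> {a..<a + l} then c (j - a) else 0)) $ i" .
  qed (use G in auto)
  have cancel: "Gi *\<^sub>v (G *\<^sub>v w) = w" "G *\<^sub>v (Gi *\<^sub>v w) = w" if "w \<in> carrier_vec n" for w
    using assoc_mult_mat_vec[OF Gi(1) G that] assoc_mult_mat_vec[OF G Gi(1) that] Gi(2,3) that unfolding G_def by auto
  show ?thesis
  proof
    assume "v \<in> vspan n (set ?vs)"
    then obtain c where c: "v = G *\<^sub>v vec n (\<lambda>j. if j \<in> {a..<a + l} then c (j - a) else 0)"
      unfolding vspan_list[OF vs] len e by blast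
    then show "v \<in> carrier_vec n \<and> (\<forall>i<n. i \<notin> {a..<a + l} \<longrightarrow> (Gi *\<^sub>v v) $ i = 0)"
      unfolding c by (subst cancel(1)) (use G in auto)
  next
    assume *: "v \<in> carrier_vec n \<and> (\<forall>i<n. i \<notin> {a..<a + l} \<longrightarrow> (Gi *\<^sub>v v) $ i = 0)"
    have "vec n (\<lambda>j. if j \<in> {a..<a + l} then (Gi *\<^sub>v v) $ (j - a + a) else 0) = Gi *\<^sub>v v"
      using * Gi(1) by (intro eq_vecI) auto
    then have "mat_of_cols n ?vs *\<^sub>v vec l (\<lambda>j. (Gi *\<^sub>v v) $ (j + a)) = v"
      unfolding e using cancel(2)[of v] * by simp
    then show "v \<in> vspan n (set ?vs)" unfolding vspan_list[OF vs] len by metis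
  qed
qed

lemma (in based_algebra) preserves_segment:
  assumes A: "A \<in> carrier_mat n n" and al: "a + l \<le> n"
    and U: "U = {v \<in> carrier_vec n. \<forall>i<n. i \<notin> {a..<a + l} \<longrightarrow> (Gi *\<^sub>v v) $ i = 0}"
  shows "preserves A U \<longleftrightarrow> (\<forall>i j. of_mat A i j \<noteq> 0 \<longrightarrow> j \<in> {a..<a + l} \<longrightarrow> i \<in> {a..<a + l})"
proof -
  have e: "Gi *\<^sub>v (A *\<^sub>v v) = (Gi * A * G) *\<^sub>v (Gi *\<^sub>v v)" if v: "v \<in> carrier_vec n" for v
  proof -
    have "(Gi * A * G) *\<^sub>v (Gi *\<^sub>v v) = (Gi * A) *\<^sub>v (G *\<^sub>v (Gi *\<^sub>v v))"
      by (rule assoc_mult_mat_vec[OF mult_carrier_mat[OF G(2) A] G(1)]) (use G(2) v in auto)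
    also have "G *\<^sub>v (Gi *\<^sub>v v) = v" using assoc_mult_mat_vec[OF G(1,2) v] G(3) v by simp
    also have "(Gi * A) *\<^sub>v v = Gi *\<^sub>v (A *\<^sub>v v)" by (rule assoc_mult_mat_vec[OF G(2) A v])
    finally show ?thesis by simp
  qed
  have M: "Gi * A * G \<in> carrier_mat n n" using A G by (intro mult_carrier_mat)
  have ent: "(Gi *\<^sub>v (A *\<^sub>v v)) $ i = (\<Sum>j<n. of_mat A i j * (Gi *\<^sub>v v) $ j)" if "v \<in> carrier_vec n" "i < n" for v i
    unfolding e[OF that(1)] using M that G(2)
    by (auto simp: scalar_prod_def of_mat_def lessThan_atLeast0 intro!: sum.cong simp del: assoc_mult_mat)
  show ?thesis
  proof
    assume p: "preserves A U"
    show "\<forall>i j. of_mat A i j \<noteq> 0 \<longrightarrow> j \<in> {a..<a + l} \<longrightarrow> i \<in> {a..<a + l}"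
    proof (intro allI impI, rule ccontr)
      fix i j assume ij: "of_mat A i j \<noteq> 0" "j \<in> {a..<a + l}" "i \<notin> {a..<a + l}"
      then have l: "i < n" "j < n" by (auto simp: of_mat_def split: if_splits)
      define v where "v = G *\<^sub>v unit_vec n j"
      have v: "v \<in> carrier_vec n" unfolding v_def using G by auto
      have Gv: "Gi *\<^sub>v v = unit_vec n j"
        unfolding v_def using assoc_mult_mat_vec[OF G(2,1), of "unit_vec n j"] G(4) by simp
      have "v \<in> U" unfolding U using v Gv ij(2) l(2) by (auto simp: unit_vec_def)
      then have "A *\<^sub>v v \<in> U" using p by (simp add: preserves_def)
      then have "(Gi *\<^sub>v (A *\<^sub>v v)) $ i = 0" using ij(3) l unfolding U by simp
      moreover have "(Gi *\<^sub>v (A *\<^sub>v v)) $ i = of_mat A i j"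
        unfolding ent[OF v l(1)] Gv using l by (simp add: unit_vec_def if_distrib[of "times _"] cong: if_cong)
      ultimately show False using ij(1) by simp
    qed
  next
    assume *: "\<forall>i j. of_mat A i j \<noteq> 0 \<longrightarrow> j \<in> {a..<a + l} \<longrightarrow> i \<in> {a..<a + l}"
    show "preserves A U" unfolding preserves_def
    proof
      fix v assume "v \<in> U"
      then have v: "v \<in> carrier_vec n" "\<forall>i<n. i \<notin> {a..<a + l} \<longrightarrow> (Gi *\<^sub>v v) $ i = 0" unfolding U by auto
      have "(Gi *\<^sub>v (A *\<^sub>v v)) $ i = 0" if "i < n" "i \<notin> {a..<a + l}" for i
        unfolding ent[OF v(1) that(1)] using * v(2) that(2) by (intro sum.neutral) (metis lessThan_iff mult_eq_0_iff)
      then show "A *\<^sub>v v \<in> U" unfolding U using A v(1) by auto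
    qed
  qed
qed

definition ht :: "(nat \<Rightarrow> nat) \<Rightarrow> nat \<Rightarrow> nat \<Rightarrow> nat" where
  "ht s m i = card {k. k \<le> m \<and> s k \<le> i}"

lemma ht_mono: "i \<le> j \<Longrightarrow> ht s m i \<le> ht s m j"
  unfolding ht_def by (intro card_mono) auto

lemma ht_le_iff: "ht s m i \<le> ht s m j \<longleftrightarrow> (\<forall>k\<le>m. s k \<le> i \<longrightarrow> s k \<le> j)"
proof
  assume l: "ht s m i \<le> ht s m j"
  show "\<forall>k\<le>m. s k \<le> i \<longrightarrow> s k \<le> j"
  proof (cases "i \<le> j")
    case False
    then have "{k. k \<le> m \<and> s k \<le> j} = {k. k \<le> m \<and> s k \<le> i}"
      using l unfolding ht_def by (intro card_seteq) auto
    then show ?thesis by blast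
  qed auto
next
  assume "\<forall>k\<le>m. s k \<le> i \<longrightarrow> s k \<le> j"
  then show "ht s m i \<le> ht s m j" unfolding ht_def by (intro card_mono) auto
qed

lemma seaweed_based:
  fixes s :: "'k::field_char_0 mat set"
  assumes "is_seaweed n s"
  obtains G Gi \<alpha> \<beta> where "mono_on {..<n} \<alpha>" "mono_on {..<n} \<beta>"
    "based_algebra n G Gi (sw_rel {..<n} \<alpha> \<beta>)" "s = based_algebra.alg n G Gi (sw_rel {..<n} \<alpha> \<beta>)"
proof -
  obtain es a b where es: "is_ordered_basis n es" and a: "is_composition n a" and b: "is_composition n b"
    and s: "s = seaweed n es a b" using assms by (auto simp: is_seaweed_def)
  obtain Gi where Gi: "length es = n" "set es \<subseteq> carrier_vec n" "Gi \<in> carrier_mat n n"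
    "mat_of_cols n es * Gi = 1\<^sub>m n" "Gi * mat_of_cols n es = 1\<^sub>m n"
    using ordered_basis_inverse[OF es] by blast
  define \<alpha> where "\<alpha> = ht (\<lambda>k. sum_list (take k a)) (length a)"
  define \<beta> where "\<beta> = ht (\<lambda>k. sum_list (take k b)) (length b)"
  interpret based_algebra n "mat_of_cols n es" Gi "sw_rel {..<n} \<alpha> \<beta>"
    by (rule based_algebra.intro[OF _ Gi(3-5) preord_sw]) (use Gi(1) in auto)
  have part: "sum_list (take k a) \<le> n" if "is_composition n a" for a k
    using that sum_list_append[of "take k a" "drop k a"] by (simp add: is_composition_def)
  have U: "preserves A (vspan n (set (take l (drop p es)))) \<longleftrightarrow>
      (\<forall>i j. of_mat A i j \<noteq> 0 \<longrightarrow> j \<in> {p..<p + l} \<longrightarrow> i \<in> {p..<p + l})"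
    if "A \<in> carrier_mat n n" "p + l \<le> n" for A p l
    by (rule preserves_segment[OF that]) (use vspan_segment[OF Gi(1,2) that(2) Gi(3-5)] in auto)
  have "preserves A (vspan n (set (take (sum_list (take k a)) es))) \<longleftrightarrow>
      (\<forall>i j. of_mat A i j \<noteq> 0 \<longrightarrow> j < sum_list (take k a) \<longrightarrow> i < sum_list (take k a))"
    if "A \<in> carrier_mat n n" for A k
    using U[OF that, of 0 "sum_list (take k a)"] part[OF a] by simp
  moreover have "preserves A (vspan n (set (drop (sum_list (take k b)) es))) \<longleftrightarrow>
      (\<forall>i j. of_mat A i j \<noteq> 0 \<longrightarrow> sum_list (take k b) \<le> j \<longrightarrow> sum_list (take k b) \<le> i)"
    if "A \<in> carrier_mat n n" for A k
  proof -
    have l: "sum_list (take k b) + (n - sum_list (take k b)) = n" using part[OF b, of k] by simp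
    have d: "take (n - sum_list (take k b)) (drop (sum_list (take k b)) es) = drop (sum_list (take k b)) es"
      using Gi(1) by simp
    have ij: "i < n \<and> j < n" if "of_mat A i j \<noteq> 0" for i j using that by (auto simp: of_mat_def split: if_splits)
    show ?thesis
      using U[OF that, of "sum_list (take k b)" "n - sum_list (take k b)"] unfolding l d atLeastLessThan_iff using ij by blast
  qed
  ultimately have pr: "A \<in> s \<longleftrightarrow> A \<in> carrier_mat n n \<and>
      (\<forall>k\<le>length a. \<forall>i j. of_mat A i j \<noteq> 0 \<longrightarrow> j < sum_list (take k a) \<longrightarrow> i < sum_list (take k a)) \<and>
      (\<forall>k\<le>length b. \<forall>i j. of_mat A i j \<noteq> 0 \<longrightarrow> sum_list (take k b) \<le> j \<longrightarrow> sum_list (take k b) \<le> i)" for A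
    unfolding s seaweed_def by (simp cong: conj_cong)
  have "A \<in> alg \<longleftrightarrow> A \<in> carrier_mat n n \<and> (\<forall>i j. of_mat A i j \<noteq> 0 \<longrightarrow>
      (\<forall>k\<le>length a. sum_list (take k a) \<le> i \<longrightarrow> sum_list (take k a) \<le> j) \<and>
      (\<forall>k\<le>length b. sum_list (take k b) \<le> j \<longrightarrow> sum_list (take k b) \<le> i))" for A
  proof -
    have "of_mat A i j \<noteq> 0 \<Longrightarrow> i < n \<and> j < n" for i j by (auto simp: of_mat_def split: if_splits)
    then show ?thesis unfolding alg_def by (simp add: sw_rel_def \<alpha>_def \<beta>_def ht_le_iff)
  qed
  then have "A \<in> s \<longleftrightarrow> A \<in> alg" for A
    unfolding pr by (simp add: not_le[symmetric]) blast
  then have "s = alg" by blast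
  then show thesis using that[of \<alpha> \<beta>, OF _ _ based_algebra_axioms] ht_mono unfolding \<alpha>_def \<beta>_def mono_on_def by blast
qed

section \<open>Function fields\<close>

lemma poly_funs_irreducible:
  fixes f g :: "'x \<Rightarrow> 'k::field_char_0"
  assumes line: "\<And>x y. x \<in> X \<Longrightarrow> y \<in> X \<Longrightarrow>
      \<exists>z. z 0 = x \<and> z 1 = y \<and> (\<forall>s. z s \<in> X) \<and> (\<forall>h\<in>G. \<exists>p. \<forall>s. poly p s = h (z s))"
    and fg: "f \<in> poly_funs G" "g \<in> poly_funs G" "\<And>x. x \<in> X \<Longrightarrow> f x * g x = 0"
    and xy: "x \<in> X" "f x \<noteq> 0" "y \<in> X"
  shows "g y = 0"
proof -
  obtain z where z: "z 0 = x" "z 1 = y" "\<And>s. z s \<in> X" "\<forall>h\<in>G. \<exists>p. \<forall>s. poly p s = h (z s)"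
    using line[OF xy(1,3)] by blast
  obtain p where p: "\<forall>s. poly p s = f (z s)" using poly_funs_line[OF fg(1), of z] z(4) by blast
  obtain q where q: "\<forall>s. poly q s = g (z s)" using poly_funs_line[OF fg(2), of z] z(4) by blast
  have "poly (p * q) s = poly 0 s" for s using p q fg(3)[OF z(3)] by simp
  then have "p * q = 0" by (simp add: poly_eq_poly_eq_iff[symmetric] fun_eq_iff del: poly_mult)
  moreover have "p \<noteq> 0" using p z(1) xy(2) by (metis poly_0)
  ultimately have "q = 0" by simp
  then show ?thesis using q z(2) by (metis poly_0)
qed

locale irreducible =
  fixes X :: "'x set" and G :: "('x \<Rightarrow> 'k::field_char_0) set"
  assumes ne: "X \<noteq> {}"
    and irr: "f \<in> poly_funs G \<Longrightarrow> g \<in> poly_funs G \<Longrightarrow> (\<And>x. x \<in> X \<Longrightarrow> f x * g x = 0) \<Longrightarrow>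
      x \<in> X \<Longrightarrow> f x \<noteq> 0 \<Longrightarrow> y \<in> X \<Longrightarrow> g y = 0"
begin

text \<open>\<open>gen Q\<close> says that \<open>Q\<close> holds on a dense open subset.\<close>

definition gen :: "('x \<Rightarrow> bool) \<Rightarrow> bool" where
  "gen Q \<longleftrightarrow> (\<exists>e\<in>poly_funs G. (\<exists>x\<in>X. e x \<noteq> 0) \<and> (\<forall>x\<in>X. e x \<noteq> 0 \<longrightarrow> Q x))"

lemma gen_poly: "f \<in> poly_funs G \<Longrightarrow> x \<in> X \<Longrightarrow> f x \<noteq> 0 \<Longrightarrow> gen (\<lambda>x. f x \<noteq> 0)"
  unfolding gen_def by blast

lemma gen_mono: "gen Q \<Longrightarrow> (\<And>x. x \<in> X \<Longrightarrow> Q x \<Longrightarrow> Q' x) \<Longrightarrow> gen Q'"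
  unfolding gen_def by blast

lemma gen_all: "(\<And>x. x \<in> X \<Longrightarrow> Q x) \<Longrightarrow> gen Q"
  unfolding gen_def using ne by (intro bexI[OF _ poly_funs.const[of 1]]) auto

lemma gen_conj: "gen Q \<Longrightarrow> gen Q' \<Longrightarrow> gen (\<lambda>x. Q x \<and> Q' x)"
proof -
  assume "gen Q" "gen Q'"
  then obtain e e' x y where e: "e \<in> poly_funs G" "x \<in> X" "e x \<noteq> 0" "\<forall>x\<in>X. e x \<noteq> 0 \<longrightarrow> Q x"
    and e': "e' \<in> poly_funs G" "y \<in> X" "e' y \<noteq> 0" "\<forall>x\<in>X. e' x \<noteq> 0 \<longrightarrow> Q' x"
    unfolding gen_def by metis
  have "\<exists>z\<in>X. e z * e' z \<noteq> 0" using irr[OF e(1) e'(1) _ e(2,3) e'(2)] e'(3) by blast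
  then show ?thesis unfolding gen_def using e e'
    by (intro bexI[of _ "\<lambda>x. e x * e' x"] poly_funs.mult) auto
qed

lemma gen_ex: "gen Q \<Longrightarrow> \<exists>x\<in>X. Q x"
  unfolding gen_def by blast

lemma gen_elim2: "gen Q \<Longrightarrow> gen Q' \<Longrightarrow> (\<And>x. x \<in> X \<Longrightarrow> Q x \<Longrightarrow> Q' x \<Longrightarrow> Q'' x) \<Longrightarrow> gen Q''"
  using gen_mono[OF gen_conj, of Q Q' Q''] by blast

lemma gen_eq:
  assumes "f \<in> poly_funs G" "g \<in> poly_funs G" "gen (\<lambda>x. f x = g x)" "x \<in> X"
  shows "f x = g x"
proof -
  obtain e z where e: "e \<in> poly_funs G" "z \<in> X" "e z \<noteq> 0" "\<forall>x\<in>X. e x \<noteq> 0 \<longrightarrow> f x = g x"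
    using assms(3) unfolding gen_def by metis
  have "f x - g x = 0"
    by (rule irr[OF e(1) poly_funs_diff[OF assms(1,2)] _ e(2,3) assms(4)]) (use e(4) in auto)
  then show ?thesis by simp
qed

abbreviation "R \<equiv> coord_ring X G"
abbreviation "F \<equiv> function_field X G"

definition res :: "('x \<Rightarrow> 'k) \<Rightarrow> 'x \<Rightarrow> 'k" where "res f = restrict f X"

lemma R_simps: "carrier R = res ` poly_funs G"
  "res f \<otimes>\<^bsub>R\<^esub> res g = res (\<lambda>x. f x * g x)" "\<one>\<^bsub>R\<^esub> = res (\<lambda>x. 1)" "\<zero>\<^bsub>R\<^esub> = res (\<lambda>x. 0)"
  "res f \<oplus>\<^bsub>R\<^esub> res g = res (\<lambda>x. f x + g x)"
  by (auto simp: coord_ring_def res_def restrict_def fun_eq_iff)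

lemma res_eq: "res f = res g \<longleftrightarrow> (\<forall>x\<in>X. f x = g x)"
  by (auto simp: res_def restrict_def fun_eq_iff)

definition fr :: "('x \<Rightarrow> 'k) \<Rightarrow> ('x \<Rightarrow> 'k) \<Rightarrow> (('x \<Rightarrow> 'k) \<times> ('x \<Rightarrow> 'k)) set" where
  "fr p q = fraction R (res p) (res q)"

definition den :: "('x \<Rightarrow> 'k) \<Rightarrow> bool" where
  "den q \<longleftrightarrow> q \<in> poly_funs G \<and> (\<exists>x\<in>X. q x \<noteq> 0)"

lemma den_poly: "den q \<Longrightarrow> q \<in> poly_funs G"
  by (simp add: den_def)

lemma den_gen: "den q \<Longrightarrow> gen (\<lambda>x. q x \<noteq> 0)"
  unfolding den_def using gen_poly by blast

lemma den_mult: "den q \<Longrightarrow> den q' \<Longrightarrow> den (\<lambda>x. q x * q' x)"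
  using gen_ex[OF gen_conj[OF den_gen den_gen], of q q'] unfolding den_def by (auto intro: poly_funs.mult)

lemma den_one: "den (\<lambda>x. 1)"
  using ne by (auto simp: den_def intro: poly_funs.const)

lemma fr_mem: "(a, b) \<in> fr p q \<longleftrightarrow>
  (\<exists>a' b'. a = res a' \<and> b = res b' \<and> a' \<in> poly_funs G \<and> den b' \<and> (\<forall>x\<in>X. p x * b' x = a' x * q x))"
proof
  assume "(a, b) \<in> fr p q"
  then have *: "a \<in> carrier R" "b \<in> carrier R" "b \<noteq> \<zero>\<^bsub>R\<^esub>" "res p \<otimes>\<^bsub>R\<^esub> b = a \<otimes>\<^bsub>R\<^esub> res q"
    by (auto simp: fr_def fraction_def)
  then obtain a' b' where ab: "a = res a'" "b = res b'" "a' \<in> poly_funs G" "b' \<in> poly_funs G" by (auto simp: R_simps)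
  have "den b'" using *(3) ab by (auto simp: R_simps res_eq den_def)
  moreover have "\<forall>x\<in>X. p x * b' x = a' x * q x" using *(4) unfolding ab R_simps res_eq .
  ultimately show "\<exists>a' b'. a = res a' \<and> b = res b' \<and> a' \<in> poly_funs G \<and> den b' \<and> (\<forall>x\<in>X. p x * b' x = a' x * q x)"
    using ab by blast
next
  assume "\<exists>a' b'. a = res a' \<and> b = res b' \<and> a' \<in> poly_funs G \<and> den b' \<and> (\<forall>x\<in>X. p x * b' x = a' x * q x)"
  then obtain a' b' where ab: "a = res a'" "b = res b'" "a' \<in> poly_funs G" "den b'" "\<forall>x\<in>X. p x * b' x = a' x * q x" by blast
  then have "b \<noteq> \<zero>\<^bsub>R\<^esub>" by (auto simp: R_simps res_eq den_def)
  moreover have "res p \<otimes>\<^bsub>R\<^esub> b = a \<otimes>\<^bsub>R\<^esub> res q" using ab(5) unfolding ab R_simps res_eq .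
  ultimately show "(a, b) \<in> fr p q" using ab by (auto simp: fr_def fraction_def R_simps den_def)
qed

lemma fr_self: "p \<in> poly_funs G \<Longrightarrow> den q \<Longrightarrow> (res p, res q) \<in> fr p q"
  unfolding fr_mem by blast

lemma fr_eq:
  assumes "p \<in> poly_funs G" "den q" "p' \<in> poly_funs G" "den q'"
  shows "fr p q = fr p' q' \<longleftrightarrow> (\<forall>x\<in>X. p x * q' x = p' x * q x)"
proof
  assume "fr p q = fr p' q'"
  then have "(res p', res q') \<in> fr p q" using fr_self[OF assms(3,4)] by simp
  then obtain a b where "res p' = res a" "res q' = res b" "\<forall>x\<in>X. p x * b x = a x * q x" unfolding fr_mem by blast
  then show "\<forall>x\<in>X. p x * q' x = p' x * q x" by (simp add: res_eq)
next
  assume e: "\<forall>x\<in>X. p x * q' x = p' x * q x"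
  have sub: "(\<forall>x\<in>X. p' x * b x = a x * q' x)"
    if "p \<in> poly_funs G" "den q" "p' \<in> poly_funs G" "den q'" "\<forall>x\<in>X. p x * q' x = p' x * q x"
      "a \<in> poly_funs G" "den b" "\<forall>x\<in>X. p x * b x = a x * q x" for p q p' q' a b
  proof -
    have "gen (\<lambda>x. p' x * b x = a x * q' x)"
    proof (rule gen_mono[OF den_gen[OF that(2)]])
      fix x assume x: "x \<in> X" "q x \<noteq> 0"
      have "q x * (p' x * b x) = (p' x * q x) * b x" by (simp add: ac_simps)
      also have "\<dots> = (p x * b x) * q' x" using that(5) x by (metis mult.commute mult.left_commute)
      also have "\<dots> = (a x * q x) * q' x" using that(8) x by simp
      finally have "q x * (p' x * b x) = q x * (a x * q' x)" by (simp add: ac_simps)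
      then show "p' x * b x = a x * q' x" using x(2) by simp
    qed
    then show ?thesis using gen_eq[OF poly_funs.mult poly_funs.mult] that den_poly by blast
  qed
  have e': "\<forall>x\<in>X. p' x * q x = p x * q' x" using e by simp
  show "fr p q = fr p' q'"
  proof (intro equalityI subrelI)
    fix a b assume "(a, b) \<in> fr p q"
    then obtain a' b' where "a = res a'" "b = res b'" "a' \<in> poly_funs G" "den b'" "\<forall>x\<in>X. p x * b' x = a' x * q x"
      unfolding fr_mem by blast
    moreover from sub[OF assms e this(3-5)] have "\<forall>x\<in>X. p' x * b' x = a' x * q' x" .
    ultimately show "(a, b) \<in> fr p' q'" unfolding fr_mem by blast
  next
    fix a b assume "(a, b) \<in> fr p' q'"
    then obtain a' b' where "a = res a'" "b = res b'" "a' \<in> poly_funs G" "den b'" "\<forall>x\<in>X. p' x * b' x = a' x * q' x"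
      unfolding fr_mem by blast
    moreover from sub[OF assms(3,4,1,2) e' this(3-5)] have "\<forall>x\<in>X. p x * b' x = a' x * q x" .
    ultimately show "(a, b) \<in> fr p q" unfolding fr_mem by blast
  qed
qed

lemma F_carrier: "w \<in> carrier F \<longleftrightarrow> (\<exists>p q. p \<in> poly_funs G \<and> den q \<and> w = fr p q)"
proof -
  have "carrier F = {fraction R p q | p q. p \<in> carrier R \<and> q \<in> carrier R - {\<zero>\<^bsub>R\<^esub>}}"
    by (simp add: fraction_field_def)
  also have "\<dots> = {fr p q | p q. p \<in> poly_funs G \<and> den q}"
  proof (intro subset_antisym subsetI)
    fix w assume "w \<in> {fraction R p q | p q. p \<in> carrier R \<and> q \<in> carrier R - {\<zero>\<^bsub>R\<^esub>}}"
    then obtain p q where pq: "w = fraction R p q" "p \<in> carrier R" "q \<in> carrier R" "q \<noteq> \<zero>\<^bsub>R\<^esub>" by blast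
    then obtain p' q' where "p = res p'" "q = res q'" "p' \<in> poly_funs G" "q' \<in> poly_funs G" by (auto simp: R_simps)
    moreover from this have "den q'" using pq(4) by (auto simp: R_simps res_eq den_def)
    ultimately show "w \<in> {fr p q | p q. p \<in> poly_funs G \<and> den q}" using pq(1) unfolding fr_def by blast
  next
    fix w assume "w \<in> {fr p q | p q. p \<in> poly_funs G \<and> den q}"
    then obtain p q where pq: "w = fr p q" "p \<in> poly_funs G" "den q" by blast
    then have "res q \<noteq> \<zero>\<^bsub>R\<^esub>" by (auto simp: R_simps res_eq den_def)
    moreover have "res p \<in> carrier R" "res q \<in> carrier R" using pq den_poly by (auto simp: R_simps)
    ultimately show "w \<in> {fraction R p q | p q. p \<in> carrier R \<and> q \<in> carrier R - {\<zero>\<^bsub>R\<^esub>}}"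
      using pq(1) unfolding fr_def by blast
  qed
  finally show ?thesis by blast
qed

lemma F_mult:
  assumes "p \<in> poly_funs G" "den q" "p' \<in> poly_funs G" "den q'"
  shows "fr p q \<otimes>\<^bsub>F\<^esub> fr p' q' = fr (\<lambda>x. p x * p' x) (\<lambda>x. q x * q' x)"
proof -
  have c: "fraction R (fst z \<otimes>\<^bsub>R\<^esub> fst z') (snd z \<otimes>\<^bsub>R\<^esub> snd z') = fr (\<lambda>x. p x * p' x) (\<lambda>x. q x * q' x)"
    if z: "z \<in> fr p q" "z' \<in> fr p' q'" for z z'
  proof -
    obtain a b where ab: "z = (res a, res b)" "a \<in> poly_funs G" "den b" "\<forall>x\<in>X. p x * b x = a x * q x"
      using z(1) fr_mem[of "fst z" "snd z" p q] by (metis prod.collapse)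
    obtain a' b' where ab': "z' = (res a', res b')" "a' \<in> poly_funs G" "den b'" "\<forall>x\<in>X. p' x * b' x = a' x * q' x"
      using z(2) fr_mem[of "fst z'" "snd z'" p' q'] by (metis prod.collapse)
    have "fr (\<lambda>x. a x * a' x) (\<lambda>x. b x * b' x) = fr (\<lambda>x. p x * p' x) (\<lambda>x. q x * q' x)"
    proof (subst fr_eq)
      show "\<forall>x\<in>X. a x * a' x * (q x * q' x) = p x * p' x * (b x * b' x)"
        using ab(4) ab'(4) by (metis (no_types, lifting) mult.assoc mult.left_commute)
    qed (use ab ab' assms in \<open>auto intro: poly_funs.mult den_mult\<close>)
    then show ?thesis unfolding ab ab' by (simp add: R_simps fr_def)
  qed
  have ne: "fr p q \<noteq> {}" "fr p' q' \<noteq> {}" using fr_self[OF assms(1,2)] fr_self[OF assms(3,4)] by blast+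
  have "fr p q \<otimes>\<^bsub>F\<^esub> fr p' q' = (\<Union>z\<in>fr p q. \<Union>z'\<in>fr p' q'. fraction R (fst z \<otimes>\<^bsub>R\<^esub> fst z') (snd z \<otimes>\<^bsub>R\<^esub> snd z'))"
    by (simp add: fraction_field_def case_prod_unfold)
  also have "\<dots> = (\<Union>z\<in>fr p q. \<Union>z'\<in>fr p' q'. fr (\<lambda>x. p x * p' x) (\<lambda>x. q x * q' x))"
    using c by simp
  finally show ?thesis using ne by simp
qed

lemma F_add:
  assumes "p \<in> poly_funs G" "den q" "p' \<in> poly_funs G" "den q'"
  shows "fr p q \<oplus>\<^bsub>F\<^esub> fr p' q' = fr (\<lambda>x. p x * q' x + p' x * q x) (\<lambda>x. q x * q' x)"
proof -
  have c: "fraction R (fst z \<otimes>\<^bsub>R\<^esub> snd z' \<oplus>\<^bsub>R\<^esub> fst z' \<otimes>\<^bsub>R\<^esub> snd z) (snd z \<otimes>\<^bsub>R\<^esub> snd z')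
      = fr (\<lambda>x. p x * q' x + p' x * q x) (\<lambda>x. q x * q' x)"
    if z: "z \<in> fr p q" "z' \<in> fr p' q'" for z z'
  proof -
    obtain a b where ab: "z = (res a, res b)" "a \<in> poly_funs G" "den b" "\<forall>x\<in>X. p x * b x = a x * q x"
      using z(1) fr_mem[of "fst z" "snd z" p q] by (metis prod.collapse)
    obtain a' b' where ab': "z' = (res a', res b')" "a' \<in> poly_funs G" "den b'" "\<forall>x\<in>X. p' x * b' x = a' x * q' x"
      using z(2) fr_mem[of "fst z'" "snd z'" p' q'] by (metis prod.collapse)
    have "fr (\<lambda>x. a x * b' x + a' x * b x) (\<lambda>x. b x * b' x) = fr (\<lambda>x. p x * q' x + p' x * q x) (\<lambda>x. q x * q' x)"
    proof (subst fr_eq)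
      show "\<forall>x\<in>X. (a x * b' x + a' x * b x) * (q x * q' x) = (p x * q' x + p' x * q x) * (b x * b' x)"
      proof
        fix x assume x: "x \<in> X"
        have "(a x * b' x + a' x * b x) * (q x * q' x) = (a x * q x) * (b' x * q' x) + (a' x * q' x) * (b x * q x)"
          by (simp add: algebra_simps)
        also have "\<dots> = (p x * b x) * (b' x * q' x) + (p' x * b' x) * (b x * q x)" using ab(4) ab'(4) x by simp
        finally show "(a x * b' x + a' x * b x) * (q x * q' x) = (p x * q' x + p' x * q x) * (b x * b' x)"
          by (simp add: algebra_simps)
      qed
    qed (use ab ab' assms den_poly in \<open>auto intro!: poly_funs.add poly_funs.mult den_mult\<close>)
    then show ?thesis unfolding ab ab' by (simp add: R_simps fr_def)
  qed
  have ne: "fr p q \<noteq> {}" "fr p' q' \<noteq> {}" using fr_self[OF assms(1,2)] fr_self[OF assms(3,4)] by blast+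
  have "fr p q \<oplus>\<^bsub>F\<^esub> fr p' q' = (\<Union>z\<in>fr p q. \<Union>z'\<in>fr p' q'.
      fraction R (fst z \<otimes>\<^bsub>R\<^esub> snd z' \<oplus>\<^bsub>R\<^esub> fst z' \<otimes>\<^bsub>R\<^esub> snd z) (snd z \<otimes>\<^bsub>R\<^esub> snd z'))"
    by (simp add: fraction_field_def case_prod_unfold)
  also have "\<dots> = (\<Union>z\<in>fr p q. \<Union>z'\<in>fr p' q'. fr (\<lambda>x. p x * q' x + p' x * q x) (\<lambda>x. q x * q' x))"
    using c by simp
  finally show ?thesis using ne by simp
qed

text \<open>\<open>rep w f\<close> says that the rational function \<open>w\<close> takes the value \<open>f x\<close> at generic points; identities
  in the function field thus reduce to identities in the ground field.\<close>

definition rep :: "(('x \<Rightarrow> 'k) \<times> ('x \<Rightarrow> 'k)) set \<Rightarrow> ('x \<Rightarrow> 'k) \<Rightarrow> bool" where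
  "rep w f \<longleftrightarrow> (\<exists>p q. p \<in> poly_funs G \<and> den q \<and> w = fr p q \<and> gen (\<lambda>x. f x = p x / q x))"

lemma rep_fr: "p \<in> poly_funs G \<Longrightarrow> den q \<Longrightarrow> rep (fr p q) (\<lambda>x. p x / q x)"
  unfolding rep_def by (rule exI[of _ p], rule exI[of _ q]) (simp add: gen_all)

lemma rep_closed: "rep w f \<Longrightarrow> w \<in> carrier F"
  unfolding rep_def F_carrier by blast

lemma rep_ex: "w \<in> carrier F \<Longrightarrow> \<exists>f. rep w f"
  using rep_fr unfolding F_carrier by blast

lemma rep_eqD:
  assumes "rep w f" "rep w g" shows "gen (\<lambda>x. f x = g x)"
proof -
  obtain p q where p: "p \<in> poly_funs G" "den q" "w = fr p q" "gen (\<lambda>x. f x = p x / q x)" using assms(1) unfolding rep_def by blast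
  obtain p' q' where p': "p' \<in> poly_funs G" "den q'" "w = fr p' q'" "gen (\<lambda>x. g x = p' x / q' x)" using assms(2) unfolding rep_def by blast
  have e: "\<forall>x\<in>X. p x * q' x = p' x * q x" using fr_eq[OF p(1,2) p'(1,2)] p(3) p'(3) by simp
  have "gen (\<lambda>x. q x \<noteq> 0 \<and> q' x \<noteq> 0)" using gen_conj[OF den_gen[OF p(2)] den_gen[OF p'(2)]] .
  with gen_conj[OF p(4) p'(4)] show ?thesis
    by (rule gen_elim2) (use e in \<open>auto simp: frac_eq_eq\<close>)
qed

lemma rep_eqI:
  assumes "rep w f" "rep w' g" "gen (\<lambda>x. f x = g x)" shows "w = w'"
proof -
  obtain p q where p: "p \<in> poly_funs G" "den q" "w = fr p q" "gen (\<lambda>x. f x = p x / q x)" using assms(1) unfolding rep_def by blast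
  obtain p' q' where p': "p' \<in> poly_funs G" "den q'" "w' = fr p' q'" "gen (\<lambda>x. g x = p' x / q' x)" using assms(2) unfolding rep_def by blast
  have "gen (\<lambda>x. p x / q x = p' x / q' x)"
    by (rule gen_elim2[OF gen_conj[OF p(4) p'(4)] assms(3)]) auto
  then have "gen (\<lambda>x. p x * q' x = p' x * q x)"
    by (rule gen_elim2[OF gen_conj[OF den_gen[OF p(2)] den_gen[OF p'(2)]]]) (auto simp: frac_eq_eq)
  then have "p x * q' x = p' x * q x" if "x \<in> X" for x
    using gen_eq[OF poly_funs.mult[OF p(1) den_poly[OF p'(2)]] poly_funs.mult[OF p'(1) den_poly[OF p(2)]] _ that] by blast
  then show ?thesis using fr_eq[OF p(1,2) p'(1,2)] p(3) p'(3) by simp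
qed

lemma rep_cong: "rep w f \<Longrightarrow> gen (\<lambda>x. g x = f x) \<Longrightarrow> rep w g"
  unfolding rep_def using gen_elim2[of "\<lambda>x. g x = f x"] by (metis (mono_tags, lifting))

lemma rep_mult:
  assumes "rep w f" "rep w' g" shows "rep (w \<otimes>\<^bsub>F\<^esub> w') (\<lambda>x. f x * g x)"
proof -
  obtain p q where p: "p \<in> poly_funs G" "den q" "w = fr p q" "gen (\<lambda>x. f x = p x / q x)" using assms(1) unfolding rep_def by blast
  obtain p' q' where p': "p' \<in> poly_funs G" "den q'" "w' = fr p' q'" "gen (\<lambda>x. g x = p' x / q' x)" using assms(2) unfolding rep_def by blast
  have "gen (\<lambda>x. f x * g x = (p x * p' x) / (q x * q' x))"
    by (rule gen_elim2[OF p(4) p'(4)]) simp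
  then show ?thesis unfolding rep_def p(3) p'(3) F_mult[OF p(1,2) p'(1,2)]
    using poly_funs.mult[OF p(1) p'(1)] den_mult[OF p(2) p'(2)] by blast
qed

lemma rep_add:
  assumes "rep w f" "rep w' g" shows "rep (w \<oplus>\<^bsub>F\<^esub> w') (\<lambda>x. f x + g x)"
proof -
  obtain p q where p: "p \<in> poly_funs G" "den q" "w = fr p q" "gen (\<lambda>x. f x = p x / q x)" using assms(1) unfolding rep_def by blast
  obtain p' q' where p': "p' \<in> poly_funs G" "den q'" "w' = fr p' q'" "gen (\<lambda>x. g x = p' x / q' x)" using assms(2) unfolding rep_def by blast
  have "gen (\<lambda>x. f x + g x = (p x * q' x + p' x * q x) / (q x * q' x))"
    by (rule gen_elim2[OF gen_conj[OF p(4) p'(4)] gen_conj[OF den_gen[OF p(2)] den_gen[OF p'(2)]]])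
      (simp add: add_frac_eq)
  moreover have "(\<lambda>x. p x * q' x + p' x * q x) \<in> poly_funs G"
    using p p' den_poly by (intro poly_funs.add poly_funs.mult) auto
  ultimately show ?thesis unfolding rep_def p(3) p'(3) F_add[OF p(1,2) p'(1,2)]
    using den_mult[OF p(2) p'(2)] by blast
qed

lemma rep_const: "rep (fr (\<lambda>_. c) (\<lambda>_. 1)) (\<lambda>_. c)"
  using rep_fr[OF poly_funs.const den_one, of c] by simp

lemma rep_zero: "rep \<zero>\<^bsub>F\<^esub> (\<lambda>_. 0)"
proof -
  have "\<zero>\<^bsub>F\<^esub> = fr (\<lambda>_. 0) (\<lambda>_. 1)" by (simp add: fraction_field_def fr_def R_simps)
  then show ?thesis using rep_const[of 0] by simp
qed

lemma rep_one: "rep \<one>\<^bsub>F\<^esub> (\<lambda>_. 1)"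
proof -
  have "\<one>\<^bsub>F\<^esub> = fr (\<lambda>_. 1) (\<lambda>_. 1)" by (simp add: fraction_field_def fr_def R_simps)
  then show ?thesis using rep_const[of 1] by simp
qed

lemma rep_minus:
  assumes "rep w f" shows "\<exists>w'. rep w' (\<lambda>x. - f x)"
proof -
  obtain p q where p: "p \<in> poly_funs G" "den q" "w = fr p q" "gen (\<lambda>x. f x = p x / q x)" using assms(1) unfolding rep_def by blast
  have "gen (\<lambda>x. - f x = - p x / q x)" by (rule gen_mono[OF p(4)]) simp
  then show ?thesis unfolding rep_def using poly_funs_minus[OF p(1)] p(2) by blast
qed

lemma rep_nonzero:
  assumes "rep w f" "w \<noteq> \<zero>\<^bsub>F\<^esub>" shows "gen (\<lambda>x. f x \<noteq> 0)"
proof -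
  obtain p q where p: "p \<in> poly_funs G" "den q" "w = fr p q" "gen (\<lambda>x. f x = p x / q x)" using assms(1) unfolding rep_def by blast
  have "\<exists>x\<in>X. p x \<noteq> 0"
  proof (rule ccontr)
    assume "\<not> ?thesis"
    then have "gen (\<lambda>x. f x = 0)" using gen_mono[OF p(4)] by simp
    then show False using rep_eqI[OF assms(1) rep_zero] assms(2) by blast
  qed
  then have "gen (\<lambda>x. p x \<noteq> 0)" using gen_poly[OF p(1)] by blast
  then have "gen (\<lambda>x. p x \<noteq> 0 \<and> q x \<noteq> 0)" using gen_conj den_gen[OF p(2)] by blast
  then show ?thesis by (rule gen_elim2[OF p(4)]) simp
qed

lemma rep_inverse:
  assumes "rep w f" "w \<noteq> \<zero>\<^bsub>F\<^esub>"
  obtains w' where "rep w' (\<lambda>x. 1 / f x)" "w \<otimes>\<^bsub>F\<^esub> w' = \<one>\<^bsub>F\<^esub>"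
proof -
  obtain p q where p: "p \<in> poly_funs G" "den q" "w = fr p q" "gen (\<lambda>x. f x = p x / q x)" using assms(1) unfolding rep_def by blast
  have nz: "gen (\<lambda>x. f x \<noteq> 0)" by (rule rep_nonzero[OF assms])
  then have "gen (\<lambda>x. p x \<noteq> 0)" by (rule gen_elim2[OF p(4)]) auto
  then have dp: "den p" using p(1) gen_ex unfolding den_def by blast
  have "gen (\<lambda>x. 1 / f x = q x / p x)" by (rule gen_mono[OF p(4)]) simp
  then have r: "rep (fr q p) (\<lambda>x. 1 / f x)" unfolding rep_def using dp p(2) den_poly by blast
  have "w \<otimes>\<^bsub>F\<^esub> fr q p = \<one>\<^bsub>F\<^esub>"
    by (rule rep_eqI[OF rep_mult[OF assms(1) r] rep_one]) (rule gen_mono[OF nz], simp)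
  then show thesis using that r by blast
qed

lemma F_field: "field F"
proof -
  have eq: "w = w'" if "rep w f" "rep w' f" for w w' f by (rule rep_eqI[OF that gen_all]) simp
  interpret cring F
  proof (intro cringI abelian_groupI comm_monoidI)
    fix x y z assume "x \<in> carrier F" "y \<in> carrier F" "z \<in> carrier F"
    then obtain f g h where r: "rep x f" "rep y g" "rep z h" using rep_ex by metis
    note [intro] = rep_mult rep_add rep_zero rep_one r
    show "x \<oplus>\<^bsub>F\<^esub> y \<oplus>\<^bsub>F\<^esub> z = x \<oplus>\<^bsub>F\<^esub> (y \<oplus>\<^bsub>F\<^esub> z)"
      using eq[OF rep_add[OF rep_add[OF r(1,2)] r(3)], of "x \<oplus>\<^bsub>F\<^esub> (y \<oplus>\<^bsub>F\<^esub> z)"] rep_add[OF r(1) rep_add[OF r(2,3)]]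
      by (simp add: add.assoc)
    show "x \<otimes>\<^bsub>F\<^esub> y \<otimes>\<^bsub>F\<^esub> z = x \<otimes>\<^bsub>F\<^esub> (y \<otimes>\<^bsub>F\<^esub> z)"
      using eq[OF rep_mult[OF rep_mult[OF r(1,2)] r(3)], of "x \<otimes>\<^bsub>F\<^esub> (y \<otimes>\<^bsub>F\<^esub> z)"] rep_mult[OF r(1) rep_mult[OF r(2,3)]]
      by (simp add: mult.assoc)
    show "(x \<oplus>\<^bsub>F\<^esub> y) \<otimes>\<^bsub>F\<^esub> z = x \<otimes>\<^bsub>F\<^esub> z \<oplus>\<^bsub>F\<^esub> y \<otimes>\<^bsub>F\<^esub> z"
      using eq[OF rep_mult[OF rep_add[OF r(1,2)] r(3)], of "x \<otimes>\<^bsub>F\<^esub> z \<oplus>\<^bsub>F\<^esub> y \<otimes>\<^bsub>F\<^esub> z"]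
        rep_add[OF rep_mult[OF r(1,3)] rep_mult[OF r(2,3)]]
      by (simp add: distrib_right)
  next
    fix x y assume "x \<in> carrier F" "y \<in> carrier F"
    then obtain f g where r: "rep x f" "rep y g" using rep_ex by metis
    show "x \<oplus>\<^bsub>F\<^esub> y \<in> carrier F" "x \<otimes>\<^bsub>F\<^esub> y \<in> carrier F"
      using rep_closed[OF rep_add[OF r]] rep_closed[OF rep_mult[OF r]] by auto
    show "x \<oplus>\<^bsub>F\<^esub> y = y \<oplus>\<^bsub>F\<^esub> x"
      using eq[OF rep_add[OF r], of "y \<oplus>\<^bsub>F\<^esub> x"] rep_add[OF r(2,1)] by (simp add: add.commute)
    show "x \<otimes>\<^bsub>F\<^esub> y = y \<otimes>\<^bsub>F\<^esub> x"
      using eq[OF rep_mult[OF r], of "y \<otimes>\<^bsub>F\<^esub> x"] rep_mult[OF r(2,1)] by (simp add: mult.commute)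
  next
    fix x assume "x \<in> carrier F"
    then obtain f where r: "rep x f" using rep_ex by metis
    show "\<zero>\<^bsub>F\<^esub> \<oplus>\<^bsub>F\<^esub> x = x" using eq[OF rep_add[OF rep_zero r], of x] r by simp
    show "\<one>\<^bsub>F\<^esub> \<otimes>\<^bsub>F\<^esub> x = x" using eq[OF rep_mult[OF rep_one r], of x] r by simp
    obtain y where y: "rep y (\<lambda>x. - f x)" using rep_minus[OF r] by blast
    have "y \<oplus>\<^bsub>F\<^esub> x = \<zero>\<^bsub>F\<^esub>" using eq[OF rep_add[OF y r], of "\<zero>\<^bsub>F\<^esub>"] rep_zero by simp
    then show "\<exists>y\<in>carrier F. y \<oplus>\<^bsub>F\<^esub> x = \<zero>\<^bsub>F\<^esub>" using rep_closed[OF y] by blast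
  qed (use rep_closed[OF rep_zero] rep_closed[OF rep_one] in auto)
  show ?thesis
  proof (rule cring_fieldI2)
    show "\<zero>\<^bsub>F\<^esub> \<noteq> \<one>\<^bsub>F\<^esub>"
    proof
      assume "\<zero>\<^bsub>F\<^esub> = \<one>\<^bsub>F\<^esub>"
      then have "gen (\<lambda>x. (0::'k) = 1)" using rep_eqD[OF rep_zero, of "\<lambda>_. 1"] rep_one by simp
      then show False by (drule_tac gen_ex) simp
    qed
    fix a assume a: "a \<in> carrier F" "a \<noteq> \<zero>\<^bsub>F\<^esub>"
    then obtain f where r: "rep a f" using rep_ex by metis
    obtain w where "rep w (\<lambda>x. 1 / f x)" "a \<otimes>\<^bsub>F\<^esub> w = \<one>\<^bsub>F\<^esub>" by (rule rep_inverse[OF r a(2)])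
    then show "\<exists>b\<in>carrier F. a \<otimes>\<^bsub>F\<^esub> b = \<one>\<^bsub>F\<^esub>" using rep_closed by blast
  qed
qed

end

section \<open>Rational invariants\<close>

lemma independent_monomials:
  fixes \<gamma> :: "'m \<Rightarrow> 'k::{field, ring_char_0}"
  assumes "finite B" "finite M" "\<And>m m'. m \<in> M \<Longrightarrow> m' \<in> M \<Longrightarrow> m \<noteq> m' \<Longrightarrow> \<exists>b\<in>B. e m b \<noteq> (e m' b :: nat)"
    and "\<And>t. (\<Sum>m\<in>M. \<gamma> m * (\<Prod>b\<in>B. t b ^ e m b)) = 0" and "m \<in> M"
  shows "\<gamma> m = 0"
  using assms
proof (induction B arbitrary: M m rule: finite_induct)
  case empty
  then have "M = {m}" by blast
  then show ?case using empty.prems(3) by simp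
next
  case (insert b B)
  define M' where "M' = {m'\<in>M. e m' b = e m b}"
  show ?case
  proof (rule insert.IH[of M'])
    show "finite M'" "m \<in> M'" using insert.prems by (auto simp: M'_def)
  next
    fix k l assume kl: "k \<in> M'" "l \<in> M'" "k \<noteq> l"
    then obtain b' where "b' \<in> insert b B" "e k b' \<noteq> e l b'" using insert.prems(2) unfolding M'_def by blast
    then show "\<exists>b\<in>B. e k b \<noteq> e l b" using kl unfolding M'_def by auto
  next
    fix t :: "'a \<Rightarrow> 'k"
    define f where "f k = \<gamma> k * (\<Prod>b\<in>B. t b ^ e k b)" for k
    define q where "q = (\<Sum>k\<in>M. monom (f k) (e k b))"
    have "poly q z = 0" for z
    proof -
      have "(\<Prod>b'\<in>B. (t(b := z)) b' ^ e k b') = (\<Prod>b\<in>B. t b ^ e k b)" for k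
        using insert.hyps(2) by (intro prod.cong) auto
      then have "\<gamma> k * (\<Prod>b'\<in>insert b B. (t(b := z)) b' ^ e k b') = poly (monom (f k) (e k b)) z" for k
        using insert.hyps by (simp add: poly_monom f_def)
      then show ?thesis using insert.prems(3)[of "t(b := z)"] by (simp add: q_def poly_sum)
    qed
    then have "q = 0" by (simp add: poly_eq_poly_eq_iff[symmetric] fun_eq_iff)
    then have "(\<Sum>k\<in>M. if e k b = e m b then f k else 0) = 0"
      using arg_cong[of q 0 "\<lambda>q. coeff q (e m b)"] unfolding q_def coeff_sum by simp
    then show "(\<Sum>k\<in>M'. \<gamma> k * (\<Prod>b\<in>B. t b ^ e k b)) = 0"
      using insert.prems(1) unfolding M'_def f_def by (simp add: sum.If_cases Int_def)
  qed
qed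

lemma tcoords_irreducible:
  fixes f g :: "('j \<Rightarrow> 'k::field_char_0) \<Rightarrow> 'k"
  assumes "f \<in> poly_funs tcoords" "g \<in> poly_funs tcoords" "\<And>t. f t * g t = 0" "f u \<noteq> 0"
  shows "g t = 0"
proof (rule poly_funs_irreducible[of UNIV tcoords f g u])
  fix x y :: "'j \<Rightarrow> 'k"
  have "\<exists>p. \<forall>s. poly p s = x j + s * (y j - x j)" for j
    by (rule exI[of _ "[:x j, y j - x j:]"]) simp
  then show "\<exists>z. z 0 = x \<and> z 1 = y \<and> (\<forall>s. z s \<in> UNIV) \<and> (\<forall>h\<in>tcoords. \<exists>p. \<forall>s. poly p s = h (z s))"
    by (intro exI[of _ "\<lambda>s j. x j + s * (y j - x j)"]) (auto simp: tcoords_def)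
qed (use assms in auto)

locale rational_quotient = irreducible X G
  for X :: "'x set" and G :: "('x \<Rightarrow> 'k::field_char_0) set" +
  fixes A :: "('x \<Rightarrow> 'x) set" and D :: "'x \<Rightarrow> 'k" and J :: "'j set"
    and \<sigma> :: "('j \<Rightarrow> 'k) \<Rightarrow> 'x" and r :: "'x \<Rightarrow> 'j \<Rightarrow> 'k"
  assumes A_closed: "a \<in> A \<Longrightarrow> x \<in> X \<Longrightarrow> a x \<in> X"
    and A_poly: "a \<in> A \<Longrightarrow> g \<in> G \<Longrightarrow> \<exists>h\<in>poly_funs G. \<forall>x\<in>X. h x = g (a x)"
    and A_inv: "a \<in> A \<Longrightarrow> \<exists>b\<in>A. \<forall>x\<in>X. a (b x) = x \<and> b (a x) = x"
    and A_comp: "a \<in> A \<Longrightarrow> b \<in> A \<Longrightarrow> \<exists>c\<in>A. \<forall>x\<in>X. c x = a (b x)"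
    and J: "finite J"
    and D_poly: "D \<in> poly_funs G"
    and \<sigma>_X: "\<sigma> t \<in> X"
    and \<sigma>_poly: "g \<in> G \<Longrightarrow> (\<lambda>t. g (\<sigma> t)) \<in> poly_funs tcoords"
    and \<sigma>_cong: "(\<And>j. j \<in> J \<Longrightarrow> t j = t' j) \<Longrightarrow> \<sigma> t = \<sigma> t'"
    and D_nonzero: "\<exists>t. D (\<sigma> t) \<noteq> 0"
    and r_frac: "j \<in> J \<Longrightarrow> \<exists>p\<in>poly_funs G. \<exists>q\<in>poly_funs G. \<forall>x\<in>X. D x \<noteq> 0 \<longrightarrow> q x \<noteq> 0 \<and> r x j = p x / q x"
    and r_supp: "j \<notin> J \<Longrightarrow> r x j = 0"
    and orbit: "x \<in> X \<Longrightarrow> D x \<noteq> 0 \<Longrightarrow> \<exists>a\<in>A. a (\<sigma> (r x)) = x"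
    and r_invariant: "a \<in> A \<Longrightarrow> x \<in> X \<Longrightarrow> D x \<noteq> 0 \<Longrightarrow> D (a x) \<noteq> 0 \<Longrightarrow> r (a x) j = r x j"
    and r_\<sigma>: "D (\<sigma> t) \<noteq> 0 \<Longrightarrow> j \<in> J \<Longrightarrow> r (\<sigma> t) j = t j"
begin

lemma pull_back:
  assumes "a \<in> A" "f \<in> poly_funs G"
  shows "\<exists>h\<in>poly_funs G. \<forall>x\<in>X. h x = f (a x)"
  using assms(2)
proof (induction)
  case (const c)
  show ?case by (rule bexI[OF _ poly_funs.const[of c]]) simp
next
  case (coord g)
  then show ?case by (rule A_poly[OF assms(1)])
next
  case (add f g)
  then obtain f' g' where "f' \<in> poly_funs G" "\<forall>x\<in>X. f' x = f (a x)" "g' \<in> poly_funs G" "\<forall>x\<in>X. g' x = g (a x)" by blast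
  then show ?case by (intro bexI[OF _ poly_funs.add[of f' G g']]) simp_all
next
  case (mult f g)
  then obtain f' g' where "f' \<in> poly_funs G" "\<forall>x\<in>X. f' x = f (a x)" "g' \<in> poly_funs G" "\<forall>x\<in>X. g' x = g (a x)" by blast
  then show ?case by (intro bexI[OF _ poly_funs.mult[of f' G g']]) simp_all
qed

lemma gen_D: "gen (\<lambda>x. D x \<noteq> 0)"
  using D_nonzero gen_poly[OF D_poly \<sigma>_X] by blast

lemma gen_pull_back:
  assumes a: "a \<in> A" and "gen Q" shows "gen (\<lambda>x. Q (a x))"
proof -
  obtain e z where e: "e \<in> poly_funs G" "z \<in> X" "e z \<noteq> 0" "\<forall>x\<in>X. e x \<noteq> 0 \<longrightarrow> Q x"
    using assms(2) unfolding gen_def by blast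
  obtain h where h: "h \<in> poly_funs G" "\<forall>x\<in>X. h x = e (a x)" using pull_back[OF a e(1)] by blast
  obtain b where b: "b \<in> A" "\<forall>x\<in>X. a (b x) = x" using A_inv[OF a] by blast
  have "h (b z) \<noteq> 0" using b h e A_closed by simp
  then have "gen (\<lambda>x. h x \<noteq> 0)" using gen_poly[OF h(1)] A_closed[OF b(1) e(2)] by blast
  then show ?thesis by (rule gen_mono) (use e h A_closed[OF a] in auto)
qed

lemma \<sigma>_comp: "f \<in> poly_funs G \<Longrightarrow> (\<lambda>t. f (\<sigma> t)) \<in> poly_funs tcoords"
  by (rule poly_funs_comp[OF _ \<sigma>_poly])

lemma generic_zero:
  assumes H: "H \<in> poly_funs tcoords" "\<And>t t'. (\<And>j. j \<in> J \<Longrightarrow> t j = t' j) \<Longrightarrow> H t = H t'"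
    and "gen (\<lambda>x. H (r x) = 0)"
  shows "H t = 0"
proof -
  obtain e z where e: "e \<in> poly_funs G" "z \<in> X" "e z \<noteq> 0" "\<forall>x\<in>X. e x \<noteq> 0 \<longrightarrow> D x \<noteq> 0 \<and> H (r x) = 0"
    using gen_conj[OF gen_D assms(3)] unfolding gen_def by blast
  obtain a where a: "a \<in> A" "a (\<sigma> (r z)) = z" using orbit e by blast
  obtain e' where e': "e' \<in> poly_funs G" "\<forall>x\<in>X. e' x = e (a x)" using pull_back[OF a(1) e(1)] by blast
  have D: "D (\<sigma> t) * H t = 0" for t
  proof (rule tcoords_irreducible[OF \<sigma>_comp[OF e'(1)] poly_funs.mult[OF \<sigma>_comp[OF D_poly] H(1)]])
    show "e' (\<sigma> (r z)) \<noteq> 0" using e' a e \<sigma>_X by simp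
    fix t
    show "e' (\<sigma> t) * (D (\<sigma> t) * H t) = 0"
    proof (rule ccontr)
      assume *: "e' (\<sigma> t) * (D (\<sigma> t) * H t) \<noteq> 0"
      then have nz: "e (a (\<sigma> t)) \<noteq> 0" "D (\<sigma> t) \<noteq> 0" "H t \<noteq> 0" using e'(2) \<sigma>_X by auto
      have x: "a (\<sigma> t) \<in> X" using A_closed[OF a(1) \<sigma>_X] .
      have "H (r (a (\<sigma> t))) = H t"
        using r_invariant[OF a(1) \<sigma>_X nz(2)] e(4) x nz(1) r_\<sigma>[OF nz(2)] by (intro H(2)) metis
      then show False using e(4) x nz by auto
    qed
  qed
  obtain u where u: "D (\<sigma> u) \<noteq> 0" using D_nonzero by blast
  show ?thesis by (rule tcoords_irreducible[OF \<sigma>_comp[OF D_poly] H(1) D u])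
qed

definition trans_frac :: "('x \<Rightarrow> 'x) \<Rightarrow> ('x \<Rightarrow> 'k) \<times> ('x \<Rightarrow> 'k) \<Rightarrow> ('x \<Rightarrow> 'k) \<times> ('x \<Rightarrow> 'k)" where
  "trans_frac a = map_prod (\<lambda>f. \<lambda>x\<in>X. f (a x)) (\<lambda>f. \<lambda>x\<in>X. f (a x))"

definition invs :: "(('x \<Rightarrow> 'k) \<times> ('x \<Rightarrow> 'k)) set set" where
  "invs = {w \<in> carrier F. \<forall>a\<in>A. trans_frac a ` w = w}"

lemma res_pull: "a \<in> A \<Longrightarrow> \<forall>x\<in>X. h x = f (a x) \<Longrightarrow> (\<lambda>x\<in>X. res f (a x)) = res h"
  using A_closed by (auto simp: res_def restrict_def fun_eq_iff)

lemma trans_frac_fr: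
  assumes a: "a \<in> A" and pq: "p \<in> poly_funs G" "den q" "p' \<in> poly_funs G" "q' \<in> poly_funs G"
    and p': "\<forall>x\<in>X. p' x = p (a x)" and q': "\<forall>x\<in>X. q' x = q (a x)"
  shows "den q'" "trans_frac a ` fr p q = fr p' q'"
proof -
  obtain b where b: "b \<in> A" "\<forall>x\<in>X. a (b x) = x \<and> b (a x) = x" using A_inv[OF a] by blast
  have den: "den h" if "c \<in> A" "den f" "h \<in> poly_funs G" "\<forall>x\<in>X. h x = f (c x)" for c f h
    using gen_ex[OF gen_pull_back[OF that(1) den_gen[OF that(2)]]] that(3,4) unfolding den_def by auto
  show "den q'" by (rule den[OF a pq(2,4) q'])
  show "trans_frac a ` fr p q = fr p' q'"
  proof (intro subset_antisym subsetI)
    fix z assume "z \<in> trans_frac a ` fr p q"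
    then obtain u v where uv: "u \<in> poly_funs G" "den v" "\<forall>x\<in>X. p x * v x = u x * q x" "z = trans_frac a (res u, res v)"
    proof -
      obtain y where y: "y \<in> fr p q" "z = trans_frac a y" using \<open>z \<in> trans_frac a ` fr p q\<close> by blast
      from y(1) have "(fst y, snd y) \<in> fr p q" by simp
      then obtain u v where "fst y = res u" "snd y = res v" "u \<in> poly_funs G" "den v" "\<forall>x\<in>X. p x * v x = u x * q x"
        unfolding fr_mem by blast
      moreover from this have "y = (res u, res v)" by (simp add: prod_eq_iff)
      ultimately show thesis using that y(2) by blast
    qed
    obtain u' v' where u': "u' \<in> poly_funs G" "\<forall>x\<in>X. u' x = u (a x)" and v': "v' \<in> poly_funs G" "\<forall>x\<in>X. v' x = v (a x)"
      using pull_back[OF a] uv(1) den_poly[OF uv(2)] by metis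
    have "\<forall>x\<in>X. p' x * v' x = u' x * q' x" using uv(3) p' q' u'(2) v'(2) A_closed[OF a] by simp
    moreover have "z = (res u', res v')"
      unfolding uv(4) trans_frac_def using res_pull[OF a u'(2)] res_pull[OF a v'(2)] by simp
    ultimately show "z \<in> fr p' q'" using u'(1) den[OF a uv(2) v'] fr_mem by blast
  next
    fix z assume z: "z \<in> fr p' q'"
    then obtain u' v' where uv: "u' \<in> poly_funs G" "den v'" "\<forall>x\<in>X. p' x * v' x = u' x * q' x" "z = (res u', res v')"
      using fr_mem by (metis (no_types, lifting) surj_pair)
    obtain u v where u: "u \<in> poly_funs G" "\<forall>x\<in>X. u x = u' (b x)" and v: "v \<in> poly_funs G" "\<forall>x\<in>X. v x = v' (b x)"
      using pull_back[OF b(1)] uv(1) den_poly[OF uv(2)] by metis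
    have "\<forall>x\<in>X. p x * v x = u x * q x"
    proof
      fix x assume x: "x \<in> X"
      then show "p x * v x = u x * q x"
        using bspec[OF uv(3) A_closed[OF b(1) x]] p' q' u(2) v(2) b A_closed[OF b(1) x] by simp
    qed
    then have "(res u, res v) \<in> fr p q" using u(1) den[OF b(1) uv(2) v] fr_mem by blast
    moreover have "\<forall>x\<in>X. u' x = u (a x)" "\<forall>x\<in>X. v' x = v (a x)" using u(2) v(2) b(2) A_closed[OF a] by auto
    then have "z = trans_frac a (res u, res v)"
      unfolding uv(4) trans_frac_def using res_pull[OF a] by simp
    ultimately show "z \<in> trans_frac a ` fr p q" by blast
  qed
qed

lemma invs_iff:
  assumes "rep w f"
  shows "w \<in> invs \<longleftrightarrow> (\<forall>a\<in>A. gen (\<lambda>x. f (a x) = f x))"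
proof -
  obtain p q where p: "p \<in> poly_funs G" "den q" "w = fr p q" "gen (\<lambda>x. f x = p x / q x)"
    using assms unfolding rep_def by blast
  have "trans_frac a ` w = w \<longleftrightarrow> gen (\<lambda>x. f (a x) = f x)" if a: "a \<in> A" for a
  proof -
    obtain p' q' where p': "p' \<in> poly_funs G" "\<forall>x\<in>X. p' x = p (a x)" and q': "q' \<in> poly_funs G" "\<forall>x\<in>X. q' x = q (a x)"
      using pull_back[OF a] p(1) den_poly[OF p(2)] by metis
    note t = trans_frac_fr[OF a p(1,2) p'(1) q'(1) p'(2) q'(2)]
    have "gen (\<lambda>x. f (a x) = p (a x) / q (a x))" using gen_pull_back[OF a p(4)] .
    then have g: "gen (\<lambda>x. f (a x) = p' x / q' x)" by (rule gen_mono) (simp add: p' q')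
    have r: "rep (trans_frac a ` w) (\<lambda>x. f (a x))"
      unfolding rep_def p(3) t(2) using p'(1) t(1) g by blast
    show ?thesis
    proof
      assume "trans_frac a ` w = w"
      then show "gen (\<lambda>x. f (a x) = f x)" using rep_eqD[OF r] assms by simp
    next
      assume "gen (\<lambda>x. f (a x) = f x)"
      then show "trans_frac a ` w = w" by (rule rep_eqI[OF r assms])
    qed
  qed
  then show ?thesis using rep_closed[OF assms] unfolding invs_def by blast
qed

abbreviation "L \<equiv> F\<lparr>carrier := invs\<rparr>"

definition irep :: "(('x \<Rightarrow> 'k) \<times> ('x \<Rightarrow> 'k)) set \<Rightarrow> ('x \<Rightarrow> 'k) \<Rightarrow> bool" where
  "irep w f \<longleftrightarrow> w \<in> invs \<and> rep w f"

lemma irepD: "irep w f \<Longrightarrow> w \<in> invs" "irep w f \<Longrightarrow> rep w f" "irep w f \<Longrightarrow> a \<in> A \<Longrightarrow> gen (\<lambda>x. f (a x) = f x)"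
  using invs_iff unfolding irep_def by blast+

lemma irepI: "rep w f \<Longrightarrow> (\<And>a. a \<in> A \<Longrightarrow> gen (\<lambda>x. f (a x) = f x)) \<Longrightarrow> irep w f"
  using invs_iff unfolding irep_def by blast

lemma irep_ex: "w \<in> invs \<Longrightarrow> \<exists>f. irep w f"
  unfolding irep_def using rep_ex unfolding invs_def by blast

lemma irep_cong: "irep w f \<Longrightarrow> gen (\<lambda>x. g x = f x) \<Longrightarrow> irep w g"
  unfolding irep_def using rep_cong by blast

lemma irep_mult: assumes "irep w f" "irep w' g" shows "irep (w \<otimes>\<^bsub>L\<^esub> w') (\<lambda>x. f x * g x)"
  by (rule irepI)
    (use rep_mult[OF irepD(2)[OF assms(1)] irepD(2)[OF assms(2)]] in simp,
      rule gen_elim2[OF irepD(3)[OF assms(1)] irepD(3)[OF assms(2)]], auto)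

lemma irep_add: assumes "irep w f" "irep w' g" shows "irep (w \<oplus>\<^bsub>L\<^esub> w') (\<lambda>x. f x + g x)"
  by (rule irepI)
    (use rep_add[OF irepD(2)[OF assms(1)] irepD(2)[OF assms(2)]] in simp,
      rule gen_elim2[OF irepD(3)[OF assms(1)] irepD(3)[OF assms(2)]], auto)

lemma irep_const: "irep (fr (\<lambda>_. c) (\<lambda>_. 1)) (\<lambda>_. c)"
  by (rule irepI[OF rep_const]) (simp add: gen_all)

lemma irep_zero: "irep \<zero>\<^bsub>L\<^esub> (\<lambda>_. 0)"
  by (rule irepI) (simp_all add: rep_zero gen_all)

lemma irep_one: "irep \<one>\<^bsub>L\<^esub> (\<lambda>_. 1)"
  by (rule irepI) (simp_all add: rep_one gen_all)

lemma irep_eq: "irep w f \<Longrightarrow> irep w' g \<Longrightarrow> gen (\<lambda>x. f x = g x) \<Longrightarrow> w = w'"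
  using rep_eqI irepD(2) by blast

lemma L_field: "field L"
proof -
  interpret F: field F by (rule F_field)
  have inv: "inv\<^bsub>F\<^esub> w \<in> invs" if w: "w \<in> invs - {\<zero>\<^bsub>F\<^esub>}" for w
  proof -
    obtain f where f: "irep w f" using w irep_ex by blast
    obtain w' where w': "rep w' (\<lambda>x. 1 / f x)" "w \<otimes>\<^bsub>F\<^esub> w' = \<one>\<^bsub>F\<^esub>"
      using rep_inverse[OF irepD(2)[OF f]] w by blast
    have "irep w' (\<lambda>x. 1 / f x)" by (rule irepI[OF w'(1)]) (rule gen_mono[OF irepD(3)[OF f]], auto)
    moreover have "inv\<^bsub>F\<^esub> w = w'"
      using F.comm_inv_char[of w w'] rep_closed[OF w'(1)] rep_closed[OF irepD(2)[OF f]] w'(2) by simp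
    ultimately show ?thesis using irepD(1) by simp
  qed
  have uminus: "\<ominus>\<^bsub>F\<^esub> w \<in> invs" if w: "w \<in> invs" for w
  proof -
    obtain f where f: "irep w f" using w irep_ex by blast
    have c: "irep (fr (\<lambda>_. -1) (\<lambda>_. 1) \<otimes>\<^bsub>L\<^esub> w) (\<lambda>x. (-1) * f x)" by (rule irep_mult[OF irep_const f])
    have z: "irep (fr (\<lambda>_. -1) (\<lambda>_. 1) \<otimes>\<^bsub>L\<^esub> w \<oplus>\<^bsub>L\<^esub> w) (\<lambda>x. (-1) * f x + f x)" by (rule irep_add[OF c f])
    have "fr (\<lambda>_. -1) (\<lambda>_. 1) \<otimes>\<^bsub>L\<^esub> w \<oplus>\<^bsub>L\<^esub> w = \<zero>\<^bsub>L\<^esub>" by (rule irep_eq[OF z irep_zero]) (simp add: gen_all)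
    then have "\<ominus>\<^bsub>F\<^esub> w = fr (\<lambda>_. -1) (\<lambda>_. 1) \<otimes>\<^bsub>L\<^esub> w"
      using F.minus_equality[of "fr (\<lambda>_. -1) (\<lambda>_. 1) \<otimes>\<^bsub>L\<^esub> w" w] rep_closed[OF irepD(2)[OF f]] rep_closed[OF irepD(2)[OF c]] by simp
    then show ?thesis using irepD(1)[OF c] by simp
  qed
  have "subring invs F"
  proof (rule F.subringI)
    show "invs \<subseteq> carrier F" unfolding invs_def by blast
    show "\<one>\<^bsub>F\<^esub> \<in> invs" using irepD(1)[OF irep_one] by simp
    fix w w' assume "w \<in> invs" "w' \<in> invs"
    then obtain f g where fg: "irep w f" "irep w' g" using irep_ex by blast
    show "w \<otimes>\<^bsub>F\<^esub> w' \<in> invs" "w \<oplus>\<^bsub>F\<^esub> w' \<in> invs"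
      using irepD(1)[OF irep_mult[OF fg]] irepD(1)[OF irep_add[OF fg]] by auto
  qed (rule uminus)
  then show ?thesis by (intro F.subfield_iff(2) F.subfieldI' inv)
qed

sublocale L: field L by (rule L_field)

lemma irep_inverse:
  assumes f: "irep w f" and nz: "w \<noteq> \<zero>\<^bsub>L\<^esub>"
  shows "irep (inv\<^bsub>L\<^esub> w) (\<lambda>x. 1 / f x)"
proof -
  have w: "w \<in> Units L" using L.field_Units nz irepD(1)[OF f] by simp
  obtain g where g: "irep (inv\<^bsub>L\<^esub> w) g" using irep_ex L.Units_inv_closed[OF w] by fastforce
  have "gen (\<lambda>x. f x * g x = 1)"
    using rep_eqD[OF irepD(2)[OF irep_mult[OF f g]], of "\<lambda>_. 1"] L.Units_r_inv[OF w] irepD(2)[OF irep_one] by simp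
  then show ?thesis proof (rule irep_cong[OF g gen_mono])
    fix x assume *: "f x * g x = 1"
    then have "f x \<noteq> 0" by auto
    then show "1 / f x = g x" using nonzero_eq_divide_eq[of "f x" "g x" 1] * mult.commute[of "f x" "g x"] by simp
  qed
qed

lemma irep_sum:
  assumes "finite M" "\<And>m. m \<in> M \<Longrightarrow> irep (w m) (f m)"
  shows "irep (\<Oplus>\<^bsub>L\<^esub>m\<in>M. w m) (\<lambda>x. \<Sum>m\<in>M. f m x)"
  using assms
proof (induction M)
  case empty
  then show ?case using irep_zero by simp
next
  case (insert m M)
  have c: "w \<in> M \<rightarrow> carrier L" "w m \<in> carrier L" using insert.prems irepD(1) by auto
  show ?case using irep_add[OF insert.prems[of m] insert.IH] insert.prems insert.hyps L.finsum_insert[OF insert.hyps c] by simp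
qed

lemma irep_pow: "irep w f \<Longrightarrow> irep (w [^]\<^bsub>L\<^esub> (n::nat)) (\<lambda>x. f x ^ n)"
proof (induction n)
  case 0
  then show ?case using irep_one by simp
next
  case (Suc n)
  then show ?case using irep_mult[OF Suc.IH[OF Suc.prems] Suc.prems] by (simp add: mult.commute)
qed

lemma irep_prod:
  assumes "finite M" "\<And>m. m \<in> M \<Longrightarrow> irep (w m) (f m)"
  shows "irep (\<Otimes>\<^bsub>L\<^esub>m\<in>M. w m) (\<lambda>x. \<Prod>m\<in>M. f m x)"
  using assms
proof (induction M)
  case empty
  then show ?case using irep_one by simp
next
  case (insert m M)
  have c: "w \<in> M \<rightarrow> carrier L" "w m \<in> carrier L" using insert.prems irepD(1) by auto
  show ?case using irep_mult[OF insert.prems[of m] insert.IH] insert.prems insert.hyps L.finprod_insert[OF insert.hyps c] by simp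
qed

lemma r_irep: "j \<in> J \<Longrightarrow> \<exists>w. irep w (\<lambda>x. r x j)"
proof -
  assume "j \<in> J"
  then obtain p q where p: "p \<in> poly_funs G" "q \<in> poly_funs G" "\<forall>x\<in>X. D x \<noteq> 0 \<longrightarrow> q x \<noteq> 0 \<and> r x j = p x / q x"
    using r_frac by blast
  have q: "den q" using gen_ex[OF gen_D] p unfolding den_def by blast
  have "rep (fr p q) (\<lambda>x. r x j)"
    by (rule rep_cong[OF rep_fr[OF p(1) q]], rule gen_mono[OF gen_D]) (use p(3) in blast)
  then have "irep (fr p q) (\<lambda>x. r x j)"
  proof (rule irepI)
    fix a assume a: "a \<in> A"
    show "gen (\<lambda>x. r (a x) j = r x j)"
      by (rule gen_elim2[OF gen_D gen_pull_back[OF a gen_D]]) (use r_invariant[OF a] in blast)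
  qed
  then show ?thesis by blast
qed

definition basic :: "'j \<Rightarrow> (('x \<Rightarrow> 'k) \<times> ('x \<Rightarrow> 'k)) set" where
  "basic j = (SOME w. irep w (\<lambda>x. r x j))"

lemma basic: "j \<in> J \<Longrightarrow> irep (basic j) (\<lambda>x. r x j)"
  unfolding basic_def by (rule someI_ex[OF r_irep])

abbreviation "K \<equiv> constants X G"

lemma K_eq: "K = range (\<lambda>c. fr (\<lambda>_. c) (\<lambda>_. 1))"
  unfolding constants_def fr_def res_def by auto

lemma poly_generated:
  assumes "H \<in> poly_funs tcoords"
  shows "\<exists>w\<in>generate_field L (K \<union> basic ` J). irep w (\<lambda>x. H (r x))"
  using assms
proof (induction)
  case (const c)
  have "fr (\<lambda>_. c) (\<lambda>_. 1) \<in> generate_field L (K \<union> basic ` J)" by (rule generate_field.incl) (auto simp: K_eq)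
  then show ?case using irep_const by blast
next
  case (coord f)
  then obtain j where j: "f = (\<lambda>t. t j)" by (auto simp: tcoords_def)
  show ?case
  proof (cases "j \<in> J")
    case True
    then have "basic j \<in> generate_field L (K \<union> basic ` J)" by (intro generate_field.incl) auto
    then show ?thesis using basic[OF True] unfolding j by blast
  next
    case False
    have "fr (\<lambda>_. 0) (\<lambda>_. 1) \<in> generate_field L (K \<union> basic ` J)" by (rule generate_field.incl) (auto simp: K_eq)
    then show ?thesis using irep_const[of 0] r_supp[OF False] unfolding j by auto
  qed
next
  case (add f g)
  then obtain w w' where w: "w \<in> generate_field L (K \<union> basic ` J)" "irep w (\<lambda>x. f (r x))"
    "w' \<in> generate_field L (K \<union> basic ` J)" "irep w' (\<lambda>x. g (r x))" by blast
  show ?case using irep_add[OF w(2,4)] generate_field.eng_add[OF w(1,3)] by blast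
next
  case (mult f g)
  then obtain w w' where w: "w \<in> generate_field L (K \<union> basic ` J)" "irep w (\<lambda>x. f (r x))"
    "w' \<in> generate_field L (K \<union> basic ` J)" "irep w' (\<lambda>x. g (r x))" by blast
  show ?case using irep_mult[OF w(2,4)] generate_field.eng_mult[OF w(1,3)] by blast
qed

lemma invs_generated:
  assumes w: "w \<in> invs"
  shows "w \<in> generate_field L (K \<union> basic ` J)"
proof -
  obtain p q where p: "p \<in> poly_funs G" "den q" "w = fr p q" using w unfolding invs_def F_carrier by blast
  then have f: "irep w (\<lambda>x. p x / q x)" using w rep_fr unfolding irep_def by blast
  obtain x0 where x0: "x0 \<in> X" "q x0 \<noteq> 0" "D x0 \<noteq> 0" using gen_ex[OF gen_conj[OF den_gen[OF p(2)] gen_D]] by blast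
  obtain a where a: "a \<in> A" "a (\<sigma> (r x0)) = x0" using orbit x0 by blast
  obtain p' q' where p': "p' \<in> poly_funs G" "\<forall>x\<in>X. p' x = p (a x)" and q': "q' \<in> poly_funs G" "\<forall>x\<in>X. q' x = q (a x)"
    using pull_back[OF a(1)] p(1) den_poly[OF p(2)] by metis
  have invariant: "p (c x) * q x = p x * q (c x)" if c: "c \<in> A" and x: "x \<in> X" for c x
  proof -
    obtain p1 q1 where p1: "p1 \<in> poly_funs G" "\<forall>x\<in>X. p1 x = p (c x)" and q1: "q1 \<in> poly_funs G" "\<forall>x\<in>X. q1 x = q (c x)"
      using pull_back[OF c] p(1) den_poly[OF p(2)] by metis
    have "gen (\<lambda>x. p (c x) / q (c x) = p x / q x \<and> q x \<noteq> 0 \<and> q (c x) \<noteq> 0)"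
      by (intro gen_conj irepD(3)[OF f c] den_gen[OF p(2)] gen_pull_back[OF c den_gen[OF p(2)]])
    then have "gen (\<lambda>x. p1 x * q x = p x * q1 x)"
      by (rule gen_mono) (auto simp: p1(2) q1(2) frac_eq_eq)
    then have "p1 x * q x = p x * q1 x"
      by (rule gen_eq[OF poly_funs.mult[OF p1(1) den_poly[OF p(2)]] poly_funs.mult[OF p(1) q1(1)] _ x])
    then show ?thesis using p1 q1 x by simp
  qed
  define P Q where "P = (\<lambda>t. p' (\<sigma> t))" and "Q = (\<lambda>t. q' (\<sigma> t))"
  obtain wP where wP: "wP \<in> generate_field L (K \<union> basic ` J)" "irep wP (\<lambda>x. P (r x))"
    using poly_generated[OF \<sigma>_comp[OF p'(1)]] unfolding P_def by blast
  obtain wQ where wQ: "wQ \<in> generate_field L (K \<union> basic ` J)" "irep wQ (\<lambda>x. Q (r x))"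
    using poly_generated[OF \<sigma>_comp[OF q'(1)]] unfolding Q_def by blast
  have Q0: "Q (r x0) \<noteq> 0" unfolding Q_def using q'(2) \<sigma>_X a(2) x0 by simp
  have nz: "wQ \<noteq> \<zero>\<^bsub>L\<^esub>"
  proof
    assume "wQ = \<zero>\<^bsub>L\<^esub>"
    then have "gen (\<lambda>x. Q (r x) = 0)" using rep_eqD[OF irepD(2)[OF wQ(2)], of "\<lambda>_. 0"] irepD(2)[OF irep_zero] by simp
    moreover have "Q t = Q t'" if "\<And>j. j \<in> J \<Longrightarrow> t j = t' j" for t t' unfolding Q_def using \<sigma>_cong[OF that] by simp
    ultimately show False using generic_zero[of Q] \<sigma>_comp[OF q'(1)] Q0 unfolding Q_def by blast
  qed
  have "w = wP \<otimes>\<^bsub>L\<^esub> inv\<^bsub>L\<^esub> wQ"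
  proof (rule irep_eq[OF f irep_mult[OF wP(2) irep_inverse[OF wQ(2) nz]]])
    have "gen (\<lambda>x. Q (r x) \<noteq> 0)" using rep_nonzero[OF irepD(2)[OF wQ(2)]] nz by simp
    from gen_conj[OF gen_D this] show "gen (\<lambda>x. p x / q x = P (r x) * (1 / Q (r x)))"
    proof (rule gen_elim2[OF den_gen[OF p(2)]])
      fix x assume x: "x \<in> X" "q x \<noteq> 0" "D x \<noteq> 0 \<and> Q (r x) \<noteq> 0"
      define y where "y = a (\<sigma> (r x))"
      have y: "y \<in> X" unfolding y_def using A_closed[OF a(1) \<sigma>_X] .
      obtain b where b: "b \<in> A" "b (\<sigma> (r x)) = x" using orbit x by blast
      obtain b' where b': "b' \<in> A" "\<forall>x\<in>X. b' (a x) = x" using A_inv[OF a(1)] by blast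
      obtain c where c: "c \<in> A" "\<forall>x\<in>X. c x = b (b' x)" using A_comp[OF b(1) b'(1)] by blast
      have "c y = x" using c y b(2) b'(2) \<sigma>_X unfolding y_def by simp
      then have "p x * q y = p y * q x" using invariant[OF c(1) y] by simp
      moreover have "P (r x) = p y" "Q (r x) = q y" unfolding P_def Q_def y_def using p' q' \<sigma>_X by auto
      ultimately show "p x / q x = P (r x) * (1 / Q (r x))" using x by (simp add: frac_eq_eq)
    qed
  qed
  then show ?thesis using generate_field.eng_mult[OF wP(1) generate_field.m_inv[OF wQ(1) nz]] by simp
qed

lemma basic_inj: "inj_on basic J"
proof (rule inj_onI, rule ccontr)
  fix i j assume ij: "i \<in> J" "j \<in> J" "basic i = basic j" "i \<noteq> j"
  have "gen (\<lambda>x. r x i = r x j)"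
    using rep_eqD[OF irepD(2)[OF basic[OF ij(1)]]] irepD(2)[OF basic[OF ij(2)]] ij(3) by simp
  then have "gen (\<lambda>x. r x i - r x j = 0)" by simp
  then have "t i - t j = (0::'k)" for t
  proof (rule generic_zero[rotated 2])
    have "(\<lambda>t. t k) \<in> poly_funs tcoords" for k :: 'j by (rule poly_funs.coord) (auto simp: tcoords_def)
    then show "(\<lambda>t. t i - t j :: 'k) \<in> poly_funs tcoords" by (intro poly_funs_diff)
  qed (simp add: ij)
  from this[of "\<lambda>k. if k = i then 1 else 0"] show False using ij(4) by simp
qed

lemma basic_independent: "alg_independent L K (basic ` J)"
  unfolding alg_independent_def
proof (intro allI impI, elim conjE)
  fix M :: "(('x \<Rightarrow> 'k) \<times> ('x \<Rightarrow> 'k)) set multiset set" and c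
  assume M: "finite M" "\<forall>m\<in>M. set_mset m \<subseteq> basic ` J" "c \<in> M \<rightarrow> K"
    and s0: "(\<Oplus>\<^bsub>L\<^esub>m\<in>M. c m \<otimes>\<^bsub>L\<^esub> (\<Otimes>\<^bsub>L\<^esub>b\<in>set_mset m. b [^]\<^bsub>L\<^esub> count m b)) = \<zero>\<^bsub>L\<^esub>"
  have "\<forall>m\<in>M. \<exists>\<gamma>. c m = fr (\<lambda>_. \<gamma>) (\<lambda>_. 1)" using M(3) K_eq by blast
  then obtain \<gamma> where \<gamma>: "\<And>m. m \<in> M \<Longrightarrow> c m = fr (\<lambda>_. \<gamma> m) (\<lambda>_. 1)" by metis
  define idx where "idx = inv_into J basic"
  have idx: "idx b \<in> J" "basic (idx b) = b" if "b \<in> basic ` J" for b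
    unfolding idx_def by (rule inv_into_into[OF that], rule f_inv_into_f[OF that])
  define H where "H t = (\<Sum>m\<in>M. \<gamma> m * (\<Prod>b\<in>set_mset m. t (idx b) ^ count m b))" for t :: "'j \<Rightarrow> 'k"
  have "irep (\<Oplus>\<^bsub>L\<^esub>m\<in>M. c m \<otimes>\<^bsub>L\<^esub> (\<Otimes>\<^bsub>L\<^esub>b\<in>set_mset m. b [^]\<^bsub>L\<^esub> count m b)) (\<lambda>x. H (r x))"
    unfolding H_def
  proof (intro irep_sum irep_mult irep_prod irep_pow M(1))
    fix m assume m: "m \<in> M"
    show "irep (c m) (\<lambda>_. \<gamma> m)" using irep_const \<gamma>[OF m] by simp
    show "irep b (\<lambda>x. r x (idx b))" if "b \<in># m" for b
    proof -
      have b: "b \<in> basic ` J" using M(2) m that by blast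
      show ?thesis using basic[OF idx(1)[OF b]] unfolding idx(2)[OF b] .
    qed
  qed simp
  then have "gen (\<lambda>x. H (r x) = 0)" using rep_eqD[OF irepD(2), of _ "\<lambda>x. H (r x)" "\<lambda>_. 0"] s0 irepD(2)[OF irep_zero] by simp
  then have H0: "H t = 0" for t
  proof (rule generic_zero[rotated 2])
    show "H \<in> poly_funs tcoords" unfolding H_def
      by (intro poly_funs_sum poly_funs.mult poly_funs.const poly_funs_prod poly_funs_power poly_funs.coord) (auto simp: tcoords_def)
    fix t t' :: "'j \<Rightarrow> 'k" assume *: "\<And>j. j \<in> J \<Longrightarrow> t j = t' j"
    show "H t = H t'" unfolding H_def
    proof (intro sum.cong refl arg_cong2[of _ _ _ _ times] prod.cong)
      fix m b assume "m \<in> M" "b \<in># m"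
      then have "b \<in> basic ` J" using M(2) by blast
      then have "idx b \<in> J" by (rule idx(1))
      then show "t (idx b) ^ count m b = t' (idx b) ^ count m b" using * by simp
    qed
  qed
  have zero: "(\<Sum>m\<in>M. \<gamma> m * (\<Prod>j\<in>J. t j ^ count m (basic j))) = 0" for t
  proof -
    have "(\<Prod>b\<in>set_mset m. t (idx b) ^ count m b) = (\<Prod>j\<in>J. t j ^ count m (basic j))" if m: "m \<in> M" for m
    proof -
      have "(\<Prod>b\<in>set_mset m. t (idx b) ^ count m b) = (\<Prod>b\<in>basic ` J. t (idx b) ^ count m b)"
        using M(2) m J by (intro prod.mono_neutral_left) (auto simp: not_in_iff)
      also have "\<dots> = (\<Prod>j\<in>J. t j ^ count m (basic j))"
        unfolding prod.reindex[OF basic_inj] by (intro prod.cong) (auto simp: idx_def inv_into_f_f[OF basic_inj])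
      finally show ?thesis .
    qed
    then show ?thesis using H0[of t] unfolding H_def by simp
  qed
  show "\<forall>m\<in>M. c m = \<zero>\<^bsub>L\<^esub>"
  proof
    fix m assume m: "m \<in> M"
    have "\<gamma> m = 0"
    proof (rule independent_monomials[OF J M(1) _ zero m])
      fix k l assume kl: "k \<in> M" "l \<in> M" "k \<noteq> l"
      then obtain b where b: "count k b \<noteq> count l b" by (meson multiset_eqI)
      then have "b \<in># k \<or> b \<in># l" by (metis not_in_iff)
      then have "b \<in> basic ` J" using M(2) kl by blast
      then show "\<exists>j\<in>J. count k (basic j) \<noteq> count l (basic j)" using b by blast
    qed
    then show "c m = \<zero>\<^bsub>L\<^esub>" using irep_eq[OF irep_const irep_zero, of 0] \<gamma>[OF m] by (simp add: gen_all)
  qed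
qed

theorem purely_transcendental_invs: "purely_transcendental L K"
  unfolding purely_transcendental_def
proof (intro exI conjI)
  show B: "basic ` J \<subseteq> carrier L" using irepD(1)[OF basic] by auto
  show "alg_independent L K (basic ` J)" by (rule basic_independent)
  have "K \<subseteq> carrier L" using irepD(1)[OF irep_const] K_eq by auto
  then show "generate_field L (K \<union> basic ` J) = carrier L"
    using L.generate_field_incl[of "K \<union> basic ` J"] B invs_generated by auto
qed

end

section \<open>The coadjoint action\<close>

locale seaweed_group = based_algebra n G Gi P
  for n and G Gi :: "'k::field_char_0 mat" and P +
  fixes S :: "'k mat set"
  assumes sub: "subgroup S (GL n)" and S_eq: "S = alg \<inter> carrier (GL n)"
begin

sublocale GL: group "GL n :: 'k mat monoid" by (rule GL_group)

abbreviation "X \<equiv> lin_dual alg"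
abbreviation "co \<equiv> coadjoint n alg"
abbreviation "\<Gamma> \<equiv> GL_restrict n S"

lemma S_GL: "u \<in> S \<Longrightarrow> u \<in> carrier (GL n)"
  by (simp add: S_eq)

lemma S_alg: "u \<in> S \<Longrightarrow> u \<in> alg"
  by (simp add: S_eq)

lemma S_carrier: "u \<in> S \<Longrightarrow> u \<in> carrier_mat n n"
  by (rule alg_carrier[OF S_alg])

lemma S_inv: "u \<in> S \<Longrightarrow> inv\<^bsub>GL n\<^esub> u \<in> S"
  by (rule subgroup.m_inv_closed[OF sub])

lemma S_mult: "u \<in> S \<Longrightarrow> v \<in> S \<Longrightarrow> u * v \<in> S"
  using subgroup.m_closed[OF sub, of u v] by (simp add: GL_mult)

lemma S_one: "1\<^sub>m n \<in> S"
  using subgroup.one_closed[OF sub] by (simp add: GL_one)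

lemma \<Gamma>_inv: "u \<in> S \<Longrightarrow> inv\<^bsub>\<Gamma>\<^esub> u = inv\<^bsub>GL n\<^esub> u"
  by (rule GL.m_inv_consistent[OF sub])

definition unit :: "nat \<Rightarrow> nat \<Rightarrow> 'k mat" where
  "unit i j = to_mat (\<lambda>k l. if k = i \<and> l = j then 1 else 0)"

lemma of_mat_E: "P i j \<Longrightarrow> of_mat (unit i j) = (\<lambda>k l. if k = i \<and> l = j then 1 else 0)"
  unfolding unit_def by (rule of_to_mat) (use fld[of i j] in \<open>auto split: if_splits\<close>)

lemma unit_alg: "P i j \<Longrightarrow> unit i j \<in> alg"
  unfolding alg_def using of_mat_E[of i j] to_mat_carrier by (auto simp: unit_def split: if_splits)

definition \<Phi> :: "('k mat \<Rightarrow> 'k) \<Rightarrow> 'k fmat" where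
  "\<Phi> \<xi> = (\<lambda>i j. if P i j then \<xi> (unit i j) else 0)"

definition fun_of :: "'k fmat \<Rightarrow> 'k mat \<Rightarrow> 'k" where
  "fun_of x = (\<lambda>A\<in>alg. \<Sum>i<n. \<Sum>j<n. of_mat A i j * x i j)"

lemma XD:
  assumes "\<xi> \<in> X" "A \<in> alg" "B \<in> alg"
  shows "\<xi> (A + B) = \<xi> A + \<xi> B" "\<xi> (a \<cdot>\<^sub>m A) = a * \<xi> A"
  using assms by (auto simp: lin_dual_def)

lemma of_mat_supp: "of_mat A i j \<noteq> 0 \<Longrightarrow> i < n \<and> j < n"
  by (auto simp: of_mat_def split: if_splits)

lemma pairing:
  assumes \<xi>: "\<xi> \<in> X" and A: "A \<in> alg"
  shows "\<xi> A = (\<Sum>i<n. \<Sum>j<n. of_mat A i j * \<Phi> \<xi> i j)"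
proof -
  define part where "part T = to_mat (\<lambda>i j. if (i, j) \<in> T then of_mat A i j else 0)" for T
  have of_part: "of_mat (part T) = (\<lambda>i j. if (i, j) \<in> T then of_mat A i j else 0)" for T
    unfolding part_def by (rule of_to_mat) (use of_mat_supp in \<open>auto split: if_splits\<close>)
  have part_carrier: "part T \<in> carrier_mat n n" for T unfolding part_def by (rule to_mat_carrier)
  have part_alg: "part T \<in> alg" for T
    using A part_carrier unfolding alg_def by (auto simp: of_part split: if_splits)
  have "\<xi> (part T) = (\<Sum>(i, j)\<in>T. of_mat A i j * \<Phi> \<xi> i j)" if "finite T" for T
    using that
  proof (induction T)
    case empty
    have "part {} = 0 \<cdot>\<^sub>m 1\<^sub>m n"
      by (rule of_mat_inj[OF part_carrier]) (simp_all add: of_part of_mat_smult fun_eq_iff)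
    then show ?case using XD(2)[OF \<xi> alg_one alg_one, of 0] by simp
  next
    case (insert p T)
    obtain i j where p: "p = (i, j)" by fastforce
    show ?case
    proof (cases "P i j")
      case True
      note E = unit_alg[OF True]
      have "part (insert p T) = part T + of_mat A i j \<cdot>\<^sub>m unit i j"
      proof (rule of_mat_inj[OF part_carrier add_carrier_mat[OF smult_carrier_mat[OF alg_carrier[OF E]]]], intro ext)
        fix k l
        show "of_mat (part (insert p T)) k l = of_mat (part T + of_mat A i j \<cdot>\<^sub>m unit i j) k l"
          using insert.hyps(2)
          by (auto simp: of_mat_add[OF part_carrier smult_carrier_mat[OF alg_carrier[OF E]]]
              of_mat_smult[OF alg_carrier[OF E]] of_part of_mat_E[OF True] p)
      qed
      then show ?thesis
        using insert XD(1)[OF \<xi> part_alg alg_smult[OF E], of T "of_mat A i j"] XD(2)[OF \<xi> E E] True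
        by (simp add: p \<Phi>_def add.commute)
    next
      case False
      then have z: "of_mat A i j = 0" using A by (auto simp: alg_def)
      have "part (insert p T) = part T" unfolding part_def
        by (rule arg_cong[of _ _ to_mat]) (use z in \<open>auto simp: p fun_eq_iff\<close>)
      then show ?thesis using insert z by (simp add: p)
    qed
  qed
  then have "\<xi> (part ({..<n} \<times> {..<n})) = (\<Sum>(i, j)\<in>{..<n} \<times> {..<n}. of_mat A i j * \<Phi> \<xi> i j)" by simp
  moreover have "part ({..<n} \<times> {..<n}) = A"
    by (rule of_mat_inj[OF part_carrier alg_carrier[OF A]]) (use of_mat_supp in \<open>auto simp: of_part fun_eq_iff\<close>)
  ultimately show ?thesis by (simp add: sum.cartesian_product)
qed

lemma fun_of_X: "fun_of x \<in> X"
proof -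
  have "fun_of x (A + B) = fun_of x A + fun_of x B" if "A \<in> alg" "B \<in> alg" for A B
    using that alg_add[OF that] of_mat_add[OF alg_carrier[OF that(1)] alg_carrier[OF that(2)]]
    by (simp add: fun_of_def sum.distrib distrib_right)
  moreover have "fun_of x (a \<cdot>\<^sub>m A) = a * fun_of x A" if "A \<in> alg" for a A
    using that alg_smult[OF that] of_mat_smult[OF alg_carrier[OF that]]
    by (simp add: fun_of_def sum_distrib_left mult.assoc)
  ultimately show ?thesis by (simp add: lin_dual_def fun_of_def)
qed

lemma \<Phi>_fun_of: "P i j \<Longrightarrow> \<Phi> (fun_of x) i j = x i j"
proof -
  assume P: "P i j"
  then have ij: "i < n" "j < n" using fld by auto
  have "fun_of x (unit i j) = (\<Sum>k<n. \<Sum>l<n. if k = i then (if l = j then x k l else 0) else 0)"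
    using unit_alg[OF P] by (auto simp: fun_of_def of_mat_E[OF P] intro!: sum.cong)
  also have "\<dots> = (\<Sum>k<n. if k = i then \<Sum>l<n. (if l = j then x k l else 0) else 0)"
    by (rule sum.cong) auto
  finally show ?thesis using P ij by (simp add: \<Phi>_def)
qed

lemma X_eqI: "\<xi> \<in> X \<Longrightarrow> \<eta> \<in> X \<Longrightarrow> (\<And>A. A \<in> alg \<Longrightarrow> \<xi> A = \<eta> A) \<Longrightarrow> \<xi> = \<eta>"
  unfolding lin_dual_def by (auto intro: extensionalityI)

lemma coadjoint_alg: "u \<in> S \<Longrightarrow> A \<in> alg \<Longrightarrow> inv\<^bsub>GL n\<^esub> u * A * u \<in> alg"
  by (intro alg_mult) (auto intro: S_alg S_inv)

lemma co_apply: "A \<in> alg \<Longrightarrow> co u \<xi> A = \<xi> (inv\<^bsub>GL n\<^esub> u * A * u)"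
  by (simp add: coadjoint_def)

lemma co_closed: "u \<in> S \<Longrightarrow> \<xi> \<in> X \<Longrightarrow> co u \<xi> \<in> X"
proof -
  assume u: "u \<in> S" and \<xi>: "\<xi> \<in> X"
  let ?v = "inv\<^bsub>GL n\<^esub> u"
  note c = S_carrier[OF u] S_carrier[OF S_inv[OF u]]
  have "co u \<xi> (A + B) = co u \<xi> A + co u \<xi> B" if A: "A \<in> alg" and B: "B \<in> alg" for A B
  proof -
    have "?v * (A + B) * u = ?v * A * u + ?v * B * u"
      using mult_add_distrib_mat[OF c(2) alg_carrier[OF A] alg_carrier[OF B]]
        add_mult_distrib_mat[OF mult_carrier_mat[OF c(2) alg_carrier[OF A]] mult_carrier_mat[OF c(2) alg_carrier[OF B]] c(1)]
      by simp
    then show ?thesis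
      using XD(1)[OF \<xi> coadjoint_alg[OF u A] coadjoint_alg[OF u B]] alg_add[OF A B] A B by (simp add: co_apply del: assoc_mult_mat)
  qed
  moreover have "co u \<xi> (a \<cdot>\<^sub>m A) = a * co u \<xi> A" if A: "A \<in> alg" for a A
  proof -
    have "?v * (a \<cdot>\<^sub>m A) * u = a \<cdot>\<^sub>m (?v * A * u)"
      using mult_smult_distrib[OF c(2) alg_carrier[OF A]] mult_smult_assoc_mat[OF mult_carrier_mat[OF c(2) alg_carrier[OF A]] c(1)]
      by simp
    then show ?thesis
      using XD(2)[OF \<xi> coadjoint_alg[OF u A] coadjoint_alg[OF u A]] alg_smult[OF A] A by (simp add: co_apply del: assoc_mult_mat)
  qed
  ultimately show ?thesis by (simp add: lin_dual_def coadjoint_def)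
qed

lemma co_mult: "u \<in> S \<Longrightarrow> v \<in> S \<Longrightarrow> \<xi> \<in> X \<Longrightarrow> co (u * v) \<xi> = co u (co v \<xi>)"
proof (rule X_eqI)
  assume uv: "u \<in> S" "v \<in> S" and \<xi>: "\<xi> \<in> X"
  show "co (u * v) \<xi> \<in> X" "co u (co v \<xi>) \<in> X" using uv \<xi> by (auto intro: co_closed S_mult)
  fix A assume A: "A \<in> alg"
  have i: "inv\<^bsub>GL n\<^esub> (u * v) = inv\<^bsub>GL n\<^esub> v * inv\<^bsub>GL n\<^esub> u"
    using GL.inv_mult_group[OF S_GL[OF uv(1)] S_GL[OF uv(2)]] by (simp add: GL_mult)
  have "inv\<^bsub>GL n\<^esub> v * inv\<^bsub>GL n\<^esub> u * A * (u * v) = inv\<^bsub>GL n\<^esub> v * (inv\<^bsub>GL n\<^esub> u * A * u) * v"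
    using S_carrier[OF uv(1)] S_carrier[OF uv(2)] S_carrier[OF S_inv[OF uv(1)]] S_carrier[OF S_inv[OF uv(2)]] alg_carrier[OF A]
    by (simp add: assoc_mult_mat[of _ n n _ n _ n] mult_carrier_mat[of _ n n _ n])
  then show "co (u * v) \<xi> A = co u (co v \<xi>) A"
    using A coadjoint_alg[OF uv(1) A] by (simp add: co_apply i del: assoc_mult_mat)
qed

lemma co_one: "\<xi> \<in> X \<Longrightarrow> co (1\<^sub>m n) \<xi> = \<xi>"
proof (rule X_eqI)
  assume \<xi>: "\<xi> \<in> X"
  then show "co (1\<^sub>m n) \<xi> \<in> X" by (rule co_closed[OF S_one])
  fix A assume A: "A \<in> alg"
  have "inv\<^bsub>GL n\<^esub> (1\<^sub>m n) = (1\<^sub>m n :: 'k mat)" using GL.inv_one by (simp add: GL_one)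
  then show "co (1\<^sub>m n) \<xi> A = \<xi> A" using A alg_carrier[OF A] by (simp add: co_apply)
qed (assumption)

lemma co_inv: "u \<in> S \<Longrightarrow> \<xi> \<in> X \<Longrightarrow> co u (co (inv\<^bsub>GL n\<^esub> u) \<xi>) = \<xi>" "u \<in> S \<Longrightarrow> \<xi> \<in> X \<Longrightarrow> co (inv\<^bsub>GL n\<^esub> u) (co u \<xi>) = \<xi>"
  using co_mult[of u "inv\<^bsub>GL n\<^esub> u" \<xi>] co_mult[of "inv\<^bsub>GL n\<^esub> u" u \<xi>] S_inv[of u] GL_inv[OF S_GL, of u] co_one[of \<xi>] by auto

lemma pairing_mult:
  assumes u: "u \<in> S" and \<xi>: "\<xi> \<in> X" and A: "A \<in> alg"
  shows "\<xi> (A * u) = (\<Sum>i<n. \<Sum>k<n. of_mat A i k * mprod I (\<Phi> \<xi>) (mtrans (of_mat u)) i k)"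
    "\<xi> (u * A) = (\<Sum>i<n. \<Sum>k<n. of_mat A i k * mprod I (mtrans (of_mat u)) (\<Phi> \<xi>) i k)"
proof -
  note c = alg_carrier[OF A] S_carrier[OF u]
  have "\<xi> (A * u) = (\<Sum>i<n. \<Sum>j<n. \<Sum>k<n. of_mat A i k * of_mat u k j * \<Phi> \<xi> i j)"
    unfolding pairing[OF \<xi> alg_mult[OF A S_alg[OF u]]] of_mat_mult[OF c] mprod_def sum_distrib_right ..
  also have "\<dots> = (\<Sum>i<n. \<Sum>k<n. \<Sum>j<n. of_mat A i k * of_mat u k j * \<Phi> \<xi> i j)"
    by (rule sum.cong[OF HOL.refl sum.swap])
  finally show "\<xi> (A * u) = (\<Sum>i<n. \<Sum>k<n. of_mat A i k * mprod I (\<Phi> \<xi>) (mtrans (of_mat u)) i k)"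
    by (simp add: mprod_def mtrans_def sum_distrib_left ac_simps)
  have "\<xi> (u * A) = (\<Sum>i<n. \<Sum>j<n. \<Sum>k<n. of_mat u i k * of_mat A k j * \<Phi> \<xi> i j)"
    unfolding pairing[OF \<xi> alg_mult[OF S_alg[OF u] A]] of_mat_mult[OF c(2,1)] mprod_def sum_distrib_right ..
  also have "\<dots> = (\<Sum>j<n. \<Sum>i<n. \<Sum>k<n. of_mat u i k * of_mat A k j * \<Phi> \<xi> i j)" by (rule sum.swap)
  also have "\<dots> = (\<Sum>j<n. \<Sum>k<n. \<Sum>i<n. of_mat u i k * of_mat A k j * \<Phi> \<xi> i j)"
    by (rule sum.cong[OF HOL.refl sum.swap])
  also have "\<dots> = (\<Sum>k<n. \<Sum>j<n. \<Sum>i<n. of_mat u i k * of_mat A k j * \<Phi> \<xi> i j)" by (rule sum.swap)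
  finally show "\<xi> (u * A) = (\<Sum>i<n. \<Sum>k<n. of_mat A i k * mprod I (mtrans (of_mat u)) (\<Phi> \<xi>) i k)"
    by (simp add: mprod_def mtrans_def sum_distrib_left ac_simps)
qed

lemma coadjoint_iff:
  assumes u: "u \<in> S" and \<xi>: "\<xi> \<in> X" and \<eta>: "\<eta> \<in> X"
  shows "co u \<xi> = \<eta> \<longleftrightarrow> mtrans (of_mat u) \<in> mhom I P (\<Phi> \<xi>) (\<Phi> \<eta>)"
proof -
  let ?v = "inv\<^bsub>GL n\<^esub> u" and ?h = "mtrans (of_mat u)"
  note c = S_carrier[OF u] S_carrier[OF S_inv[OF u]] and i = GL_inv(4,5)[OF S_GL[OF u]]
  have "co u \<xi> = \<eta> \<longleftrightarrow> (\<forall>A\<in>alg. \<xi> (A * u) = \<eta> (u * A))"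
  proof
    assume e: "co u \<xi> = \<eta>"
    show "\<forall>A\<in>alg. \<xi> (A * u) = \<eta> (u * A)"
    proof
      fix A assume A: "A \<in> alg"
      have "?v * (u * A) * u = (?v * u) * (A * u)"
        using c alg_carrier[OF A] by (simp add: assoc_mult_mat[of _ n n _ n _ n] mult_carrier_mat[of _ n n _ n])
      then have "?v * (u * A) * u = A * u" unfolding i using left_mult_one_mat[OF mult_carrier_mat[OF alg_carrier[OF A] c(1)]] by simp
      then show "\<xi> (A * u) = \<eta> (u * A)" unfolding e[symmetric] co_apply[OF alg_mult[OF S_alg[OF u] A]] by simp
    qed
  next
    assume e: "\<forall>A\<in>alg. \<xi> (A * u) = \<eta> (u * A)"
    show "co u \<xi> = \<eta>"
    proof (rule X_eqI[OF co_closed[OF u \<xi>] \<eta>])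
      fix A assume A: "A \<in> alg"
      have vA: "?v * A \<in> alg" using alg_mult[OF S_alg[OF S_inv[OF u]] A] .
      have "u * (?v * A) = (u * ?v) * A" by (rule assoc_mult_mat[symmetric, OF c alg_carrier[OF A]])
      then have "u * (?v * A) = A" unfolding i using alg_carrier[OF A] by simp
      then show "co u \<xi> A = \<eta> A" using bspec[OF e vA] A by (simp add: co_apply del: assoc_mult_mat)
    qed
  qed
  also have "\<dots> \<longleftrightarrow> (\<forall>k l. P k l \<longrightarrow> mprod I (\<Phi> \<xi>) ?h k l = mprod I ?h (\<Phi> \<eta>) k l)"
  proof
    assume e: "\<forall>A\<in>alg. \<xi> (A * u) = \<eta> (u * A)"
    show "\<forall>k l. P k l \<longrightarrow> mprod I (\<Phi> \<xi>) ?h k l = mprod I ?h (\<Phi> \<eta>) k l"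
    proof (intro allI impI)
      fix k l assume P: "P k l"
      then have kl: "k < n" "l < n" using fld by auto
      have s: "(\<Sum>i<n. \<Sum>j<n. of_mat (unit k l) i j * f i j) = f k l" for f :: "nat \<Rightarrow> nat \<Rightarrow> 'k"
      proof -
        have "(\<Sum>i<n. \<Sum>j<n. of_mat (unit k l) i j * f i j) = (\<Sum>i<n. if i = k then \<Sum>j<n. (if j = l then f i j else 0) else 0)"
          unfolding of_mat_E[OF P] by (intro sum.cong) (auto simp: if_distrib[of "\<lambda>x. x * _"] cong: if_cong)
        also have "\<dots> = (\<Sum>j<n. if j = l then f k j else 0)" using kl(1) by simp
        finally show ?thesis using kl(2) by simp
      qed
      show "mprod I (\<Phi> \<xi>) ?h k l = mprod I ?h (\<Phi> \<eta>) k l"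
        using bspec[OF e unit_alg[OF P]] unfolding pairing_mult(1)[OF u \<xi> unit_alg[OF P]] pairing_mult(2)[OF u \<eta> unit_alg[OF P]] s .
    qed
  next
    assume e: "\<forall>k l. P k l \<longrightarrow> mprod I (\<Phi> \<xi>) ?h k l = mprod I ?h (\<Phi> \<eta>) k l"
    show "\<forall>A\<in>alg. \<xi> (A * u) = \<eta> (u * A)"
    proof
      fix A assume A: "A \<in> alg"
      have "of_mat A i k * mprod I (\<Phi> \<xi>) ?h i k = of_mat A i k * mprod I ?h (\<Phi> \<eta>) i k" for i k
        using e A unfolding alg_def by (cases "of_mat A i k = 0") auto
      then show "\<xi> (A * u) = \<eta> (u * A)" unfolding pairing_mult(1)[OF u \<xi> A] pairing_mult(2)[OF u \<eta> A] by (intro sum.cong HOL.refl)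
    qed
  qed
  also have "\<dots> \<longleftrightarrow> ?h \<in> mhom I P (\<Phi> \<xi>) (\<Phi> \<eta>)"
    using alg_malg[OF c(1)] S_alg[OF u] unfolding mhom_def by blast
  finally show ?thesis .
qed

lemma mtrans_mone: "mtrans (mone I) = mone I"
  by (auto simp: mtrans_def mone_def fun_eq_iff)

lemma orbit_iff:
  assumes \<xi>: "\<xi> \<in> X" and \<eta>: "\<eta> \<in> X"
  shows "(\<exists>u\<in>S. co u \<xi> = \<eta>) \<longleftrightarrow> miso I P (\<Phi> \<xi>) (\<Phi> \<eta>)"
proof
  assume "\<exists>u\<in>S. co u \<xi> = \<eta>"
  then obtain u where u: "u \<in> S" "mtrans (of_mat u) \<in> mhom I P (\<Phi> \<xi>) (\<Phi> \<eta>)" using coadjoint_iff[OF _ \<xi> \<eta>] by blast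
  let ?v = "inv\<^bsub>GL n\<^esub> u"
  note c = S_carrier[OF u(1)] S_carrier[OF S_inv[OF u(1)]]
  have "mprod I (mtrans (of_mat u)) (mtrans (of_mat ?v)) = mone I" "mprod I (mtrans (of_mat ?v)) (mtrans (of_mat u)) = mone I"
    unfolding mprod_mtrans of_mat_mult[OF c, symmetric] of_mat_mult[OF c(2,1), symmetric] GL_inv(4,5)[OF S_GL[OF u(1)]] of_mat_one
    by (rule mtrans_mone)+
  moreover have "mtrans (of_mat ?v) \<in> malg P" using alg_malg[OF c(2)] S_alg[OF S_inv[OF u(1)]] by blast
  ultimately show "miso I P (\<Phi> \<xi>) (\<Phi> \<eta>)" unfolding miso_def using u(2) by blast
next
  assume "miso I P (\<Phi> \<xi>) (\<Phi> \<eta>)"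
  then obtain h h' where h: "h \<in> mhom I P (\<Phi> \<xi>) (\<Phi> \<eta>)" "h' \<in> malg P" "mprod I h h' = mone I" "mprod I h' h = mone I"
    unfolding miso_def by blast
  have hm: "h \<in> malg P" using h(1) unfolding mhom_def by blast
  have of_to: "of_mat (to_mat (mtrans x)) = mtrans x" if "x \<in> malg P" for x
    by (rule of_to_mat) (use that fld in \<open>auto simp: mtrans_def malg_def\<close>)
  have alg: "to_mat (mtrans x) \<in> alg" if "x \<in> malg P" for x
    using alg_malg[OF to_mat_carrier] of_to[OF that] that by simp
  have one: "to_mat (mtrans x) * to_mat (mtrans y) = 1\<^sub>m n" if "x \<in> malg P" "y \<in> malg P" "mprod I y x = mone I" for x y
    by (rule of_mat_inj[OF mult_carrier_mat[OF to_mat_carrier to_mat_carrier] one_carrier_mat])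
      (simp add: of_mat_mult[OF to_mat_carrier to_mat_carrier] of_to that mprod_mtrans mtrans_mone of_mat_one)
  have "to_mat (mtrans h) \<in> carrier (GL n)"
    unfolding GL_carrier using to_mat_carrier one[OF hm h(2,4)] one[OF h(2) hm h(3)] by blast
  then have "to_mat (mtrans h) \<in> S" using alg[OF hm] by (simp add: S_eq)
  moreover from this have "co (to_mat (mtrans h)) \<xi> = \<eta>" using coadjoint_iff[OF _ \<xi> \<eta>] of_to[OF hm] h(1) by simp
  ultimately show "\<exists>u\<in>S. co u \<xi> = \<eta>" by blast
qed

lemma stabilizer_conj:
  assumes g: "g \<in> S" and \<xi>: "\<xi> \<in> X"
  shows "stabilizer \<Gamma> co (co g \<xi>) = g <#\<^bsub>\<Gamma>\<^esub> stabilizer \<Gamma> co \<xi> #>\<^bsub>\<Gamma>\<^esub> inv\<^bsub>\<Gamma>\<^esub> g"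
    "stabilizer \<Gamma> co (co g \<xi>) = {g * t * inv\<^bsub>GL n\<^esub> g | t. t \<in> stabilizer \<Gamma> co \<xi>}"
proof -
  let ?v = "inv\<^bsub>GL n\<^esub> g"
  note c = S_carrier[OF g] S_carrier[OF S_inv[OF g]] and i = GL_inv(4,5)[OF S_GL[OF g]]
  show "stabilizer \<Gamma> co (co g \<xi>) = {g * t * ?v | t. t \<in> stabilizer \<Gamma> co \<xi>}"
  proof (intro subset_antisym subsetI)
    fix t assume "t \<in> stabilizer \<Gamma> co (co g \<xi>)"
    then have t: "t \<in> S" "co t (co g \<xi>) = co g \<xi>" by (auto simp: stabilizer_def)
    have "co (?v * (t * g)) \<xi> = \<xi>"
      using t g \<xi> co_inv(2)[OF g \<xi>] by (simp add: co_mult S_mult S_inv)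
    then have "?v * (t * g) \<in> stabilizer \<Gamma> co \<xi>" using t g by (simp add: stabilizer_def S_mult S_inv)
    moreover have "g * (?v * (t * g)) * ?v = (g * ?v) * t * (g * ?v)"
      using c S_carrier[OF t(1)] by (simp add: assoc_mult_mat[of _ n n _ n _ n] mult_carrier_mat[of _ n n _ n])
    then have "t = g * (?v * (t * g)) * ?v" unfolding i using S_carrier[OF t(1)] by simp
    ultimately show "t \<in> {g * t * ?v | t. t \<in> stabilizer \<Gamma> co \<xi>}" by blast
  next
    fix t' assume "t' \<in> {g * t * ?v | t. t \<in> stabilizer \<Gamma> co \<xi>}"
    then obtain t where t: "t' = g * t * ?v" "t \<in> S" "co t \<xi> = \<xi>" by (auto simp: stabilizer_def)
    have "co t' (co g \<xi>) = co g \<xi>"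
      unfolding t(1) using t g \<xi> co_inv(2)[OF g \<xi>] by (simp add: co_mult S_mult S_inv co_closed del: assoc_mult_mat)
    then show "t' \<in> stabilizer \<Gamma> co (co g \<xi>)" using t g by (simp add: stabilizer_def S_mult S_inv del: assoc_mult_mat)
  qed
  then show "stabilizer \<Gamma> co (co g \<xi>) = g <#\<^bsub>\<Gamma>\<^esub> stabilizer \<Gamma> co \<xi> #>\<^bsub>\<Gamma>\<^esub> inv\<^bsub>\<Gamma>\<^esub> g"
    unfolding l_coset_def r_coset_def \<Gamma>_inv[OF g] by (auto simp: GL_mult simp del: assoc_mult_mat)
qed

end

locale seaweed_data = seaweed_group n G Gi P S + good_data "{..<n}" P J \<sigma> r D c
  for n and G Gi :: "'k::field_char_0 mat" and P S J \<sigma> and r :: "'k fmat \<Rightarrow> nat \<times> nat \<Rightarrow> 'k" and D c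
begin

abbreviation "Y \<equiv> dual_coords alg"

lemma \<Phi>_\<sigma>: "\<Phi> (fun_of (\<sigma> t)) = \<sigma> t"
proof (intro ext)
  fix i j
  show "\<Phi> (fun_of (\<sigma> t)) i j = \<sigma> t i j"
    by (cases "P i j") (use \<Phi>_fun_of \<sigma>_supp[of t i j] in \<open>auto simp: \<Phi>_def\<close>)
qed

lemma coord_poly: "A \<in> alg \<Longrightarrow> (\<lambda>\<xi>. \<xi> A) \<in> poly_funs Y"
  by (rule poly_funs.coord) (auto simp: dual_coords_def)

lemma \<Phi>_poly: "f \<in> poly_funs mcoords \<Longrightarrow> (\<lambda>\<xi>. f (\<Phi> \<xi>)) \<in> poly_funs Y"
proof (erule poly_funs_comp)
  fix h :: "'k fmat \<Rightarrow> 'k" assume "h \<in> mcoords"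
  then obtain i j where h: "h = (\<lambda>x. x i j)" by (auto simp: mcoords_def)
  show "(\<lambda>\<xi>. h (\<Phi> \<xi>)) \<in> poly_funs Y"
    unfolding h \<Phi>_def by (cases "P i j") (auto intro: coord_poly unit_alg poly_funs.const)
qed

lemma X_irreducible: "irreducible X Y"
proof
  show "X \<noteq> {}" using fun_of_X by blast
  fix f g :: "('k mat \<Rightarrow> 'k) \<Rightarrow> 'k" and x y
  assume fg: "f \<in> poly_funs Y" "g \<in> poly_funs Y" "\<And>x. x \<in> X \<Longrightarrow> f x * g x = 0" and xy: "x \<in> X" "f x \<noteq> 0" "y \<in> X"
  show "g y = 0"
  proof (rule poly_funs_irreducible[OF _ fg xy])
    fix x y assume x: "x \<in> X" and y: "y \<in> X"
    define z where "z s = (\<lambda>A\<in>alg. x A + s * (y A - x A))" for s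
    have zX: "z s \<in> X" for s
    proof -
      have "z s (A + B) = z s A + z s B" "z s (a \<cdot>\<^sub>m A) = a * z s A" if "A \<in> alg" "B \<in> alg" for A B a
        using that alg_add[OF that] alg_smult[OF that(1), of a] XD[OF x that] XD[OF y that]
        by (simp_all add: z_def algebra_simps)
      then show ?thesis by (simp add: lin_dual_def z_def)
    qed
    have "\<exists>p. \<forall>s. poly p s = h (z s)" if hY: "h \<in> Y" for h :: "('k mat \<Rightarrow> 'k) \<Rightarrow> 'k"
    proof -
      obtain A where h: "A \<in> alg" "h = (\<lambda>\<xi>. \<xi> A)" using hY by (auto simp: dual_coords_def)
      show ?thesis by (rule exI[of _ "[:x A, y A - x A:]"]) (simp add: h z_def)
    qed
    moreover have "z 0 = x \<and> z 1 = y" using x y by (simp add: z_def lin_dual_def extensional_restrict)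
    ultimately show "\<exists>z. z 0 = x \<and> z 1 = y \<and> (\<forall>s. z s \<in> X) \<and> (\<forall>h\<in>Y. \<exists>p. \<forall>s. poly p s = h (z s))"
      using zX by blast
  qed
qed

abbreviation "r' \<equiv> \<lambda>\<xi> p. if p \<in> J then r (\<Phi> \<xi>) p else 0"

lemma \<sigma>_r': "\<sigma> (r' \<xi>) = \<sigma> (r (\<Phi> \<xi>))"
  by (rule \<sigma>_cong) simp

sublocale Q: rational_quotient X Y "co ` S" "\<lambda>\<xi>. D (\<Phi> \<xi>)" J "\<lambda>t. fun_of (\<sigma> t)" r'
proof (intro rational_quotient.intro X_irreducible rational_quotient_axioms.intro)
  fix a x assume "a \<in> co ` S" "x \<in> X"
  then show "a x \<in> X" using co_closed by blast
next
  fix a and g :: "('k mat \<Rightarrow> 'k) \<Rightarrow> 'k" assume "a \<in> co ` S" "g \<in> Y"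
  then obtain u A where u: "a = co u" "u \<in> S" "A \<in> alg" "g = (\<lambda>\<xi>. \<xi> A)" by (auto simp: dual_coords_def)
  show "\<exists>h\<in>poly_funs Y. \<forall>x\<in>X. h x = g (a x)"
    by (rule bexI[OF _ coord_poly[OF coadjoint_alg[OF u(2,3)]]]) (simp add: u co_apply del: assoc_mult_mat)
next
  fix a assume "a \<in> co ` S"
  then obtain u where u: "a = co u" "u \<in> S" by blast
  show "\<exists>b\<in>co ` S. \<forall>x\<in>X. a (b x) = x \<and> b (a x) = x"
    by (rule bexI[of _ "co (inv\<^bsub>GL n\<^esub> u)"]) (use u co_inv[OF u(2)] S_inv in auto)
next
  fix a b assume "a \<in> co ` S" "b \<in> co ` S"
  then obtain u v where u: "a = co u" "u \<in> S" "b = co v" "v \<in> S" by blast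
  show "\<exists>c\<in>co ` S. \<forall>x\<in>X. c x = a (b x)"
    by (rule bexI[of _ "co (u * v)"]) (use u co_mult[OF u(2,4)] S_mult in auto)
next
  show "finite J" by (rule J(1))
  show "(\<lambda>\<xi>. D (\<Phi> \<xi>)) \<in> poly_funs Y" by (rule \<Phi>_poly[OF D_poly])
  show "\<exists>t. D (\<Phi> (fun_of (\<sigma> t))) \<noteq> 0" using D_nonzero unfolding \<Phi>_\<sigma> .
next
  fix t :: "nat \<times> nat \<Rightarrow> 'k" show "fun_of (\<sigma> t) \<in> X" by (rule fun_of_X)
next
  fix g :: "('k mat \<Rightarrow> 'k) \<Rightarrow> 'k" assume "g \<in> Y"
  then obtain A where A: "A \<in> alg" "g = (\<lambda>\<xi>. \<xi> A)" by (auto simp: dual_coords_def)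
  show "(\<lambda>t. g (fun_of (\<sigma> t))) \<in> poly_funs tcoords"
    unfolding A(2) fun_of_def using A(1) by (simp, intro poly_funs_sum poly_funs.mult poly_funs.const \<sigma>_poly)
next
  fix t t' :: "nat \<times> nat \<Rightarrow> 'k" assume "\<And>j. j \<in> J \<Longrightarrow> t j = t' j"
  then show "fun_of (\<sigma> t) = fun_of (\<sigma> t')" using \<sigma>_cong[of t t'] by simp
next
  fix j assume j: "j \<in> J"
  then obtain p m where p: "p \<in> poly_funs mcoords" "\<And>x. D x \<noteq> 0 \<Longrightarrow> r x j * D x ^ m = p x"
    using r_loc unfolding loc_def by blast
  show "\<exists>p\<in>poly_funs Y. \<exists>q\<in>poly_funs Y. \<forall>x\<in>X. D (\<Phi> x) \<noteq> 0 \<longrightarrow> q x \<noteq> 0 \<and> r' x j = p x / q x"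
  proof (rule bexI[OF _ \<Phi>_poly[OF p(1)]], rule bexI[OF _ \<Phi>_poly[OF poly_funs_power[OF D_poly, of m]]], intro ballI impI conjI)
    fix x assume d: "D (\<Phi> x) \<noteq> 0"
    then show "D (\<Phi> x) ^ m \<noteq> 0" by simp
    then show "r' x j = p (\<Phi> x) / D (\<Phi> x) ^ m" using p(2)[OF d] j by (simp add: eq_divide_eq)
  qed
next
  fix j x assume "j \<notin> J"
  then show "r' x j = 0" by simp
next
  fix x assume x: "x \<in> X" "D (\<Phi> x) \<noteq> 0"
  have "miso I P (\<Phi> x) (\<Phi> (fun_of (\<sigma> (r' x))))" unfolding \<Phi>_\<sigma> \<sigma>_r' by (rule iso[OF x(2)])
  then have "miso I P (\<Phi> (fun_of (\<sigma> (r' x)))) (\<Phi> x)" by (rule miso_sym)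
  then show "\<exists>a\<in>co ` S. a (fun_of (\<sigma> (r' x))) = x" using orbit_iff[OF fun_of_X x(1)] by blast
next
  fix a x j assume a: "a \<in> co ` S" and x: "x \<in> X" "D (\<Phi> x) \<noteq> 0" "D (\<Phi> (a x)) \<noteq> 0"
  then have "miso I P (\<Phi> x) (\<Phi> (a x))" using orbit_iff[OF x(1)] co_closed by blast
  then show "r' (a x) j = r' x j" using r_invariant[OF x(2,3)] by simp
next
  fix t :: "nat \<times> nat \<Rightarrow> 'k" and j assume "D (\<Phi> (fun_of (\<sigma> t))) \<noteq> 0" "j \<in> J"
  then show "r' (fun_of (\<sigma> t)) j = t j" unfolding \<Phi>_\<sigma> using r_\<sigma> by simp
qed

lemma invariant_field_eq: "invariant_field \<Gamma> X Y co = Q.L"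
proof -
  have "(\<forall>g\<in>S. map_prod (translate \<Gamma> X co g) (translate \<Gamma> X co g) ` w = w) \<longleftrightarrow> (\<forall>a\<in>co ` S. Q.trans_frac a ` w = w)" for w
  proof -
    have e: "map_prod (translate \<Gamma> X co g) (translate \<Gamma> X co g) = Q.trans_frac (co (inv\<^bsub>GL n\<^esub> g))" if "g \<in> S" for g
      unfolding Q.trans_frac_def translate_def \<Gamma>_inv[OF that] ..
    have A: "Q.trans_frac (co v) ` w = w"
      if "\<forall>g\<in>S. map_prod (translate \<Gamma> X co g) (translate \<Gamma> X co g) ` w = w" and v: "v \<in> S" for v
      using bspec[OF that(1) S_inv[OF v]] e[OF S_inv[OF v]] GL.inv_inv[OF S_GL[OF v]] by simp
    have B: "map_prod (translate \<Gamma> X co g) (translate \<Gamma> X co g) ` w = w"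
      if "\<forall>a\<in>co ` S. Q.trans_frac a ` w = w" and g: "g \<in> S" for g
      unfolding e[OF g] using that(1) S_inv[OF g] by blast
    show ?thesis
    proof (intro iffI ballI)
      fix a assume h: "\<forall>g\<in>S. map_prod (translate \<Gamma> X co g) (translate \<Gamma> X co g) ` w = w" and "a \<in> co ` S"
      then obtain v where "a = co v" "v \<in> S" by blast
      then show "Q.trans_frac a ` w = w" using A[OF h] by simp
    qed (rule B)
  qed
  then show ?thesis unfolding invariant_field_def Q.invs_def by simp
qed

lemma transcendental: "purely_transcendental (invariant_field \<Gamma> X Y co) (constants X Y)"
  unfolding invariant_field_eq by (rule Q.purely_transcendental_invs)

definition T :: "'k mat set" where
  "T = {G * dmat n (t \<circ> c) * Gi | t. \<forall>i<n. t (c i) \<noteq> 0}"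

lemma of_mat_dmat: "of_mat (G * dmat n t * Gi) = mdiag I t"
  unfolding of_mat_def by (subst conj_cancel) (auto simp: mdiag_def fun_eq_iff)

lemma dmat_conj_carrier: "G * dmat n t * Gi \<in> carrier_mat n n"
  by (rule mult_carrier_mat[OF mult_carrier_mat[OF G(1) dmat_carrier] G(2)])

lemma mtrans_mdiag: "mtrans (mdiag I t) = mdiag I t"
  by (auto simp: mtrans_def mdiag_def fun_eq_iff)

lemma T_stabilizer:
  assumes \<eta>: "\<eta> \<in> X" and e: "mhom I P (\<Phi> \<eta>) (\<Phi> \<eta>) = {mdiag I (t \<circ> c) | t. True}"
  shows "stabilizer \<Gamma> co \<eta> = T"
proof (intro subset_antisym subsetI)
  fix u assume "u \<in> stabilizer \<Gamma> co \<eta>"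
  then have u: "u \<in> S" "co u \<eta> = \<eta>" by (auto simp: stabilizer_def)
  then have "mtrans (of_mat u) \<in> mhom I P (\<Phi> \<eta>) (\<Phi> \<eta>)" using coadjoint_iff[OF u(1) \<eta> \<eta>] by simp
  then obtain t where "mtrans (of_mat u) = mdiag I (t \<circ> c)" unfolding e by blast
  then have ofu: "of_mat u = mdiag I (t \<circ> c)" using mtrans_mdiag by (metis mtrans_mtrans)
  then have ut: "u = G * dmat n (t \<circ> c) * Gi"
    by (intro of_mat_inj[OF S_carrier[OF u(1)] dmat_conj_carrier]) (simp only: of_mat_dmat)
  have "t (c i) \<noteq> 0" if i: "i < n" for i
  proof
    assume z: "t (c i) = 0"
    let ?v = "inv\<^bsub>GL n\<^esub> u"
    have "of_mat (u * ?v) i i = (\<Sum>k<n. mdiag I (t \<circ> c) i k * of_mat ?v k i)"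
      unfolding of_mat_mult[OF S_carrier[OF u(1)] S_carrier[OF S_inv[OF u(1)]]] mprod_def ofu ..
    also have "\<dots> = 0" by (rule sum.neutral) (simp add: mdiag_def z)
    finally show False using i unfolding GL_inv(5)[OF S_GL[OF u(1)]] of_mat_one by (simp add: mone_def)
  qed
  then show "u \<in> T" unfolding T_def using ut by blast
next
  fix u assume "u \<in> T"
  then obtain t where t: "u = G * dmat n (t \<circ> c) * Gi" "\<forall>i<n. t (c i) \<noteq> 0" unfolding T_def by blast
  have uc: "u \<in> carrier_mat n n" unfolding t(1) by (rule dmat_conj_carrier)
  have "of_mat u = mdiag I (t \<circ> c)" unfolding t(1) by (rule of_mat_dmat)
  then have "u \<in> alg" unfolding alg_def using uc preord.refl[OF preord] by (auto simp: mdiag_def split: if_splits)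
  moreover have "u \<in> carrier (GL n)" unfolding GL_carrier
  proof (intro conjI uc bexI)
    let ?v = "G * dmat n (\<lambda>i. inverse (t (c i))) * Gi"
    show v: "?v \<in> carrier_mat n n" by (rule dmat_conj_carrier)
    have m: "mprod I (mdiag I a) (mdiag I b) = mone I" if "\<And>i. i < n \<Longrightarrow> a i * b i = 1" for a b :: "nat \<Rightarrow> 'k"
      using that by (auto simp: mprod_def mdiag_def mone_def fun_eq_iff if_distrib[of "\<lambda>x. x * _"] cong: if_cong)
    show "u * ?v = 1\<^sub>m n"
      by (rule of_mat_inj[OF mult_carrier_mat[OF uc v] one_carrier_mat])
        (unfold of_mat_mult[OF uc v] of_mat_one, unfold t(1) of_mat_dmat, rule m, use t(2) in simp)
    show "?v * u = 1\<^sub>m n"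
      by (rule of_mat_inj[OF mult_carrier_mat[OF v uc] one_carrier_mat])
        (unfold of_mat_mult[OF v uc] of_mat_one, unfold t(1) of_mat_dmat, rule m, use t(2) in simp)
  qed
  ultimately have u: "u \<in> S" by (simp add: S_eq)
  have "mtrans (of_mat u) \<in> mhom I P (\<Phi> \<eta>) (\<Phi> \<eta>)" unfolding e t(1) of_mat_dmat mtrans_mdiag by blast
  then show "u \<in> stabilizer \<Gamma> co \<eta>" using coadjoint_iff[OF u \<eta> \<eta>] u by (simp add: stabilizer_def)
qed

lemma generic_orbit:
  assumes "D (\<Phi> \<xi>) \<noteq> 0" "\<xi> \<in> X"
  obtains g \<eta> where "g \<in> S" "\<eta> \<in> X" "co g \<eta> = \<xi>" "stabilizer \<Gamma> co \<eta> = T"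
proof -
  obtain y where y: "miso I P (\<Phi> \<xi>) y" "mhom I P y y = {mdiag I (t \<circ> c) | t. True}" using endo[OF assms(1)] by blast
  have e: "mhom I P (\<Phi> (fun_of y)) (\<Phi> (fun_of y)) = mhom I P y y" by (rule mhom_cong) (simp_all add: \<Phi>_fun_of)
  have "miso I P (\<Phi> \<xi>) (\<Phi> (fun_of y))" using y(1) miso_cong[of "\<Phi> \<xi>" "\<Phi> \<xi>" "\<Phi> (fun_of y)" y] \<Phi>_fun_of by simp
  then obtain g where "g \<in> S" "co g (fun_of y) = \<xi>" using orbit_iff[OF fun_of_X assms(2)] miso_sym by blast
  then show thesis using that fun_of_X T_stabilizer[OF fun_of_X] e y(2) by metis
qed

abbreviation "Z \<equiv> zariski X Y"

definition \<Omega> :: "('k mat \<Rightarrow> 'k) set" where "\<Omega> = {\<xi> \<in> X. D (\<Phi> \<xi>) \<noteq> 0}"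

lemma \<Omega>_open: "openin Z \<Omega>"
  unfolding openin_zariski zariski_open_def \<Omega>_def
  by (rule exI[of _ "{\<lambda>\<xi>. D (\<Phi> \<xi>)}"]) (use \<Phi>_poly[OF D_poly] in auto)

lemma \<Omega>_meets: "openin Z U \<Longrightarrow> x \<in> U \<Longrightarrow> \<exists>y\<in>U. y \<in> \<Omega>"
proof -
  assume "openin Z U" "x \<in> U"
  then obtain F f where F: "F \<subseteq> poly_funs Y" "U = {x \<in> X. \<exists>f\<in>F. f x \<noteq> 0}" "f \<in> F" "f x \<noteq> 0" "x \<in> X"
    unfolding openin_zariski zariski_open_def by blast
  have "Q.gen (\<lambda>x. f x \<noteq> 0)" by (rule Q.gen_poly[of f x]) (use F in blast)+
  then show ?thesis using Q.gen_ex[OF Q.gen_conj[OF _ Q.gen_D]] F(2,3) unfolding \<Omega>_def by blast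
qed

lemma generic_stabiliser_exists: "\<exists>H. generic_stabiliser \<Gamma> Z co H"
proof -
  obtain \<xi>0 where \<xi>0: "\<xi>0 \<in> \<Omega>" 
  proof -
    obtain t where "D (\<Phi> (fun_of (\<sigma> t))) \<noteq> 0" using D_nonzero unfolding \<Phi>_\<sigma> by blast
    then show thesis using that fun_of_X unfolding \<Omega>_def by blast
  qed
  have "generic_stabiliser \<Gamma> Z co (stabilizer \<Gamma> co \<xi>0)" unfolding generic_stabiliser_def
  proof (intro exI conjI ballI)
    show "openin Z \<Omega>" by (rule \<Omega>_open)
    show "Z closure_of \<Omega> = topspace Z"
    proof (intro subset_antisym closure_of_subset_topspace subsetI)
      fix x assume "x \<in> topspace Z"
      then show "x \<in> Z closure_of \<Omega>" using \<Omega>_meets unfolding in_closure_of by blast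
    qed
    show "\<exists>x\<in>\<Omega>. stabilizer \<Gamma> co \<xi>0 = stabilizer \<Gamma> co x" using \<xi>0 by blast
    fix x y assume "x \<in> \<Omega>" "y \<in> \<Omega>"
    then have x: "x \<in> X" "D (\<Phi> x) \<noteq> 0" and y: "y \<in> X" "D (\<Phi> y) \<noteq> 0" by (auto simp: \<Omega>_def)
    obtain g \<eta> where g: "g \<in> S" "\<eta> \<in> X" "co g \<eta> = x" "stabilizer \<Gamma> co \<eta> = T" by (rule generic_orbit[OF x(2,1)])
    obtain h \<theta> where h: "h \<in> S" "\<theta> \<in> X" "co h \<theta> = y" "stabilizer \<Gamma> co \<theta> = T" by (rule generic_orbit[OF y(2,1)])
    let ?v = "inv\<^bsub>GL n\<^esub> g"
    have "co ?v x = \<eta>" using co_inv(2)[OF g(1,2)] g(3) by simp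
    then have e: "stabilizer \<Gamma> co \<theta> = stabilizer \<Gamma> co (co ?v x)" using g(4) h(4) by simp
    have "stabilizer \<Gamma> co y = {h * t * inv\<^bsub>GL n\<^esub> h | t. t \<in> stabilizer \<Gamma> co (co ?v x)}"
      using stabilizer_conj(2)[OF h(1,2)] unfolding h(3) e .
    also have "\<dots> = stabilizer \<Gamma> co (co h (co ?v x))"
      by (rule stabilizer_conj(2)[symmetric, OF h(1) co_closed[OF S_inv[OF g(1)] x(1)]])
    also have "co h (co ?v x) = co (h * ?v) x" using co_mult[OF h(1) S_inv[OF g(1)] x(1)] by simp
    finally have "stabilizer \<Gamma> co y = h * ?v <#\<^bsub>\<Gamma>\<^esub> stabilizer \<Gamma> co x #>\<^bsub>\<Gamma>\<^esub> inv\<^bsub>\<Gamma>\<^esub> (h * ?v)"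
      using stabilizer_conj(1)[OF S_mult[OF h(1) S_inv[OF g(1)]] x(1)] by simp
    then show "\<exists>g\<in>carrier \<Gamma>. stabilizer \<Gamma> co y = g <#\<^bsub>\<Gamma>\<^esub> stabilizer \<Gamma> co x #>\<^bsub>\<Gamma>\<^esub> inv\<^bsub>\<Gamma>\<^esub> g"
      using S_mult[OF h(1) S_inv[OF g(1)]] by (intro bexI[of _ "h * ?v"]) auto
  qed
  then show ?thesis by blast
qed

lemma torus_conj: "g \<in> S \<Longrightarrow> is_torus n {g * t * inv\<^bsub>GL n\<^esub> g | t. t \<in> T}"
proof (rule torus_of_classes)
  assume g: "g \<in> S"
  let ?v = "inv\<^bsub>GL n\<^esub> g"
  note c = S_carrier[OF g] S_carrier[OF S_inv[OF g]] G(1,2) and i = GL_inv(4,5)[OF S_GL[OF g]]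
  note a = assoc_mult_mat[of _ n n _ n _ n] mult_carrier_mat[of _ n n _ n]
  show "g * G \<in> carrier_mat n n" "Gi * ?v \<in> carrier_mat n n" using c by (auto simp: a)
  have "g * G * (Gi * ?v) = g * (G * Gi) * ?v" using c by (simp add: a)
  also have "\<dots> = 1\<^sub>m n" unfolding G(3) using c i by simp
  finally show "g * G * (Gi * ?v) = 1\<^sub>m n" .
  have "Gi * ?v * (g * G) = Gi * (?v * g) * G" using c by (simp add: a)
  also have "\<dots> = 1\<^sub>m n" unfolding i(1) using c G(4) by simp
  finally show "Gi * ?v * (g * G) = 1\<^sub>m n" .
  have "g * (G * dmat n t * Gi) * ?v = g * G * dmat n t * (Gi * ?v)" for t using c by (simp add: a)
  then show "{g * t * ?v | t. t \<in> T} = {g * G * dmat n (t \<circ> c) * (Gi * ?v) | t. \<forall>i<n. t (c i) \<noteq> 0}"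
    unfolding T_def by (auto simp del: assoc_mult_mat) metis
qed

lemma generic_stabiliser_torus:
  assumes "generic_stabiliser \<Gamma> Z co H" shows "is_torus n H"
proof -
  obtain U x where U: "openin Z U" "\<forall>x\<in>U. \<forall>y\<in>U. \<exists>g\<in>carrier \<Gamma>.
      stabilizer \<Gamma> co y = g <#\<^bsub>\<Gamma>\<^esub> stabilizer \<Gamma> co x #>\<^bsub>\<Gamma>\<^esub> inv\<^bsub>\<Gamma>\<^esub> g" "x \<in> U" "H = stabilizer \<Gamma> co x"
    using assms unfolding generic_stabiliser_def by blast
  obtain z where z: "z \<in> U" "z \<in> X" "D (\<Phi> z) \<noteq> 0" using \<Omega>_meets[OF U(1,3)] unfolding \<Omega>_def by blast
  obtain h \<eta> where h: "h \<in> S" "\<eta> \<in> X" "co h \<eta> = z" "stabilizer \<Gamma> co \<eta> = T" by (rule generic_orbit[OF z(3,2)])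
  obtain g where g: "g \<in> carrier \<Gamma>" "H = g <#\<^bsub>\<Gamma>\<^esub> stabilizer \<Gamma> co z #>\<^bsub>\<Gamma>\<^esub> inv\<^bsub>\<Gamma>\<^esub> g" 
    using U(2,3,4) z(1) by blast
  then have gS: "g \<in> S" by simp
  have "H = stabilizer \<Gamma> co (co g z)" unfolding g(2) by (rule stabilizer_conj(1)[symmetric, OF gS z(2)])
  also have "co g z = co (g * h) \<eta>" using co_mult[OF gS h(1,2)] h(3) by simp
  also have "stabilizer \<Gamma> co \<dots> = {g * h * t * inv\<^bsub>GL n\<^esub> (g * h) | t. t \<in> T}"
    using stabilizer_conj(2)[OF S_mult[OF gS h(1)] h(2)] unfolding h(4) .
  finally show ?thesis using torus_conj[OF S_mult[OF gS h(1)]] by simp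
qed

end

theorem theorem4p3:
  fixes n :: nat and s S :: "'k::{alg_closed_field, field_char_0} mat set"
  assumes "is_seaweed n s"
    and "connected_algebraic_subgroup n S"
    and "lie_algebra n S = s"
  shows "purely_transcendental
           (invariant_field (GL_restrict n S) (lin_dual s) (dual_coords s) (coadjoint n s))
           (constants (lin_dual s) (dual_coords s))
       \<and> (\<exists>H. generic_stabiliser (GL_restrict n S) (zariski (lin_dual s) (dual_coords s)) (coadjoint n s) H)
       \<and> (\<forall>H. generic_stabiliser (GL_restrict n S) (zariski (lin_dual s) (dual_coords s)) (coadjoint n s) H
              \<longrightarrow> is_torus n H)"
proof -
  obtain G Gi \<alpha> \<beta> where ab: "mono_on {..<n} \<alpha>" "mono_on {..<n} \<beta>"
    and b: "based_algebra n G Gi (sw_rel {..<n} \<alpha> \<beta>)" and s: "s = based_algebra.alg n G Gi (sw_rel {..<n} \<alpha> \<beta>)"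
    by (rule seaweed_based[OF assms(1)])
  interpret based_algebra n G Gi "sw_rel {..<n} \<alpha> \<beta>" by (rule b)
  have S: "S = alg \<inter> carrier (GL n)" using group_eq_units[OF assms(2)] assms(3) s by simp
  have sub: "subgroup S (GL n)"
    using assms(2) by (simp add: connected_algebraic_subgroup_def algebraic_subgroup_def)
  obtain J \<sigma> D c and r :: "'k fmat \<Rightarrow> nat \<times> nat \<Rightarrow> 'k" where d: "good_data {..<n} (sw_rel {..<n} \<alpha> \<beta>) J \<sigma> r D c"
    using good_seaweed[OF finite_lessThan ab, where ?'k = 'k] unfolding good_def by blast
  interpret seaweed_data n G Gi "sw_rel {..<n} \<alpha> \<beta>" S J \<sigma> r D c
    by (intro seaweed_data.intro seaweed_group.intro b seaweed_group_axioms.intro sub S d)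
  show ?thesis unfolding s using transcendental generic_stabiliser_exists generic_stabiliser_torus by blast
qed

end
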